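(* Let $f\in W^{1,1}(\mathbb{R})\cap C_b(\mathbb{R})$ be real-valued and assume that $$\bigg(\int_0^\infty f(x)\,dx-\int_0^{-\infty}f(x)\,dx\bigg)\notin 2\pi\mathbb{Z}.$$ Let $\psi(x)=\exp\big(-i\int_0^xf(y)\,dy\big)$, $x\in\mathbb{R}$. Then $[\psi,g(D)]\in\mathcal{B}_1(L^2(\mathbb{R}))$, while $[\psi,\operatorname{sgn}(D)]\notin\mathcal{B}_1(L^2(\mathbb{R}))$.
   Context: $D=-i\frac{d}{dx}$ is self-adjoint in $L^2(\mathbb{R})$ with domain $W^{1,2}(\mathbb{R})$; $g(x)=x(1+x^2)^{-1/2}$; $g(D)$ and $\operatorname{sgn}(D)$ are given by the functional calculus. $\psi$ also denotes the operator of multiplication by $\psi$, $[S,T]=ST-TS$, $\mathcal{B}_1$ denotes the trace class, and $C_b(\mathbb{R})$ the bounded continuous functions. *)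

theory Defs
  imports "HOL-Analysis.Analysis"
begin

section \<open>Complex Hilbert spaces\<close>

text \<open>The inner product \<open>cinner\<close> is antilinear in its first and linear in its second argument.\<close>

class complex_inner = real_inner +
  fixes scaleC :: "complex \<Rightarrow> 'a \<Rightarrow> 'a"  (infixr \<open>*\<^sub>C\<close> 75)
    and cinner :: "'a \<Rightarrow> 'a \<Rightarrow> complex"
  assumes scaleC_add_right: "a *\<^sub>C (x + y) = a *\<^sub>C x + a *\<^sub>C y"
    and scaleC_add_left: "(a + b) *\<^sub>C x = a *\<^sub>C x + b *\<^sub>C x"
    and scaleC_scaleC: "a *\<^sub>C b *\<^sub>C x = (a * b) *\<^sub>C x"
    and scaleR_scaleC: "r *\<^sub>R x = complex_of_real r *\<^sub>C x"
    and cinner_commute: "cinner x y = cnj (cinner y x)"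
    and cinner_add_right: "cinner x (y + z) = cinner x y + cinner x z"
    and cinner_scaleC_right: "cinner x (a *\<^sub>C y) = a * cinner x y"
    and inner_cinner: "inner x y = Re (cinner x y)"

class chilbert = complex_inner + complete_space

section \<open>Trace class operators\<close>

definition bounded_clinear :: "('a::chilbert \<Rightarrow> 'a) \<Rightarrow> bool" where
  "bounded_clinear T \<longleftrightarrow> bounded_linear T \<and> (\<forall>c x. T (c *\<^sub>C x) = c *\<^sub>C T x)"

definition cadjoint :: "('a::chilbert \<Rightarrow> 'a) \<Rightarrow> 'a \<Rightarrow> 'a" where
  "cadjoint T = (THE S. \<forall>x y. cinner (S x) y = cinner x (T y))"

definition positive_op :: "('a::chilbert \<Rightarrow> 'a) \<Rightarrow> bool" where
  "positive_op P \<longleftrightarrow> bounded_clinear P \<and> (\<forall>x. cinner x (P x) \<in> \<real>\<^sub>\<ge>\<^sub>0)"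

definition abs_op :: "('a::chilbert \<Rightarrow> 'a) \<Rightarrow> 'a \<Rightarrow> 'a" where
  "abs_op T = (THE P. positive_op P \<and> P \<circ> P = cadjoint T \<circ> T)"

definition is_onb :: "'a::chilbert set \<Rightarrow> bool" where
  "is_onb B \<longleftrightarrow> (\<forall>e\<in>B. norm e = 1) \<and> pairwise (\<lambda>x y. cinner x y = 0) B
     \<and> (\<forall>x. (\<forall>e\<in>B. cinner e x = 0) \<longrightarrow> x = 0)"

text \<open>Finiteness of the trace of \<open>|T|\<close>; for the positive operator \<open>|T|\<close> it does not depend
  on the orthonormal basis.\<close>

definition trace_class :: "('a::chilbert \<Rightarrow> 'a) \<Rightarrow> bool" where
  "trace_class T \<longleftrightarrow> bounded_clinear T \<and>
     (\<exists>B. is_onb B \<and> (\<lambda>e. cinner e (abs_op T e)) summable_on B)"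

definition commutator :: "('a::ab_group_add \<Rightarrow> 'a) \<Rightarrow> ('a \<Rightarrow> 'a) \<Rightarrow> 'a \<Rightarrow> 'a" where
  "commutator S T = (\<lambda>x. S (T x) - T (S x))"

section \<open>Spectral measures and functional calculus\<close>

text \<open>Unbounded operators are given by their graphs.\<close>

definition op_of_graph :: "('a \<times> 'a) set \<Rightarrow> 'a \<Rightarrow> 'a" where
  "op_of_graph G x = (THE y. (x, y) \<in> G)"

text \<open>Projection-valued measures on the Borel sets of the real line; the values off the Borel
  sets play no role. Countable additivity is in the strong operator topology.\<close>

definition projection_measure :: "(real set \<Rightarrow> 'a::chilbert \<Rightarrow> 'a) \<Rightarrow> bool" where
  "projection_measure E \<longleftrightarrow>
     (\<forall>B\<in>sets borel. bounded_clinear (E B) \<and> E B \<circ> E B = E B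
        \<and> (\<forall>x y. cinner (E B x) y = cinner x (E B y)))
     \<and> E UNIV = id
     \<and> (\<forall>B :: nat \<Rightarrow> real set. range B \<subseteq> sets borel \<longrightarrow> disjoint_family B \<longrightarrow>
          (\<forall>x. (\<lambda>n. E (B n) x) sums E (\<Union>n. B n) x))"

text \<open>The scalar measure \<open>B \<mapsto> \<langle>x, E(B) x\<rangle>\<close>.\<close>

definition scalar_measure :: "(real set \<Rightarrow> 'a::chilbert \<Rightarrow> 'a) \<Rightarrow> 'a \<Rightarrow> real measure" where
  "scalar_measure E x = measure_of UNIV (sets borel) (\<lambda>B. ennreal (Re (cinner x (E B x))))"

definition spectral_domain :: "(real set \<Rightarrow> 'a::chilbert \<Rightarrow> 'a) \<Rightarrow> (real \<Rightarrow> complex) \<Rightarrow> 'a set" where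
  "spectral_domain E h = {x. integrable (scalar_measure E x) (\<lambda>t. (cmod (h t))\<^sup>2)}"

text \<open>The integral of \<open>h\<close> against the complex measure \<open>B \<mapsto> \<langle>z, E(B) x\<rangle>\<close>, the latter being
  expressed by polarization.\<close>

definition spectral_form ::
    "(real set \<Rightarrow> 'a::chilbert \<Rightarrow> 'a) \<Rightarrow> (real \<Rightarrow> complex) \<Rightarrow> 'a \<Rightarrow> 'a \<Rightarrow> complex" where
  "spectral_form E h z x =
     (\<Sum>k<4. (- \<i>) ^ k * (LINT t|scalar_measure E (z + \<i> ^ k *\<^sub>C x). h t)) / 4"

text \<open>The graph of the normal operator \<open>\<integral> h dE\<close> for a Borel function \<open>h\<close>.\<close>

definition spectral_integral ::
    "(real set \<Rightarrow> 'a::chilbert \<Rightarrow> 'a) \<Rightarrow> (real \<Rightarrow> complex) \<Rightarrow> ('a \<times> 'a) set" where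
  "spectral_integral E h = {(x, y). x \<in> spectral_domain E h \<and>
     (\<forall>z\<in>spectral_domain E h. cinner z y = spectral_form E h z x)}"

definition is_spectral_measure :: "(real set \<Rightarrow> 'a::chilbert \<Rightarrow> 'a) \<Rightarrow> ('a \<times> 'a) set \<Rightarrow> bool" where
  "is_spectral_measure E T \<longleftrightarrow> projection_measure E \<and> T = spectral_integral E complex_of_real"

text \<open>The operator \<open>h(T)\<close> for a self-adjoint \<open>T\<close> and a Borel function \<open>h\<close>. By the spectral
  theorem the choice below exists and is unique on Borel sets.\<close>

definition functional_calculus ::
    "(real \<Rightarrow> complex) \<Rightarrow> ('a::chilbert \<times> 'a) set \<Rightarrow> ('a \<times> 'a) set" where
  "functional_calculus h T = spectral_integral (SOME E. is_spectral_measure E T) h"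

section \<open>The Hilbert space of square integrable functions on the real line\<close>

definition square_integrable :: "(real \<Rightarrow> complex) \<Rightarrow> bool" where
  "square_integrable u \<longleftrightarrow>
     u \<in> borel_measurable lborel \<and> integrable lborel (\<lambda>x. (cmod (u x))\<^sup>2)"

lemma square_integrable_zero: "square_integrable (\<lambda>x. 0)"
  by (simp add: square_integrable_def)

lemma square_integrable_scale:
  "square_integrable u \<Longrightarrow> square_integrable (\<lambda>x. c * u x)"
  by (auto simp: square_integrable_def norm_mult power_mult_distrib)

lemma square_integrable_bound:
  assumes "u \<in> borel_measurable lborel" "integrable lborel b" "\<And>x. (cmod (u x))\<^sup>2 \<le> b x"
  shows "square_integrable u"
  unfolding square_integrable_def
proof
  show "integrable lborel (\<lambda>x. (cmod (u x))\<^sup>2)"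
  proof (rule Bochner_Integration.integrable_bound[OF assms(2)])
    show "(\<lambda>x. (cmod (u x))\<^sup>2) \<in> borel_measurable lborel"
      using assms(1) by measurable
    show "AE x in lborel. norm ((cmod (u x))\<^sup>2) \<le> norm (b x)"
      using assms(3) by (intro AE_I2) (simp add: order_trans[OF _ abs_ge_self])
  qed
qed fact

lemma square_integrable_mult:
  assumes \<psi>: "\<psi> \<in> borel_measurable lborel" "bounded (range \<psi>)" and u: "square_integrable u"
  shows "square_integrable (\<lambda>x. \<psi> x * u x)"
proof -
  obtain K where K: "\<And>x. cmod (\<psi> x) \<le> K"
    using \<psi>(2) by (auto simp: bounded_iff)
  show ?thesis
  proof (rule square_integrable_bound)
    show "(\<lambda>x. \<psi> x * u x) \<in> borel_measurable lborel"
      using \<psi>(1) u by (auto simp: square_integrable_def intro: borel_measurable_times)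
    show "integrable lborel (\<lambda>x. K\<^sup>2 * (cmod (u x))\<^sup>2)"
      using u by (simp add: square_integrable_def)
    show "(cmod (\<psi> x * u x))\<^sup>2 \<le> K\<^sup>2 * (cmod (u x))\<^sup>2" for x
      unfolding norm_mult power_mult_distrib using K[of x]
      by (intro mult_right_mono power_mono) auto
  qed
qed

lemma square_integrable_add:
  assumes u: "square_integrable u" and v: "square_integrable v"
  shows "square_integrable (\<lambda>x. u x + v x)"
proof (rule square_integrable_bound)
  show "(\<lambda>x. u x + v x) \<in> borel_measurable lborel"
    using u v by (auto simp: square_integrable_def)
  show "integrable lborel (\<lambda>x. 2 * (cmod (u x))\<^sup>2 + 2 * (cmod (v x))\<^sup>2)"
    using u v by (simp add: square_integrable_def)
  show "(cmod (u x + v x))\<^sup>2 \<le> 2 * (cmod (u x))\<^sup>2 + 2 * (cmod (v x))\<^sup>2" for x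
  proof -
    have "(cmod (u x + v x))\<^sup>2 \<le> (cmod (u x) + cmod (v x))\<^sup>2"
      by (intro power_mono norm_triangle_ineq norm_ge_zero)
    then show ?thesis
      using sum_squares_bound[of "cmod (u x)" "cmod (v x)"] unfolding power2_sum by linarith
  qed
qed

lemma square_integrable_uminus: "square_integrable u \<Longrightarrow> square_integrable (\<lambda>x. - u x)"
  using square_integrable_scale[of u "-1"] by simp

lemma square_integrable_diff:
  "square_integrable u \<Longrightarrow> square_integrable v \<Longrightarrow> square_integrable (\<lambda>x. u x - v x)"
  using square_integrable_add[of u "\<lambda>x. - v x"] square_integrable_uminus[of v] by simp

lemma borel_measurable_cnj [measurable]:
  "u \<in> borel_measurable M \<Longrightarrow> (\<lambda>x. cnj (u x)) \<in> borel_measurable M"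
  by (rule borel_measurable_continuous_on[of cnj]) (intro continuous_intros)

lemma square_integrable_product:
  assumes u: "square_integrable u" and v: "square_integrable v"
  shows "integrable lborel (\<lambda>x. cnj (u x) * v x)"
proof (rule Bochner_Integration.integrable_bound)
  show "integrable lborel (\<lambda>x. (cmod (u x))\<^sup>2 + (cmod (v x))\<^sup>2)"
    using u v by (simp add: square_integrable_def)
  show "(\<lambda>x. cnj (u x) * v x) \<in> borel_measurable lborel"
    using u v by (auto simp: square_integrable_def intro: borel_measurable_times borel_measurable_cnj)
  have "cmod (cnj (u x) * v x) \<le> (cmod (u x))\<^sup>2 + (cmod (v x))\<^sup>2" for x
    using sum_squares_bound[of "cmod (u x)" "cmod (v x)"]
      mult_nonneg_nonneg[OF norm_ge_zero[of "u x"] norm_ge_zero[of "v x"]]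
    unfolding norm_mult complex_mod_cnj by linarith
  then show "AE x in lborel. norm (cnj (u x) * v x) \<le> norm ((cmod (u x))\<^sup>2 + (cmod (v x))\<^sup>2)"
    by (intro AE_I2) (metis abs_ge_self order_trans real_norm_def)
qed

definition L2_rel :: "(real \<Rightarrow> complex) \<Rightarrow> (real \<Rightarrow> complex) \<Rightarrow> bool" where
  "L2_rel u v \<longleftrightarrow> square_integrable u \<and> square_integrable v \<and> (AE x in lborel. u x = v x)"

quotient_type L2 = "real \<Rightarrow> complex" / partial: L2_rel
proof (rule part_equivpI)
  show "\<exists>u. L2_rel u u"
    using square_integrable_zero by (auto simp: L2_rel_def)
  show "symp L2_rel"
    by (auto simp: symp_def L2_rel_def)
  show "transp L2_rel"
    unfolding transp_def L2_rel_def by (auto elim: AE_mp)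
qed

instantiation L2 :: complex_inner
begin

lift_definition zero_L2 :: L2 is "\<lambda>x. 0"
  by (simp add: L2_rel_def square_integrable_zero)

lift_definition plus_L2 :: "L2 \<Rightarrow> L2 \<Rightarrow> L2" is "\<lambda>u v x. u x + v x"
  by (auto simp: L2_rel_def square_integrable_add)

lift_definition minus_L2 :: "L2 \<Rightarrow> L2 \<Rightarrow> L2" is "\<lambda>u v x. u x - v x"
  by (auto simp: L2_rel_def square_integrable_diff)

lift_definition uminus_L2 :: "L2 \<Rightarrow> L2" is "\<lambda>u x. - u x"
  by (auto simp: L2_rel_def square_integrable_uminus)

lift_definition scaleC_L2 :: "complex \<Rightarrow> L2 \<Rightarrow> L2" is "\<lambda>c u x. c * u x"
  by (auto simp: L2_rel_def square_integrable_scale)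

lift_definition scaleR_L2 :: "real \<Rightarrow> L2 \<Rightarrow> L2" is "\<lambda>r u x. complex_of_real r * u x"
  by (auto simp: L2_rel_def square_integrable_scale)

lift_definition cinner_L2 :: "L2 \<Rightarrow> L2 \<Rightarrow> complex" is "\<lambda>u v. LINT x|lborel. cnj (u x) * v x"
proof goal_cases
  case (1 u u' v v')
  then show ?case
    unfolding L2_rel_def
    by (intro integral_cong_AE borel_measurable_integrable square_integrable_product) auto
qed

definition inner_L2 :: "L2 \<Rightarrow> L2 \<Rightarrow> real" where
  "inner_L2 u v = Re (cinner u v)"

definition norm_L2 :: "L2 \<Rightarrow> real" where
  "norm_L2 u = sqrt (inner u u)"

definition dist_L2 :: "L2 \<Rightarrow> L2 \<Rightarrow> real" where
  "dist_L2 u v = norm (u - v)"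

definition sgn_L2 :: "L2 \<Rightarrow> L2" where
  "sgn_L2 u = inverse (norm u) *\<^sub>R u"

definition uniformity_L2 :: "(L2 \<times> L2) filter" where
  "uniformity_L2 = (INF e\<in>{0 <..}. principal {(x, y). dist x y < e})"

definition open_L2 :: "L2 set \<Rightarrow> bool" where
  "open_L2 U = (\<forall>x\<in>U. eventually (\<lambda>(x', y). x' = x \<longrightarrow> y \<in> U) uniformity)"

instance
proof
  fix u v w :: L2 and r s :: real and a b :: complex
  show "u + v + w = u + (v + w)"
    by transfer (auto simp: L2_rel_def square_integrable_add algebra_simps)
  show "u + v = v + u"
    by transfer (auto simp: L2_rel_def square_integrable_add algebra_simps)
  show "0 + u = u"
    by transfer (auto simp: L2_rel_def)
  show "- u + u = 0"
    by transfer (auto simp: L2_rel_def square_integrable_zero)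
  show "u - v = u + - v"
    by transfer (auto simp: L2_rel_def square_integrable_diff)
  show "r *\<^sub>R (u + v) = r *\<^sub>R u + r *\<^sub>R v"
    by transfer (auto simp: L2_rel_def distrib_left distrib_right mult.assoc intro!: square_integrable_scale square_integrable_add)
  show "(r + s) *\<^sub>R u = r *\<^sub>R u + s *\<^sub>R u"
    by transfer (auto simp: L2_rel_def distrib_left distrib_right mult.assoc intro!: square_integrable_scale square_integrable_add)
  show "r *\<^sub>R s *\<^sub>R u = (r * s) *\<^sub>R u"
    by transfer (auto simp: L2_rel_def distrib_left distrib_right mult.assoc intro!: square_integrable_scale)
  show "1 *\<^sub>R u = u"
    by transfer (auto simp: L2_rel_def)
  show "sgn u = inverse (norm u) *\<^sub>R u"
    by (rule sgn_L2_def)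
  show "dist u v = norm (u - v)"
    by (rule dist_L2_def)
  show "norm u = sqrt (inner u u)"
    by (rule norm_L2_def)
  show "(uniformity :: (L2 \<times> L2) filter) = (INF e\<in>{0 <..}. principal {(x, y). dist x y < e})"
    by (rule uniformity_L2_def)
  show "open U \<longleftrightarrow> (\<forall>x\<in>U. \<forall>\<^sub>F (x', y) in uniformity. x' = x \<longrightarrow> y \<in> U)" for U :: "L2 set"
    by (rule open_L2_def)
  show "a *\<^sub>C (u + v) = a *\<^sub>C u + a *\<^sub>C v"
    by transfer (auto simp: L2_rel_def distrib_left distrib_right mult.assoc intro!: square_integrable_scale square_integrable_add)
  show "(a + b) *\<^sub>C u = a *\<^sub>C u + b *\<^sub>C u"
    by transfer (auto simp: L2_rel_def distrib_left distrib_right mult.assoc intro!: square_integrable_scale square_integrable_add)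
  show "a *\<^sub>C b *\<^sub>C u = (a * b) *\<^sub>C u"
    by transfer (auto simp: L2_rel_def distrib_left distrib_right mult.assoc intro!: square_integrable_scale)
  show "r *\<^sub>R u = complex_of_real r *\<^sub>C u"
    by transfer (auto simp: L2_rel_def intro!: square_integrable_scale)
  show c1: "cinner u v = cnj (cinner v u)" for u v :: L2
    by transfer (subst Bochner_Integration.integral_cnj[symmetric], rule Bochner_Integration.integral_cong[OF refl],
        simp add: mult.commute)
  show c2: "cinner u (v + w) = cinner u v + cinner u w" for u v w :: L2
    by transfer (simp add: L2_rel_def distrib_left square_integrable_product)
  show c3: "cinner u (a *\<^sub>C v) = a * cinner u v" for u v :: L2 and a
    by transfer (simp add: mult.left_commute)
  show "inner u v = Re (cinner u v)"
    by (rule inner_L2_def)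
  show "inner u v = inner v u"
    unfolding inner_L2_def by (subst c1) simp
  show "inner (u + v) w = inner u w + inner v w"
    unfolding inner_L2_def by (subst (1 2 3) c1) (simp add: c2)
  have R: "r *\<^sub>R u = complex_of_real r *\<^sub>C u"
    by transfer (auto simp: L2_rel_def intro!: square_integrable_scale)
  show "inner (r *\<^sub>R u) v = r * inner u v"
    unfolding inner_L2_def R by (subst (1 2) c1) (simp add: c3)
  have n: "Re (LINT x|lborel. cnj (f x) * f x) = (LINT x|lborel. (cmod (f x))\<^sup>2)" for f
  proof -
    have "(\<lambda>x. cnj (f x) * f x) = (\<lambda>x. complex_of_real ((cmod (f x))\<^sup>2))"
      by (simp only: mult.commute[of "cnj _"] complex_norm_square)
    then show ?thesis
      by (simp only: integral_complex_of_real Re_complex_of_real)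
  qed
  show "0 \<le> inner u u"
    unfolding inner_L2_def by transfer (simp add: n)
  show "inner u u = 0 \<longleftrightarrow> u = 0"
    unfolding inner_L2_def
    by transfer (simp add: n L2_rel_def square_integrable_zero, simp add: square_integrable_def integral_nonneg_eq_0_iff_AE)
qed

end

lemma norm_abs_L2:
  assumes "square_integrable u"
  shows "(norm (abs_L2 u))\<^sup>2 = (LINT x|lborel. (cmod (u x))\<^sup>2)"
proof -
  have "L2_rel u u"
    using assms by (simp add: L2_rel_def)
  then have "cinner (abs_L2 u) (abs_L2 u) = (LINT x|lborel. cnj (u x) * u x)"
    by (simp add: cinner_L2.abs_eq)
  moreover have "(\<lambda>x. cnj (u x) * u x) = (\<lambda>x. complex_of_real ((cmod (u x))\<^sup>2))"
    by (simp only: mult.commute[of "cnj _"] complex_norm_square)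
  ultimately have "Re (cinner (abs_L2 u) (abs_L2 u)) = (LINT x|lborel. (cmod (u x))\<^sup>2)"
    by (simp only: integral_complex_of_real Re_complex_of_real)
  then show ?thesis
    by (metis inner_cinner power2_norm_eq_inner)
qed

lemma norm_diff_abs_L2:
  assumes "square_integrable u" "square_integrable v"
  shows "(norm (abs_L2 u - abs_L2 v))\<^sup>2 = (LINT x|lborel. (cmod (u x - v x))\<^sup>2)"
    and "ennreal ((norm (abs_L2 u - abs_L2 v))\<^sup>2) = (\<integral>\<^sup>+x. ennreal ((cmod (u x - v x))\<^sup>2) \<partial>lborel)"
proof -
  have "abs_L2 u - abs_L2 v = abs_L2 (\<lambda>x. u x - v x)"
    using assms by (intro minus_L2.abs_eq) (auto simp: L2_rel_def)
  then show *: "(norm (abs_L2 u - abs_L2 v))\<^sup>2 = (LINT x|lborel. (cmod (u x - v x))\<^sup>2)"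
    using norm_abs_L2[OF square_integrable_diff[OF assms]] by simp
  have "integrable lborel (\<lambda>x. (cmod (u x - v x))\<^sup>2)"
    using square_integrable_diff[OF assms] by (simp add: square_integrable_def)
  from nn_integral_eq_integral[OF this]
  show "ennreal ((norm (abs_L2 u - abs_L2 v))\<^sup>2) = (\<integral>\<^sup>+x. ennreal ((cmod (u x - v x))\<^sup>2) \<partial>lborel)"
    by (simp add: *)
qed

lemma square_integrable_rep_L2: "square_integrable (rep_L2 u)"
  using Quotient_rep_reflp[OF Quotient_L2, of u] by (simp add: L2_rel_def)

lemma abs_rep_L2: "abs_L2 (rep_L2 u) = u"
  by (rule Quotient_abs_rep[OF Quotient_L2])

text \<open>The Riesz--Fischer theorem.\<close>

instance L2 :: chilbert
proof
  fix X :: "nat \<Rightarrow> L2"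
  assume X: "Cauchy X"
  have "\<exists>N. \<forall>m\<ge>N. \<forall>n\<ge>N. norm (X m - X n) < (1/2) ^ k" for k :: nat
    using X[unfolded Cauchy_iff, rule_format, of "(1/2)^k"] by auto
  then obtain N where N: "\<And>k m n. m \<ge> N k \<Longrightarrow> n \<ge> N k \<Longrightarrow> norm (X m - X n) < (1/2) ^ k"
    by metis
  define r where "r k = k + (\<Sum>i\<le>k. N i)" for k
  have r_N: "N j \<le> r k" if "j \<le> k" for j k
    using member_le_sum[of j "{..k}" N] that by (auto simp: r_def)
  have r_mono: "strict_mono r"
    by (rule strict_monoI_Suc) (simp add: r_def)
  define F where "F k = rep_L2 (X (r k))" for k
  have F: "square_integrable (F k)" and absF: "abs_L2 (F k) = X (r k)" for k
    by (simp_all add: F_def square_integrable_rep_L2 abs_rep_L2)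
  have Fmeas [measurable]: "F k \<in> borel_measurable lborel" for k
    using F[of k] by (simp add: square_integrable_def)
  have F_dist: "(\<integral>\<^sup>+x. ennreal ((cmod (F m x - F n x))\<^sup>2) \<partial>lborel) \<le> ennreal ((1/4) ^ k)"
    if "k \<le> m" "k \<le> n" for k m n
  proof -
    have "norm (X (r m) - X (r n)) < (1/2) ^ k"
      using N r_N that by blast
    then have "(norm (X (r m) - X (r n)))\<^sup>2 \<le> ((1/2) ^ k)\<^sup>2"
      by (intro power_mono) auto
    also have "((1/2) ^ k)\<^sup>2 = (1/4 :: real) ^ k"
      by (simp add: power2_eq_square flip: power_mult_distrib)
    finally have "(norm (X (r m) - X (r n)))\<^sup>2 \<le> (1/4) ^ k" .
    then show ?thesis
      by (subst norm_diff_abs_L2(2)[OF F F, symmetric]) (simp add: absF ennreal_leI)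
  qed
  have "(\<integral>\<^sup>+x. (\<Sum>k. ennreal (2 ^ k * (cmod (F (Suc k) x - F k x))\<^sup>2)) \<partial>lborel)
      = (\<Sum>k. \<integral>\<^sup>+x. ennreal (2 ^ k) * ennreal ((cmod (F (Suc k) x - F k x))\<^sup>2) \<partial>lborel)"
    by (subst nn_integral_suminf) (simp_all add: ennreal_mult)
  also have "\<dots> = (\<Sum>k. ennreal (2 ^ k) * (\<integral>\<^sup>+x. ennreal ((cmod (F (Suc k) x - F k x))\<^sup>2) \<partial>lborel))"
    by (subst nn_integral_cmult) simp_all
  also have "\<dots> \<le> (\<Sum>k. ennreal (2 ^ k) * ennreal ((1/4) ^ k))"
    by (intro suminf_le mult_left_mono F_dist) auto
  also have "\<dots> = (\<Sum>k. ennreal ((1/2) ^ k))"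
  proof -
    have "(2 :: real) ^ k * (1/4) ^ k = (1/2) ^ k" for k
      by (simp flip: power_mult_distrib)
    then show ?thesis
      by (simp flip: ennreal_mult)
  qed
  also have "\<dots> = ennreal (\<Sum>k. (1/2) ^ k)"
    by (intro suminf_ennreal2) (auto intro: summable_geometric)
  finally have "(\<integral>\<^sup>+x. (\<Sum>k. ennreal (2 ^ k * (cmod (F (Suc k) x - F k x))\<^sup>2)) \<partial>lborel) \<noteq> \<infinity>"
    by (auto simp: top_unique)
  then have "AE x in lborel. (\<Sum>k. ennreal (2 ^ k * (cmod (F (Suc k) x - F k x))\<^sup>2)) \<noteq> \<infinity>"
    by (intro nn_integral_PInf_AE) auto
  moreover have "convergent (\<lambda>k. F k x)"
    if fin: "(\<Sum>k. ennreal (2 ^ k * (cmod (F (Suc k) x - F k x))\<^sup>2)) \<noteq> \<infinity>" for x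
  proof -
    define d where "d k = cmod (F (Suc k) x - F k x)" for k
    have s: "summable (\<lambda>k. 2 ^ k * (d k)\<^sup>2)"
      using fin by (intro summable_suminf_not_top) (auto simp: d_def)
    have "d k \<le> (1/2) ^ k + 2 ^ k * (d k)\<^sup>2" for k
    proof -
      have "a \<le> 1 + a\<^sup>2" for a :: real
        using zero_le_power2[of "a - 1/2"] unfolding power2_diff by (simp add: power_divide)
      then have "2 ^ k * d k \<le> 1 + (2 ^ k * d k)\<^sup>2" .
      then have "(1/2) ^ k * (2 ^ k * d k) \<le> (1/2) ^ k * (1 + (2 ^ k * d k)\<^sup>2)"
        by (intro mult_left_mono) auto
      then show ?thesis
        by (simp add: power2_eq_square field_simps)
    qed
    then have "summable d"
      by (intro summable_comparison_test'[OF summable_add[OF summable_geometric[of "1/2"] s]])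
         (auto simp: d_def)
    then have "summable (\<lambda>k. F (Suc k) x - F k x)"
      unfolding d_def by (rule summable_norm_cancel)
    then have "convergent (\<lambda>n. \<Sum>k<n. F (Suc k) x - F k x)"
      by (simp add: summable_iff_convergent)
    then have "convergent (\<lambda>n. F n x - F 0 x)"
      by (simp add: sum_lessThan_telescope[of "\<lambda>k. F k x"])
    then show ?thesis
      using convergent_add[OF _ convergent_const[of "F 0 x"]] by force
  qed
  ultimately have conv: "AE x in lborel. convergent (\<lambda>k. F k x)"
    by (rule eventually_mono)
  define G where "G x = lim (\<lambda>k. F k x)" for x
  have Gmeas [measurable]: "G \<in> borel_measurable lborel"
    unfolding G_def[abs_def] by measurable
  have FG: "(\<integral>\<^sup>+x. ennreal ((cmod (F k x - G x))\<^sup>2) \<partial>lborel) \<le> ennreal ((1/4) ^ k)" for k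
  proof -
    have "(\<integral>\<^sup>+x. ennreal ((cmod (F k x - G x))\<^sup>2) \<partial>lborel)
        = (\<integral>\<^sup>+x. liminf (\<lambda>m. ennreal ((cmod (F k x - F m x))\<^sup>2)) \<partial>lborel)"
    proof (rule nn_integral_cong_AE, rule AE_mp[OF conv AE_I2], rule impI)
      fix x
      assume "convergent (\<lambda>k. F k x)"
      then have "(\<lambda>m. F m x) \<longlonglongrightarrow> G x"
        by (simp add: G_def convergent_LIMSEQ_iff)
      then have "(\<lambda>m. ennreal ((cmod (F k x - F m x))\<^sup>2)) \<longlonglongrightarrow> ennreal ((cmod (F k x - G x))\<^sup>2)"
        by (intro tendsto_ennrealI tendsto_intros)
      then show "ennreal ((cmod (F k x - G x))\<^sup>2) = liminf (\<lambda>m. ennreal ((cmod (F k x - F m x))\<^sup>2))"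
        by (rule lim_imp_Liminf[OF sequentially_bot, symmetric])
    qed
    also have "\<dots> \<le> liminf (\<lambda>m. \<integral>\<^sup>+x. ennreal ((cmod (F k x - F m x))\<^sup>2) \<partial>lborel)"
      by (intro nn_integral_liminf) auto
    also have "\<dots> \<le> limsup (\<lambda>m. \<integral>\<^sup>+x. ennreal ((cmod (F k x - F m x))\<^sup>2) \<partial>lborel)"
      by (intro Liminf_le_Limsup) auto
    also have "\<dots> \<le> ennreal ((1/4) ^ k)"
      by (intro Limsup_bounded eventually_sequentiallyI[of k] F_dist) auto
    finally show ?thesis .
  qed
  have sub: "square_integrable (\<lambda>x. F 0 x - G x)"
    unfolding square_integrable_def
  proof
    show "integrable lborel (\<lambda>x. (cmod (F 0 x - G x))\<^sup>2)"
      using FG[of 0] by (intro integrableI_bounded) (auto simp: le_less_trans)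
  qed auto
  have G: "square_integrable G"
    using square_integrable_diff[OF F[of 0] sub] by simp
  have "norm (X (r k) - abs_L2 G) \<le> (1/2) ^ k" for k
  proof -
    have "ennreal ((norm (X (r k) - abs_L2 G))\<^sup>2) \<le> ennreal ((1/4) ^ k)"
      using FG[of k] norm_diff_abs_L2(2)[OF F[of k] G] by (simp add: absF)
    then have "(norm (X (r k) - abs_L2 G))\<^sup>2 \<le> (1/4) ^ k"
      by (simp add: ennreal_le_iff)
    also have "(1/4 :: real) ^ k = ((1/2) ^ k)\<^sup>2"
      by (simp add: power2_eq_square flip: power_mult_distrib)
    finally show ?thesis
      by (rule power2_le_imp_le) simp
  qed
  then have "(\<lambda>k. X (r k) - abs_L2 G) \<longlonglongrightarrow> 0"
    by (intro Lim_null_comparison[OF _ LIMSEQ_power_zero[of "1/2 :: real"]]) auto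
  then have "(\<lambda>k. X (r k)) \<longlonglongrightarrow> abs_L2 G"
    by (simp add: LIM_zero_iff)
  then have "(X \<circ> r) \<longlonglongrightarrow> abs_L2 G"
    by (simp add: comp_def)
  moreover have "\<forall>e>0. \<exists>M. \<forall>m\<ge>M. \<forall>n\<ge>M. dist (X m) (X n) < e"
    using X by (simp add: Cauchy_def)
  ultimately have "X \<longlonglongrightarrow> abs_L2 G"
    using Cauchy_converges_subseq[OF X r_mono] by blast
  then show "convergent X"
    by (rule convergentI)
qed

text \<open>Multiplication by a bounded measurable function (and zero if \<open>\<psi>\<close> is not such a function).\<close>

lift_definition mult_op :: "(real \<Rightarrow> complex) \<Rightarrow> L2 \<Rightarrow> L2" is
  "\<lambda>\<psi> u x. if \<psi> \<in> borel_measurable lborel \<and> bounded (range \<psi>) then \<psi> x * u x else 0"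
proof goal_cases
  case (1 \<psi> u v)
  then show ?case
    by (cases "\<psi> \<in> borel_measurable lborel \<and> bounded (range \<psi>)")
       (auto simp: L2_rel_def square_integrable_mult square_integrable_zero)
qed

section \<open>Weak derivatives and the operator D\<close>

definition test_function :: "(real \<Rightarrow> real) \<Rightarrow> bool" where
  "test_function \<phi> \<longleftrightarrow>
     (\<forall>n. (deriv ^^ n) \<phi> differentiable_on UNIV) \<and> bounded {x. \<phi> x \<noteq> 0}"

definition locally_integrable ::
    "(real \<Rightarrow> 'a::{banach, second_countable_topology}) \<Rightarrow> bool" where
  "locally_integrable u \<longleftrightarrow> (\<forall>K. compact K \<longrightarrow> set_integrable lborel K u)"

definition weak_derivative ::
    "(real \<Rightarrow> 'a::{banach, second_countable_topology}) \<Rightarrow> (real \<Rightarrow> 'a) \<Rightarrow> bool" where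
  "weak_derivative u v \<longleftrightarrow> locally_integrable u \<and> locally_integrable v \<and>
     (\<forall>\<phi>. test_function \<phi> \<longrightarrow>
        (LINT x|lborel. deriv \<phi> x *\<^sub>R u x) = - (LINT x|lborel. \<phi> x *\<^sub>R v x))"

definition sobolev_W11 :: "(real \<Rightarrow> real) \<Rightarrow> bool" where
  "sobolev_W11 f \<longleftrightarrow> integrable lborel f \<and> (\<exists>f'. integrable lborel f' \<and> weak_derivative f f')"

text \<open>The graph of \<open>D = -i d/dx\<close>. Its domain consists of the \<open>u\<close> in \<open>L\<^sup>2\<close> with weak derivative
  in \<open>L\<^sup>2\<close>, that is, of the Sobolev space \<open>W\<^sup>1\<^sup>,\<^sup>2\<close>.\<close>

definition D_op :: "(L2 \<times> L2) set" where
  "D_op = {(u, - \<i> *\<^sub>C w) | u w. weak_derivative (rep_L2 u) (rep_L2 w)}"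

definition g_fun :: "real \<Rightarrow> real" where
  "g_fun x = x * (1 + x\<^sup>2) powr (- 1 / 2)"

end

(*
On the Fourier side the commutator [psi, g(D)] has the kernel psihat(x - y) (g(y) - g(x)). With A = (1 + x^2)^(1/2)
and B = (1 + y^2)^(1/2) one has
  g(x) - g(y) = 2 (x - y) / (A B (A + B)) + (g(x) - g(y)) (x - y)^2 / (A + B)^2,
and the factors x - y turn psihat into the transforms of psi' and psi''. Both 2 / (A B (A + B)) and 1 / (A + B)^2 are of the form
int a(t, x) a(t, y) dt, so multiplication by the transform of an integrable h yields a superposition of rank one operators, with
trace norm at most a constant times the L1 norm of h. As psi itself is not integrable, it is cut off by 1 / (1 + (x/n)^2) with bounds
uniform in n; the trace norm is controlled by duality, through sums over pairs of finite Bessel families.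

For sgn(D), let u and v be the indicators of (r, 2 r] and of its mirror image. Then |<v, sgn(D) u>| is at least r / (4 pi), while psi is
almost equal to its limits, which differ, on the two intervals. Hence ||[psi, sgn(D)] u|| is at least a constant times ||u||; for
r = 2^n these are infinitely many orthogonal vectors, and the commutator is not even Hilbert--Schmidt.

The functional calculus is defined by an arbitrary spectral measure of D, which therefore has to be shown unique; it is the one
induced by the Fourier transform.
*)
theory Submission
  imports Defs "HOL-Probability.Probability"
begin

section \<open>Complex inner product spaces\<close>

text \<open>Both symbols tend to 1 and -1 at the two ends of the line; what separates them is the
  jump of \<open>sgn\<close> at 0. It makes sgn(D) scale invariant, so it couples the two half lines
  equally strongly at every scale, and the integral condition says precisely that
  \<open>\<psi>\<close> has different limits there. For g the obstacle is that g(x) - g(y) does not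
  become small when x and y have opposite signs. Its identity therefore keeps g(x) - g(y) on the
  right, where it costs only two bounded multiplications by g. The price is two derivatives: psi' =
  -i f psi and psi'' = (-i f' - f^2) psi are integrable because f and f' are and f is bounded. As f'
  is only a weak derivative, psi'' is identified through its transform, by integration by parts.
  Bessel families replace orthonormal ones in the duality because contractions with an adjoint
  preserve them: the Fourier transform, cutoffs, multiplication by g. Since \<open>abs_op\<close>
  and \<open>cadjoint\<close> are definite descriptions, square roots of positive operators are
  constructed and adjoints are exhibited.\<close>

lemma cinner_add_left: "cinner (x + y) z = cinner x z + cinner y z"
  for x y z :: "'a::complex_inner"
  by (metis cinner_commute cinner_add_right complex_cnj_add)

lemma cinner_scaleC_left: "cinner (a *\<^sub>C x) y = cnj a * cinner x y"
  for x y :: "'a::complex_inner"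
  by (metis cinner_commute cinner_scaleC_right complex_cnj_mult)

lemma cinner_scaleR_right [simp]: "cinner x (r *\<^sub>R y) = complex_of_real r * cinner x y"
  for x y :: "'a::complex_inner"
  by (simp add: scaleR_scaleC cinner_scaleC_right)

lemma cinner_scaleR_left [simp]: "cinner (r *\<^sub>R x) y = complex_of_real r * cinner x y"
  for x y :: "'a::complex_inner"
  by (simp add: scaleR_scaleC cinner_scaleC_left)

lemma cinner_zero_right [simp]: "cinner x 0 = 0" for x :: "'a::complex_inner"
  using cinner_scaleR_right[of x 0 0] by simp

lemma cinner_zero_left [simp]: "cinner 0 x = 0" for x :: "'a::complex_inner"
  using cinner_scaleR_left[of 0 0 x] by simp

lemma cinner_minus_right [simp]: "cinner x (- y) = - cinner x y" for x y :: "'a::complex_inner"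
  using cinner_scaleR_right[of x "-1" y] by simp

lemma cinner_minus_left [simp]: "cinner (- x) y = - cinner x y" for x y :: "'a::complex_inner"
  using cinner_scaleR_left[of "-1" x y] by simp

lemma cinner_diff_right: "cinner x (y - z) = cinner x y - cinner x z"
  for x y z :: "'a::complex_inner"
  using cinner_add_right[of x y "- z"] by simp

lemma cinner_diff_left: "cinner (x - y) z = cinner x z - cinner y z"
  for x y z :: "'a::complex_inner"
  using cinner_add_left[of x "- y" z] by simp

lemma cinner_sum_right: "cinner x (\<Sum>i\<in>I. f i) = (\<Sum>i\<in>I. cinner x (f i))"
  for x :: "'a::complex_inner"
  by (induction I rule: infinite_finite_induct) (simp_all add: cinner_add_right)

lemma cinner_sum_left: "cinner (\<Sum>i\<in>I. f i) x = (\<Sum>i\<in>I. cinner (f i) x)"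
  for x :: "'a::complex_inner"
  by (induction I rule: infinite_finite_induct) (simp_all add: cinner_add_left)

lemmas cinner_distribs = cinner_add_left cinner_add_right cinner_diff_left cinner_diff_right
  cinner_scaleC_left cinner_scaleC_right

lemma cinner_self: "cinner x x = complex_of_real ((norm x)\<^sup>2)" for x :: "'a::complex_inner"
proof -
  have "Im (cinner x x) = 0"
    by (metis cinner_commute Reals_cnj_iff complex_is_Real_iff)
  then show ?thesis
    by (simp add: complex_eq_iff power2_norm_eq_inner inner_cinner)
qed

lemma complex_mult_cnj_cmod': "z * cnj z = (complex_of_real (cmod z))\<^sup>2" "cnj z * z = (complex_of_real (cmod z))\<^sup>2"
  by (metis complex_norm_square of_real_power mult.commute)+

lemma norm_scaleC: "norm (a *\<^sub>C x) = cmod a * norm x" for x :: "'a::complex_inner"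
proof -
  have "complex_of_real ((norm (a *\<^sub>C x))\<^sup>2) = complex_of_real ((cmod a * norm x)\<^sup>2)"
    unfolding cinner_self[symmetric] cinner_scaleC_left cinner_scaleC_right
    by (simp add: cinner_self power_mult_distrib complex_mult_cnj_cmod')
  then have "(norm (a *\<^sub>C x))\<^sup>2 = (cmod a * norm x)\<^sup>2"
    by (simp only: of_real_eq_iff)
  then show ?thesis
    by (simp add: power2_eq_iff_nonneg)
qed

text \<open>The real inequality is applied after x has been multiplied by the phase of the inner
  product: this makes the inner product real and nonnegative and changes no norm.\<close>

lemma cinner_Cauchy_Schwarz: "cmod (cinner x y) \<le> norm x * norm y" for x y :: "'a::complex_inner"
proof (cases "cinner x y = 0")
  case False
  define c where "c = cinner x y / cmod (cinner x y)"
  have "cmod c = 1"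
    using False by (simp add: c_def norm_divide)
  have "cmod (cinner x y) = Re (cinner (c *\<^sub>C x) y)"
    using False by (simp add: cinner_scaleC_left c_def mult.commute[of "cnj _"] complex_norm_square[symmetric] power2_eq_square
        flip: of_real_mult)
  also have "\<dots> \<le> norm (c *\<^sub>C x) * norm y"
    using Cauchy_Schwarz_ineq2[of "c *\<^sub>C x" y] by (simp add: inner_cinner)
  also have "\<dots> = norm x * norm y"
    by (simp add: norm_scaleC \<open>cmod c = 1\<close>)
  finally show ?thesis .
qed auto

lemma bounded_bilinear_cinner: "bounded_bilinear (cinner :: 'a::complex_inner \<Rightarrow> 'a \<Rightarrow> complex)"
proof
  show "\<exists>K. \<forall>a b::'a. norm (cinner a b) \<le> norm a * norm b * K"
    using cinner_Cauchy_Schwarz by (intro exI[of _ 1]) auto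
qed (auto simp: cinner_add_left cinner_add_right scaleR_conv_of_real)

lemmas tendsto_cinner [tendsto_intros] = bounded_bilinear.tendsto[OF bounded_bilinear_cinner]

lemma scaleC_zero_right [simp]: "a *\<^sub>C (0::'a::complex_inner) = 0"
  by (metis add_cancel_right_right scaleC_add_right)

lemma scaleC_minus_right: "a *\<^sub>C (- x) = - (a *\<^sub>C x)" for x :: "'a::complex_inner"
  by (metis add.right_inverse neg_eq_iff_add_eq_0 scaleC_add_right scaleC_zero_right)

lemma scaleC_diff_right: "a *\<^sub>C (x - y) = a *\<^sub>C x - a *\<^sub>C y" for x y :: "'a::complex_inner"
  using scaleC_add_right[of a x "- y"] by (simp add: scaleC_minus_right)

lemma scaleC_one [simp]: "1 *\<^sub>C x = x" for x :: "'a::complex_inner"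
  using scaleR_scaleC[of 1 x] by simp

lemma scaleC_scaleR: "c *\<^sub>C r *\<^sub>R x = r *\<^sub>R c *\<^sub>C x" for x :: "'a::complex_inner"
  by (simp add: scaleR_scaleC scaleC_scaleC mult.commute)

lemma cinner_eqI:
  fixes x y :: "'a::complex_inner"
  assumes "\<And>z. cinner z x = cinner z y"
  shows "x = y"
proof -
  have "cinner (x - y) (x - y) = 0"
    using assms by (simp add: cinner_diff_right)
  then show ?thesis
    by (simp add: cinner_self)
qed

lemma cnj_cinner [simp]: "cnj (cinner x y) = cinner y x" for x y :: "'a::complex_inner"
  by (metis cinner_commute)

lemma cinner_mult_swap: "cinner x y * cinner y x = (complex_of_real (cmod (cinner x y)))\<^sup>2"
  for x y :: "'a::complex_inner"
  by (metis cnj_cinner complex_mult_cnj_cmod'(1))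

lemma cmod_cinner_commute: "cmod (cinner x y) = cmod (cinner y x)" for x y :: "'a::complex_inner"
  by (metis cinner_commute complex_mod_cnj)

lemma bounded_clinearD:
  assumes "bounded_clinear T"
  shows "T (x + y) = T x + T y" "T (x - y) = T x - T y" "T (r *\<^sub>R x) = r *\<^sub>R T x" "T (c *\<^sub>C x) = c *\<^sub>C T x"
    "T 0 = 0" "T (- x) = - T x"
  using assms by (auto simp: bounded_clinear_def linear_simps)

lemma bounded_clinearI:
  assumes "\<And>x y. T (x + y) = T x + T y" "\<And>c x. T (c *\<^sub>C x) = c *\<^sub>C T x" "\<And>x. norm (T x) \<le> K * norm x"
  shows "bounded_clinear T"
  unfolding bounded_clinear_def
proof
  show "bounded_linear T"
    by (rule bounded_linear_intro[of _ K]) (auto simp: assms scaleR_scaleC mult.commute)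
qed (auto simp: assms)

lemma bounded_clinear_bound:
  assumes "bounded_clinear T"
  obtains K where "K > 0" "\<And>x. norm (T x) \<le> K * norm x"
  using bounded_linear.pos_bounded[of T] assms by (auto simp: bounded_clinear_def mult.commute)

lemma bounded_clinear_compose:
  assumes "bounded_clinear S" "bounded_clinear T"
  shows "bounded_clinear (\<lambda>x. S (T x))"
  using assms by (auto simp: bounded_clinear_def intro: bounded_linear_compose)

lemma bounded_clinear_diff:
  assumes "bounded_clinear S" "bounded_clinear T"
  shows "bounded_clinear (\<lambda>x. S x - T x)"
  using assms by (auto simp: bounded_clinear_def scaleC_diff_right intro: bounded_linear_sub)

lemma bounded_clinear_add:
  assumes "bounded_clinear S" "bounded_clinear T"
  shows "bounded_clinear (\<lambda>x. S x + T x)"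
  using assms by (auto simp: bounded_clinear_def scaleC_add_right intro: bounded_linear_add)

lemma bounded_clinear_scaleR:
  assumes "bounded_clinear T"
  shows "bounded_clinear (\<lambda>x. r *\<^sub>R T x)"
  using assms by (auto simp: bounded_clinear_def scaleC_scaleR intro: bounded_linear_const_scaleR)

lemma bounded_clinear_ident: "bounded_clinear (\<lambda>x. x)"
  by (simp add: bounded_clinear_def)

lemma bounded_clinear_zero: "bounded_clinear (\<lambda>x. 0)"
  by (simp add: bounded_clinear_def)

lemma bounded_clinear_tendsto:
  assumes "bounded_clinear T" "(f \<longlongrightarrow> l) net"
  shows "((\<lambda>x. T (f x)) \<longlongrightarrow> T l) net"
  using assms by (auto simp: bounded_clinear_def intro: bounded_linear.tendsto)

text \<open>A relation between explicit operators: each adjoint below is exhibited, and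
  \<open>cadjoint\<close> is then computed from it by uniqueness.\<close>

definition adjoint_pair :: "('a::chilbert \<Rightarrow> 'a) \<Rightarrow> ('a \<Rightarrow> 'a) \<Rightarrow> bool" where
  "adjoint_pair T S \<longleftrightarrow> (\<forall>x y. cinner (S x) y = cinner x (T y))"

lemma adjoint_pair_sym: "adjoint_pair T S \<Longrightarrow> adjoint_pair S T"
  unfolding adjoint_pair_def by (metis cinner_commute)

lemma cadjoint_eq:
  assumes "adjoint_pair T S"
  shows "cadjoint T = S"
  unfolding cadjoint_def
proof (rule the_equality)
  show "\<forall>x y. cinner (S x) y = cinner x (T y)"
    using assms by (simp add: adjoint_pair_def)
  fix S' assume S': "\<forall>x y. cinner (S' x) y = cinner x (T y)"
  show "S' = S"
  proof (rule ext, rule cinner_eqI)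
    fix x z
    have "cinner (S' x) z = cinner (S x) z"
      using S' assms by (simp add: adjoint_pair_def)
    then show "cinner z (S' x) = cinner z (S x)"
      by (metis cinner_commute)
  qed
qed

text \<open>||S x||^2 = <x, T S x> is at most K ||x|| ||S x||; one factor ||S x|| cancels.\<close>

lemma adjoint_bound:
  assumes "adjoint_pair T S" "\<And>x. norm (T x) \<le> K * norm x"
  shows "norm (S x) \<le> K * norm x"
proof (cases "norm (S x) = 0")
  case True
  then show ?thesis using order_trans[OF norm_ge_zero assms(2)[of x]] by simp
next
  case False
  have "norm (S x) * norm (S x) = cmod (cinner (S x) (S x))"
    by (simp add: cinner_self power2_eq_square norm_mult)
  also have "\<dots> = cmod (cinner x (T (S x)))"
    using assms(1) by (simp add: adjoint_pair_def)
  also have "\<dots> \<le> norm x * norm (T (S x))"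
    by (rule cinner_Cauchy_Schwarz)
  also have "\<dots> \<le> norm x * (K * norm (S x))"
    using assms(2) by (intro mult_left_mono) auto
  finally show ?thesis
    using False by (simp add: mult.left_commute mult.assoc)
qed

section \<open>Bessel families and orthonormal bases\<close>

text \<open>Orthonormality is weakened to its consequence, Bessel's inequality, which survives
  contractions. The vectors are indexed, not collected in a set, because images under a contraction
  may coincide or vanish.\<close>

definition bessel_family :: "'i set \<Rightarrow> ('i \<Rightarrow> 'a::chilbert) \<Rightarrow> bool" where
  "bessel_family F e \<longleftrightarrow> finite F \<and> (\<forall>z. (\<Sum>j\<in>F. (cmod (cinner (e j) z))\<^sup>2) \<le> (norm z)\<^sup>2)"

text \<open>The finite sum is the orthogonal projection of z; Pythagoras gives the first two claims,
  and the first one, being a square, gives the third.\<close>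

lemma bessel_inequality:
  fixes e :: "'i \<Rightarrow> 'a::chilbert"
  assumes fin: "finite F" and one: "\<And>i. i \<in> F \<Longrightarrow> norm (e i) = 1"
    and orth: "\<And>i j. i \<in> F \<Longrightarrow> j \<in> F \<Longrightarrow> i \<noteq> j \<Longrightarrow> cinner (e i) (e j) = 0"
  shows "(norm (z - (\<Sum>i\<in>F. cinner (e i) z *\<^sub>C e i)))\<^sup>2 = (norm z)\<^sup>2 - (\<Sum>j\<in>F. (cmod (cinner (e j) z))\<^sup>2)"
    and "(norm (\<Sum>i\<in>F. cinner (e i) z *\<^sub>C e i))\<^sup>2 = (\<Sum>j\<in>F. (cmod (cinner (e j) z))\<^sup>2)"
    and "bessel_family F e"
proof -
  let ?s = "\<lambda>z. \<Sum>i\<in>F. cinner (e i) z *\<^sub>C e i"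
  have ej: "cinner (e j) (?s z) = cinner (e j) z" if "j \<in> F" for j z
  proof -
    have "cinner (e j) (?s z) = (\<Sum>i\<in>F. if i = j then cinner (e j) z else 0)"
      unfolding cinner_sum_right
      by (rule sum.cong) (auto simp: cinner_scaleC_right cinner_self one that orth)
    then show ?thesis using fin that by simp
  qed
  have sz: "cinner (?s z) z = complex_of_real (\<Sum>j\<in>F. (cmod (cinner (e j) z))\<^sup>2)" for z
    unfolding cinner_sum_left of_real_sum
    by (rule sum.cong) (simp_all add: cinner_scaleC_left cinner_mult_swap cmod_cinner_commute[of z])
  have ss: "cinner (?s z) (?s z) = complex_of_real (\<Sum>j\<in>F. (cmod (cinner (e j) z))\<^sup>2)" for z
    unfolding cinner_sum_left[of _ _ "?s z"] of_real_sum
    by (rule sum.cong) (simp_all add: cinner_scaleC_left ej cinner_mult_swap cmod_cinner_commute[of z])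
  show s2: "(norm (?s z))\<^sup>2 = (\<Sum>j\<in>F. (cmod (cinner (e j) z))\<^sup>2)" for z
    using ss[of z] unfolding cinner_self by (simp only: of_real_eq_iff)
  show d2: "(norm (z - ?s z))\<^sup>2 = (norm z)\<^sup>2 - (\<Sum>j\<in>F. (cmod (cinner (e j) z))\<^sup>2)" for z
  proof -
    have zs: "cinner z (?s z) = complex_of_real (\<Sum>j\<in>F. (cmod (cinner (e j) z))\<^sup>2)"
      by (subst cinner_commute, subst sz) simp
    have "complex_of_real ((norm (z - ?s z))\<^sup>2) = complex_of_real ((norm z)\<^sup>2 - (\<Sum>j\<in>F. (cmod (cinner (e j) z))\<^sup>2))"
      unfolding cinner_self[symmetric] cinner_diff_left cinner_diff_right zs sz ss by (simp add: cinner_self)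
    then show ?thesis by (simp only: of_real_eq_iff)
  qed
  show "bessel_family F e"
    unfolding bessel_family_def
  proof (intro conjI allI fin)
    fix z
    have "0 \<le> (norm (z - ?s z))\<^sup>2" by simp
    then show "(\<Sum>j\<in>F. (cmod (cinner (e j) z))\<^sup>2) \<le> (norm z)\<^sup>2"
      unfolding d2 by simp
  qed
qed

text \<open>The Bessel sum of the vectors T e at z is that of the vectors e at S z, and the adjoint
  S is a contraction together with T.\<close>

lemma bessel_family_image:
  assumes "bessel_family F e" "adjoint_pair T S" "\<And>x. norm (T x) \<le> norm x"
  shows "bessel_family F (\<lambda>j. T (e j))"
  unfolding bessel_family_def
proof (intro conjI allI)
  show "finite F" using assms(1) by (simp add: bessel_family_def)
  fix z
  have eq: "cinner (T (e j)) z = cinner (e j) (S z)" for j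
    using adjoint_pair_sym[OF assms(2)] by (simp add: adjoint_pair_def)
  have "(\<Sum>j\<in>F. (cmod (cinner (T (e j)) z))\<^sup>2) \<le> (norm (S z))\<^sup>2"
    using assms(1) by (simp add: bessel_family_def eq)
  also have "\<dots> \<le> (norm z)\<^sup>2"
    using adjoint_bound[OF assms(2), of 1 z] assms(3) by (intro power_mono) auto
  finally show "(\<Sum>j\<in>F. (cmod (cinner (T (e j)) z))\<^sup>2) \<le> (norm z)\<^sup>2" .
qed

lemma onb_bessel:
  assumes "is_onb B" "finite F" "F \<subseteq> B"
  shows "(norm (\<Sum>e\<in>F. cinner e z *\<^sub>C e))\<^sup>2 = (\<Sum>e\<in>F. (cmod (cinner e z))\<^sup>2)"
    and "bessel_family F (\<lambda>e. e)"
proof -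
  have 1: "norm e = 1" if "e \<in> F" for e
    using assms that by (auto simp: is_onb_def)
  have 2: "cinner e e' = 0" if "e \<in> F" "e' \<in> F" "e \<noteq> e'" for e e'
  proof -
    have "pairwise (\<lambda>x y. cinner x y = 0) B" using assms(1) by (simp add: is_onb_def)
    then show ?thesis using pairwiseD[of _ B e e'] that assms(3) by auto
  qed
  show "(norm (\<Sum>e\<in>F. cinner e z *\<^sub>C e))\<^sup>2 = (\<Sum>e\<in>F. (cmod (cinner e z))\<^sup>2)"
    by (rule bessel_inequality(2)[OF assms(2) 1 2])
  show "bessel_family F (\<lambda>e. e)"
    by (rule bessel_inequality(3)[OF assms(2) 1 2])
qed

text \<open>Zorn's lemma for orthonormal sets. Maximality becomes the totality clause of
  \<open>is_onb\<close>: a nonzero vector orthogonal to all of M could be normalised and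
  added.\<close>

lemma onb_exists: "\<exists>B::'a::chilbert set. is_onb B"
proof -
  define S where "S = {B::'a set. (\<forall>e\<in>B. norm e = 1) \<and> pairwise (\<lambda>x y. cinner x y = 0) B}"
  have "\<exists>M\<in>S. \<forall>X\<in>S. M \<subseteq> X \<longrightarrow> X = M"
  proof (rule subset_Zorn_nonempty)
    have "{} \<in> S" by (simp add: S_def)
    then show "S \<noteq> {}" by blast
    fix C assume C: "C \<noteq> {}" "subset.chain S C"
    then have CS: "C \<subseteq> S" and ch: "\<And>X Y. X \<in> C \<Longrightarrow> Y \<in> C \<Longrightarrow> X \<subseteq> Y \<or> Y \<subseteq> X"
      by (auto simp: subset.chain_def)
    have "cinner x y = 0" if "x \<in> X" "X \<in> C" "y \<in> Y" "Y \<in> C" "x \<noteq> y" for x y X Y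
    proof -
      have "X \<in> S" "Y \<in> S" using that(2,4) CS by auto
      then have p: "pairwise (\<lambda>x y. cinner x y = 0) X" "pairwise (\<lambda>x y. cinner x y = 0) Y"
        by (simp_all add: S_def)
      from ch[OF that(2,4)] show ?thesis
      proof
        assume "X \<subseteq> Y"
        then show ?thesis using pairwiseD[OF p(2), of x y] that by auto
      next
        assume "Y \<subseteq> X"
        then show ?thesis using pairwiseD[OF p(1), of x y] that by auto
      qed
    qed
    then have "pairwise (\<lambda>x y. cinner x y = 0) (\<Union>C)"
      by (intro pairwiseI) (elim UnionE)
    moreover have "norm e = 1" if "e \<in> \<Union>C" for e
    proof -
      from that obtain X where "e \<in> X" "X \<in> S" using CS by auto
      then show ?thesis by (simp add: S_def)
    qed
    ultimately show "\<Union>C \<in> S"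
      by (simp add: S_def)
  qed
  then obtain M where M: "M \<in> S" and "\<forall>X\<in>S. M \<subseteq> X \<longrightarrow> X = M" by (rule bexE)
  then have M': "X = M" if "X \<in> S" "M \<subseteq> X" for X using that by simp
  have "x = 0" if x: "\<forall>e\<in>M. cinner e x = 0" for x
  proof (rule ccontr)
    assume nz: "x \<noteq> 0"
    define u where "u = (1 / norm x) *\<^sub>R x"
    have u: "norm u = 1" "\<And>e. e \<in> M \<Longrightarrow> cinner e u = 0"
      using nz x by (auto simp: u_def)
    have u': "\<And>e. e \<in> M \<Longrightarrow> cinner u e = 0"
      using u(2) by (metis cinner_commute complex_cnj_zero)
    have "insert u M \<in> S"
      using M u u' by (auto simp: S_def pairwise_insert)
    then have "u \<in> M" using M'[of "insert u M"] by auto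
    then have "cinner u u = 0" using u(2) by blast
    then show False using u(1) by (simp add: cinner_self)
  qed
  then have "is_onb M"
    using M by (auto simp: is_onb_def S_def)
  then show ?thesis ..
qed

text \<open>An orthonormal expansion converges to a vector y with the same coefficients as z, so y =
  z by totality; continuity of the norm then identifies the sum of squares.\<close>

lemma parseval:
  assumes B: "is_onb B"
  shows "((\<lambda>e. (cmod (cinner e z))\<^sup>2) has_sum (norm z)\<^sup>2) B"
proof -
  let ?s = "\<lambda>F. \<Sum>e\<in>F. cinner e z *\<^sub>C e"
  let ?q = "\<lambda>F. \<Sum>e\<in>F. (cmod (cinner e z))\<^sup>2"
  have bess: "?q F \<le> (norm z)\<^sup>2" if "finite F" "F \<subseteq> B" for F
    using onb_bessel(2)[OF B that] by (simp add: bessel_family_def)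
  define q where "q = Sup (?q ` {F. finite F \<and> F \<subseteq> B})"
  have bdd: "bdd_above (?q ` {F. finite F \<and> F \<subseteq> B})"
    using bess by (intro bdd_aboveI2) auto
  have q_ub: "?q F \<le> q" if "finite F" "F \<subseteq> B" for F
    unfolding q_def using bdd that by (intro cSup_upper) auto
  \<comment> \<open>B may be uncountable. Finite sets that come within (1/2)^n of the supremum q
    yield a convergent sequence of partial sums; taking unions makes them increasing.\<close>
  have "\<exists>F. finite F \<and> F \<subseteq> B \<and> q - (1/2)^n < ?q F" for n :: nat
  proof -
    have "q - (1/2)^n < Sup (?q ` {F. finite F \<and> F \<subseteq> B})" by (simp add: q_def)
    then show ?thesis
      by (subst (asm) less_cSup_iff[OF _ bdd]) auto
  qed
  then obtain F0 where F0: "\<And>n. finite (F0 n)" "\<And>n. F0 n \<subseteq> B" "\<And>n. q - (1/2)^n < ?q (F0 n)"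
    by metis
  define F where "F n = (\<Union>k\<le>n. F0 k)" for n
  have F: "finite (F n)" "F n \<subseteq> B" for n
    using F0 by (auto simp: F_def)
  have Fmono: "F m \<subseteq> F n" if "m \<le> n" for m n
    using that by (auto simp: F_def intro: order_trans)
  have Fq: "q - (1/2)^n < ?q (F n)" for n
    by (rule less_le_trans[OF F0(3)], rule sum_mono2) (use F(1) in \<open>auto simp: F_def\<close>)
  have diff: "(norm (?s (F n) - ?s (F m)))\<^sup>2 \<le> (1/2)^m" if "m \<le> n" for m n
  proof -
    have "?s (F n) - ?s (F m) = ?s (F n - F m)"
      using F Fmono[OF that] by (simp add: sum_diff)
    then have "(norm (?s (F n) - ?s (F m)))\<^sup>2 = ?q (F n - F m)"
      using onb_bessel(1)[OF B, of "F n - F m"] F by auto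
    also have "\<dots> = ?q (F n) - ?q (F m)"
      using F Fmono[OF that] by (simp add: sum_diff)
    also have "\<dots> \<le> (1/2)^m"
      using Fq[of m] q_ub[OF F, of n] by simp
    finally show ?thesis .
  qed
  have "Cauchy (\<lambda>n. ?s (F n))"
  proof (rule metric_CauchyI)
    fix \<epsilon> :: real assume "\<epsilon> > 0"
    then obtain M where M: "(1/2)^M < \<epsilon>\<^sup>2"
      using real_arch_pow_inv[of "\<epsilon>\<^sup>2" "1/2"] by auto
    show "\<exists>M. \<forall>m\<ge>M. \<forall>n\<ge>M. dist (?s (F m)) (?s (F n)) < \<epsilon>"
    proof (intro exI allI impI)
      have *: "dist (?s (F m)) (?s (F n)) < \<epsilon>" if "M \<le> m" "m \<le> n" for m n
      proof -
        have "(norm (?s (F n) - ?s (F m)))\<^sup>2 \<le> (1/2)^m" by (rule diff[OF that(2)])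
        also have "\<dots> \<le> (1/2)^M" using that by (intro power_decreasing) auto
        also have "\<dots> < \<epsilon>\<^sup>2" by (rule M)
        finally show ?thesis
          using \<open>\<epsilon> > 0\<close> by (simp add: dist_norm norm_minus_commute power_less_imp_less_base)
      qed
      fix m n assume "M \<le> m" "M \<le> n"
      then show "dist (?s (F m)) (?s (F n)) < \<epsilon>"
        using *[of m n] *[of n m] by (cases "m \<le> n") (auto simp: dist_commute)
    qed
  qed
  then obtain y where y: "(\<lambda>n. ?s (F n)) \<longlonglongrightarrow> y"
    using Cauchy_convergent_iff convergent_def by blast
  have ey: "cinner e y = cinner e z" if e: "e \<in> B" for e
  proof -
    have lim: "(\<lambda>n. cinner e (?s (F n))) \<longlonglongrightarrow> cinner e y"
      by (intro tendsto_intros y)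
    have val: "cinner e (?s G) = (if e \<in> G then cinner e z else 0)" if "finite G" "G \<subseteq> B" for G
    proof -
      have "cinner e (?s G) = (\<Sum>e'\<in>G. if e' = e then cinner e z else 0)"
        unfolding cinner_sum_right using B e that
        by (intro sum.cong) (auto simp: cinner_scaleC_right cinner_self is_onb_def pairwise_def subset_iff)
      then show ?thesis using that by simp
    qed
    show ?thesis
    proof (cases "\<exists>m. e \<in> F m")
      case True
      then obtain m where m: "e \<in> F m" by blast
      have "eventually (\<lambda>n. cinner e (?s (F n)) = cinner e z) sequentially"
        using eventually_ge_at_top[of m]
      proof eventually_elim
        case (elim n)
        then show ?case using val[OF F] Fmono[of m n] m by auto
      qed
      then show ?thesis
        using LIMSEQ_unique[OF lim tendsto_eventually] by blast
    next
      case False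
      have "(\<lambda>n. cinner e (?s (F n))) = (\<lambda>n. 0)"
        using False val[OF F] by auto
      then have "cinner e y = 0" using lim LIMSEQ_unique tendsto_const by metis
      moreover have "cinner e z = 0"
      proof (rule ccontr)
        \<comment> \<open>An e outside all the sets \<open>F n\<close> but with a nonzero
          coefficient could be added to a late \<open>F n\<close> and would push its sum above
          q.\<close>
        assume nz: "cinner e z \<noteq> 0"
        then obtain n where n: "(1/2)^n < (cmod (cinner e z))\<^sup>2"
          using real_arch_pow_inv[of "(cmod (cinner e z))\<^sup>2" "1/2"] by auto
        have "?q (insert e (F n)) = (cmod (cinner e z))\<^sup>2 + ?q (F n)"
          using False F by simp
        moreover have "?q (insert e (F n)) \<le> q"
          using F e by (intro q_ub) auto
        ultimately show False using Fq[of n] n by linarith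
      qed
      ultimately show ?thesis by simp
    qed
  qed
  have "\<forall>e\<in>B. cinner e (y - z) = 0"
    by (simp add: cinner_diff_right ey)
  then have "y - z = 0"
    using B unfolding is_onb_def by blast
  then have yz: "y = z" by simp
  have "(\<lambda>n. (norm (?s (F n)))\<^sup>2) \<longlonglongrightarrow> (norm z)\<^sup>2"
    using y by (auto intro!: tendsto_intros simp: yz)
  then have "(\<lambda>n. ?q (F n)) \<longlonglongrightarrow> (norm z)\<^sup>2"
    using onb_bessel(1)[OF B F] by simp
  then have "(norm z)\<^sup>2 \<le> q"
    by (rule LIMSEQ_le_const2) (use q_ub[OF F] in blast)
  moreover have "q \<le> (norm z)\<^sup>2"
    unfolding q_def using bess by (intro cSup_least) auto
  ultimately have "q = (norm z)\<^sup>2" by simp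
  moreover have "((\<lambda>e. (cmod (cinner e z))\<^sup>2) has_sum q) B"
    unfolding q_def using bdd by (intro nonneg_bdd_above_has_sum) (simp_all add: conj_commute)
  ultimately show ?thesis by simp
qed


section \<open>Positive operators and their square roots\<close>

lemma positive_opD:
  assumes "positive_op P"
  shows "bounded_clinear P" and "0 \<le> Re (cinner x (P x))"
    and "cinner x (P x) = complex_of_real (Re (cinner x (P x)))"
  using assms by (auto simp: positive_op_def complex_nonneg_Reals_iff complex_eq_iff)

text \<open>The quadratic form is real. At x + y this gives the imaginary part of the symmetry
  relation, at x + i y the real part.\<close>

lemma positive_op_selfadjoint:
  assumes "positive_op P"
  shows "adjoint_pair P P"
  unfolding adjoint_pair_def
proof (intro allI)
  fix x y
  note lin = bounded_clinearD[OF positive_opD(1)[OF assms]]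
  have real: "Im (cinner z (P z)) = 0" for z
    using positive_opD(3)[OF assms, of z] by (metis Im_complex_of_real)
  have 1: "Im (cinner x (P y) + cinner y (P x)) = 0"
    using real[of "x + y"] real[of x] real[of y] by (simp add: lin cinner_distribs)
  have 2: "Re (cinner x (P y)) = Re (cinner y (P x))"
    using real[of "x + \<i> *\<^sub>C y"] real[of x] real[of y] by (simp add: lin cinner_distribs)
  have "cinner x (P y) = cnj (cinner y (P x))"
    using 1 2 by (simp add: complex_eq_iff del: cnj_cinner)
  then show "cinner (P x) y = cinner x (P y)"
    by (simp only: cnj_cinner)
qed

lemma positive_opI:
  assumes "bounded_clinear P" "adjoint_pair P P" "\<And>x. 0 \<le> Re (cinner x (P x))"
  shows "positive_op P"
proof -
  have "Im (cinner x (P x)) = 0" for x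
  proof -
    have "cnj (cinner x (P x)) = cinner x (P x)"
      using assms(2) by (simp add: adjoint_pair_def)
    then show ?thesis
      by (metis Reals_cnj_iff complex_is_Real_iff)
  qed
  then show ?thesis
    using assms by (auto simp: positive_op_def complex_nonneg_Reals_iff)
qed

text \<open>The operator inequality P^2 <= K P. The positive form is evaluated at x - P x / K, and
  <P x, P P x> is estimated by K ||P x||^2.\<close>

lemma positive_op_norm_le:
  assumes P: "positive_op P" and K: "K > 0" "\<And>x. norm (P x) \<le> K * norm x"
  shows "(norm (P x))\<^sup>2 \<le> K * Re (cinner x (P x))"
proof -
  note lin = bounded_clinearD[OF positive_opD(1)[OF P]]
  have sa: "cinner (P a) b = cinner a (P b)" for a b
    using positive_op_selfadjoint[OF P] by (simp add: adjoint_pair_def)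
  have xPPx: "cinner x (P (P x)) = complex_of_real ((norm (P x))\<^sup>2)"
    by (simp add: sa[symmetric] cinner_self)
  have "Re (cinner (P x) (P (P x))) \<le> norm (P x) * norm (P (P x))"
    using cinner_Cauchy_Schwarz complex_Re_le_cmod order_trans by blast
  also have "\<dots> \<le> norm (P x) * (K * norm (P x))"
    using K by (intro mult_left_mono) auto
  finally have 1: "Re (cinner (P x) (P (P x))) \<le> K * (norm (P x))\<^sup>2"
    by (simp add: power2_eq_square mult_ac)
  have "0 \<le> Re (cinner (x - (1/K) *\<^sub>R P x) (P (x - (1/K) *\<^sub>R P x)))"
    by (rule positive_opD(2)[OF P])
  also have "\<dots> = Re (cinner x (P x)) - 2 * (norm (P x))\<^sup>2 / K + Re (cinner (P x) (P (P x))) / K\<^sup>2"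
    by (simp add: lin cinner_diff_left cinner_diff_right xPPx cinner_self)
       (simp add: power2_eq_square diff_divide_distrib)
  also have "\<dots> \<le> Re (cinner x (P x)) - 2 * (norm (P x))\<^sup>2 / K + K * (norm (P x))\<^sup>2 / K\<^sup>2"
    using 1 by (simp add: divide_right_mono)
  also have "\<dots> = Re (cinner x (P x)) - (norm (P x))\<^sup>2 / K"
    using K by (simp add: field_simps power2_eq_square)
  finally show ?thesis
    using K by (simp add: field_simps)
qed

text \<open>||x - P x||^2 = ||x||^2 - 2 <x, P x> + ||P x||^2, and the last term is at most <x, P x>
  by the preceding estimate with K = 1.\<close>

lemma positive_op_complement_contraction:
  assumes P: "positive_op P" and K: "\<And>x. norm (P x) \<le> norm x"
  shows "norm (x - P x) \<le> norm x" and "positive_op (\<lambda>x. x - P x)"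
proof -
  have nn: "(norm (P x))\<^sup>2 \<le> Re (cinner x (P x))" for x
    using positive_op_norm_le[OF P, of 1 x] K by simp
  have sa: "cinner (P a) b = cinner a (P b)" for a b
    using positive_op_selfadjoint[OF P] by (simp add: adjoint_pair_def)
  have "complex_of_real ((norm (x - P x))\<^sup>2) = complex_of_real ((norm x)\<^sup>2 - 2 * Re (cinner x (P x)) + (norm (P x))\<^sup>2)"
    unfolding cinner_self[symmetric] cinner_diff_left cinner_diff_right
    by (simp add: sa positive_opD(3)[OF P, symmetric] cinner_self)
  then have "(norm (x - P x))\<^sup>2 = (norm x)\<^sup>2 - 2 * Re (cinner x (P x)) + (norm (P x))\<^sup>2"
    by (simp only: of_real_eq_iff)
  also have "\<dots> \<le> (norm x)\<^sup>2"
    using nn[of x] zero_le_power2[of "norm (P x)"] by linarith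
  finally show "norm (x - P x) \<le> norm x"
    by (simp add: power_mono_iff)
  show "positive_op (\<lambda>x. x - P x)"
  proof (rule positive_opI)
    show "bounded_clinear (\<lambda>x. x - P x)"
      by (intro bounded_clinear_diff bounded_clinear_ident positive_opD(1)[OF P])
    show "adjoint_pair (\<lambda>x. x - P x) (\<lambda>x. x - P x)"
      by (simp add: adjoint_pair_def cinner_diff_left cinner_diff_right sa)
    fix x
    have "Re (cinner x (P x)) \<le> norm x * norm (P x)"
      using cinner_Cauchy_Schwarz complex_Re_le_cmod order_trans by blast
    also have "\<dots> \<le> norm x * norm x"
      using K by (intro mult_left_mono) auto
    finally show "0 \<le> Re (cinner x (x - P x))"
      by (simp add: cinner_diff_right cinner_self power2_eq_square)
  qed
qed

text \<open>The solution \<open>Y\<close> of \<open>Y = (C + Y\<^sup>2) / 2\<close> satisfies \<open>(1 - Y)\<^sup>2 = 1 - C\<close>; the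
  same iteration for the number \<open>1\<close> in place of the contraction \<open>C\<close> is a majorant.\<close>

primrec sqrt_iter :: "('a::chilbert \<Rightarrow> 'a) \<Rightarrow> nat \<Rightarrow> 'a \<Rightarrow> 'a" where
  "sqrt_iter C 0 = (\<lambda>x. 0)"
| "sqrt_iter C (Suc n) = (\<lambda>x. (1/2) *\<^sub>R (C x + sqrt_iter C n (sqrt_iter C n x)))"

primrec sqrt_majorant :: "nat \<Rightarrow> real" where
  "sqrt_majorant 0 = 0"
| "sqrt_majorant (Suc n) = (1 + (sqrt_majorant n)\<^sup>2) / 2"

lemma sqrt_majorant: "0 \<le> sqrt_majorant n" "sqrt_majorant n \<le> 1" "sqrt_majorant n \<le> sqrt_majorant (Suc n)"
proof -
  show *: "0 \<le> sqrt_majorant n" for n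
    by (cases n) (auto simp: add_nonneg_nonneg)
  show "sqrt_majorant n \<le> 1" for n
    by (induction n) (use * in \<open>auto intro: power_le_one\<close>)
  show "sqrt_majorant n \<le> sqrt_majorant (Suc n)"
    using sum_squares_bound[of 1 "sqrt_majorant n"] by simp
qed

text \<open>The commutation clause, applied to an iterate as Q, factors a difference of squares as
  (Z + Y)(Z - Y). This is why the increments obey the recursion of the scalar majorant.\<close>

lemma sqrt_iter:
  assumes C: "positive_op C" and K: "\<And>x. norm (C x) \<le> norm x"
  shows "bounded_clinear (sqrt_iter C n)" and "adjoint_pair (sqrt_iter C n) (sqrt_iter C n)"
    and "bounded_clinear Q \<Longrightarrow> (\<And>x. Q (C x) = C (Q x)) \<Longrightarrow> Q (sqrt_iter C n x) = sqrt_iter C n (Q x)"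
    and "norm (sqrt_iter C n x) \<le> sqrt_majorant n * norm x"
    and "norm (sqrt_iter C (Suc n) x - sqrt_iter C n x) \<le> (sqrt_majorant (Suc n) - sqrt_majorant n) * norm x"
proof -
  show lin: "bounded_clinear (sqrt_iter C n)" for n
  proof (induction n)
    case (Suc n)
    from bounded_clinear_scaleR[OF bounded_clinear_add[OF positive_opD(1)[OF C] bounded_clinear_compose[OF Suc Suc]]]
    show ?case by simp
  qed (simp add: bounded_clinear_zero)
  show "adjoint_pair (sqrt_iter C n) (sqrt_iter C n)"
    using positive_op_selfadjoint[OF C]
    by (induction n) (auto simp: adjoint_pair_def cinner_add_left cinner_add_right)
  show comm: "Q (sqrt_iter C n x) = sqrt_iter C n (Q x)"
    if Q: "bounded_clinear Q" "\<And>x. Q (C x) = C (Q x)" for Q n x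
    by (induction n arbitrary: x) (auto simp: bounded_clinearD[OF Q(1)] Q(2))
  show norm: "norm (sqrt_iter C n x) \<le> sqrt_majorant n * norm x" for n x
  proof (induction n arbitrary: x)
    case (Suc n)
    have "norm (sqrt_iter C n (sqrt_iter C n x)) \<le> sqrt_majorant n * norm (sqrt_iter C n x)"
      by (rule Suc)
    also have "\<dots> \<le> sqrt_majorant n * (sqrt_majorant n * norm x)"
      by (intro mult_left_mono Suc sqrt_majorant)
    finally have "norm (C x + sqrt_iter C n (sqrt_iter C n x)) \<le> norm x + (sqrt_majorant n)\<^sup>2 * norm x"
      using norm_triangle_ineq[of "C x" "sqrt_iter C n (sqrt_iter C n x)"] K[of x]
      by (simp add: power2_eq_square)
    then have "(1/2) * norm (C x + sqrt_iter C n (sqrt_iter C n x)) \<le> (1/2) * (norm x + (sqrt_majorant n)\<^sup>2 * norm x)"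
      by simp
    then show ?case
      unfolding sqrt_iter.simps sqrt_majorant.simps norm_scaleR by (simp add: distrib_right add_divide_distrib del: scaleR_add_right)
  qed simp
  show "norm (sqrt_iter C (Suc n) x - sqrt_iter C n x) \<le> (sqrt_majorant (Suc n) - sqrt_majorant n) * norm x"
  proof (induction n arbitrary: x)
    case 0
    then show ?case using K[of x] by simp
  next
    case (Suc n)
    let ?Z = "sqrt_iter C (Suc n)" and ?Y = "sqrt_iter C n"
    let ?z = "sqrt_majorant (Suc n)" and ?y = "sqrt_majorant n"
    have cC: "?Y (C x) = C (?Y x)" for x
      by (rule comm[symmetric]) (auto simp: positive_opD(1)[OF C])
    have cc: "?Y (?Z x) = ?Z (?Y x)" for x
      by (rule comm[OF lin cC])
    let ?d = "?Z x - ?Y x"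
    have "sqrt_iter C (Suc (Suc n)) x - ?Z x = (1/2) *\<^sub>R (?Z (?Z x) - ?Y (?Y x))"
      unfolding sqrt_iter.simps(2)[of C "Suc n"] unfolding sqrt_iter.simps(2)[of C n]
      by (simp only: scaleR_diff_right[symmetric] add_diff_cancel_left)
    also have "?Z (?Z x) - ?Y (?Y x) = ?Z ?d + ?Y ?d"
      unfolding bounded_clinearD(2)[OF lin] cc by simp
    finally have "sqrt_iter C (Suc (Suc n)) x - ?Z x = (1/2) *\<^sub>R (?Z ?d + ?Y ?d)" .
    moreover have "norm (?Z ?d + ?Y ?d) \<le> (?z + ?y) * norm ?d"
      using norm_triangle_ineq[of "?Z ?d" "?Y ?d"] norm[of "Suc n" ?d] norm[of n ?d]
      by (simp only: distrib_right)
    moreover have "(?z + ?y) * norm ?d \<le> (?z + ?y) * ((?z - ?y) * norm x)"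
      by (intro mult_left_mono Suc add_nonneg_nonneg sqrt_majorant)
    ultimately have "norm (sqrt_iter C (Suc (Suc n)) x - ?Z x) \<le> (1/2) * ((?z + ?y) * ((?z - ?y) * norm x))"
      by simp
    also have "\<dots> = (sqrt_majorant (Suc (Suc n)) - ?z) * norm x"
      unfolding sqrt_majorant.simps(2)[of "Suc n"] sqrt_majorant.simps(2)[of n]
      by (simp add: field_simps power2_eq_square)
    finally show ?case .
  qed
qed

text \<open>Up to the factor sqrt M the root is 1 - Y, where Y is the limit of the iterates for C =
  1 - A / M. Commutation with everything that commutes with A is recorded because uniqueness rests
  on it.\<close>

lemma sqrt_op_exists:
  assumes A: "positive_op A"
  obtains P where "positive_op P" "\<And>x. P (P x) = A x"
    "\<forall>Q. bounded_clinear Q \<longrightarrow> (\<forall>x. Q (A x) = A (Q x)) \<longrightarrow> (\<forall>x. Q (P x) = P (Q x))"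
proof -
  obtain M where M: "M > 0" "\<And>x. norm (A x) \<le> M * norm x"
    using bounded_clinear_bound[OF positive_opD(1)[OF A]] by blast
  define p where "p x = (1/M) *\<^sub>R A x" for x
  have p: "positive_op p" "norm (p x) \<le> norm x" for x
  proof -
    show "norm (p x) \<le> norm x"
      using M(1) M(2)[of x] by (simp add: p_def field_simps)
    show "positive_op p"
      unfolding p_def[abs_def] using positive_op_selfadjoint[OF A] positive_opD(2)[OF A] M(1)
      by (intro positive_opI bounded_clinear_scaleR positive_opD(1)[OF A]) (auto simp: adjoint_pair_def)
  qed
  define C where "C x = x - p x" for x
  have C: "positive_op C" "norm (C x) \<le> norm x" for x
    using positive_op_complement_contraction[OF p(1) p(2)] by (auto simp: C_def[abs_def])
  note iter = sqrt_iter[OF C]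
  have mono: "mono sqrt_majorant"
    by (intro mono_iff_le_Suc[THEN iffD2] allI sqrt_majorant)
  have diff: "norm (sqrt_iter C n x - sqrt_iter C m x) \<le> (sqrt_majorant n - sqrt_majorant m) * norm x"
    if "m \<le> n" for m n x
    using that
  proof (induction rule: dec_induct)
    case (step n)
    have "norm (sqrt_iter C (Suc n) x - sqrt_iter C m x)
        \<le> norm (sqrt_iter C (Suc n) x - sqrt_iter C n x) + norm (sqrt_iter C n x - sqrt_iter C m x)"
      by (rule order_trans[OF eq_refl norm_triangle_ineq]) simp
    then show ?case
      using step.IH iter(5)[of n x] by (simp only: left_diff_distrib)
  qed simp
  \<comment> \<open>A bounded increasing sequence; by \<open>diff\<close> its Cauchy property passes
    to the iterates at every x.\<close>
  have "convergent sqrt_majorant"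
    using mono sqrt_majorant(2) by (intro Bseq_mono_convergent) (auto intro!: BseqI'[of _ 1] simp: sqrt_majorant mono_def)
  then have Cm: "Cauchy sqrt_majorant"
    by (rule convergent_Cauchy)
  have "Cauchy (\<lambda>n. sqrt_iter C n x)" for x
  proof (rule metric_CauchyI)
    fix \<epsilon> :: real assume "\<epsilon> > 0"
    then have e: "\<epsilon> / (norm x + 1) > 0" by (simp add: add_nonneg_pos)
    then obtain N where N: "\<And>m n. m \<ge> N \<Longrightarrow> n \<ge> N \<Longrightarrow> \<bar>sqrt_majorant m - sqrt_majorant n\<bar> < \<epsilon> / (norm x + 1)"
      using metric_CauchyD[OF Cm e] by (auto simp: dist_real_def)
    have *: "dist (sqrt_iter C m x) (sqrt_iter C n x) < \<epsilon>" if "N \<le> m" "m \<le> n" for m n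
    proof -
      have "dist (sqrt_iter C m x) (sqrt_iter C n x) \<le> (sqrt_majorant n - sqrt_majorant m) * norm x"
        using diff[OF that(2), of x] by (simp add: dist_norm norm_minus_commute)
      also have "\<dots> \<le> (\<epsilon> / (norm x + 1)) * norm x"
        using N[of n m] that by (intro mult_right_mono) auto
      also have "\<dots> < \<epsilon>"
        using \<open>\<epsilon> > 0\<close> add_nonneg_pos[OF norm_ge_zero zero_less_one, of x] by (simp add: field_simps)
      finally show ?thesis .
    qed
    show "\<exists>M. \<forall>m\<ge>M. \<forall>n\<ge>M. dist (sqrt_iter C m x) (sqrt_iter C n x) < \<epsilon>"
    proof (intro exI allI impI)
      fix m n assume "N \<le> m" "N \<le> n"
      then show "dist (sqrt_iter C m x) (sqrt_iter C n x) < \<epsilon>"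
        using *[of m n] *[of n m] by (cases "m \<le> n") (auto simp: dist_commute)
    qed
  qed
  then have "\<exists>y. (\<lambda>n. sqrt_iter C n x) \<longlonglongrightarrow> y" for x
    using Cauchy_convergent_iff convergent_def by blast
  then obtain Y where Y: "\<And>x. (\<lambda>n. sqrt_iter C n x) \<longlonglongrightarrow> Y x" by metis
  have Ynorm: "norm (Y x) \<le> 1 * norm x" for x
  proof (rule LIMSEQ_le_const2[OF tendsto_norm[OF Y]])
    have "norm (sqrt_iter C n x) \<le> 1 * norm x" for n
      by (rule order_trans[OF iter(4) mult_right_mono]) (auto simp: sqrt_majorant)
    then show "\<exists>N. \<forall>n\<ge>N. norm (sqrt_iter C n x) \<le> 1 * norm x" by blast
  qed
  have Ylin: "bounded_clinear Y"
  proof (rule bounded_clinearI[OF _ _ Ynorm])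
    fix x y c
    have "(\<lambda>n. sqrt_iter C n (x + y)) \<longlonglongrightarrow> Y x + Y y"
      using tendsto_add[OF Y[of x] Y[of y]] by (simp add: bounded_clinearD[OF iter(1)])
    then show "Y (x + y) = Y x + Y y"
      using LIMSEQ_unique[OF Y] by blast
    have "bounded_clinear (\<lambda>z::'a. c *\<^sub>C z)"
      by (rule bounded_clinearI[of _ "cmod c"]) (auto simp: scaleC_add_right scaleC_scaleC norm_scaleC mult.commute)
    from bounded_clinear_tendsto[OF this Y[of x]]
    have "(\<lambda>n. sqrt_iter C n (c *\<^sub>C x)) \<longlonglongrightarrow> c *\<^sub>C Y x"
      by (simp add: bounded_clinearD[OF iter(1)])
    then show "Y (c *\<^sub>C x) = c *\<^sub>C Y x"
      using LIMSEQ_unique[OF Y] by blast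
  qed
  have Yadj: "adjoint_pair Y Y"
    unfolding adjoint_pair_def
  proof (intro allI)
    fix x y
    have "(\<lambda>n. cinner (sqrt_iter C n x) y) \<longlonglongrightarrow> cinner (Y x) y"
      by (intro tendsto_intros Y)
    moreover have "(\<lambda>n. cinner x (sqrt_iter C n y)) \<longlonglongrightarrow> cinner x (Y y)"
      by (intro tendsto_intros Y)
    ultimately show "cinner (Y x) y = cinner x (Y y)"
      using iter(2) LIMSEQ_unique by (auto simp: adjoint_pair_def)
  qed
  have Ycomm: "Q (Y x) = Y (Q x)" if Q: "bounded_clinear Q" "\<And>x. Q (C x) = C (Q x)" for Q x
  proof -
    have "(\<lambda>n. Q (sqrt_iter C n x)) \<longlonglongrightarrow> Q (Y x)"
      by (rule bounded_clinear_tendsto[OF Q(1) Y])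
    then have "(\<lambda>n. sqrt_iter C n (Q x)) \<longlonglongrightarrow> Q (Y x)"
      by (simp add: iter(3)[OF Q])
    then show ?thesis
      by (rule LIMSEQ_unique[OF _ Y])
  qed
  have Yeq: "Y x = (1/2) *\<^sub>R (C x + Y (Y x))" for x
  proof -
    \<comment> \<open>The limit of a composition: all iterates are contractions, so the inner error
      is not amplified by the outer one.\<close>
    have 1: "(\<lambda>n. sqrt_iter C n (sqrt_iter C n x - Y x)) \<longlonglongrightarrow> 0"
    proof (rule tendsto_norm_zero_cancel, rule Lim_null_comparison)
      show "(\<lambda>n. norm (sqrt_iter C n x - Y x)) \<longlonglongrightarrow> 0"
        using Y[of x] by (simp add: LIM_zero_iff tendsto_norm_zero_iff)
      have "norm (sqrt_iter C n z) \<le> 1 * norm z" for n z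
        by (rule order_trans[OF iter(4) mult_right_mono]) (auto simp: sqrt_majorant)
      then show "\<forall>\<^sub>F n in sequentially. norm (norm (sqrt_iter C n (sqrt_iter C n x - Y x))) \<le> norm (sqrt_iter C n x - Y x)"
        by auto
    qed
    have "(\<lambda>n. sqrt_iter C n (sqrt_iter C n x)) \<longlonglongrightarrow> Y (Y x)"
      using tendsto_add[OF 1 Y[of "Y x"]] by (simp add: bounded_clinearD[OF iter(1)])
    then have "(\<lambda>n. sqrt_iter C (Suc n) x) \<longlonglongrightarrow> (1/2) *\<^sub>R (C x + Y (Y x))"
      by (auto intro!: tendsto_intros)
    moreover have "(\<lambda>n. sqrt_iter C (Suc n) x) \<longlonglongrightarrow> Y x"
      using Y[of x] by (rule LIMSEQ_Suc)
    ultimately show ?thesis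
      using LIMSEQ_unique by blast
  qed
  define R where "R x = x - Y x" for x
  have Rlin: "bounded_clinear R"
    unfolding R_def[abs_def] by (intro bounded_clinear_diff bounded_clinear_ident Ylin)
  have Rpos: "positive_op R"
  proof (rule positive_opI[OF Rlin])
    show "adjoint_pair R R"
      using Yadj by (simp add: adjoint_pair_def R_def cinner_diff_left cinner_diff_right)
    fix x
    have "Re (cinner x (Y x)) \<le> norm x * norm (Y x)"
      using cinner_Cauchy_Schwarz complex_Re_le_cmod order_trans by blast
    also have "\<dots> \<le> norm x * norm x"
      using Ynorm[of x] by (intro mult_left_mono) auto
    finally show "0 \<le> Re (cinner x (R x))"
      by (simp add: R_def cinner_diff_right cinner_self power2_eq_square)
  qed
  have RR: "R (R x) = p x" for x
  proof -
    have "2 *\<^sub>R Y x = C x + Y (Y x)"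
      using arg_cong[OF Yeq[of x], of "\<lambda>z. 2 *\<^sub>R z"] by simp
    then show ?thesis
      by (simp add: R_def bounded_clinearD[OF Ylin] C_def scaleR_2 algebra_simps)
  qed
  show thesis
  proof (rule that[of "\<lambda>x. sqrt M *\<^sub>R R x"])
    show "positive_op (\<lambda>x. sqrt M *\<^sub>R R x)"
      using positive_op_selfadjoint[OF Rpos] positive_opD(2)[OF Rpos] M(1)
      by (intro positive_opI bounded_clinear_scaleR Rlin) (auto simp: adjoint_pair_def)
    show "sqrt M *\<^sub>R R (sqrt M *\<^sub>R R x) = A x" for x
      using M(1) by (simp add: bounded_clinearD[OF Rlin] RR p_def)
    show "\<forall>Q. bounded_clinear Q \<longrightarrow> (\<forall>x. Q (A x) = A (Q x)) \<longrightarrow> (\<forall>x. Q (sqrt M *\<^sub>R R x) = sqrt M *\<^sub>R R (Q x))"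
    proof (intro allI impI)
      fix Q x assume Q: "bounded_clinear Q" "\<forall>x. Q (A x) = A (Q x)"
      have "Q (Y x) = Y (Q x)"
        by (rule Ycomm[OF Q(1)]) (simp add: C_def p_def bounded_clinearD[OF Q(1)] Q(2))
      then show "Q (sqrt M *\<^sub>R R x) = sqrt M *\<^sub>R R (Q x)"
        by (simp add: R_def bounded_clinearD[OF Q(1)])
    qed
  qed
qed

lemma positive_op_form_zero:
  assumes "positive_op P" "cinner x (P x) = 0"
  shows "P x = 0"
proof -
  obtain K where "K > 0" "\<And>x. norm (P x) \<le> K * norm x"
    using bounded_clinear_bound[OF positive_opD(1)[OF assms(1)]] by blast
  from positive_op_norm_le[OF assms(1) this, of x] show ?thesis
    using assms(2) by simp
qed

text \<open>P and Q commute, so P + Q annihilates z = P x - Q x. Both forms are nonnegative and add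
  up to 0 at z, hence P z = Q z = 0, and ||z||^2 = <x, P z - Q z> vanishes.\<close>

lemma sqrt_op_unique:
  assumes P: "positive_op P" "\<And>x. P (P x) = A x"
    and comm: "\<forall>Q. bounded_clinear Q \<longrightarrow> (\<forall>x. Q (A x) = A (Q x)) \<longrightarrow> (\<forall>x. Q (P x) = P (Q x))"
    and Q: "positive_op Q" "\<And>x. Q (Q x) = A x"
  shows "Q = P"
proof
  fix x
  note lin = bounded_clinearD[OF positive_opD(1)[OF P(1)]] bounded_clinearD[OF positive_opD(1)[OF Q(1)]]
  have QP: "Q (P x) = P (Q x)" for x
    using comm positive_opD(1)[OF Q(1)] by (simp add: Q(2)[symmetric])
  let ?z = "P x - Q x"
  have "P ?z + Q ?z = 0"
    by (simp add: lin QP P(2) Q(2))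
  then have "cinner ?z (P ?z) + cinner ?z (Q ?z) = 0"
    by (metis cinner_add_right cinner_zero_right)
  then have "Re (cinner ?z (P ?z)) + Re (cinner ?z (Q ?z)) = 0"
    by (metis plus_complex.simps(1) zero_complex.simps(1))
  then have "Re (cinner ?z (P ?z)) = 0" "Re (cinner ?z (Q ?z)) = 0"
    using positive_opD(2)[OF P(1), of ?z] positive_opD(2)[OF Q(1), of ?z] by linarith+
  then have "P ?z = 0" "Q ?z = 0"
    using positive_op_form_zero[OF P(1), of ?z] positive_op_form_zero[OF Q(1), of ?z]
      positive_opD(3)[OF P(1), of ?z] positive_opD(3)[OF Q(1), of ?z] by simp_all
  moreover have "cinner ?z ?z = cinner x (P ?z - Q ?z)"
    using positive_op_selfadjoint[OF P(1)] positive_op_selfadjoint[OF Q(1)]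
    by (simp add: adjoint_pair_def cinner_diff_left cinner_diff_right lin)
  ultimately have "cinner ?z ?z = 0" by simp
  then show "Q x = P x"
    by (simp add: cinner_self)
qed

text \<open>Existence and uniqueness of the square root of S T turn the definite description
  \<open>abs_op\<close> into an actual operator.\<close>

lemma abs_op:
  assumes T: "bounded_clinear T" and S: "bounded_clinear S" "adjoint_pair T S"
  shows "positive_op (abs_op T)" and "abs_op T (abs_op T x) = S (T x)" and "norm (abs_op T x) = norm (T x)"
proof -
  have "positive_op (\<lambda>x. S (T x))"
  proof (rule positive_opI)
    show "bounded_clinear (\<lambda>x. S (T x))"
      by (rule bounded_clinear_compose[OF S(1) T])
    show "adjoint_pair (\<lambda>x. S (T x)) (\<lambda>x. S (T x))"
      using S(2) adjoint_pair_sym[OF S(2)] by (simp add: adjoint_pair_def)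
    show "0 \<le> Re (cinner x (S (T x)))" for x
    proof -
      have "cinner x (S (T x)) = cinner (T x) (T x)"
        using adjoint_pair_sym[OF S(2)] by (simp add: adjoint_pair_def)
      then show ?thesis by (simp add: cinner_self)
    qed
  qed
  from sqrt_op_exists[OF this] obtain P where P: "positive_op P" "\<And>x. P (P x) = S (T x)"
    "\<forall>Q. bounded_clinear Q \<longrightarrow> (\<forall>x. Q (S (T x)) = S (T (Q x))) \<longrightarrow> (\<forall>x. Q (P x) = P (Q x))" by blast
  have "abs_op T = P"
    unfolding abs_op_def cadjoint_eq[OF S(2)]
  proof (rule the_equality)
    show "positive_op P \<and> P \<circ> P = S \<circ> T"
      using P by auto
    fix Q assume Q: "positive_op Q \<and> Q \<circ> Q = S \<circ> T"
    then have "Q (Q x) = S (T x)" for x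
      by (metis comp_apply)
    with Q show "Q = P"
      by (intro sqrt_op_unique[OF P]) auto
  qed
  with P show 1: "positive_op (abs_op T)" and 2: "abs_op T (abs_op T x) = S (T x)" for x by auto
  have "cinner (abs_op T x) (abs_op T x) = cinner (T x) (T x)"
  proof -
    have "cinner (abs_op T x) (abs_op T x) = cinner x (S (T x))"
      using positive_op_selfadjoint[OF 1] by (simp add: adjoint_pair_def 2)
    also have "\<dots> = cinner (T x) (T x)"
      using adjoint_pair_sym[OF S(2)] by (simp add: adjoint_pair_def)
    finally show ?thesis .
  qed
  then have "(norm (abs_op T x))\<^sup>2 = (norm (T x))\<^sup>2"
    by (simp only: cinner_self of_real_eq_iff)
  then show "norm (abs_op T x) = norm (T x)"
    by (simp add: power2_eq_iff_nonneg)
qed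


section \<open>Criteria for the trace class\<close>

text \<open>If \<open>|T|\<close> had a bounded inverse then \<open>\<langle>e, |T| e\<rangle> = \<langle>W e, T e\<rangle>\<close> with the
  contraction \<open>W = T |T|\<^sup>-\<^sup>1\<close>; the partial sums of the Neumann series replace the inverse.\<close>

lemma trace_classI:
  fixes T :: "'a::chilbert \<Rightarrow> 'a"
  assumes T: "bounded_clinear T" and S: "bounded_clinear S" "adjoint_pair T S"
    and C: "\<And>F e f. bessel_family (F :: 'a set) e \<Longrightarrow> bessel_family F f
      \<Longrightarrow> (\<Sum>j\<in>F. cmod (cinner (f j) (T (e j)))) \<le> C"
  shows "trace_class T"
proof -
  define P where "P = abs_op T"
  have P: "positive_op P" "\<And>x. P (P x) = S (T x)" "\<And>x. norm (P x) = norm (T x)"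
    using abs_op[OF T S] by (auto simp: P_def)
  note Plin = bounded_clinearD[OF positive_opD(1)[OF P(1)]]
  have Psa: "cinner (P a) b = cinner a (P b)" for a b
    using positive_op_selfadjoint[OF P(1)] by (simp add: adjoint_pair_def)
  have TT: "cinner (T a) (T b) = cinner (P a) (P b)" for a b
    using adjoint_pair_sym[OF S(2)] by (simp add: Psa P(2) adjoint_pair_def)
  obtain M where M: "M > 0" "\<And>x. norm (P x) \<le> M * norm x"
    using bounded_clinear_bound[OF positive_opD(1)[OF P(1)]] by blast
  define p where "p x = (1/M) *\<^sub>R P x" for x
  define r where "r x = x - p x" for x
  have p: "positive_op p" "norm (p x) \<le> norm x" for x
  proof -
    show "norm (p x) \<le> norm x"
      using M(1) M(2)[of x] by (simp add: p_def field_simps)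
    show "positive_op p"
      unfolding p_def[abs_def] using positive_op_selfadjoint[OF P(1)] positive_opD(2)[OF P(1)] M(1)
      by (intro positive_opI bounded_clinear_scaleR positive_opD(1)[OF P(1)]) (auto simp: adjoint_pair_def)
  qed
  note plin = bounded_clinearD[OF positive_opD(1)[OF p(1)]]
  have r: "positive_op r" "norm (r x) \<le> norm x" for x
    using positive_op_complement_contraction[OF p(1) p(2)] by (auto simp: r_def[abs_def])
  note rlin = bounded_clinearD[OF positive_opD(1)[OF r(1)]]
  have rn: "bounded_clinear (r ^^ n)" "adjoint_pair (r ^^ n) (r ^^ n)" "norm ((r ^^ n) x) \<le> norm x"
    "p ((r ^^ n) x) = (r ^^ n) (p x)" for n x
  proof -
    show "bounded_clinear (r ^^ n)"
    proof (induction n)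
      case (Suc n)
      from bounded_clinear_compose[OF positive_opD(1)[OF r(1)] Suc] show ?case by (simp add: comp_def)
    qed (simp add: bounded_clinear_ident id_def)
    show "adjoint_pair (r ^^ n) (r ^^ n)"
      using positive_op_selfadjoint[OF r(1)]
      by (induction n) (auto simp: adjoint_pair_def funpow_swap1)
    show "norm ((r ^^ n) x) \<le> norm x"
      by (induction n) (auto intro: order_trans[OF r(2)])
    show "p ((r ^^ n) x) = (r ^^ n) (p x)"
      by (induction n) (auto simp: r_def plin)
  qed
  note rnlin = bounded_clinearD[OF rn(1)]
  \<comment> \<open>A partial sum of the Neumann series for the inverse of p = 1 - r. As p may fail
    to be invertible, p q n = 1 - r^n is kept with its defect.\<close>
  define q where "q n x = (\<Sum>k<n. (r ^^ k) x)" for n x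
  have qlin: "bounded_clinear (q n)" for n
  proof (induction n)
    case 0
    then show ?case by (simp add: q_def[abs_def] bounded_clinear_zero)
  next
    case (Suc n)
    from bounded_clinear_add[OF this rn(1)[of n]] show ?case
      by (simp add: q_def[abs_def])
  qed
  have pq: "p (q n x) = x - (r ^^ n) x" for n x
  proof -
    have "p (q n x) = (\<Sum>k<n. (r ^^ k) x - (r ^^ Suc k) x)"
      unfolding q_def
      by (induction n) (auto simp: plin r_def)
    also have "\<dots> = x - (r ^^ n) x"
      by (induction n) auto
    finally show ?thesis .
  qed
  \<comment> \<open>The 2 makes up for ||1 - r^n|| <= 2 and so makes W a contraction; it returns as
    the factor of C in the final bound.\<close>
  define W where "W n x = (1 / (2 * M)) *\<^sub>R T (q n x)" for n x
  have Wadj: "adjoint_pair (W n) (\<lambda>y. (1 / (2 * M)) *\<^sub>R q n (S y))" for n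
    unfolding adjoint_pair_def
  proof (intro allI)
    fix x y
    have "cinner (q n (S x)) y = cinner (S x) (q n y)"
      unfolding q_def cinner_sum_left cinner_sum_right using rn(2) by (simp add: adjoint_pair_def)
    also have "\<dots> = cinner x (T (q n y))"
      using S(2) by (simp add: adjoint_pair_def)
    finally show "cinner ((1 / (2 * M)) *\<^sub>R q n (S x)) y = cinner x (W n y)"
      by (simp add: W_def)
  qed
  have Wnorm: "norm (W n x) \<le> norm x" for n x
  proof -
    have "norm (W n x) = norm (p (q n x)) / 2"
      using M(1) by (simp add: W_def p_def P(3))
    also have "\<dots> \<le> (norm x + norm ((r ^^ n) x)) / 2"
      unfolding pq by (intro divide_right_mono norm_triangle_ineq4) auto
    also have "\<dots> \<le> norm x"
      using rn(3)[of n x] by simp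
    finally show ?thesis .
  qed
  have We: "cinner (W n e) (T e) = complex_of_real (M / 2) * (cinner e (p e) - cinner ((r ^^ n) e) (p e))" for n e
  proof -
    have "P x = M *\<^sub>R p x" for x
      using M(1) by (simp add: p_def)
    then have "cinner (W n e) (T e) = complex_of_real (M / 2) * cinner (p (q n e)) (p e)"
      using M(1) by (simp add: W_def TT)
    then show ?thesis
      by (simp add: pq cinner_diff_left)
  qed
  define d where "d e m = Re (cinner ((r ^^ m) e) (p ((r ^^ m) e)))" for e m
  \<comment> \<open>Only even powers are used: half of r^(2m) is moved to the other side, so the
    error term is the form of p at r^m e.\<close>
  have d_even: "Re (cinner ((r ^^ (2 * m)) e) (p e)) = d e m" for e m
  proof -
    have "cinner ((r ^^ (m + m)) e) (p e) = cinner ((r ^^ m) e) (p ((r ^^ m) e))"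
      using rn(2)[of m] by (simp add: funpow_add adjoint_pair_def rn(4))
    then show ?thesis by (simp add: d_def mult_2)
  qed
  have d_lim: "(\<lambda>m. d e m) \<longlonglongrightarrow> 0" for e
  proof (rule summable_LIMSEQ_zero, rule summableI_nonneg_bounded)
    show "0 \<le> d e m" for m
      using positive_opD(2)[OF p(1)] by (simp add: d_def)
    \<comment> \<open>From ||r x||^2 = ||x||^2 - 2 <x, p x> + ||p x||^2 and ||p x||^2 <= <x, p x>.
      The values d e m are thus bounded by telescoping differences, so they are summable and tend to
      0.\<close>
    have step: "d e m \<le> (norm ((r ^^ m) e))\<^sup>2 - (norm ((r ^^ Suc m) e))\<^sup>2" for m
    proof -
      let ?x = "(r ^^ m) e"
      have psa: "cinner (p a) b = cinner a (p b)" for a b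
        using positive_op_selfadjoint[OF p(1)] by (simp add: adjoint_pair_def)
      have "(norm (p ?x))\<^sup>2 \<le> Re (cinner ?x (p ?x))"
        using positive_op_norm_le[OF p(1), of 1 ?x] p(2) by simp
      moreover have "Re (cinner (r ?x) (r ?x)) = Re (cinner ?x ?x) - 2 * Re (cinner ?x (p ?x)) + Re (cinner (p ?x) (p ?x))"
        by (simp add: r_def cinner_diff_left cinner_diff_right psa)
      ultimately show ?thesis
        by (simp add: cinner_self d_def)
    qed
    have "(\<Sum>m<n. d e m) \<le> (norm e)\<^sup>2 - (norm ((r ^^ n) e))\<^sup>2" for n
    proof (induction n)
      case (Suc n)
      then show ?case using step[of n] by simp
    qed simp
    then show "(\<Sum>m<n. d e m) \<le> (norm e)\<^sup>2" for n
      by (rule order_trans) simp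
  qed
  obtain B :: "'a set" where B: "is_onb B"
    using onb_exists by blast
  have bound: "(\<Sum>e\<in>F. Re (cinner e (P e))) \<le> 2 * C" if F: "finite F" "F \<subseteq> B" for F
  proof -
    have "(\<Sum>e\<in>F. Re (cinner e (P e))) \<le> 2 * C + M * (\<Sum>e\<in>F. d e m)" for m
    proof -
      \<comment> \<open>The two Bessel families fed into the hypothesis are finitely many basis
        vectors and their images under the contraction \<open>W (2 * m)\<close>.\<close>
      have bes: "bessel_family F (\<lambda>e. e)"
        by (rule onb_bessel(2)[OF B F])
      have "Re (cinner e (P e)) \<le> 2 * cmod (cinner (W (2 * m) e) (T e)) + M * d e m" for e
      proof -
        have "Re (cinner (W (2 * m) e) (T e)) = (M / 2) * (Re (cinner e (p e)) - d e m)"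
          unfolding We by (simp add: d_even)
        moreover have "Re (cinner e (P e)) = M * Re (cinner e (p e))"
          using M(1) by (simp add: p_def)
        ultimately have "Re (cinner e (P e)) = 2 * Re (cinner (W (2 * m) e) (T e)) + M * d e m"
          by (simp add: right_diff_distrib)
        then show ?thesis
          using complex_Re_le_cmod[of "cinner (W (2 * m) e) (T e)"] by linarith
      qed
      then have "(\<Sum>e\<in>F. Re (cinner e (P e))) \<le> (\<Sum>e\<in>F. 2 * cmod (cinner (W (2 * m) e) (T e)) + M * d e m)"
        by (intro sum_mono)
      also have "\<dots> = 2 * (\<Sum>e\<in>F. cmod (cinner (W (2 * m) e) (T e))) + M * (\<Sum>e\<in>F. d e m)"
        by (simp add: sum.distrib sum_distrib_left)
      also have "\<dots> \<le> 2 * C + M * (\<Sum>e\<in>F. d e m)"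
        using C[OF bes bessel_family_image[OF bes Wadj Wnorm]] by simp
      finally show ?thesis .
    qed
    moreover have "(\<lambda>m. 2 * C + M * (\<Sum>e\<in>F. d e m)) \<longlonglongrightarrow> 2 * C + M * (\<Sum>e\<in>F. 0)"
      by (intro tendsto_intros d_lim)
    ultimately show ?thesis
      by (intro LIMSEQ_le_const) auto
  qed
  have "(\<lambda>e. Re (cinner e (P e))) summable_on B"
    using bound positive_opD(2)[OF P(1)] by (intro nonneg_bdd_above_summable_on bdd_aboveI2[of _ _ "2 * C"]) auto
  then have "(\<lambda>e. complex_of_real (Re (cinner e (P e)))) summable_on B"
    by (rule summable_on_of_real)
  then have "(\<lambda>e. cinner e (P e)) summable_on B"
    by (simp flip: positive_opD(3)[OF P(1)])
  with T B show ?thesis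
    by (auto simp: trace_class_def P_def)
qed

text \<open>Trace class implies Hilbert-Schmidt. With Q the square root of |T|, ||T e|| = ||Q Q e||
  <= K ||Q e||; by Parseval the sum of ||Q e_j||^2 is a double sum over the basis, and Bessel in j
  bounds it by the sum of ||Q b||^2, the trace of |T|.\<close>

lemma trace_class_square_summable:
  fixes T :: "'a::chilbert \<Rightarrow> 'a"
  assumes T: "trace_class T" and S: "bounded_clinear S" "adjoint_pair T S"
  obtains C where "\<And>F (e :: 'i \<Rightarrow> 'a). bessel_family F e \<Longrightarrow> (\<Sum>j\<in>F. (norm (T (e j)))\<^sup>2) \<le> C"
proof -
  have Tlin: "bounded_clinear T"
    using T by (simp add: trace_class_def)
  define P where "P = abs_op T"
  have P: "positive_op P" "\<And>x. norm (P x) = norm (T x)"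
    using abs_op[OF Tlin S] by (auto simp: P_def)
  obtain B where B: "is_onb B" and sB: "(\<lambda>e. cinner e (P e)) summable_on B"
    using T by (auto simp: trace_class_def P_def)
  obtain Q where Q: "positive_op Q" "\<And>x. Q (Q x) = P x"
    using sqrt_op_exists[OF P(1)] by metis
  have Qsa: "cinner (Q a) b = cinner a (Q b)" for a b
    using positive_op_selfadjoint[OF Q(1)] by (simp add: adjoint_pair_def)
  obtain K where K: "K > 0" "\<And>x. norm (Q x) \<le> K * norm x"
    using bounded_clinear_bound[OF positive_opD(1)[OF Q(1)]] by blast
  have QP: "(norm (Q e))\<^sup>2 = Re (cinner e (P e))" for e
  proof -
    have "cinner (Q e) (Q e) = cinner e (P e)" by (simp add: Qsa Q(2))
    then show ?thesis by (metis cinner_self Re_complex_of_real)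
  qed
  obtain L where L: "((\<lambda>e. (norm (Q e))\<^sup>2) has_sum L) B"
    using has_sum_Re[OF has_sum_infsum[OF sB]] unfolding QP by blast
  show thesis
  proof (rule that[of "K\<^sup>2 * L"])
    fix F and e :: "'i \<Rightarrow> 'a" assume bes: "bessel_family F e"
    then have fin: "finite F" by (simp add: bessel_family_def)
    have 1: "((\<lambda>b. \<Sum>j\<in>F. (cmod (cinner b (Q (e j))))\<^sup>2) has_sum (\<Sum>j\<in>F. (norm (Q (e j)))\<^sup>2)) B"
      using fin by (induction F rule: finite_induct) (auto intro!: has_sum_add parseval[OF B])
    have 2: "(\<Sum>j\<in>F. (cmod (cinner b (Q (e j))))\<^sup>2) \<le> (norm (Q b))\<^sup>2" for b
      using bes by (simp add: bessel_family_def cmod_cinner_commute[of b] Qsa)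
    have "(\<Sum>j\<in>F. (norm (Q (e j)))\<^sup>2) \<le> L"
      by (rule has_sum_mono[OF 1 L 2])
    have TQ: "(norm (T (e j)))\<^sup>2 \<le> K\<^sup>2 * (norm (Q (e j)))\<^sup>2" for j
    proof -
      have "norm (T (e j)) \<le> K * norm (Q (e j))"
        using K(2)[of "Q (e j)"] by (simp add: Q(2) P(2))
      then have "(norm (T (e j)))\<^sup>2 \<le> (K * norm (Q (e j)))\<^sup>2"
        by (intro power_mono) auto
      then show ?thesis by (simp add: power_mult_distrib)
    qed
    have "(\<Sum>j\<in>F. (norm (T (e j)))\<^sup>2) \<le> (\<Sum>j\<in>F. K\<^sup>2 * (norm (Q (e j)))\<^sup>2)"
      by (rule sum_mono) (rule TQ)
    also have "\<dots> = K\<^sup>2 * (\<Sum>j\<in>F. (norm (Q (e j)))\<^sup>2)"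
      by (simp add: sum_distrib_left)
    also have "\<dots> \<le> K\<^sup>2 * L"
      using \<open>(\<Sum>j\<in>F. (norm (Q (e j)))\<^sup>2) \<le> L\<close> by (intro mult_left_mono) auto
    finally show "(\<Sum>j\<in>F. (norm (T (e j)))\<^sup>2) \<le> K\<^sup>2 * L" .
  qed
qed

section \<open>Square integrable functions\<close>

lemma rep_L2_measurable [measurable]: "rep_L2 u \<in> borel_measurable borel"
  using square_integrable_rep_L2[of u] by (simp add: square_integrable_def)

lemma square_integrable_measurable: "square_integrable f \<Longrightarrow> f \<in> borel_measurable borel"
  by (simp add: square_integrable_def)

lemma rep_abs_L2: "square_integrable f \<Longrightarrow> AE x in lborel. rep_L2 (abs_L2 f) x = f x"
  using Quotient3_rep_abs[OF Quotient3_L2, of f] by (simp add: L2_rel_def)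

lemma abs_L2_eqI:
  assumes "square_integrable f" "square_integrable g" "AE x in lborel. f x = g x"
  shows "abs_L2 f = abs_L2 g"
  using assms Quotient3_rel_abs[OF Quotient3_L2, of f g] by (simp add: L2_rel_def)

lemma L2_eqI:
  assumes "AE x in lborel. rep_L2 u x = rep_L2 v x"
  shows "u = v"
  using abs_L2_eqI[OF square_integrable_rep_L2 square_integrable_rep_L2 assms] by (simp add: abs_rep_L2)

lemma L2_eqI_abs:
  assumes "square_integrable f" "AE x in lborel. rep_L2 u x = f x"
  shows "u = abs_L2 f"
  using abs_L2_eqI[OF square_integrable_rep_L2 assms] by (simp add: abs_rep_L2)

lemma cinner_abs_L2:
  "square_integrable f \<Longrightarrow> square_integrable g \<Longrightarrow> cinner (abs_L2 f) (abs_L2 g) = (LINT x|lborel. cnj (f x) * g x)"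
  by (simp add: cinner_L2.abs_eq L2_rel_def)

lemma cinner_rep_L2: "cinner u v = (LINT x|lborel. cnj (rep_L2 u x) * rep_L2 v x)"
  using cinner_abs_L2[OF square_integrable_rep_L2 square_integrable_rep_L2, of u v] by (simp add: abs_rep_L2)

lemma norm_rep_L2: "(norm u)\<^sup>2 = (LINT x|lborel. (cmod (rep_L2 u x))\<^sup>2)"
  using norm_abs_L2[OF square_integrable_rep_L2, of u] by (simp add: abs_rep_L2)

lemma abs_L2_add: "square_integrable f \<Longrightarrow> square_integrable g \<Longrightarrow> abs_L2 f + abs_L2 g = abs_L2 (\<lambda>x. f x + g x)"
  by (simp add: plus_L2.abs_eq L2_rel_def)

lemma abs_L2_diff: "square_integrable f \<Longrightarrow> square_integrable g \<Longrightarrow> abs_L2 f - abs_L2 g = abs_L2 (\<lambda>x. f x - g x)"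
  by (simp add: minus_L2.abs_eq L2_rel_def)

lemma abs_L2_scaleC: "square_integrable f \<Longrightarrow> c *\<^sub>C abs_L2 f = abs_L2 (\<lambda>x. c * f x)"
  by (simp add: scaleC_L2.abs_eq L2_rel_def)

lemma rep_L2_add: "AE x in lborel. rep_L2 (u + v) x = rep_L2 u x + rep_L2 v x"
  using rep_abs_L2[OF square_integrable_add[OF square_integrable_rep_L2[of u] square_integrable_rep_L2[of v]]]
  by (simp add: abs_L2_add[symmetric] abs_rep_L2 square_integrable_rep_L2)

lemma rep_L2_diff: "AE x in lborel. rep_L2 (u - v) x = rep_L2 u x - rep_L2 v x"
  using rep_abs_L2[OF square_integrable_diff[OF square_integrable_rep_L2[of u] square_integrable_rep_L2[of v]]]
  by (simp add: abs_L2_diff[symmetric] abs_rep_L2 square_integrable_rep_L2)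

lemma rep_L2_scaleC: "AE x in lborel. rep_L2 (c *\<^sub>C u) x = c * rep_L2 u x"
  using rep_abs_L2[OF square_integrable_scale[OF square_integrable_rep_L2[of u]], of c]
  by (simp add: abs_L2_scaleC[symmetric] abs_rep_L2 square_integrable_rep_L2)

lemma rep_L2_zero: "AE x in lborel. rep_L2 0 x = 0"
  using rep_abs_L2[OF square_integrable_zero] by (simp add: zero_L2_def)

section \<open>Multiplication operators on L2\<close>

lemma rep_mult_op:
  assumes "h \<in> borel_measurable borel" "bounded (range h)"
  shows "AE x in lborel. rep_L2 (mult_op h u) x = h x * rep_L2 u x"
proof -
  have "mult_op h (abs_L2 (rep_L2 u)) = abs_L2 (\<lambda>x. h x * rep_L2 u x)"
    using assms by (subst mult_op.abs_eq) (simp_all add: L2_rel_def square_integrable_rep_L2)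
  then show ?thesis
    using rep_abs_L2[OF square_integrable_mult[OF _ assms(2) square_integrable_rep_L2]] assms(1)
    by (simp add: abs_rep_L2)
qed

lemma mult_op_eqI:
  assumes "h \<in> borel_measurable borel" "bounded (range h)" "AE x in lborel. rep_L2 v x = h x * rep_L2 u x"
  shows "mult_op h u = v"
  by (rule L2_eqI) (use rep_mult_op[OF assms(1,2), of u] assms(3) in eventually_elim, simp)

lemma mult_op_abs_L2:
  assumes "h \<in> borel_measurable borel" "bounded (range h)" "square_integrable f"
  shows "mult_op h (abs_L2 f) = abs_L2 (\<lambda>x. h x * f x)"
  using assms by (subst mult_op.abs_eq) (simp_all add: L2_rel_def)

lemma norm_mult_op_le:
  assumes "h \<in> borel_measurable borel" "\<And>x. cmod (h x) \<le> K"
  shows "norm (mult_op h u) \<le> K * norm u"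
proof -
  have K: "0 \<le> K" using norm_ge_zero assms(2) order_trans by blast
  have b: "bounded (range h)" using assms(2) by (auto simp: bounded_iff)
  have "(norm (mult_op h u))\<^sup>2 = (LINT x|lborel. (cmod (rep_L2 (mult_op h u) x))\<^sup>2)"
    by (rule norm_rep_L2)
  also have "\<dots> \<le> (LINT x|lborel. K\<^sup>2 * (cmod (rep_L2 u x))\<^sup>2)"
  proof (rule integral_mono_AE)
    show "AE x in lborel. (cmod (rep_L2 (mult_op h u) x))\<^sup>2 \<le> K\<^sup>2 * (cmod (rep_L2 u x))\<^sup>2"
      using rep_mult_op[OF assms(1) b, of u]
    proof eventually_elim
      case (elim x)
      show ?case unfolding elim norm_mult power_mult_distrib
        using assms(2)[of x] by (intro mult_right_mono power_mono) auto
    qed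
  qed (use square_integrable_rep_L2 in \<open>auto simp: square_integrable_def\<close>)
  also have "\<dots> = (K * norm u)\<^sup>2"
    by (simp add: norm_rep_L2 power_mult_distrib)
  finally show ?thesis
    using K by (simp add: power2_le_iff_abs_le abs_mult)
qed

lemma bounded_range_norm: "bounded (range h) \<longleftrightarrow> (\<exists>K. \<forall>x. norm (h x) \<le> K)"
  by (auto simp: bounded_iff)

lemma bounded_clinear_mult_op:
  assumes "h \<in> borel_measurable borel" "bounded (range h)"
  shows "bounded_clinear (mult_op h)"
proof -
  obtain K where K: "\<And>x. cmod (h x) \<le> K" using assms(2) by (auto simp: bounded_range_norm)
  show ?thesis
  proof (rule bounded_clinearI[OF _ _ norm_mult_op_le[OF assms(1) K]])
    fix u v c
    show "mult_op h (u + v) = mult_op h u + mult_op h v"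
      by (rule mult_op_eqI[OF assms])
        (use rep_mult_op[OF assms, of u] rep_mult_op[OF assms, of v] rep_L2_add[of u v] rep_L2_add[of "mult_op h u" "mult_op h v"]
          in eventually_elim, simp add: distrib_left)
    show "mult_op h (c *\<^sub>C u) = c *\<^sub>C mult_op h u"
      by (rule mult_op_eqI[OF assms])
        (use rep_mult_op[OF assms, of u] rep_L2_scaleC[of c u] rep_L2_scaleC[of c "mult_op h u"]
          in eventually_elim, simp)
  qed
qed

lemma cinner_mult_op:
  assumes "h \<in> borel_measurable borel" "bounded (range h)"
  shows "cinner u (mult_op h v) = (LINT x|lborel. cnj (rep_L2 u x) * h x * rep_L2 v x)"
  unfolding cinner_rep_L2
  by (rule integral_cong_AE) (use assms(1) in measurable, use rep_mult_op[OF assms, of v] in eventually_elim, simp)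

lemma adjoint_mult_op:
  assumes "h \<in> borel_measurable borel" "bounded (range h)"
  shows "adjoint_pair (mult_op h) (mult_op (\<lambda>x. cnj (h x)))"
  unfolding adjoint_pair_def
proof (intro allI)
  fix u v
  note [measurable] = assms(1)
  have b: "bounded (range (\<lambda>x. cnj (h x)))" using assms(2) by (auto simp: bounded_iff)
  have m: "(\<lambda>x. cnj (h x)) \<in> borel_measurable borel" using assms(1) by measurable
  show "cinner (mult_op (\<lambda>x. cnj (h x)) u) v = cinner u (mult_op h v)"
  proof -
    have "AE x in lborel. cnj (rep_L2 (mult_op (\<lambda>x. cnj (h x)) u) x) * rep_L2 v x = cnj (rep_L2 u x) * h x * rep_L2 v x"
      using rep_mult_op[OF m b, of u] by eventually_elim simp
    then have "(LINT x|lborel. cnj (rep_L2 (mult_op (\<lambda>x. cnj (h x)) u) x) * rep_L2 v x)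
        = (LINT x|lborel. cnj (rep_L2 u x) * h x * rep_L2 v x)"
      by (intro integral_cong_AE) measurable
    then show ?thesis
      by (simp only: cinner_mult_op[OF assms] cinner_rep_L2[of "mult_op (\<lambda>x. cnj (h x)) u" v])
  qed
qed

lemma mult_op_mult_op:
  assumes "h \<in> borel_measurable borel" "bounded (range h)" "k \<in> borel_measurable borel" "bounded (range k)"
  shows "mult_op h (mult_op k u) = mult_op (\<lambda>x. h x * k x) u"
proof (rule mult_op_eqI[OF assms(1,2)])
  obtain K where K: "\<And>x. cmod (h x) \<le> K" using assms(2) by (auto simp: bounded_range_norm)
  obtain L where L: "\<And>x. cmod (k x) \<le> L" using assms(4) by (auto simp: bounded_range_norm)
  have "cmod (h x * k x) \<le> K * L" for x
    unfolding norm_mult by (intro mult_mono K L order_trans[OF norm_ge_zero K]) auto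
  then have b: "bounded (range (\<lambda>x. h x * k x))" by (auto simp: bounded_range_norm)
  have m: "(\<lambda>x. h x * k x) \<in> borel_measurable borel" using assms by measurable
  show "AE x in lborel. rep_L2 (mult_op (\<lambda>x. h x * k x) u) x = h x * rep_L2 (mult_op k u) x"
    using rep_mult_op[OF m b, of u] rep_mult_op[OF assms(3,4), of u] by eventually_elim simp
qed

text \<open>Dominated convergence with majorant (2 K)^2 |u|^2. Cutoffs are removed by it, and it
  also gives countable additivity of the spectral measure of D.\<close>

lemma mult_op_tendsto:
  assumes s: "\<And>n. s n \<in> borel_measurable borel" "\<And>n x. cmod (s n x) \<le> K"
    and l: "l \<in> borel_measurable borel" "\<And>x. cmod (l x) \<le> K"
    and lim: "\<And>x. (\<lambda>n. s n x) \<longlonglongrightarrow> l x"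
  shows "(\<lambda>n. mult_op (s n) u) \<longlonglongrightarrow> mult_op l u"
proof -
  note [measurable] = s(1) l(1)
  have b: "bounded (range (s n))" "bounded (range l)" for n
    using s(2) l(2) by (auto simp: bounded_range_norm)
  have "(\<lambda>n. (norm (mult_op (s n) u - mult_op l u))\<^sup>2) \<longlonglongrightarrow> 0"
  proof -
    have eq: "(norm (mult_op (s n) u - mult_op l u))\<^sup>2 = (LINT x|lborel. (cmod ((s n x - l x) * rep_L2 u x))\<^sup>2)" for n
      unfolding norm_rep_L2
      by (rule integral_cong_AE, measurable, measurable,
        use rep_mult_op[OF s(1) b(1), of n u] rep_mult_op[OF l(1) b(2), of u] rep_L2_diff[of "mult_op (s n) u" "mult_op l u"]
        in eventually_elim, simp add: left_diff_distrib)
    have "(\<lambda>n. LINT x|lborel. (cmod ((s n x - l x) * rep_L2 u x))\<^sup>2) \<longlonglongrightarrow> integral\<^sup>L lborel (\<lambda>x::real. 0::real)"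
    proof (rule integral_dominated_convergence[where w = "\<lambda>x. (2 * K)\<^sup>2 * (cmod (rep_L2 u x))\<^sup>2"])
      show "integrable lborel (\<lambda>x. (2 * K)\<^sup>2 * (cmod (rep_L2 u x))\<^sup>2)"
        using square_integrable_rep_L2[of u] by (simp add: square_integrable_def)
      show "AE x in lborel. (\<lambda>n. (cmod ((s n x - l x) * rep_L2 u x))\<^sup>2) \<longlonglongrightarrow> 0"
      proof (rule AE_I2)
        fix x
        have "(\<lambda>n. (cmod ((s n x - l x) * rep_L2 u x))\<^sup>2) \<longlonglongrightarrow> (cmod ((l x - l x) * rep_L2 u x))\<^sup>2"
          by (intro tendsto_intros lim)
        then show "(\<lambda>n. (cmod ((s n x - l x) * rep_L2 u x))\<^sup>2) \<longlonglongrightarrow> 0" by simp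
      qed
      show "AE x in lborel. norm ((cmod ((s n x - l x) * rep_L2 u x))\<^sup>2) \<le> (2 * K)\<^sup>2 * (cmod (rep_L2 u x))\<^sup>2" for n
      proof (rule AE_I2)
        fix x
        have "cmod (s n x - l x) \<le> 2 * K"
          using norm_triangle_ineq4[of "s n x" "l x"] s(2)[of n x] l(2)[of x] by linarith
        then show "norm ((cmod ((s n x - l x) * rep_L2 u x))\<^sup>2) \<le> (2 * K)\<^sup>2 * (cmod (rep_L2 u x))\<^sup>2"
          using mult_right_mono[OF power_mono[of "cmod (s n x - l x)" "2 * K" 2] zero_le_power2[of "cmod (rep_L2 u x)"]]
          by (simp add: norm_mult power_mult_distrib)
      qed
    qed measurable
    then show ?thesis by (simp add: eq)
  qed
  then have "(\<lambda>n. norm (mult_op (s n) u - mult_op l u)) \<longlonglongrightarrow> 0"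
    using tendsto_real_sqrt by fastforce
  then show ?thesis
    by (simp add: LIM_zero_iff tendsto_norm_zero_iff)
qed

lemma mult_op_one: "mult_op (\<lambda>x. 1) u = u"
  by (rule mult_op_eqI) auto

definition cutoff :: "nat \<Rightarrow> L2 \<Rightarrow> L2" where
  "cutoff n = mult_op (indicator {-real n..real n})"

lemma bounded_indicator: "bounded (range (indicator A :: real \<Rightarrow> complex))"
  by (auto simp: bounded_range_norm indicator_def intro!: exI[of _ 1])

lemma norm_indicator_le: "cmod (indicator A x) \<le> 1"
  by (auto simp: indicator_def)

lemma cutoff_tendsto: "(\<lambda>n. cutoff n u) \<longlonglongrightarrow> u"
proof -
  have "(\<lambda>n. mult_op (indicator {-real n..real n}) u) \<longlonglongrightarrow> mult_op (\<lambda>x. 1) u"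
  proof (rule mult_op_tendsto[where K = 1])
    fix x :: real
    obtain N where N: "\<bar>x\<bar> \<le> real N" using real_arch_simple by blast
    have "eventually (\<lambda>n. (indicator {-real n..real n} x :: complex) = 1) sequentially"
      using eventually_ge_at_top[of N] by eventually_elim (use N in \<open>auto simp: indicator_def\<close>)
    then show "(\<lambda>n. indicator {-real n..real n} x :: complex) \<longlonglongrightarrow> 1"
      by (rule tendsto_eventually)
  qed (auto simp: norm_indicator_le)
  then show ?thesis by (simp add: cutoff_def mult_op_one)
qed

section \<open>Complex conjugation on L2\<close>

definition conj_L2 :: "L2 \<Rightarrow> L2" where
  "conj_L2 u = abs_L2 (\<lambda>x. cnj (rep_L2 u x))"

lemma square_integrable_cnj: "square_integrable f \<Longrightarrow> square_integrable (\<lambda>x. cnj (f x))"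
  by (auto simp: square_integrable_def)

lemma rep_conj_L2: "AE x in lborel. rep_L2 (conj_L2 u) x = cnj (rep_L2 u x)"
  unfolding conj_L2_def by (intro rep_abs_L2 square_integrable_cnj square_integrable_rep_L2)

lemma conj_abs_L2: "square_integrable f \<Longrightarrow> conj_L2 (abs_L2 f) = abs_L2 (\<lambda>x. cnj (f x))"
  by (rule L2_eqI_abs[OF square_integrable_cnj], assumption)
     (use rep_conj_L2[of "abs_L2 f"] rep_abs_L2[of f] in auto)

lemma conj_conj_L2 [simp]: "conj_L2 (conj_L2 u) = u"
  by (rule L2_eqI) (use rep_conj_L2[of "conj_L2 u"] rep_conj_L2[of u] in eventually_elim, simp)

lemma conj_L2_add: "conj_L2 (u + v) = conj_L2 u + conj_L2 v"
  by (rule L2_eqI) (use rep_conj_L2[of "u + v"] rep_conj_L2[of u] rep_conj_L2[of v] rep_L2_add[of u v]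
      rep_L2_add[of "conj_L2 u" "conj_L2 v"] in eventually_elim, simp)

lemma conj_L2_scaleC: "conj_L2 (c *\<^sub>C u) = cnj c *\<^sub>C conj_L2 u"
  by (rule L2_eqI) (use rep_conj_L2[of "c *\<^sub>C u"] rep_conj_L2[of u] rep_L2_scaleC[of c u]
      rep_L2_scaleC[of "cnj c" "conj_L2 u"] in eventually_elim, simp)

lemma cinner_conj_L2: "cinner (conj_L2 u) (conj_L2 v) = cinner v u"
  unfolding cinner_rep_L2
  by (rule integral_cong_AE, measurable, use rep_conj_L2[of u] rep_conj_L2[of v] in eventually_elim, simp)

lemma norm_conj_L2: "norm (conj_L2 u) = norm u"
proof -
  have "(norm (conj_L2 u))\<^sup>2 = (norm u)\<^sup>2"
    using cinner_conj_L2[of u u] by (simp only: cinner_self of_real_eq_iff)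
  then show ?thesis by (simp add: power2_eq_iff_nonneg)
qed

lemma conj_L2_tendsto: "(f \<longlongrightarrow> l) net \<Longrightarrow> ((\<lambda>x. conj_L2 (f x)) \<longlongrightarrow> conj_L2 l) net"
proof -
  have "bounded_linear conj_L2"
    by (rule bounded_linear_intro[of _ 1]) (auto simp: conj_L2_add conj_L2_scaleC scaleR_scaleC norm_conj_L2)
  then show "(f \<longlongrightarrow> l) net \<Longrightarrow> ((\<lambda>x. conj_L2 (f x)) \<longlongrightarrow> conj_L2 l) net"
    by (rule bounded_linear.tendsto)
qed

lemma square_integrable_indicator_Ioc: "square_integrable (indicator {a<..b})"
proof -
  have "(\<lambda>x. (cmod (indicator {a<..b} x))\<^sup>2) = (indicator {a<..b} :: real \<Rightarrow> real)"
    by (auto simp: indicator_def)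
  moreover have "emeasure lborel {a<..b} < \<infinity>" by (intro emeasure_bounded_finite) (auto intro: bounded_subset[of "{a..b}"])
  ultimately show ?thesis by (simp add: square_integrable_def)
qed

text \<open>On [-K, K] one has |f| <= 1 + |f|^2, because (a - 1/2)^2 >= 0.\<close>

lemma integrable_compact_square_integrable:
  assumes "square_integrable f" "\<And>x. \<bar>x\<bar> > K \<Longrightarrow> f x = 0"
  shows "integrable lborel f"
proof (rule Bochner_Integration.integrable_bound)
  show "integrable lborel (\<lambda>x. indicator {-K..K} x + (cmod (f x))\<^sup>2)"
    using assms(1) by (auto simp: square_integrable_def intro!: Bochner_Integration.integrable_add integrable_real_indicator emeasure_bounded_finite)
  have "cmod (f x) \<le> indicator {-K..K} x + (cmod (f x))\<^sup>2" for x
  proof (cases "\<bar>x\<bar> \<le> K")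
    case True
    have "a \<le> 1 + a\<^sup>2" for a :: real
      using zero_le_power2[of "a - 1/2"] unfolding power2_diff by (simp add: power_divide)
    with True show ?thesis by (auto simp: indicator_def)
  qed (use assms(2) in \<open>auto simp: indicator_def\<close>)
  then show "AE x in lborel. norm (f x) \<le> norm (indicator {-K..K} x + (cmod (f x))\<^sup>2)"
    by (intro AE_I2) (auto intro: order_trans)
qed (use assms(1) in \<open>simp add: square_integrable_def\<close>)

text \<open>On each window (-n, n] the integral of the conjugate of z vanishes over half-open
  intervals. These form a generator stable under intersection, so it vanishes over all Borel sets
  and z is 0 almost everywhere on the window.\<close>

lemma L2_indicators_total:
  assumes "\<And>a b. a < b \<Longrightarrow> cinner z (abs_L2 (indicator {a<..b})) = 0"
  shows "z = 0"
proof -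
  let ?f = "rep_L2 z"
  have f: "(LINT x|lborel. cnj (?f x) * indicator {a<..b} x) = 0" for a b
  proof (cases "a < b")
    case True
    have "cinner z (abs_L2 (indicator {a<..b})) = (LINT x|lborel. cnj (?f x) * indicator {a<..b} x)"
      using cinner_abs_L2[OF square_integrable_rep_L2 square_integrable_indicator_Ioc, of z a b]
      by (simp add: abs_rep_L2)
    with assms[OF True] show ?thesis by simp
  qed simp
  have "AE x in lborel. indicator {-real n<..real n} x *\<^sub>R cnj (?f x) = 0" for n :: nat
  proof (rule sigma_finite_measure.density_zero[OF sigma_finite_lborel])
    let ?g = "\<lambda>x. indicator {-real n<..real n} x *\<^sub>R cnj (?f x)"
    have "integrable lborel (\<lambda>x. cnj (?f x) * indicator {-real n<..real n} x)"
      by (intro square_integrable_product square_integrable_rep_L2 square_integrable_indicator_Ioc)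
    then show g: "integrable lborel ?g"
      by (simp add: scaleR_conv_of_real mult.commute of_real_indicator)
    fix A assume "A \<in> sets (lborel :: real measure)"
    then have A: "A \<in> sigma_sets UNIV (range (\<lambda>(a, b). {a<..b::real}))"
      by (simp add: borel_sigma_sets_Ioc)
    have int: "integrable lborel (\<lambda>x. indicator B x *\<^sub>R ?g x)" if "B \<in> sets borel" for B
      using integrable_mult_indicator[OF _ g, of B] that by simp
    have sb: "B \<in> sets borel" if "B \<in> sigma_sets UNIV (range (\<lambda>(a, b). {a<..b::real}))" for B
      using that by (simp add: borel_sigma_sets_Ioc)
    have Ioc: "(LINT x|lborel. indicator {a<..b} x *\<^sub>R ?g x) = 0" for a b
    proof -
      have "(\<lambda>x. indicator {a<..b} x *\<^sub>R ?g x) = (\<lambda>x. cnj (?f x) * indicator {max a (-real n)<..min b (real n)} x)"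
        by (auto simp: indicator_def)
      then show ?thesis using f by simp
    qed
    \<comment> \<open>The window makes the total integral one of the interval integrals; the
      complement step of the induction needs this.\<close>
    have total: "(LINT x|lborel. ?g x) = 0"
    proof -
      have "?g = (\<lambda>x. indicator {-real n<..real n} x *\<^sub>R ?g x)" by (auto simp: indicator_def)
      then show ?thesis using Ioc[of "-real n" "real n"] by simp
    qed
    have "(LINT x|lborel. indicator A x *\<^sub>R ?g x) = 0"
    proof (rule sigma_sets_induct_disjoint[OF _ _ A])
      show "Int_stable (range (\<lambda>(a, b). {a<..b::real}))"
      proof (rule Int_stableI)
        fix A B assume "A \<in> range (\<lambda>(a, b). {a<..b::real})" "B \<in> range (\<lambda>(a, b). {a<..b::real})"
        then obtain a b c d where "A = {a<..b}" "B = {c<..d}" by auto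
        then have "A \<inter> B = (\<lambda>(a, b). {a<..b}) (max a c, min b d)" by auto
        then show "A \<inter> B \<in> range (\<lambda>(a, b). {a<..b::real})" by blast
      qed
      fix B assume "B \<in> range (\<lambda>(a, b). {a<..b::real})"
      then show "(LINT x|lborel. indicator B x *\<^sub>R ?g x) = 0" using Ioc by auto
    next
      fix B assume B: "B \<in> sigma_sets UNIV (range (\<lambda>(a, b). {a<..b::real}))" "(LINT x|lborel. indicator B x *\<^sub>R ?g x) = 0"
      have "(LINT x|lborel. indicator (UNIV - B) x *\<^sub>R ?g x) = (LINT x|lborel. ?g x - indicator B x *\<^sub>R ?g x)"
        by (rule Bochner_Integration.integral_cong) (auto simp: indicator_def)
      also have "\<dots> = 0"
        using g int[OF sb[OF B(1)]] B(2) total by (subst Bochner_Integration.integral_diff) auto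
      finally show "(LINT x|lborel. indicator (UNIV - B) x *\<^sub>R ?g x) = 0" .
    next
      fix B :: "nat \<Rightarrow> real set" assume B: "disjoint_family B" "range B \<subseteq> sigma_sets UNIV (range (\<lambda>(a, b). {a<..b::real}))"
        "\<And>i. (LINT x|lborel. indicator (B i) x *\<^sub>R ?g x) = 0"
      have "set_lebesgue_integral lborel (\<Union>i. B i) ?g = (\<Sum>i. set_lebesgue_integral lborel (B i) ?g)"
      proof (rule lebesgue_integral_countable_add)
        show "B i \<in> sets lborel" for i using B(2) sb by auto
        then have "(\<Union>i. B i) \<in> sets borel" by auto
        then show "set_integrable lborel (\<Union>i. B i) ?g"
          unfolding set_integrable_def by (rule int)
        show "B i \<inter> B j = {}" if "i \<noteq> j" for i j
          using B(1) that by (auto simp: disjoint_family_on_def)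
      qed
      then show "(LINT x|lborel. indicator (\<Union>i. B i) x *\<^sub>R ?g x) = 0"
        using B(3) by (simp add: set_lebesgue_integral_def)
    qed auto
    then show "set_lebesgue_integral lborel A ?g = 0"
      by (simp add: set_lebesgue_integral_def)
  qed
  then have "AE x in lborel. \<forall>n. indicator {-real n<..real n} x *\<^sub>R cnj (?f x) = 0"
    by (intro AE_all_countable[THEN iffD2] allI)
  then have "AE x in lborel. ?f x = rep_L2 0 x"
    using rep_L2_zero
  proof eventually_elim
    case (elim x)
    obtain n where "\<bar>x\<bar> < real n" using reals_Archimedean2 by blast
    then show ?case using elim(1)[rule_format, of n] elim(2) by (auto simp: indicator_def abs_if split: if_splits)
  qed
  then show ?thesis by (rule L2_eqI)
qed

section \<open>The Fourier transform\<close>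

lemma measurable_cis [measurable]: "cis \<in> borel \<rightarrow>\<^sub>M borel"
  by (intro borel_measurable_continuous_onI continuous_intros)

lemma integrable_mult_bounded:
  fixes f k :: "'a \<Rightarrow> complex"
  assumes "integrable M f" "k \<in> borel_measurable M" "\<And>x. cmod (k x) \<le> K"
  shows "integrable M (\<lambda>x. k x * f x)"
proof (rule Bochner_Integration.integrable_bound)
  show "integrable M (\<lambda>x. complex_of_real K * f x)"
    using assms(1) by simp
  show "(\<lambda>x. k x * f x) \<in> borel_measurable M"
    using assms by measurable
  have "0 \<le> K" using assms(3) norm_ge_zero order_trans by blast
  then show "AE x in M. norm (k x * f x) \<le> norm (complex_of_real K * f x)"
    using assms(3) by (auto simp: norm_mult intro!: mult_right_mono)
qed

text \<open>The shape of most interchanges of integrals below: a bounded kernel, usually a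
  character, times a product of two integrable functions.\<close>

lemma Fubini_bounded_kernel:
  fixes f g :: "real \<Rightarrow> complex"
  assumes f: "integrable lborel f" and g: "integrable lborel g"
    and k: "(\<lambda>(x, y). k x y) \<in> borel_measurable (borel \<Otimes>\<^sub>M borel)" "\<And>x y. cmod (k x y) \<le> K"
  shows "integrable (lborel \<Otimes>\<^sub>M lborel) (\<lambda>(x, y). k x y * (f x * g y))"
    and "(LINT x|lborel. LINT y|lborel. k x y * (f x * g y)) = (LINT y|lborel. LINT x|lborel. k x y * (f x * g y))"
proof -
  have [measurable]: "f \<in> borel_measurable borel" "g \<in> borel_measurable borel"
    using f g by auto
  note [measurable] = k(1)
  have "integrable (lborel \<Otimes>\<^sub>M lborel) (\<lambda>(x, y). f x * g y)"
  proof (rule lborel_pair.Fubini_integrable)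
    show "integrable lborel (\<lambda>x. LINT y|lborel. norm (case (x, y) of (x, y) \<Rightarrow> f x * g y))"
      using f by (simp add: norm_mult)
    show "AE x in lborel. integrable lborel (\<lambda>y. case (x, y) of (x, y) \<Rightarrow> f x * g y)"
      using g by simp
  qed measurable
  from integrable_mult_bounded[OF this, of "\<lambda>(x, y). k x y" K]
  show *: "integrable (lborel \<Otimes>\<^sub>M lborel) (\<lambda>(x, y). k x y * (f x * g y))"
    using k by (simp add: case_prod_unfold)
  show "(LINT x|lborel. LINT y|lborel. k x y * (f x * g y)) = (LINT y|lborel. LINT x|lborel. k x y * (f x * g y))"
    by (rule lborel_pair.Fubini_integral[symmetric]) (use * in simp)
qed

text \<open>The unitary normalisation, for which Plancherel's theorem has no constant. The function
  is total: its value is 0 where the integral does not exist.\<close>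

definition ft :: "(real \<Rightarrow> complex) \<Rightarrow> real \<Rightarrow> complex" where
  "ft f \<xi> = complex_of_real (1 / sqrt (2 * pi)) * (LINT x|lborel. cis (- (x * \<xi>)) * f x)"

lemma integrable_cis_mult:
  "integrable lborel f \<Longrightarrow> integrable lborel (\<lambda>x::real. cis (a * x) * f x)"
  by (rule integrable_mult_bounded[where K = 1]) auto

lemma ft_measurable [measurable]:
  assumes [measurable]: "f \<in> borel_measurable borel"
  shows "ft f \<in> borel_measurable borel"
  unfolding ft_def by measurable

lemma ft_bound: "cmod (ft f \<xi>) \<le> (LINT x|lborel. cmod (f x)) / sqrt (2 * pi)"
proof -
  have "cmod (LINT x|lborel. cis (- (x * \<xi>)) * f x) \<le> (LINT x|lborel. cmod (cis (- (x * \<xi>)) * f x))"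
    by (rule integral_norm_bound)
  then have "cmod (LINT x|lborel. cis (- (x * \<xi>)) * f x) \<le> (LINT x|lborel. cmod (f x))"
    by (simp add: norm_mult)
  from divide_right_mono[OF this, of "sqrt (2 * pi)"] show ?thesis
    by (simp add: ft_def norm_divide)
qed

lemma ft_cong_AE:
  assumes "f \<in> borel_measurable borel" "g \<in> borel_measurable borel" "AE x in lborel. f x = g x"
  shows "ft f = ft g"
proof -
  note [measurable] = assms(1,2)
  have "(LINT x|lborel. cis (- (x * \<xi>)) * f x) = (LINT x|lborel. cis (- (x * \<xi>)) * g x)" for \<xi>
    using assms(3) by (intro integral_cong_AE) auto
  then show ?thesis by (simp add: ft_def fun_eq_iff)
qed

lemma ft_add: "integrable lborel f \<Longrightarrow> integrable lborel g \<Longrightarrow> ft (\<lambda>x. f x + g x) = (\<lambda>\<xi>. ft f \<xi> + ft g \<xi>)"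
  using integrable_cis_mult[of f "- _"] integrable_cis_mult[of g "- _"]
  by (simp add: fun_eq_iff ft_def distrib_left mult.commute)

lemma ft_diff: "integrable lborel f \<Longrightarrow> integrable lborel g \<Longrightarrow> ft (\<lambda>x. f x - g x) = (\<lambda>\<xi>. ft f \<xi> - ft g \<xi>)"
  using integrable_cis_mult[of f "- _"] integrable_cis_mult[of g "- _"]
  by (simp add: fun_eq_iff ft_def right_diff_distrib mult.commute)

lemma ft_scale: "ft (\<lambda>x. c * f x) = (\<lambda>\<xi>. c * ft f \<xi>)"
  by (simp add: fun_eq_iff ft_def mult.left_commute)

lemma integrable_gauss: "\<epsilon> > 0 \<Longrightarrow> integrable lborel (\<lambda>\<xi>. exp (- (\<epsilon> * \<xi>)\<^sup>2 / 2 :: real))"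
proof -
  assume e: "\<epsilon> > 0"
  have "integrable lborel (\<lambda>x. sqrt (2 * pi) * std_normal_density x)"
    by simp
  then have "integrable lborel (\<lambda>x. exp (- x\<^sup>2 / 2 :: real))"
    by (simp add: normal_density_def)
  from lborel_integrable_real_affine[OF this, of \<epsilon> 0] e show ?thesis
    by simp
qed

text \<open>The characteristic function of the standard normal distribution, rescaled by the
  substitution x = \<epsilon> \<xi>.\<close>

lemma integral_cis_gauss:
  assumes e: "\<epsilon> > 0"
  shows "(LINT \<xi>|lborel. cis (t * \<xi>) * complex_of_real (exp (- (\<epsilon> * \<xi>)\<^sup>2 / 2)))
    = complex_of_real (sqrt (2 * pi) / \<epsilon> * exp (- (t / \<epsilon>)\<^sup>2 / 2))"
proof -
  have std: "(LINT x|lborel. cis (s * x) * complex_of_real (exp (- x\<^sup>2 / 2))) = complex_of_real (sqrt (2 * pi) * exp (- s\<^sup>2 / 2))" for s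
  proof -
    have "complex_of_real (exp (- s\<^sup>2 / 2)) = char std_normal_distribution s"
      by (simp add: char_std_normal_distribution)
    also have "\<dots> = (LINT x|lborel. std_normal_density x *\<^sub>R cis (s * x))"
      unfolding char_def by (subst integral_density) (auto simp: cis_conv_exp)
    also have "\<dots> = (LINT x|lborel. complex_of_real (1 / sqrt (2 * pi)) * (cis (s * x) * complex_of_real (exp (- x\<^sup>2 / 2))))"
      by (rule Bochner_Integration.integral_cong) (auto simp: normal_density_def scaleR_conv_of_real)
    also have "\<dots> = complex_of_real (1 / sqrt (2 * pi)) * (LINT x|lborel. cis (s * x) * complex_of_real (exp (- x\<^sup>2 / 2)))"
      by simp
    finally show ?thesis
      by (simp add: field_simps)
  qed
  have "(LINT x|lborel. cis (t / \<epsilon> * x) * complex_of_real (exp (- x\<^sup>2 / 2)))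
      = \<bar>\<epsilon>\<bar> *\<^sub>R (LINT \<xi>|lborel. cis (t / \<epsilon> * (0 + \<epsilon> * \<xi>)) * complex_of_real (exp (- (0 + \<epsilon> * \<xi>)\<^sup>2 / 2)))"
    by (rule lborel_integral_real_affine) (use e in simp)
  then have "\<epsilon> *\<^sub>R (LINT \<xi>|lborel. cis (t * \<xi>) * complex_of_real (exp (- (\<epsilon> * \<xi>)\<^sup>2 / 2))) = complex_of_real (sqrt (2 * pi) * exp (- (t / \<epsilon>)\<^sup>2 / 2))"
    using e std[of "t / \<epsilon>"] by simp
  then show ?thesis
    using e by (simp add: scaleR_conv_of_real field_simps)
qed

text \<open>A regularised Parseval identity. The Gaussian factor makes everything absolutely
  convergent before the transforms are known to be square integrable; on the other side it averages
  g with a normal density of width \<epsilon>.\<close>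

lemma ft_gauss_product:
  assumes f: "integrable lborel f" and g: "integrable lborel g" and e: "\<epsilon> > 0"
  shows "(LINT \<xi>|lborel. cnj (ft f \<xi>) * ft g \<xi> * complex_of_real (exp (- (\<epsilon> * \<xi>)\<^sup>2 / 2)))
    = (LINT x|lborel. cnj (f x) * (LINT s|lborel. complex_of_real (std_normal_density s) * g (x + \<epsilon> * s)))"
proof -
  define e' where "e' \<xi> = complex_of_real (exp (- (\<epsilon> * \<xi>)\<^sup>2 / 2))" for \<xi>
  have e'_int: "integrable lborel e'"
    using integrable_gauss[OF e] unfolding e'_def by simp
  have [measurable]: "f \<in> borel_measurable borel" "g \<in> borel_measurable borel" "e' \<in> borel_measurable borel"
    using f g e'_int by auto
  have f': "integrable lborel (\<lambda>x. cnj (f x))" using f by simp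
  let ?c = "complex_of_real (1 / sqrt (2 * pi))"
  let ?L = "(LINT x|lborel. cmod (g x)) / sqrt (2 * pi)"
  have inner: "(LINT \<xi>|lborel. cis (x * \<xi>) * ft g \<xi> * e' \<xi>)
      = complex_of_real (sqrt (2 * pi)) * (LINT s|lborel. complex_of_real (std_normal_density s) * g (x + \<epsilon> * s))" for x
  proof -
    have "cis (x * \<xi>) * ft g \<xi> * e' \<xi> = ?c * (LINT y|lborel. cis ((x - y) * \<xi>) * (e' \<xi> * g y))" for \<xi>
    proof -
      have "cis ((x - y) * \<xi>) * (e' \<xi> * g y) = (cis (x * \<xi>) * e' \<xi>) * (cis (- (y * \<xi>)) * g y)" for y
      proof -
        have "cis ((x - y) * \<xi>) = cis (x * \<xi>) * cis (- (y * \<xi>))"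
          by (simp add: cis_mult left_diff_distrib)
        then show ?thesis by (simp only: mult_ac)
      qed
      then have "(LINT y|lborel. cis ((x - y) * \<xi>) * (e' \<xi> * g y))
          = (cis (x * \<xi>) * e' \<xi>) * (LINT y|lborel. cis (- (y * \<xi>)) * g y)"
        by (simp only: integral_mult_right_zero)
      then show ?thesis
        by (simp only: ft_def mult_ac)
    qed
    then have "(LINT \<xi>|lborel. cis (x * \<xi>) * ft g \<xi> * e' \<xi>) = ?c * (LINT \<xi>|lborel. LINT y|lborel. cis ((x - y) * \<xi>) * (e' \<xi> * g y))"
      by (simp only: integral_mult_right_zero)
    also have "(LINT \<xi>|lborel. LINT y|lborel. cis ((x - y) * \<xi>) * (e' \<xi> * g y))
        = (LINT y|lborel. LINT \<xi>|lborel. cis ((x - y) * \<xi>) * (e' \<xi> * g y))"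
      by (rule Fubini_bounded_kernel(2)[OF e'_int g, where K = 1]) auto
    also have "\<dots> = (LINT y|lborel. complex_of_real (sqrt (2 * pi) / \<epsilon> * exp (- ((x - y) / \<epsilon>)\<^sup>2 / 2)) * g y)"
      using integral_cis_gauss[OF e, of "x - _"] by (simp add: e'_def mult.assoc[symmetric])
    \<comment> \<open>The substitution y = x + \<epsilon> s replaces the kernel of width \<epsilon>
      by a fixed density and shifts of g.\<close>
    also have "\<dots> = \<epsilon> *\<^sub>R (LINT s|lborel. complex_of_real (sqrt (2 * pi) / \<epsilon> * exp (- ((x - (x + \<epsilon> * s)) / \<epsilon>)\<^sup>2 / 2)) * g (x + \<epsilon> * s))"
      using lborel_integral_real_affine[of \<epsilon> "\<lambda>y. complex_of_real (sqrt (2 * pi) / \<epsilon> * exp (- ((x - y) / \<epsilon>)\<^sup>2 / 2)) * g y" x] e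
      by simp
    also have "\<dots> = (LINT s|lborel. \<epsilon> *\<^sub>R (complex_of_real (sqrt (2 * pi) / \<epsilon> * exp (- ((x - (x + \<epsilon> * s)) / \<epsilon>)\<^sup>2 / 2)) * g (x + \<epsilon> * s)))"
      by (rule integral_scaleR_right[symmetric])
    also have "\<dots> = (LINT s|lborel. complex_of_real (2 * pi) * (complex_of_real (std_normal_density s) * g (x + \<epsilon> * s)))"
    proof (rule Bochner_Integration.integral_cong[OF refl])
      fix s
      define r where "r = complex_of_real (sqrt (2 * pi))"
      have r: "r \<noteq> 0" "complex_of_real (2 * pi) = r * r"
        unfolding r_def of_real_mult[symmetric] by simp_all
      have n: "complex_of_real (std_normal_density s) = complex_of_real (exp (- s\<^sup>2 / 2)) / r"
        by (simp add: normal_density_def r_def)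
      have "\<epsilon> *\<^sub>R (complex_of_real (sqrt (2 * pi) / \<epsilon> * exp (- ((x - (x + \<epsilon> * s)) / \<epsilon>)\<^sup>2 / 2)) * g (x + \<epsilon> * s))
        = r * complex_of_real (exp (- s\<^sup>2 / 2)) * g (x + \<epsilon> * s)"
        using e by (simp add: scaleR_conv_of_real r_def)
      then show "\<epsilon> *\<^sub>R (complex_of_real (sqrt (2 * pi) / \<epsilon> * exp (- ((x - (x + \<epsilon> * s)) / \<epsilon>)\<^sup>2 / 2)) * g (x + \<epsilon> * s))
        = complex_of_real (2 * pi) * (complex_of_real (std_normal_density s) * g (x + \<epsilon> * s))"
        unfolding n r(2) using r(1) by simp
    qed
    also have "\<dots> = complex_of_real (2 * pi) * (LINT s|lborel. complex_of_real (std_normal_density s) * g (x + \<epsilon> * s))"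
      by simp
    also have "?c * \<dots> = complex_of_real (sqrt (2 * pi)) * (LINT s|lborel. complex_of_real (std_normal_density s) * g (x + \<epsilon> * s))"
      unfolding mult.assoc[symmetric] of_real_mult[symmetric] by (simp add: real_div_sqrt)
    finally show ?thesis .
  qed
  have "(LINT \<xi>|lborel. cnj (ft f \<xi>) * ft g \<xi> * e' \<xi>)
      = ?c * (LINT \<xi>|lborel. LINT x|lborel. (cis (x * \<xi>) * ft g \<xi>) * (e' \<xi> * cnj (f x)))"
    unfolding integral_mult_right_zero[symmetric]
  proof (rule Bochner_Integration.integral_cong[OF refl])
    fix \<xi>
    have "cnj (ft f \<xi>) = ?c * (LINT x|lborel. cis (x * \<xi>) * cnj (f x))"
      unfolding ft_def complex_cnj_mult Bochner_Integration.integral_cnj[symmetric] by (simp add: cis_cnj)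
    then have "cnj (ft f \<xi>) * ft g \<xi> * e' \<xi> = ?c * ((ft g \<xi> * e' \<xi>) * (LINT x|lborel. cis (x * \<xi>) * cnj (f x)))"
      by (simp add: mult_ac)
    also have "\<dots> = (LINT x|lborel. ?c * ((ft g \<xi> * e' \<xi>) * (cis (x * \<xi>) * cnj (f x))))"
      by (simp only: integral_mult_right_zero)
    also have "\<dots> = (LINT x|lborel. ?c * ((cis (x * \<xi>) * ft g \<xi>) * (e' \<xi> * cnj (f x))))"
      by (simp only: mult_ac)
    finally show "cnj (ft f \<xi>) * ft g \<xi> * e' \<xi> = (LINT x|lborel. ?c * ((cis (x * \<xi>) * ft g \<xi>) * (e' \<xi> * cnj (f x))))" .
  qed
  also have "(LINT \<xi>|lborel. LINT x|lborel. (cis (x * \<xi>) * ft g \<xi>) * (e' \<xi> * cnj (f x)))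
      = (LINT x|lborel. LINT \<xi>|lborel. (cis (x * \<xi>) * ft g \<xi>) * (e' \<xi> * cnj (f x)))"
    by (rule Fubini_bounded_kernel(2)[OF e'_int f', where K = ?L]) (auto simp: norm_mult intro: ft_bound)
  also have "\<dots> = (LINT x|lborel. cnj (f x) * (LINT \<xi>|lborel. cis (x * \<xi>) * ft g \<xi> * e' \<xi>))"
    unfolding integral_mult_right_zero[symmetric] by (simp only: mult_ac)
  also have "\<dots> = (LINT x|lborel. complex_of_real (sqrt (2 * pi)) * (cnj (f x) * (LINT s|lborel. complex_of_real (std_normal_density s) * g (x + \<epsilon> * s))))"
    unfolding inner by (simp only: mult.left_commute)
  also have "?c * \<dots> = (LINT x|lborel. cnj (f x) * (LINT s|lborel. complex_of_real (std_normal_density s) * g (x + \<epsilon> * s)))"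
    by (simp only: integral_mult_right_zero) simp
  finally show ?thesis by (simp add: e'_def)
qed

lemma norm_integral_le_nn_integral:
  fixes f :: "'a \<Rightarrow> complex"
  shows "ennreal (cmod (integral\<^sup>L M f)) \<le> (\<integral>\<^sup>+x. ennreal (cmod (f x)) \<partial>M)"
  by (cases "integrable M f") (auto simp: integral_norm_bound_ennreal not_integrable_integral_eq)

text \<open>Take g = f in the regularised identity. The arithmetic mean of squares and translation
  invariance bound the right side by the square norm of f for every \<epsilon>, and Fatou's lemma
  removes the Gaussian. Integrals with values in \<open>ennreal\<close> are used since finiteness of
  the left side is part of the claim.\<close>

lemma ft_contraction_nn:
  assumes f: "integrable lborel f" "square_integrable f"
  shows "(\<integral>\<^sup>+\<xi>. ennreal ((cmod (ft f \<xi>))\<^sup>2) \<partial>lborel) \<le> (\<integral>\<^sup>+x. ennreal ((cmod (f x))\<^sup>2) \<partial>lborel)"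
proof -
  have [measurable]: "f \<in> borel_measurable borel" using f by auto
  define I where "I = (\<integral>\<^sup>+x. ennreal ((cmod (f x))\<^sup>2) \<partial>lborel)"
  define e where "e n = inverse (real (Suc n))" for n
  have e0: "e n > 0" for n by (simp add: e_def)
  let ?F = "\<lambda>n \<xi>. (cmod (ft f \<xi>))\<^sup>2 * exp (- (e n * \<xi>)\<^sup>2 / 2)"
  have bound: "(\<integral>\<^sup>+\<xi>. ennreal (?F n \<xi>) \<partial>lborel) \<le> I" for n
  proof -
    have int: "integrable lborel (?F n)"
    proof (rule Bochner_Integration.integrable_bound)
      show "integrable lborel (\<lambda>\<xi>. ((LINT x|lborel. cmod (f x)) / sqrt (2 * pi))\<^sup>2 * exp (- (e n * \<xi>)\<^sup>2 / 2))"
        using integrable_gauss[OF e0] by simp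
      show "AE \<xi> in lborel. norm (?F n \<xi>) \<le> norm (((LINT x|lborel. cmod (f x)) / sqrt (2 * pi))\<^sup>2 * exp (- (e n * \<xi>)\<^sup>2 / 2))"
        by (auto simp: abs_mult intro!: mult_right_mono power_mono ft_bound)
    qed measurable
    have "(\<lambda>\<xi>. cnj (ft f \<xi>) * ft f \<xi> * complex_of_real (exp (- (e n * \<xi>)\<^sup>2 / 2))) = (\<lambda>\<xi>. complex_of_real (?F n \<xi>))"
      by (simp add: complex_mult_cnj_cmod')
    then have "(LINT \<xi>|lborel. ?F n \<xi>) = cmod (LINT \<xi>|lborel. cnj (ft f \<xi>) * ft f \<xi> * complex_of_real (exp (- (e n * \<xi>)\<^sup>2 / 2)))"
      by (simp del: of_real_mult of_real_power)
    also have "\<dots> = cmod (LINT x|lborel. cnj (f x) * (LINT s|lborel. complex_of_real (std_normal_density s) * f (x + e n * s)))"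
      by (simp only: ft_gauss_product[OF f(1) f(1) e0])
    finally have "(\<integral>\<^sup>+\<xi>. ennreal (?F n \<xi>) \<partial>lborel)
        = ennreal (cmod (LINT x|lborel. cnj (f x) * (LINT s|lborel. complex_of_real (std_normal_density s) * f (x + e n * s))))"
      by (subst nn_integral_eq_integral[OF int]) auto
    also have "\<dots> \<le> (\<integral>\<^sup>+x. ennreal (cmod (cnj (f x) * (LINT s|lborel. complex_of_real (std_normal_density s) * f (x + e n * s)))) \<partial>lborel)"
      by (rule norm_integral_le_nn_integral)
    also have "\<dots> \<le> (\<integral>\<^sup>+x. \<integral>\<^sup>+s. ennreal (std_normal_density s) * ennreal (cmod (f x) * cmod (f (x + e n * s))) \<partial>lborel \<partial>lborel)"
    proof (rule nn_integral_mono)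
      fix x
      have "ennreal (cmod (cnj (f x) * (LINT s|lborel. complex_of_real (std_normal_density s) * f (x + e n * s))))
          = ennreal (cmod (f x)) * ennreal (cmod (LINT s|lborel. complex_of_real (std_normal_density s) * f (x + e n * s)))"
        by (simp add: norm_mult ennreal_mult)
      also have "\<dots> \<le> ennreal (cmod (f x)) * (\<integral>\<^sup>+s. ennreal (cmod (complex_of_real (std_normal_density s) * f (x + e n * s))) \<partial>lborel)"
        by (intro mult_left_mono norm_integral_le_nn_integral) auto
      also have "\<dots> = (\<integral>\<^sup>+s. ennreal (cmod (f x)) * ennreal (cmod (complex_of_real (std_normal_density s) * f (x + e n * s))) \<partial>lborel)"
        by (rule nn_integral_cmult[symmetric]) measurable
      also have "\<dots> = (\<integral>\<^sup>+s. ennreal (std_normal_density s) * ennreal (cmod (f x) * cmod (f (x + e n * s))) \<partial>lborel)"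
        by (rule nn_integral_cong) (simp add: norm_mult ennreal_mult mult_ac)
      finally show "ennreal (cmod (cnj (f x) * (LINT s|lborel. complex_of_real (std_normal_density s) * f (x + e n * s))))
          \<le> (\<integral>\<^sup>+s. ennreal (std_normal_density s) * ennreal (cmod (f x) * cmod (f (x + e n * s))) \<partial>lborel)" .
    qed
    also have "\<dots> = (\<integral>\<^sup>+s. \<integral>\<^sup>+x. ennreal (std_normal_density s) * ennreal (cmod (f x) * cmod (f (x + e n * s))) \<partial>lborel \<partial>lborel)"
      by (rule lborel_pair.Fubini') measurable
    also have "\<dots> \<le> (\<integral>\<^sup>+s. ennreal (std_normal_density s) * I \<partial>lborel)"
    proof (rule nn_integral_mono)
      fix s
      have "(\<integral>\<^sup>+x. ennreal (cmod (f x) * cmod (f (x + e n * s))) \<partial>lborel)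
          \<le> (\<integral>\<^sup>+x. ennreal (1/2) * ennreal ((cmod (f x))\<^sup>2) + ennreal (1/2) * ennreal ((cmod (f (x + e n * s)))\<^sup>2) \<partial>lborel)"
      proof (rule nn_integral_mono)
        fix x
        have "cmod (f x) * cmod (f (x + e n * s)) \<le> 1/2 * (cmod (f x))\<^sup>2 + 1/2 * (cmod (f (x + e n * s)))\<^sup>2"
          using sum_squares_bound[of "cmod (f x)" "cmod (f (x + e n * s))"] by simp
        then show "ennreal (cmod (f x) * cmod (f (x + e n * s)))
            \<le> ennreal (1/2) * ennreal ((cmod (f x))\<^sup>2) + ennreal (1/2) * ennreal ((cmod (f (x + e n * s)))\<^sup>2)"
          by (subst (1 2) ennreal_mult[symmetric]) (auto simp: ennreal_leI simp flip: ennreal_plus)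
      qed
      also have "\<dots> = ennreal (1/2) * I + ennreal (1/2) * (\<integral>\<^sup>+x. ennreal ((cmod (f (x + e n * s)))\<^sup>2) \<partial>lborel)"
        unfolding I_def by (simp add: nn_integral_add nn_integral_cmult)
      also have "(\<integral>\<^sup>+x. ennreal ((cmod (f (x + e n * s)))\<^sup>2) \<partial>lborel) = I"
        unfolding I_def using nn_integral_real_affine[of "\<lambda>x. ennreal ((cmod (f x))\<^sup>2)" 1 "e n * s"]
        by (simp add: add.commute)
      also have "ennreal (1/2) * I + ennreal (1/2) * I = I"
      proof -
        have "ennreal (1/2) + ennreal (1/2) = 1" by (subst ennreal_plus[symmetric]) auto
        then show ?thesis by (metis distrib_right mult_1)
      qed
      finally show "(\<integral>\<^sup>+x. ennreal (std_normal_density s) * ennreal (cmod (f x) * cmod (f (x + e n * s))) \<partial>lborel)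
          \<le> ennreal (std_normal_density s) * I"
        by (subst nn_integral_cmult) (auto intro!: mult_left_mono)
    qed
    also have "\<dots> = (\<integral>\<^sup>+s. ennreal (std_normal_density s) \<partial>lborel) * I"
      by (rule nn_integral_multc) measurable
    also have "(\<integral>\<^sup>+s. ennreal (std_normal_density s) \<partial>lborel) = 1"
      by (subst nn_integral_eq_integral) auto
    finally show ?thesis by simp
  qed
  have "e \<longlonglongrightarrow> 0"
    unfolding e_def by (rule LIMSEQ_inverse_real_of_nat)
  then have lim: "(\<lambda>n. ennreal (?F n \<xi>)) \<longlonglongrightarrow> ennreal ((cmod (ft f \<xi>))\<^sup>2 * exp (- (0 * \<xi>)\<^sup>2 / 2))" for \<xi>
    by (intro tendsto_intros) auto
  have "(\<integral>\<^sup>+\<xi>. ennreal ((cmod (ft f \<xi>))\<^sup>2) \<partial>lborel) = (\<integral>\<^sup>+\<xi>. liminf (\<lambda>n. ennreal (?F n \<xi>)) \<partial>lborel)"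
    using lim_imp_Liminf[OF sequentially_bot lim] by simp
  also have "\<dots> \<le> liminf (\<lambda>n. \<integral>\<^sup>+\<xi>. ennreal (?F n \<xi>) \<partial>lborel)"
    by (rule nn_integral_liminf) measurable
  also have "\<dots> \<le> I"
    by (rule Liminf_le, simp, intro always_eventually allI bound)
  finally show ?thesis by (simp add: I_def)
qed

lemma square_integrable_ft:
  assumes f: "integrable lborel f" "square_integrable f"
  shows "square_integrable (ft f)" and "norm (abs_L2 (ft f)) \<le> norm (abs_L2 f)"
proof -
  have [measurable]: "f \<in> borel_measurable borel" using f by auto
  have eq: "(\<integral>\<^sup>+x. ennreal ((cmod (f x))\<^sup>2) \<partial>lborel) = ennreal (LINT x|lborel. (cmod (f x))\<^sup>2)"
    using f(2) by (intro nn_integral_eq_integral) (auto simp: square_integrable_def)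
  note le = ft_contraction_nn[OF f, unfolded eq]
  have "integrable lborel (\<lambda>\<xi>. (cmod (ft f \<xi>))\<^sup>2)"
    using le by (intro integrableI_bounded) (auto simp: le_less_trans)
  then show si: "square_integrable (ft f)"
    by (simp add: square_integrable_def)
  have "(norm (abs_L2 (ft f)))\<^sup>2 \<le> (norm (abs_L2 f))\<^sup>2"
    using le \<open>integrable lborel (\<lambda>\<xi>. (cmod (ft f \<xi>))\<^sup>2)\<close>
    by (simp add: nn_integral_eq_integral norm_abs_L2 si f)
  then show "norm (abs_L2 (ft f)) \<le> norm (abs_L2 f)"
    by (simp add: power_mono_iff)
qed

text \<open>For an indicator the Gaussian averages are bounded by 1 and converge off the two end
  points, so both sides of the regularised identity pass to the limit. Indicators are total, so this
  case suffices for the isometry.\<close>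

lemma ft_indicator_parseval:
  assumes f: "integrable lborel f" "square_integrable f" and ab: "a < b"
  shows "(LINT \<xi>|lborel. cnj (ft f \<xi>) * ft (indicator {a<..b}) \<xi>) = (LINT x|lborel. cnj (f x) * indicator {a<..b} x)"
proof -
  have [measurable]: "f \<in> borel_measurable borel" using f by auto
  let ?g = "indicator {a<..b} :: real \<Rightarrow> complex"
  have g: "square_integrable ?g" by (rule square_integrable_indicator_Ioc)
  have g1: "integrable lborel ?g"
    by (rule integrable_compact_square_integrable[OF g, of "max \<bar>a\<bar> \<bar>b\<bar>"]) (auto simp: indicator_def)
  define e where "e n = inverse (real (Suc n))" for n
  have e0: "e n > 0" for n by (simp add: e_def)
  have elim: "e \<longlonglongrightarrow> 0"
    unfolding e_def by (rule LIMSEQ_inverse_real_of_nat)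
  let ?m = "\<lambda>n x. LINT s|lborel. complex_of_real (std_normal_density s) * ?g (x + e n * s)"
  have lhs: "(\<lambda>n. LINT \<xi>|lborel. cnj (ft f \<xi>) * ft ?g \<xi> * complex_of_real (exp (- (e n * \<xi>)\<^sup>2 / 2)))
      \<longlonglongrightarrow> (LINT \<xi>|lborel. cnj (ft f \<xi>) * ft ?g \<xi>)"
  proof (rule integral_dominated_convergence[where w = "\<lambda>\<xi>. cmod (cnj (ft f \<xi>) * ft ?g \<xi>)"])
    show "integrable lborel (\<lambda>\<xi>. cmod (cnj (ft f \<xi>) * ft ?g \<xi>))"
      by (intro integrable_norm square_integrable_product square_integrable_ft f g g1)
    show "AE \<xi> in lborel. (\<lambda>n. cnj (ft f \<xi>) * ft ?g \<xi> * complex_of_real (exp (- (e n * \<xi>)\<^sup>2 / 2))) \<longlonglongrightarrow> cnj (ft f \<xi>) * ft ?g \<xi>"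
    proof (rule AE_I2)
      fix \<xi>
      have "(\<lambda>n. cnj (ft f \<xi>) * ft ?g \<xi> * complex_of_real (exp (- (e n * \<xi>)\<^sup>2 / 2))) \<longlonglongrightarrow> cnj (ft f \<xi>) * ft ?g \<xi> * complex_of_real (exp (- (0 * \<xi>)\<^sup>2 / 2))"
        by (intro tendsto_intros elim) auto
      then show "(\<lambda>n. cnj (ft f \<xi>) * ft ?g \<xi> * complex_of_real (exp (- (e n * \<xi>)\<^sup>2 / 2))) \<longlonglongrightarrow> cnj (ft f \<xi>) * ft ?g \<xi>"
        by simp
    qed
    show "AE \<xi> in lborel. norm (cnj (ft f \<xi>) * ft ?g \<xi> * complex_of_real (exp (- (e n * \<xi>)\<^sup>2 / 2))) \<le> cmod (cnj (ft f \<xi>) * ft ?g \<xi>)" for n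
      by (intro AE_I2) (auto simp: norm_mult intro!: mult_left_le)
  qed measurable
  have dens: "integrable lborel (\<lambda>s. complex_of_real (std_normal_density s))"
    by simp
  have m_lim: "(\<lambda>n. ?m n x) \<longlonglongrightarrow> ?g x" if x: "x \<noteq> a" "x \<noteq> b" for x
  proof -
    have "(\<lambda>n. ?m n x) \<longlonglongrightarrow> (LINT s|lborel. complex_of_real (std_normal_density s) * ?g x)"
    proof (rule integral_dominated_convergence[where w = "\<lambda>s. std_normal_density s"])
      show "AE s in lborel. (\<lambda>n. complex_of_real (std_normal_density s) * ?g (x + e n * s)) \<longlonglongrightarrow> complex_of_real (std_normal_density s) * ?g x"
      proof (rule AE_I2, rule tendsto_mult[OF tendsto_const])
        fix s
        have l: "(\<lambda>n. x + e n * s) \<longlonglongrightarrow> x + 0 * s"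
          by (intro tendsto_intros elim)
        have "eventually (\<lambda>n. ?g (x + e n * s) = ?g x) sequentially"
        proof (cases "a < x \<and> x < b")
          case True
          then have "eventually (\<lambda>n. x + e n * s \<in> {a<..<b}) sequentially"
            using l by (intro topological_tendstoD[OF l]) auto
          then show ?thesis by eventually_elim (use True in \<open>auto simp: indicator_def\<close>)
        next
          case False
          then have "eventually (\<lambda>n. x + e n * s \<in> - {a..b}) sequentially"
            using x by (intro topological_tendstoD[OF l]) auto
          then show ?thesis by eventually_elim (use False x in \<open>auto simp: indicator_def\<close>)
        qed
        then show "(\<lambda>n. ?g (x + e n * s)) \<longlonglongrightarrow> ?g x"
          by (rule tendsto_eventually)
      qed
      show "AE s in lborel. norm (complex_of_real (std_normal_density s) * ?g (x + e n * s)) \<le> std_normal_density s" for n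
        by (intro AE_I2) (auto simp: norm_mult indicator_def)
    qed auto
    also have "(LINT s|lborel. complex_of_real (std_normal_density s) * ?g x) = (LINT s|lborel. complex_of_real (std_normal_density s)) * ?g x"
      using dens by simp
    also have "(LINT s|lborel. complex_of_real (std_normal_density s)) = 1"
      by (subst integral_complex_of_real) simp
    finally show ?thesis by simp
  qed
  have m_bd: "cmod (?m n x) \<le> 1" for n x
  proof -
    have int: "integrable lborel (\<lambda>s. complex_of_real (std_normal_density s) * ?g (x + e n * s))"
      using integrable_mult_bounded[OF dens, of "\<lambda>s. ?g (x + e n * s)" 1] by (simp add: mult.commute norm_indicator_le)
    have "cmod (?m n x) \<le> (LINT s|lborel. cmod (complex_of_real (std_normal_density s) * ?g (x + e n * s)))"
      by (rule integral_norm_bound)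
    also have "\<dots> \<le> (LINT s|lborel. std_normal_density s)"
      by (intro integral_mono integrable_norm int) (auto simp: norm_mult indicator_def)
    finally have "cmod (?m n x) \<le> (LINT s|lborel. std_normal_density s)" .
    then show ?thesis by simp
  qed
  have rhs: "(\<lambda>n. LINT x|lborel. cnj (f x) * ?m n x) \<longlonglongrightarrow> (LINT x|lborel. cnj (f x) * ?g x)"
  proof (rule integral_dominated_convergence[where w = "\<lambda>x. cmod (f x)"])
    have "AE x in lborel. x \<noteq> a" "AE x in lborel. x \<noteq> b"
      by (rule AE_lborel_singleton)+
    then show "AE x in lborel. (\<lambda>n. cnj (f x) * ?m n x) \<longlonglongrightarrow> cnj (f x) * ?g x"
      by eventually_elim (intro tendsto_intros m_lim)
    show "AE x in lborel. norm (cnj (f x) * ?m n x) \<le> cmod (f x)" for n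
      using m_bd by (intro AE_I2) (auto simp: norm_mult intro!: mult_left_le)
  qed (use f in auto)
  show ?thesis
    using LIMSEQ_unique[OF lhs] rhs unfolding ft_gauss_product[OF f(1) g1 e0] by blast
qed


section \<open>The Plancherel transform on L2\<close>

definition fourier_cut :: "nat \<Rightarrow> L2 \<Rightarrow> L2" where
  "fourier_cut n u = abs_L2 (ft (\<lambda>x. indicator {-real n..real n} x * rep_L2 u x))"

text \<open>The limit exists because \<open>ft\<close> does not increase the norm of differences of
  truncations.\<close>

definition fourier :: "L2 \<Rightarrow> L2" where
  "fourier u = lim (\<lambda>n. fourier_cut n u)"

text \<open>The kernel of the transform is symmetric, so conjugating the transform by complex
  conjugation yields its adjoint; that this is also the inverse is proved separately.\<close>

definition inv_fourier :: "L2 \<Rightarrow> L2" where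
  "inv_fourier u = conj_L2 (fourier (conj_L2 u))"

lemma cut_rep:
  "square_integrable (\<lambda>x. indicator {-real n..real n} x * rep_L2 u x)"
  "integrable lborel (\<lambda>x. indicator {-real n..real n} x * rep_L2 u x)"
proof -
  show *: "square_integrable (\<lambda>x. indicator {-real n..real n} x * rep_L2 u x)"
    by (intro square_integrable_mult bounded_indicator square_integrable_rep_L2) auto
  show "integrable lborel (\<lambda>x. indicator {-real n..real n} x * rep_L2 u x)"
    by (rule integrable_compact_square_integrable[OF *, of "real n"]) (auto simp: indicator_def)
qed

lemma cutoff_abs: "cutoff n u = abs_L2 (\<lambda>x. indicator {-real n..real n} x * rep_L2 u x)"
  unfolding cutoff_def by (rule L2_eqI_abs[OF cut_rep(1) rep_mult_op]) (auto simp: bounded_indicator)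

lemma fourier_cut_diff: "norm (fourier_cut m u - fourier_cut n u) \<le> norm (cutoff m u - cutoff n u)"
proof -
  let ?f = "\<lambda>n x. indicator {-real n..real n} x * rep_L2 u x"
  have "fourier_cut m u - fourier_cut n u = abs_L2 (ft (\<lambda>x. ?f m x - ?f n x))"
    unfolding fourier_cut_def
    by (subst abs_L2_diff) (auto intro!: square_integrable_ft cut_rep simp: ft_diff[OF cut_rep(2) cut_rep(2)])
  moreover have "cutoff m u - cutoff n u = abs_L2 (\<lambda>x. ?f m x - ?f n x)"
    unfolding cutoff_abs by (rule abs_L2_diff[OF cut_rep(1) cut_rep(1)])
  ultimately show ?thesis
    by (simp add: square_integrable_ft(2) square_integrable_diff cut_rep)
qed

lemma norm_fourier_cut: "norm (fourier_cut n u) \<le> norm u"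
proof -
  have "norm (fourier_cut n u) \<le> norm (cutoff n u)"
    unfolding fourier_cut_def cutoff_abs by (intro square_integrable_ft(2) cut_rep)
  also have "\<dots> \<le> 1 * norm u"
    unfolding cutoff_def by (rule norm_mult_op_le) (auto simp: norm_indicator_le)
  finally show ?thesis by simp
qed

lemma fourier_cut_tendsto: "(\<lambda>n. fourier_cut n u) \<longlonglongrightarrow> fourier u"
proof -
  have "Cauchy (\<lambda>n. cutoff n u)"
    using cutoff_tendsto by (rule LIMSEQ_imp_Cauchy)
  then have "Cauchy (\<lambda>n. fourier_cut n u)"
    unfolding Cauchy_iff using fourier_cut_diff order_le_less_trans by meson
  then have "convergent (\<lambda>n. fourier_cut n u)"
    by (simp add: Cauchy_convergent_iff)
  then show ?thesis
    by (simp add: fourier_def convergent_LIMSEQ_iff)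
qed

lemma fourier_cut_add: "fourier_cut n (u + v) = fourier_cut n u + fourier_cut n v"
proof -
  let ?f = "\<lambda>u x. indicator {-real n..real n} x * rep_L2 u x"
  have "ft (?f (u + v)) = ft (\<lambda>x. ?f u x + ?f v x)"
    by (rule ft_cong_AE, measurable, use rep_L2_add[of u v] in \<open>eventually_elim, simp add: distrib_left\<close>)
  then show ?thesis
    unfolding fourier_cut_def
    by (subst abs_L2_add) (auto intro!: square_integrable_ft cut_rep simp: ft_add[OF cut_rep(2) cut_rep(2)])
qed

lemma fourier_cut_scaleC: "fourier_cut n (c *\<^sub>C u) = c *\<^sub>C fourier_cut n u"
proof -
  let ?f = "\<lambda>u x. indicator {-real n..real n} x * rep_L2 u x"
  have "ft (?f (c *\<^sub>C u)) = ft (\<lambda>x. c * ?f u x)"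
    by (rule ft_cong_AE, measurable, use rep_L2_scaleC[of c u] in \<open>eventually_elim, simp\<close>)
  then show ?thesis
    unfolding fourier_cut_def
    by (subst abs_L2_scaleC) (auto intro!: square_integrable_ft cut_rep simp: ft_scale)
qed

lemma norm_fourier_le: "norm (fourier u) \<le> norm u"
  by (rule LIMSEQ_le_const2[OF tendsto_norm[OF fourier_cut_tendsto]]) (use norm_fourier_cut in auto)

lemma bounded_clinear_fourier: "bounded_clinear fourier"
proof (rule bounded_clinearI[of _ 1])
  fix u v c
  have "(\<lambda>n. fourier_cut n (u + v)) \<longlonglongrightarrow> fourier u + fourier v"
    unfolding fourier_cut_add by (intro tendsto_add fourier_cut_tendsto)
  then show "fourier (u + v) = fourier u + fourier v"
    by (rule LIMSEQ_unique[OF fourier_cut_tendsto])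
  have "bounded_clinear (\<lambda>z::L2. c *\<^sub>C z)"
    by (rule bounded_clinearI[of _ "cmod c"]) (auto simp: scaleC_add_right scaleC_scaleC norm_scaleC mult.commute)
  from bounded_clinear_tendsto[OF this fourier_cut_tendsto[of u]]
  have "(\<lambda>n. fourier_cut n (c *\<^sub>C u)) \<longlonglongrightarrow> c *\<^sub>C fourier u"
    unfolding fourier_cut_scaleC .
  then show "fourier (c *\<^sub>C u) = c *\<^sub>C fourier u"
    by (rule LIMSEQ_unique[OF fourier_cut_tendsto])
qed (simp add: norm_fourier_le)

text \<open>For a function of compact support the truncations are eventually constant, so the
  integral formula needs no limit.\<close>

lemma fourier_abs_L2:
  assumes f: "square_integrable f" "\<And>x. \<bar>x\<bar> > K \<Longrightarrow> f x = 0"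
  shows "fourier (abs_L2 f) = abs_L2 (ft f)"
proof -
  have [measurable]: "f \<in> borel_measurable borel" using f(1) by (rule square_integrable_measurable)
  obtain N where N: "K \<le> real N" using real_arch_simple by blast
  have "fourier_cut n (abs_L2 f) = abs_L2 (ft f)" if "n \<ge> N" for n
  proof -
    have "AE x in lborel. indicator {-real n..real n} x * rep_L2 (abs_L2 f) x = f x"
      using rep_abs_L2[OF f(1)]
    proof eventually_elim
      case (elim x)
      show ?case
      proof (cases "\<bar>x\<bar> \<le> real n")
        case False
        then have "f x = 0" using f(2)[of x] N that by simp
        with elim show ?thesis by simp
      qed (use elim in \<open>auto simp: indicator_def abs_le_iff\<close>)
    qed
    then show ?thesis
      unfolding fourier_cut_def by (subst ft_cong_AE[of _ f]) (auto simp: square_integrable_measurable)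
  qed
  then have "(\<lambda>n. fourier_cut n (abs_L2 f)) \<longlonglongrightarrow> abs_L2 (ft f)"
    by (intro tendsto_eventually eventually_sequentiallyI[of N])
  then show ?thesis
    by (rule LIMSEQ_unique[OF fourier_cut_tendsto])
qed

lemma ft_symmetric:
  assumes f: "integrable lborel f" and g: "integrable lborel g"
  shows "(LINT x|lborel. f x * ft g x) = (LINT x|lborel. ft f x * g x)"
proof -
  let ?c = "complex_of_real (1 / sqrt (2 * pi))"
  have "(LINT x|lborel. f x * ft g x) = ?c * (LINT x|lborel. LINT y|lborel. cis (- (x * y)) * (f x * g y))"
    unfolding integral_mult_right_zero[symmetric] ft_def by (simp only: mult_ac)
  also have "(LINT x|lborel. LINT y|lborel. cis (- (x * y)) * (f x * g y)) = (LINT y|lborel. LINT x|lborel. cis (- (x * y)) * (f x * g y))"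
    by (rule Fubini_bounded_kernel(2)[OF f g, where K = 1]) auto
  also have "?c * \<dots> = (LINT x|lborel. ft f x * g x)"
    unfolding integral_mult_right_zero[symmetric] integral_mult_left_zero[symmetric] ft_def by (simp only: mult_ac)
  finally show ?thesis .
qed

text \<open>The multiplication formula \<open>ft_symmetric\<close> for truncated functions, followed
  by the limit.\<close>

lemma adjoint_fourier: "adjoint_pair fourier inv_fourier"
  unfolding adjoint_pair_def
proof (intro allI)
  fix u v
  let ?f = "\<lambda>n u x. indicator {-real n..real n} x * rep_L2 u x"
  have eq: "cinner (conj_L2 (fourier_cut n (conj_L2 u))) (cutoff n v) = cinner (conj_L2 (cutoff n (conj_L2 u))) (fourier_cut n v)" for n
  proof -
    note si = cut_rep square_integrable_ft[OF cut_rep(2) cut_rep(1)] square_integrable_cnj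
    have "cinner (conj_L2 (fourier_cut n (conj_L2 u))) (cutoff n v) = (LINT x|lborel. ft (?f n (conj_L2 u)) x * ?f n v x)"
      unfolding fourier_cut_def cutoff_abs by (simp add: conj_abs_L2 cinner_abs_L2 si)
    also have "\<dots> = (LINT x|lborel. ?f n (conj_L2 u) x * ft (?f n v) x)"
      by (rule ft_symmetric[symmetric]) (rule cut_rep)+
    also have "\<dots> = cinner (conj_L2 (cutoff n (conj_L2 u))) (fourier_cut n v)"
      unfolding fourier_cut_def cutoff_abs conj_abs_L2[OF cut_rep(1)]
      by (subst cinner_abs_L2) (auto intro: si simp del: complex_cnj_mult)
    finally show ?thesis .
  qed
  have "(\<lambda>n. cinner (conj_L2 (fourier_cut n (conj_L2 u))) (cutoff n v)) \<longlonglongrightarrow> cinner (inv_fourier u) v"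
    unfolding inv_fourier_def by (intro tendsto_cinner conj_L2_tendsto fourier_cut_tendsto cutoff_tendsto)
  moreover have "(\<lambda>n. cinner (conj_L2 (cutoff n (conj_L2 u))) (fourier_cut n v)) \<longlonglongrightarrow> cinner (conj_L2 (conj_L2 u)) (fourier v)"
    by (intro tendsto_cinner conj_L2_tendsto fourier_cut_tendsto cutoff_tendsto)
  ultimately show "cinner (inv_fourier u) v = cinner u (fourier v)"
    unfolding eq using LIMSEQ_unique by fastforce
qed

text \<open>Parseval is tested against indicators of intervals only; as these are total, it
  identifies F* F u with u.\<close>

lemma inv_fourier_fourier [simp]: "inv_fourier (fourier u) = u"
proof -
  have "inv_fourier (fourier u) - u = 0"
  proof (rule L2_indicators_total)
    fix a b :: real assume ab: "a < b"
    let ?g = "indicator {a<..b} :: real \<Rightarrow> complex" and ?f = "\<lambda>n x. indicator {-real n..real n} x * rep_L2 u x"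
    have g: "square_integrable ?g" by (rule square_integrable_indicator_Ioc)
    have g0: "?g x = 0" if "\<bar>x\<bar> > max \<bar>a\<bar> \<bar>b\<bar>" for x
      using that by (auto simp: indicator_def)
    have g1: "integrable lborel ?g"
      by (rule integrable_compact_square_integrable[OF g g0])
    have gt: "fourier (abs_L2 ?g) = abs_L2 (ft ?g)"
      by (rule fourier_abs_L2[OF g g0])
    have eq: "cinner (fourier_cut n u) (fourier (abs_L2 ?g)) = cinner (cutoff n u) (abs_L2 ?g)" for n
      unfolding gt fourier_cut_def cutoff_abs
      by (simp add: cinner_abs_L2 cut_rep square_integrable_ft g g1 ft_indicator_parseval[OF cut_rep(2) cut_rep(1) ab])
    have "(\<lambda>n. cinner (fourier_cut n u) (fourier (abs_L2 ?g))) \<longlonglongrightarrow> cinner (fourier u) (fourier (abs_L2 ?g))"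
      by (intro tendsto_intros fourier_cut_tendsto)
    moreover have "(\<lambda>n. cinner (cutoff n u) (abs_L2 ?g)) \<longlonglongrightarrow> cinner u (abs_L2 ?g)"
      by (intro tendsto_intros cutoff_tendsto)
    ultimately have "cinner (fourier u) (fourier (abs_L2 ?g)) = cinner u (abs_L2 ?g)"
      unfolding eq by (rule LIMSEQ_unique)
    then show "cinner (inv_fourier (fourier u) - u) (abs_L2 ?g) = 0"
      using adjoint_fourier by (simp add: cinner_diff_left adjoint_pair_def)
  qed
  then show ?thesis by simp
qed

text \<open>Surjectivity: \<open>inv_fourier\<close> is \<open>fourier\<close> conjugated by the
  involution \<open>conj_L2\<close>, so conjugating the left inverse identity gives the right
  inverse identity.\<close>

lemma fourier_inv_fourier [simp]: "fourier (inv_fourier u) = u"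
proof -
  have "conj_L2 (fourier (inv_fourier u)) = inv_fourier (fourier (conj_L2 u))"
    by (simp add: inv_fourier_def)
  then have "conj_L2 (conj_L2 (fourier (inv_fourier u))) = conj_L2 (conj_L2 u)"
    by simp
  then show ?thesis by (simp only: conj_conj_L2)
qed

lemma cinner_fourier [simp]: "cinner (fourier u) (fourier v) = cinner u v"
proof -
  have "cinner (fourier u) (fourier v) = cinner (inv_fourier (fourier u)) v"
    using adjoint_fourier by (simp only: adjoint_pair_def)
  then show ?thesis by simp
qed

lemma norm_fourier [simp]: "norm (fourier u) = norm u"
proof -
  have "(norm (fourier u))\<^sup>2 = (norm u)\<^sup>2"
    using cinner_fourier[of u u] by (simp only: cinner_self of_real_eq_iff)
  then show ?thesis by (simp add: power2_eq_iff_nonneg)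
qed

lemma norm_inv_fourier [simp]: "norm (inv_fourier u) = norm u"
  using norm_fourier[of "inv_fourier u"] by simp

lemma bounded_clinear_inv_fourier: "bounded_clinear inv_fourier"
proof (rule bounded_clinearI[of _ 1])
  note lin = bounded_clinearD[OF bounded_clinear_fourier]
  show "inv_fourier (u + v) = inv_fourier u + inv_fourier v" for u v
    by (simp add: inv_fourier_def conj_L2_add lin)
  show "inv_fourier (c *\<^sub>C u) = c *\<^sub>C inv_fourier u" for c u
    by (simp add: inv_fourier_def conj_L2_scaleC lin)
qed simp

lemma inv_fourier_abs_L2:
  assumes f: "square_integrable f" "\<And>x. \<bar>x\<bar> > K \<Longrightarrow> f x = 0"
  shows "inv_fourier (abs_L2 f) = abs_L2 (\<lambda>x. ft f (- x))"
proof -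
  have [measurable]: "f \<in> borel_measurable borel" using f(1) by (rule square_integrable_measurable)
  have c: "square_integrable (\<lambda>x. cnj (f x))" "\<And>x. \<bar>x\<bar> > K \<Longrightarrow> cnj (f x) = 0"
    using f by (auto intro: square_integrable_cnj)
  have ci: "integrable lborel (\<lambda>x. cnj (f x))"
    by (rule integrable_compact_square_integrable[OF c])
  have "cnj (ft (\<lambda>x. cnj (f x)) x) = ft f (- x)" for x
    unfolding ft_def complex_cnj_mult Bochner_Integration.integral_cnj[symmetric] by (simp add: cis_cnj)
  then have "conj_L2 (abs_L2 (ft (\<lambda>x. cnj (f x)))) = abs_L2 (\<lambda>x. ft f (- x))"
    using conj_abs_L2[OF square_integrable_ft(1)[OF ci c(1)]] by simp
  then show ?thesis
    by (simp only: inv_fourier_def conj_abs_L2[OF f(1)] fourier_abs_L2[OF c])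
qed

lemma scaleC_diff_left: "(a - b) *\<^sub>C x = a *\<^sub>C x - b *\<^sub>C x" for x :: "'a::complex_inner"
proof -
  have "(a - b) *\<^sub>C x + b *\<^sub>C x = a *\<^sub>C x"
    by (simp flip: scaleC_add_left)
  then show ?thesis by (simp add: eq_diff_eq)
qed

section \<open>Uniqueness of the spectral measure\<close>

lemma projection_measureD:
  assumes "projection_measure E" "B \<in> sets borel"
  shows "bounded_clinear (E B)" "E B (E B x) = E B x" "cinner (E B x) y = cinner x (E B y)"
  using assms unfolding projection_measure_def by (auto simp: fun_eq_iff)

lemma projection_measure_UNIV: "projection_measure E \<Longrightarrow> E UNIV x = x"
  by (simp add: projection_measure_def)

lemma projection_measure_sums:
  assumes "projection_measure E" "range B \<subseteq> sets borel" "disjoint_family (B :: nat \<Rightarrow> real set)"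
  shows "(\<lambda>n. E (B n) x) sums E (\<Union>n. B n) x"
  using assms unfolding projection_measure_def by blast

lemma projection_measure_empty:
  assumes "projection_measure E"
  shows "E {} x = 0"
proof -
  have "(\<lambda>n::nat. E {} x) sums E (\<Union>n::nat. {}) x"
    by (rule projection_measure_sums[OF assms]) (auto simp: disjoint_family_on_def)
  then have "(\<lambda>n::nat. E {} x) \<longlonglongrightarrow> 0"
    by (intro summable_LIMSEQ_zero sums_summable)
  then show ?thesis by (simp add: LIMSEQ_const_iff)
qed

lemma projection_measure_Un:
  assumes E: "projection_measure E" and "A \<in> sets borel" "B \<in> sets borel" "A \<inter> B = {}"
  shows "E (A \<union> B) x = E A x + E B x"
proof -
  have "(\<lambda>n. E (binaryset A B n) x) sums E (\<Union>n. binaryset A B n) x"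
    by (rule projection_measure_sums[OF E])
       (use assms in \<open>auto simp: range_binaryset_eq disjoint_family_on_def binaryset_def\<close>)
  moreover have "(\<lambda>n. E (binaryset A B n) x) sums (E A x + E B x)"
    by (rule binaryset_sums) (rule projection_measure_empty[OF E])
  ultimately show ?thesis
    using sums_unique2 by (fastforce simp: UN_binaryset_eq)
qed

lemma projection_measure_cinner:
  assumes "projection_measure E" "B \<in> sets borel"
  shows "cinner (E B x) (E B y) = cinner x (E B y)" and "cinner x (E B x) = complex_of_real ((norm (E B x))\<^sup>2)"
proof -
  show *: "cinner (E B x) (E B y) = cinner x (E B y)" for x y
    by (simp add: projection_measureD[OF assms])
  show "cinner x (E B x) = complex_of_real ((norm (E B x))\<^sup>2)"
    using *[of x x] by (simp add: cinner_self)
qed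

lemma projection_measure_norm_le:
  assumes "projection_measure E" "B \<in> sets borel"
  shows "norm (E B x) \<le> norm x"
proof (cases "norm (E B x) = 0")
  case False
  have "(norm (E B x))\<^sup>2 = cmod (cinner x (E B x))"
    unfolding projection_measure_cinner(2)[OF assms] by (simp add: norm_power)
  also have "\<dots> \<le> norm x * norm (E B x)" by (rule cinner_Cauchy_Schwarz)
  finally show ?thesis
    using False by (simp add: power2_eq_square)
qed simp

text \<open>For y = E(B) x additivity gives ||E(A u B) y||^2 = ||E(A) y||^2 + ||y||^2, while E(A u
  B) is a contraction.\<close>

lemma projection_measure_disjoint:
  assumes E: "projection_measure E" and AB: "A \<in> sets borel" "B \<in> sets borel" "A \<inter> B = {}"
  shows "E A (E B x) = 0"
proof -
  let ?y = "E B x"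
  have "complex_of_real ((norm (E (A \<union> B) ?y))\<^sup>2) = cinner ?y (E (A \<union> B) ?y)"
    using AB by (intro projection_measure_cinner(2)[OF E, symmetric]) auto
  also have "\<dots> = cinner ?y (E A ?y) + cinner ?y (E B ?y)"
    unfolding projection_measure_Un[OF E AB] by (rule cinner_add_right)
  also have "\<dots> = complex_of_real ((norm (E A ?y))\<^sup>2 + (norm ?y)\<^sup>2)"
    unfolding projection_measure_cinner(2)[OF E AB(1)] projection_measure_cinner(2)[OF E AB(2)]
    by (simp add: projection_measureD[OF E AB(2)])
  finally have "(norm (E (A \<union> B) ?y))\<^sup>2 = (norm (E A ?y))\<^sup>2 + (norm ?y)\<^sup>2"
    by (simp only: of_real_eq_iff)
  moreover have "(norm (E (A \<union> B) ?y))\<^sup>2 \<le> (norm ?y)\<^sup>2"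
    using AB by (intro power_mono projection_measure_norm_le[OF E]) auto
  ultimately show ?thesis by simp
qed

text \<open>Multiplicativity is no axiom of \<open>projection_measure\<close>; it follows from the
  orthogonality of disjoint pieces.\<close>

lemma projection_measure_Int:
  assumes E: "projection_measure E" and AB: "A \<in> sets borel" "B \<in> sets borel"
  shows "E A (E B x) = E (A \<inter> B) x"
proof -
  have m: "A \<inter> B \<in> sets borel" "A - B \<in> sets borel" "B - A \<in> sets borel" using AB by auto
  have A: "E A y = E (A \<inter> B) y + E (A - B) y" for y
    using projection_measure_Un[OF E m(1,2)] by (auto simp: Int_Diff_Un Int_Diff_disjoint)
  have B: "E B x = E (A \<inter> B) x + E (B - A) x"
  proof -
    have "(A \<inter> B) \<union> (B - A) = B" "(A \<inter> B) \<inter> (B - A) = {}" by auto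
    then show ?thesis using projection_measure_Un[OF E m(1,3), of x] by simp
  qed
  have "E A (E B x) = E (A \<inter> B) (E B x)"
    using A[of "E B x"] projection_measure_disjoint[OF E m(2) AB(2)] by auto
  also have "\<dots> = E (A \<inter> B) (E (A \<inter> B) x) + E (A \<inter> B) (E (B - A) x)"
    unfolding B by (rule bounded_clinearD(1)[OF projection_measureD(1)[OF E m(1)]])
  also have "\<dots> = E (A \<inter> B) x"
    using projection_measure_disjoint[OF E m(1,3)] projection_measureD(2)[OF E m(1)] by auto
  finally show ?thesis .
qed

lemma scalar_measure:
  assumes E: "projection_measure E"
  shows "sets (scalar_measure E x) = sets borel" and "space (scalar_measure E x) = UNIV"
    and "B \<in> sets borel \<Longrightarrow> emeasure (scalar_measure E x) B = ennreal ((norm (E B x))\<^sup>2)"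
    and "finite_measure (scalar_measure E x)"
proof -
  have sa: "sigma_algebra UNIV (sets (borel :: real measure))"
    using sets.sigma_algebra_axioms[of "borel :: real measure"] by simp
  show s: "sets (scalar_measure E x) = sets borel" and sp: "space (scalar_measure E x) = UNIV"
    unfolding scalar_measure_def
    using sigma_algebra.sets_measure_of_eq[OF sa] by (auto simp: space_measure_of_conv)
  show em: "emeasure (scalar_measure E x) B = ennreal ((norm (E B x))\<^sup>2)" if B: "B \<in> sets borel" for B
  proof -
    let ?\<mu> = "\<lambda>B. ennreal (Re (cinner x (E B x)))"
    have re: "Re (cinner x (E B x)) = (norm (E B x))\<^sup>2" if "B \<in> sets borel" for B
      using projection_measure_cinner(2)[OF E that, of x] by simp
    have "emeasure (scalar_measure E x) B = ?\<mu> B"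
    proof (rule emeasure_measure_of[OF scalar_measure_def])
      show "sets (borel :: real measure) \<subseteq> Pow UNIV" by simp
      show "B \<in> sets (scalar_measure E x)" using B s by simp
      show "positive (sets (scalar_measure E x)) ?\<mu>"
        by (simp add: positive_def projection_measure_empty[OF E])
      show "countably_additive (sets (scalar_measure E x)) ?\<mu>"
        unfolding countably_additive_def s
      proof (intro allI impI)
        fix A :: "nat \<Rightarrow> real set" assume A: "range A \<subseteq> sets borel" "disjoint_family A" "\<Union> (range A) \<in> sets borel"
        have "(\<lambda>n. E (A n) x) sums E (\<Union>n. A n) x"
          by (rule projection_measure_sums[OF E A(1,2)])
        then have "(\<lambda>n. Re (cinner x (E (A n) x))) sums Re (cinner x (E (\<Union>n. A n) x))"
          by (intro sums_Re bounded_linear.sums[OF bounded_bilinear.bounded_linear_right[OF bounded_bilinear_cinner]])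
        then show "(\<Sum>n. ?\<mu> (A n)) = ?\<mu> (\<Union> (range A))"
          using A(1) re by (intro suminf_ennreal_eq) (auto simp: image_subset_iff)
      qed
    qed
    then show ?thesis using re[OF B] by simp
  qed
  show "finite_measure (scalar_measure E x)"
    by (rule finite_measureI) (simp add: sp em)
qed

lemma measure_scalar_measure:
  assumes "projection_measure E" "B \<in> sets borel"
  shows "measure (scalar_measure E x) B = (norm (E B x))\<^sup>2"
  by (simp add: measure_def scalar_measure(3)[OF assms])

text \<open>Restricting both measures to B by an indicator density makes them equal, so integrals
  over B agree together with integrability.\<close>

lemma integral_indicator_cong_measure:
  fixes f :: "real \<Rightarrow> complex"
  assumes s: "sets M = sets borel" "sets N = sets borel" and B: "B \<in> sets borel" and f: "f \<in> borel_measurable borel"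
    and eq: "\<And>C. C \<in> sets borel \<Longrightarrow> C \<subseteq> B \<Longrightarrow> emeasure M C = emeasure N C"
  shows "(LINT t|M. indicator B t *\<^sub>R f t) = (LINT t|N. indicator B t *\<^sub>R f t)"
    and "integrable M (\<lambda>t. indicator B t *\<^sub>R f t) \<longleftrightarrow> integrable N (\<lambda>t. indicator B t *\<^sub>R f t)"
proof -
  have i: "(\<lambda>t. ennreal (indicator B t)) \<in> borel_measurable M" "(\<lambda>t. ennreal (indicator B t)) \<in> borel_measurable N"
    "f \<in> borel_measurable M" "f \<in> borel_measurable N" "(indicator B :: real \<Rightarrow> real) \<in> borel_measurable M" "(indicator B :: real \<Rightarrow> real) \<in> borel_measurable N"
    using B f s by (auto simp: measurable_cong_sets[OF s(1) refl] measurable_cong_sets[OF s(2) refl])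
  have "density M (\<lambda>t. ennreal (indicator B t)) = density N (\<lambda>t. ennreal (indicator B t))"
  proof (rule measure_eqI)
    fix C assume "C \<in> sets (density M (\<lambda>t. ennreal (indicator B t)))"
    then have C: "C \<in> sets borel" using s by simp
    have "emeasure (density M (\<lambda>t. ennreal (indicator B t))) C = emeasure M (B \<inter> C)"
      using C B s by (subst emeasure_density[OF i(1)]) (auto simp: indicator_inter_arith[symmetric] ennreal_indicator)
    also have "\<dots> = emeasure N (B \<inter> C)" using eq B C by auto
    also have "\<dots> = emeasure (density N (\<lambda>t. ennreal (indicator B t))) C"
      using C B s by (subst emeasure_density[OF i(2)]) (auto simp: indicator_inter_arith[symmetric] ennreal_indicator)
    finally show "emeasure (density M (\<lambda>t. ennreal (indicator B t))) C = emeasure (density N (\<lambda>t. ennreal (indicator B t))) C" .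
  qed (simp add: s)
  then show "(LINT t|M. indicator B t *\<^sub>R f t) = (LINT t|N. indicator B t *\<^sub>R f t)"
    "integrable M (\<lambda>t. indicator B t *\<^sub>R f t) \<longleftrightarrow> integrable N (\<lambda>t. indicator B t *\<^sub>R f t)"
    using integral_density[OF i(3) i(5)] integral_density[OF i(4) i(6)] integrable_density[OF i(3) i(5)] integrable_density[OF i(4) i(6)]
    by auto
qed

lemma integrable_bounded_on:
  fixes f :: "real \<Rightarrow> complex"
  assumes "finite_measure M" "sets M = sets borel" "B \<in> sets borel" "f \<in> borel_measurable borel"
    "\<And>t. t \<in> B \<Longrightarrow> cmod (f t) \<le> K"
  shows "integrable M (\<lambda>t. indicator B t *\<^sub>R f t)"
proof -
  interpret finite_measure M by fact
  have [measurable]: "f \<in> borel_measurable M" "B \<in> sets M"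
    using assms by (auto simp: measurable_cong_sets[OF assms(2) refl])
  show ?thesis
  proof (rule integrable_const_bound)
    show "AE t in M. norm (indicator B t *\<^sub>R f t) \<le> \<bar>K\<bar>"
      using assms(5) by (intro AE_I2) (auto simp: indicator_def intro: order_trans[OF _ abs_ge_self])
  qed measurable
qed

section \<open>Localising a spectral integral by polarization\<close>

lemma sum_four: "(\<Sum>k<4. F k) = F 0 + F 1 + F 2 + F (3::nat)" for F :: "nat \<Rightarrow> 'a::comm_monoid_add"
  by (simp add: eval_nat_numeral)

lemma imaginary_powers: "\<i> ^ 3 = - \<i>" "(- \<i>) ^ 3 = \<i>"
  by (simp_all add: power3_eq_cube)

lemma polarization:
  fixes a b :: "'a::complex_inner"
  shows "(\<Sum>k<4. (- \<i>) ^ k * complex_of_real ((norm (a + \<i> ^ k *\<^sub>C b))\<^sup>2)) / 4 = cinner a b"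
    and "(\<Sum>k<4. (norm (a + \<i> ^ k *\<^sub>C b))\<^sup>2) = 4 * (norm a)\<^sup>2 + 4 * (norm b)\<^sup>2"
proof -
  have n: "complex_of_real ((norm (a + c *\<^sub>C b))\<^sup>2)
      = complex_of_real ((norm a)\<^sup>2) + c * cinner a b + cnj c * cinner b a + complex_of_real ((cmod c)\<^sup>2 * (norm b)\<^sup>2)" for c
  proof -
    have "complex_of_real ((norm (a + c *\<^sub>C b))\<^sup>2) = cinner (a + c *\<^sub>C b) (a + c *\<^sub>C b)"
      by (simp only: cinner_self)
    also have "\<dots> = cinner a a + c * cinner a b + cnj c * cinner b a + (cnj c * c) * cinner b b"
      unfolding cinner_add_left cinner_add_right cinner_scaleC_left cinner_scaleC_right
      by (simp add: algebra_simps)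
    finally show ?thesis by (simp add: cinner_self complex_mult_cnj_cmod')
  qed
  show "(\<Sum>k<4. (- \<i>) ^ k * complex_of_real ((norm (a + \<i> ^ k *\<^sub>C b))\<^sup>2)) / 4 = cinner a b"
    unfolding sum_four n by (simp add: imaginary_powers algebra_simps)
  have "complex_of_real (\<Sum>k<4. (norm (a + \<i> ^ k *\<^sub>C b))\<^sup>2) = complex_of_real (4 * (norm a)\<^sup>2 + 4 * (norm b)\<^sup>2)"
    unfolding of_real_sum sum_four of_real_add n by (simp add: imaginary_powers algebra_simps)
  then show "(\<Sum>k<4. (norm (a + \<i> ^ k *\<^sub>C b))\<^sup>2) = 4 * (norm a)\<^sup>2 + 4 * (norm b)\<^sup>2"
    by (simp only: of_real_eq_iff)
qed

text \<open>The weak definition of the spectral integral is tested with E(B) w and sorted into the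
  parts on and off B; only the part on B survives polarization.\<close>

lemma spectral_integral_localized:
  assumes E: "projection_measure E" and xy: "(x, y) \<in> spectral_integral E complex_of_real"
    and B: "B \<in> sets borel" "\<And>t. t \<in> B \<Longrightarrow> \<bar>t\<bar> \<le> N"
  shows "cinner w (E B y) = (\<Sum>k<4. (- \<i>) ^ k * (LINT t|scalar_measure E (w + \<i> ^ k *\<^sub>C x). indicator B t *\<^sub>R complex_of_real t)) / 4"
proof -
  let ?\<mu> = "scalar_measure E"
  note sm = scalar_measure[OF E]
  \<comment> \<open>The scalar measure of z is carried by the bounded set B. This puts z into the
    domain, whereas w is arbitrary.\<close>
  define z where "z = E B w"
  have id_meas [measurable]: "complex_of_real \<in> borel_measurable borel" by simp
  note [measurable] = B(1)
  have Bc: "- B \<in> sets borel" using B(1) by auto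
  have zdom: "z \<in> spectral_domain E complex_of_real"
  proof -
    interpret finite_measure "?\<mu> z" by (rule sm(4))
    have "AE t in ?\<mu> z. t \<notin> - B"
    proof (rule AE_not_in)
      have "emeasure (?\<mu> z) (- B) = 0"
        using B(1) Bc by (simp add: sm(3) z_def projection_measure_disjoint[OF E Bc B(1)])
      then show "- B \<in> null_sets (?\<mu> z)" using Bc sm(1) by (auto simp: null_sets_def)
    qed
    then have "AE t in ?\<mu> z. norm ((cmod (complex_of_real t))\<^sup>2) \<le> N\<^sup>2"
    proof eventually_elim
      case (elim t)
      then have "\<bar>t\<bar> \<le> N" using B(2) by simp
      then have "\<bar>t\<bar>\<^sup>2 \<le> N\<^sup>2" by (intro power_mono) auto
      then show ?case by simp
    qed
    moreover have "(\<lambda>t. (cmod (complex_of_real t))\<^sup>2) \<in> borel_measurable (?\<mu> z)"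
      by (subst measurable_cong_sets[OF sm(1) refl]) measurable
    ultimately have "integrable (?\<mu> z) (\<lambda>t. (cmod (complex_of_real t))\<^sup>2)"
      by (rule integrable_const_bound)
    then show ?thesis by (simp add: spectral_domain_def)
  qed
  have key: "(LINT t|?\<mu> (z + c *\<^sub>C x). complex_of_real t)
      = (LINT t|?\<mu> (w + c *\<^sub>C x). indicator B t *\<^sub>R complex_of_real t) + (LINT t|?\<mu> x. indicator (- B) t *\<^sub>R complex_of_real t)"
    if c: "cmod c = 1" for c
  proof -
    let ?v = "c *\<^sub>C x"
    have inB: "emeasure (?\<mu> (z + ?v)) C = emeasure (?\<mu> (w + ?v)) C" if C: "C \<in> sets borel" "C \<subseteq> B" for C
    proof -
      have "E C z = E C w"
        unfolding z_def projection_measure_Int[OF E C(1) B(1)] using C(2) by (simp add: Int_absorb2)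
      then show ?thesis
        using C(1) by (simp add: sm(3) bounded_clinearD(1)[OF projection_measureD(1)[OF E C(1)]])
    qed
    \<comment> \<open>Off B the vector z contributes nothing, and the unimodular c does not change
      the norm of E(C) x.\<close>
    have offB: "emeasure (?\<mu> (z + ?v)) C = emeasure (?\<mu> x) C" if C: "C \<in> sets borel" "C \<subseteq> - B" for C
    proof -
      have "E C z = 0"
        unfolding z_def by (rule projection_measure_disjoint[OF E C(1) B(1)]) (use C in auto)
      then show ?thesis
        using C(1) c by (simp add: sm(3) bounded_clinearD[OF projection_measureD(1)[OF E C(1)]] norm_scaleC)
    qed
    have i1: "integrable (?\<mu> (z + ?v)) (\<lambda>t. indicator B t *\<^sub>R complex_of_real t)"
      by (rule integrable_bounded_on[OF sm(4) sm(1) B(1), of _ N]) (use B(2) in auto)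
    have x2: "integrable (?\<mu> x) (\<lambda>t. (cmod (complex_of_real t))\<^sup>2)"
      using xy by (simp add: spectral_integral_def spectral_domain_def)
    have "integrable (?\<mu> x) (\<lambda>t. indicator (- B) t *\<^sub>R complex_of_real t)"
    proof (rule Bochner_Integration.integrable_bound)
      interpret finite_measure "?\<mu> x" by (rule sm(4))
      show "integrable (?\<mu> x) (\<lambda>t. 1 + (cmod (complex_of_real t))\<^sup>2)"
        using x2 by (intro Bochner_Integration.integrable_add) auto
      show "(\<lambda>t. indicator (- B) t *\<^sub>R complex_of_real t) \<in> borel_measurable (?\<mu> x)"
        using Bc by (subst measurable_cong_sets[OF sm(1) refl]) measurable
      have "a \<le> 1 + a\<^sup>2" for a :: real
        using zero_le_power2[of "a - 1/2"] unfolding power2_diff by (simp add: power_divide)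
      then have "\<bar>t\<bar> \<le> 1 + t\<^sup>2" for t :: real
        by (metis power2_abs)
      then show "AE t in ?\<mu> x. norm (indicator (- B) t *\<^sub>R complex_of_real t) \<le> norm (1 + (cmod (complex_of_real t))\<^sup>2)"
        by (intro AE_I2) (auto simp: indicator_def add_nonneg_nonneg)
    qed
    then have i2: "integrable (?\<mu> (z + ?v)) (\<lambda>t. indicator (- B) t *\<^sub>R complex_of_real t)"
      using integral_indicator_cong_measure(2)[OF sm(1) sm(1) Bc id_meas offB] by blast
    have "(LINT t|?\<mu> (z + ?v). complex_of_real t)
        = (LINT t|?\<mu> (z + ?v). indicator B t *\<^sub>R complex_of_real t + indicator (- B) t *\<^sub>R complex_of_real t)"
      by (rule Bochner_Integration.integral_cong) (auto simp: indicator_def)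
    also have "\<dots> = (LINT t|?\<mu> (z + ?v). indicator B t *\<^sub>R complex_of_real t) + (LINT t|?\<mu> (z + ?v). indicator (- B) t *\<^sub>R complex_of_real t)"
      by (rule Bochner_Integration.integral_add[OF i1 i2])
    finally show ?thesis
      using integral_indicator_cong_measure(1)[OF sm(1) sm(1) B(1) id_meas inB]
        integral_indicator_cong_measure(1)[OF sm(1) sm(1) Bc id_meas offB] by simp
  qed
  have key_k: "(LINT t|?\<mu> (z + \<i> ^ k *\<^sub>C x). complex_of_real t)
      = (LINT t|?\<mu> (w + \<i> ^ k *\<^sub>C x). indicator B t *\<^sub>R complex_of_real t) + (LINT t|?\<mu> x. indicator (- B) t *\<^sub>R complex_of_real t)" for k
    by (rule key) (simp add: norm_power)
  have "cinner w (E B y) = cinner z y"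
    by (simp add: z_def projection_measureD(3)[OF E B(1)])
  also have "\<dots> = spectral_form E complex_of_real z x"
    using xy zdom by (simp add: spectral_integral_def)
  \<comment> \<open>The part off B is the same for all k, and the weights (-i)^k add up to
    0.\<close>
  also have "\<dots> = (\<Sum>k<4. (- \<i>) ^ k * (LINT t|?\<mu> (w + \<i> ^ k *\<^sub>C x). indicator B t *\<^sub>R complex_of_real t)) / 4"
    unfolding spectral_form_def key_k sum_four by (simp add: imaginary_powers algebra_simps)
  finally show ?thesis .
qed

text \<open>On B the function t differs from c by at most \<delta>, so the localized form of y - c x
  at w is at most \<delta> (||E(B) w||^2 + ||E(B) x||^2). A suitable length of w makes the two
  squares balance.\<close>

lemma spectral_integral_approx_eigenvector:
  assumes E: "projection_measure E" and xy: "(x, y) \<in> spectral_integral E complex_of_real"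
    and B: "B \<in> sets borel" "\<And>t. t \<in> B \<Longrightarrow> \<bar>t - c\<bar> \<le> \<delta>" and \<delta>: "\<delta> \<ge> 0"
  shows "norm (E B (y - c *\<^sub>R x)) \<le> 2 * \<delta> * norm (E B x)"
proof -
  let ?\<mu> = "scalar_measure E"
  note sm = scalar_measure[OF E] and lin = bounded_clinearD[OF projection_measureD(1)[OF E B(1)]]
  have bound: "cmod (cinner w (E B (y - c *\<^sub>R x))) \<le> \<delta> * ((norm (E B w))\<^sup>2 + (norm (E B x))\<^sup>2)" for w
  proof -
    let ?I = "\<lambda>k. LINT t|?\<mu> (w + \<i> ^ k *\<^sub>C x). indicator B t *\<^sub>R complex_of_real t"
    have B': "\<bar>t\<bar> \<le> \<bar>c\<bar> + \<delta>" if "t \<in> B" for t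
      using B(2)[OF that] by linarith
    have part: "cmod (?I k - complex_of_real c * complex_of_real ((norm (E B w + \<i> ^ k *\<^sub>C E B x))\<^sup>2)) \<le> \<delta> * (norm (E B w + \<i> ^ k *\<^sub>C E B x))\<^sup>2" for k
    proof -
      let ?M = "?\<mu> (w + \<i> ^ k *\<^sub>C x)"
      interpret finite_measure ?M by (rule sm(4))
      have BM: "B \<in> sets ?M" using B(1) sm(1) by simp
      have m: "measure ?M B = (norm (E B w + \<i> ^ k *\<^sub>C E B x))\<^sup>2"
        by (simp add: measure_scalar_measure[OF E B(1)] lin)
      have i1: "integrable ?M (\<lambda>t. indicator B t *\<^sub>R complex_of_real t)"
        by (rule integrable_bounded_on[OF sm(4) sm(1) B(1), of _ "\<bar>c\<bar> + \<delta>"]) (use B' in auto)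
      have i2: "integrable ?M (\<lambda>t. indicator B t *\<^sub>R complex_of_real c)"
        by (rule integrable_bounded_on[OF sm(4) sm(1) B(1), of _ "\<bar>c\<bar>"]) auto
      have "(LINT t|?M. indicator B t *\<^sub>R complex_of_real c) = complex_of_real c * complex_of_real (measure ?M B)"
        using BM by (simp add: scaleR_conv_of_real)
      then have "?I k - complex_of_real c * complex_of_real (measure ?M B)
          = (LINT t|?M. indicator B t *\<^sub>R complex_of_real t - indicator B t *\<^sub>R complex_of_real c)"
        using Bochner_Integration.integral_diff[OF i1 i2] by simp
      also have "cmod \<dots> \<le> (LINT t|?M. cmod (indicator B t *\<^sub>R complex_of_real t - indicator B t *\<^sub>R complex_of_real c))"
        by (rule integral_norm_bound)
      also have "\<dots> \<le> (LINT t|?M. indicator B t * \<delta>)"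
      proof (rule integral_mono)
        show "integrable ?M (\<lambda>t. cmod (indicator B t *\<^sub>R complex_of_real t - indicator B t *\<^sub>R complex_of_real c))"
          by (intro integrable_norm Bochner_Integration.integrable_diff i1 i2)
        show "integrable ?M (\<lambda>t. indicator B t * \<delta>)"
          using BM by (simp add: less_top[symmetric])
        show "cmod (indicator B t *\<^sub>R complex_of_real t - indicator B t *\<^sub>R complex_of_real c) \<le> indicator B t * \<delta>" for t
          using B(2)[of t] by (auto simp: indicator_def simp flip: of_real_diff)
      qed
      also have "\<dots> = \<delta> * measure ?M B"
        using BM by simp
      finally show ?thesis by (simp add: m)
    qed
    have "cinner w (E B (y - c *\<^sub>R x)) = cinner w (E B y) - complex_of_real c * cinner (E B w) (E B x)"
      by (simp add: lin cinner_diff_right projection_measure_cinner(1)[OF E B(1)])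
    also have "\<dots> = (\<Sum>k<4. (- \<i>) ^ k * ?I k) / 4
        - complex_of_real c * ((\<Sum>k<4. (- \<i>) ^ k * complex_of_real ((norm (E B w + \<i> ^ k *\<^sub>C E B x))\<^sup>2)) / 4)"
      by (simp only: polarization(1) spectral_integral_localized[OF E xy B(1) B'])
    also have "\<dots> = (\<Sum>k<4. (- \<i>) ^ k * (?I k - complex_of_real c * complex_of_real ((norm (E B w + \<i> ^ k *\<^sub>C E B x))\<^sup>2))) / 4"
      unfolding right_diff_distrib sum_subtractf diff_divide_distrib sum_distrib_left times_divide_eq_right
      by (simp only: mult.left_commute)
    also have "cmod \<dots> \<le> (\<Sum>k<4. \<delta> * (norm (E B w + \<i> ^ k *\<^sub>C E B x))\<^sup>2) / 4"
      unfolding norm_divide norm_numeral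
    proof (intro divide_right_mono order_trans[OF norm_sum] sum_mono)
      fix k
      show "cmod ((- \<i>) ^ k * (?I k - complex_of_real c * complex_of_real ((norm (E B w + \<i> ^ k *\<^sub>C E B x))\<^sup>2))) \<le> \<delta> * (norm (E B w + \<i> ^ k *\<^sub>C E B x))\<^sup>2"
        using part[of k] by (simp add: norm_mult norm_power)
    qed simp
    also have "\<dots> = \<delta> * (4 * (norm (E B w))\<^sup>2 + 4 * (norm (E B x))\<^sup>2) / 4"
      unfolding sum_distrib_left[symmetric] polarization(2) ..
    finally show ?thesis by (simp add: distrib_left)
  qed
  let ?u = "E B (y - c *\<^sub>R x)"
  show ?thesis
  proof (cases "?u = 0")
    case True
    then show ?thesis using \<delta> by simp
  next
    case False
    \<comment> \<open>The vector to be estimated, rescaled to length s. The optimal s is ||E(B) x||,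
      and the two equal squares produce the factor 2.\<close>
    define w where "w s = (s / norm ?u) *\<^sub>R ?u" for s
    have Ew: "E B (w s) = w s" for s
      by (simp add: w_def lin projection_measureD(2)[OF E B(1)])
    have nw: "norm (w s) = s" if "s \<ge> 0" for s
      using False that by (simp add: w_def)
    have cw: "cinner (w s) ?u = complex_of_real (s * norm ?u)" for s
      using False by (simp add: w_def cinner_self power2_eq_square)
    have *: "s * norm ?u \<le> \<delta> * (s\<^sup>2 + (norm (E B x))\<^sup>2)" if "s \<ge> 0" for s
      using bound[of "w s"] that unfolding cw Ew nw[OF that] by (simp add: norm_mult abs_mult)
    show ?thesis
    proof (cases "norm (E B x) = 0")
      case True
      \<comment> \<open>With E(B) x = 0 the length s is free; the choice below gives ||u|| <= ||u||
        / 2, which contradicts u being nonzero.\<close>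
      have "norm ?u \<le> \<delta> * s" if "s > 0" for s
        using *[of s] that True by (simp add: power2_eq_square field_simps)
      from this[of 1] this[of "norm ?u / (2 * (\<delta> + 1))"] have "norm ?u \<le> \<delta> * (norm ?u / (2 * (\<delta> + 1)))"
        using \<delta> False by simp
      also have "\<dots> \<le> norm ?u / 2"
        using \<delta> by (simp add: field_simps mult_right_mono)
      finally show ?thesis using False by simp
    next
      case nz: False
      show ?thesis
      proof -
        have "norm (E B x) * norm ?u \<le> norm (E B x) * (2 * \<delta> * norm (E B x))"
          using *[of "norm (E B x)"] by (simp add: power2_eq_square algebra_simps)
        then show ?thesis using nz by (simp add: mult_le_cancel_left)
      qed
    qed
  qed
qed

text \<open>With \<open>v = (D - \<zeta>) x\<close> the left-hand side is \<open>\<langle>v, |D - \<zeta>|\<^sup>-\<^sup>2 v\<rangle>\<close>.\<close>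

lemma poisson_integral_scalar_measure:
  assumes E: "projection_measure E" and xy: "(x, v + \<zeta> *\<^sub>C x) \<in> spectral_integral E complex_of_real" and \<zeta>: "Im \<zeta> \<noteq> 0"
  shows "(\<integral>\<^sup>+t. ennreal (1 / (cmod (complex_of_real t - \<zeta>))\<^sup>2) \<partial>scalar_measure E v) = ennreal ((norm x)\<^sup>2)"
proof -
  let ?\<mu> = "scalar_measure E"
  note sm = scalar_measure[OF E]
  define \<epsilon> where "\<epsilon> = \<bar>Im \<zeta>\<bar>"
  have \<epsilon>: "\<epsilon> > 0" using \<zeta> by (simp add: \<epsilon>_def)
  have low: "\<epsilon> \<le> cmod (complex_of_real t - \<zeta>)" for t
    using abs_Im_le_cmod[of "complex_of_real t - \<zeta>"] by (simp add: \<epsilon>_def)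
  define P where "P t = 1 / (cmod (complex_of_real t - \<zeta>))\<^sup>2" for t
  have P0: "0 \<le> P t" for t by (simp add: P_def)
  have [measurable]: "P \<in> borel_measurable borel" unfolding P_def by measurable
  let ?I = "\<integral>\<^sup>+t. ennreal (P t) \<partial>?\<mu> v"
  \<comment> \<open>Two-sided bounds at mesh \<delta>, which close up as \<delta> tends to 0. The 3
    consists of 2 from the approximate eigenvector estimate and 1 from the variation of |t -
    \<zeta>| over a cell.\<close>
  have main: "ennreal ((1 - 3 * \<delta> / \<epsilon>)\<^sup>2 * (norm x)\<^sup>2) \<le> ?I \<and> ?I \<le> ennreal ((1 + 3 * \<delta> / \<epsilon>)\<^sup>2 * (norm x)\<^sup>2)"
    if \<delta>: "0 < \<delta>" "3 * \<delta> < \<epsilon>" for \<delta>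
  proof -
    \<comment> \<open>The left ends of half-open cells of length \<delta>; \<open>int_decode\<close>
      numbers them by naturals, as countable additivity requires.\<close>
    define c where "c n = real_of_int (int_decode n) * \<delta>" for n
    define B where "B n = {c n..<c n + \<delta>}" for n
    have Bb [measurable]: "B n \<in> sets borel" for n by (simp add: B_def)
    have fl: "t \<in> B n \<longleftrightarrow> \<lfloor>t / \<delta>\<rfloor> = int_decode n" for t n
      using \<delta>(1) by (auto simp: B_def c_def floor_eq_iff field_simps)
    have disj: "disjoint_family B"
      unfolding disjoint_family_on_def
    proof (intro ballI impI)
      fix m n :: nat assume "m \<noteq> n"
      then have "int_decode m \<noteq> int_decode n" by (metis int_decode_inverse)
      then show "B m \<inter> B n = {}" by (auto simp: fl)
    qed
    have un: "(\<Union>n. B n) = UNIV"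
    proof -
      have "t \<in> B (int_encode \<lfloor>t / \<delta>\<rfloor>)" for t by (simp add: fl)
      then show ?thesis by blast
    qed
    have near: "\<bar>cmod (complex_of_real t - \<zeta>) - cmod (complex_of_real (c n) - \<zeta>)\<bar> \<le> \<delta>" if "t \<in> B n" for t n
    proof -
      have "\<bar>cmod (complex_of_real t - \<zeta>) - cmod (complex_of_real (c n) - \<zeta>)\<bar> \<le> cmod ((complex_of_real t - \<zeta>) - (complex_of_real (c n) - \<zeta>))"
        by (rule norm_triangle_ineq3)
      also have "\<dots> = \<bar>t - c n\<bar>" by (simp flip: of_real_diff)
      finally show ?thesis using that by (simp add: B_def)
    qed
    have comp: "\<bar>norm (E (B n) v) - cmod (complex_of_real (c n) - \<zeta>) * norm (E (B n) x)\<bar> \<le> 2 * \<delta> * norm (E (B n) x)" for n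
    proof -
      note lin = bounded_clinearD[OF projection_measureD(1)[OF E Bb]]
      have "norm (E (B n) (v + \<zeta> *\<^sub>C x - c n *\<^sub>R x)) \<le> 2 * \<delta> * norm (E (B n) x)"
        by (rule spectral_integral_approx_eigenvector[OF E xy Bb]) (use \<delta>(1) in \<open>auto simp: B_def\<close>)
      moreover have "E (B n) (v + \<zeta> *\<^sub>C x - c n *\<^sub>R x) = E (B n) v - (complex_of_real (c n) - \<zeta>) *\<^sub>C E (B n) x"
        by (simp add: lin scaleR_scaleC scaleC_diff_left)
      ultimately show ?thesis
        using norm_triangle_ineq3[of "E (B n) v" "(complex_of_real (c n) - \<zeta>) *\<^sub>C E (B n) x"]
        by (simp add: norm_scaleC)
    qed
    have piece: "(1 - 3 * \<delta> / \<epsilon>)\<^sup>2 * (norm (E (B n) x))\<^sup>2 \<le> P t * (norm (E (B n) v))\<^sup>2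
        \<and> P t * (norm (E (B n) v))\<^sup>2 \<le> (1 + 3 * \<delta> / \<epsilon>)\<^sup>2 * (norm (E (B n) x))\<^sup>2" if t: "t \<in> B n" for t n
    proof -
      define r where "r = cmod (complex_of_real t - \<zeta>)"
      define a where "a = norm (E (B n) x)"
      define b where "b = norm (E (B n) v)"
      have r: "\<epsilon> \<le> r" "r > 0" using low[of t] \<epsilon> by (auto simp: r_def)
      have a: "a \<ge> 0" by (simp add: a_def)
      have "\<bar>b - r * a\<bar> \<le> 3 * \<delta> * a"
      proof -
        let ?c = "cmod (complex_of_real (c n) - \<zeta>)"
        have "\<bar>b - ?c * a\<bar> \<le> 2 * \<delta> * a" using comp[of n] by (simp add: a_def b_def)
        moreover have "\<bar>?c * a - r * a\<bar> \<le> \<delta> * a"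
          using mult_right_mono[OF near[OF t] a] a by (simp add: r_def abs_mult left_diff_distrib[symmetric] abs_minus_commute)
        ultimately show ?thesis by linarith
      qed
      \<comment> \<open>The distance of \<zeta> from the real line, \<epsilon> <= r, turns the
        absolute error into a relative one.\<close>
      moreover have "3 * \<delta> * a \<le> 3 * \<delta> / \<epsilon> * r * a"
        using r \<epsilon> \<delta> a by (intro mult_right_mono) (auto simp: field_simps)
      ultimately have b: "(1 - 3 * \<delta> / \<epsilon>) * (r * a) \<le> b" "b \<le> (1 + 3 * \<delta> / \<epsilon>) * (r * a)"
        by (auto simp: algebra_simps abs_le_iff)
      have nn: "0 \<le> (1 - 3 * \<delta> / \<epsilon>) * (r * a)"
        using r \<epsilon> \<delta> a by (intro mult_nonneg_nonneg) (auto simp: field_simps)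
      have "((1 - 3 * \<delta> / \<epsilon>) * (r * a))\<^sup>2 \<le> b\<^sup>2" "b\<^sup>2 \<le> ((1 + 3 * \<delta> / \<epsilon>) * (r * a))\<^sup>2"
        using b nn by (auto intro!: power_mono simp: b_def)
      then have "r\<^sup>2 * ((1 - 3 * \<delta> / \<epsilon>)\<^sup>2 * a\<^sup>2) \<le> b\<^sup>2" "b\<^sup>2 \<le> r\<^sup>2 * ((1 + 3 * \<delta> / \<epsilon>)\<^sup>2 * a\<^sup>2)"
        by (simp_all add: power_mult_distrib mult_ac)
      then have "(1 - 3 * \<delta> / \<epsilon>)\<^sup>2 * a\<^sup>2 \<le> b\<^sup>2 / r\<^sup>2" "b\<^sup>2 / r\<^sup>2 \<le> (1 + 3 * \<delta> / \<epsilon>)\<^sup>2 * a\<^sup>2"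
        using r(2) by (simp_all add: pos_le_divide_eq pos_divide_le_eq mult.commute)
      then show ?thesis
        by (simp add: P_def r_def a_def b_def)
    qed
    have sumx: "(\<Sum>n. ennreal ((norm (E (B n) x))\<^sup>2)) = ennreal ((norm x)\<^sup>2)"
    proof -
      have "(\<Sum>n. emeasure (?\<mu> x) (B n)) = emeasure (?\<mu> x) (\<Union>n. B n)"
        by (rule suminf_emeasure) (use Bb disj sm(1) in auto)
      then show ?thesis by (simp add: un sm(3) Bb projection_measure_UNIV[OF E])
    qed
    have split: "?I = (\<Sum>n. \<integral>\<^sup>+t. ennreal (P t) * indicator (B n) t \<partial>?\<mu> v)"
    proof -
      have "ennreal (P t) = (\<Sum>n. ennreal (P t) * indicator (B n) t)" for t
        using suminf_indicator[OF disj, of t] by (simp add: un)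
      then have "?I = (\<integral>\<^sup>+t. (\<Sum>n. ennreal (P t) * indicator (B n) t) \<partial>?\<mu> v)" by simp
      also have "\<dots> = (\<Sum>n. \<integral>\<^sup>+t. ennreal (P t) * indicator (B n) t \<partial>?\<mu> v)"
        using Bb by (intro nn_integral_suminf) (subst measurable_cong_sets[OF sm(1) refl], measurable)
      finally show ?thesis .
    qed
    have const: "(\<integral>\<^sup>+t. ennreal k * indicator (B n) t \<partial>?\<mu> v) = ennreal k * ennreal ((norm (E (B n) v))\<^sup>2)" for k n
      using Bb sm(1)[of v] by (simp add: nn_integral_cmult_indicator sm(3))
    have in_n: "ennreal ((1 - 3 * \<delta> / \<epsilon>)\<^sup>2 * (norm (E (B n) x))\<^sup>2) \<le> (\<integral>\<^sup>+t. ennreal (P t) * indicator (B n) t \<partial>?\<mu> v)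
       \<and> (\<integral>\<^sup>+t. ennreal (P t) * indicator (B n) t \<partial>?\<mu> v) \<le> ennreal ((1 + 3 * \<delta> / \<epsilon>)\<^sup>2 * (norm (E (B n) x))\<^sup>2)" for n
    proof (cases "E (B n) v = 0")
      case True
      \<comment> \<open>The other case divides by ||E v||^2. Here v has no mass on the cell, and the
        estimate at the single point \<open>c n\<close> shows that the lower bound is 0 as
        well.\<close>
      have "c n \<in> B n" using \<delta>(1) by (simp add: B_def)
      from piece[OF this] True have "(1 - 3 * \<delta> / \<epsilon>)\<^sup>2 * (norm (E (B n) x))\<^sup>2 \<le> 0" by simp
      moreover have "(\<integral>\<^sup>+t. ennreal (P t) * indicator (B n) t \<partial>?\<mu> v) = 0"
      proof -
        have "(\<integral>\<^sup>+t. ennreal (P t) * indicator (B n) t \<partial>?\<mu> v) = (\<integral>\<^sup>+t. 0 \<partial>?\<mu> v)"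
        proof (rule nn_integral_cong_AE)
          have "B n \<in> null_sets (?\<mu> v)" using True Bb sm(1) by (auto simp: null_sets_def sm(3))
          from AE_not_in[OF this] show "AE t in ?\<mu> v. ennreal (P t) * indicator (B n) t = 0"
            by eventually_elim simp
        qed
        then show ?thesis by simp
      qed
      ultimately show ?thesis by (simp add: ennreal_neg)
    next
      case False
      then have nz: "(norm (E (B n) v))\<^sup>2 > 0" by simp
      let ?l = "(1 - 3 * \<delta> / \<epsilon>)\<^sup>2 * (norm (E (B n) x))\<^sup>2" and ?u = "(1 + 3 * \<delta> / \<epsilon>)\<^sup>2 * (norm (E (B n) x))\<^sup>2" and ?w = "(norm (E (B n) v))\<^sup>2"
      have "ennreal ?l = (\<integral>\<^sup>+t. ennreal (?l / ?w) * indicator (B n) t \<partial>?\<mu> v)"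
        unfolding const using nz by (subst ennreal_mult[symmetric]) auto
      also have "\<dots> \<le> (\<integral>\<^sup>+t. ennreal (P t) * indicator (B n) t \<partial>?\<mu> v)"
        using piece nz by (intro nn_integral_mono) (auto simp: indicator_def pos_divide_le_eq intro!: ennreal_leI)
      finally have 1: "ennreal ?l \<le> (\<integral>\<^sup>+t. ennreal (P t) * indicator (B n) t \<partial>?\<mu> v)" .
      have "(\<integral>\<^sup>+t. ennreal (P t) * indicator (B n) t \<partial>?\<mu> v) \<le> (\<integral>\<^sup>+t. ennreal (?u / ?w) * indicator (B n) t \<partial>?\<mu> v)"
        using piece nz by (intro nn_integral_mono) (auto simp: indicator_def pos_le_divide_eq intro!: ennreal_leI)
      also have "\<dots> = ennreal ?u"
        unfolding const using nz by (subst ennreal_mult[symmetric]) auto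
      finally show ?thesis using 1 by blast
    qed
    have "ennreal (k * (norm x)\<^sup>2) = (\<Sum>n. ennreal (k * (norm (E (B n) x))\<^sup>2))" if "k \<ge> 0" for k
    proof -
      have "(\<Sum>n. ennreal (k * (norm (E (B n) x))\<^sup>2)) = (\<Sum>n. ennreal k * ennreal ((norm (E (B n) x))\<^sup>2))"
        using that by (simp add: ennreal_mult)
      also have "\<dots> = ennreal k * ennreal ((norm x)\<^sup>2)"
        unfolding ennreal_suminf_cmult sumx ..
      finally show ?thesis using that by (simp add: ennreal_mult)
    qed
    then show ?thesis
      unfolding split using in_n by (auto intro!: suminf_le)
  qed
  \<comment> \<open>The 4 ensures 3 \<delta> < \<epsilon> already for n = 0.\<close>
  have "(\<lambda>n. \<epsilon> / real (n + 4)) \<longlonglongrightarrow> 0"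
    using LIMSEQ_ignore_initial_segment[OF lim_const_over_n[of \<epsilon>], of 4] by simp
  note l = this
  have lim: "(\<lambda>n. (1 + 3 * (\<epsilon> / real (n + 4)) / \<epsilon>)\<^sup>2 * (norm x)\<^sup>2) \<longlonglongrightarrow> (1 + 3 * 0 / \<epsilon>)\<^sup>2 * (norm x)\<^sup>2"
    "(\<lambda>n. (1 - 3 * (\<epsilon> / real (n + 4)) / \<epsilon>)\<^sup>2 * (norm x)\<^sup>2) \<longlonglongrightarrow> (1 - 3 * 0 / \<epsilon>)\<^sup>2 * (norm x)\<^sup>2"
    by (intro tendsto_intros l; use \<epsilon> in simp)+
  have d: "0 < \<epsilon> / real (n + 4)" "3 * (\<epsilon> / real (n + 4)) < \<epsilon>" for n
    using \<epsilon> by (simp_all add: field_simps add_pos_nonneg)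
  have "?I \<le> ennreal ((1 + 3 * 0 / \<epsilon>)\<^sup>2 * (norm x)\<^sup>2)"
    by (rule LIMSEQ_le_const[OF tendsto_ennrealI[OF lim(1)]]) (intro exI allI impI main[OF d, THEN conjunct2])
  moreover have "ennreal ((1 - 3 * 0 / \<epsilon>)\<^sup>2 * (norm x)\<^sup>2) \<le> ?I"
    by (rule LIMSEQ_le_const2[OF tendsto_ennrealI[OF lim(2)]]) (intro exI allI impI main[OF d, THEN conjunct1])
  ultimately show ?thesis by (simp add: P_def)
qed


section \<open>Recovering a finite measure from its Poisson integrals (Stieltjes inversion)\<close>

lemma poisson_integral_primitive:
  assumes e: "\<epsilon> > 0" and pq: "p \<le> q"
  shows "(\<integral>\<^sup>+a. ennreal (\<epsilon> / (cmod (complex_of_real t - Complex a \<epsilon>))\<^sup>2) * indicator {p..q} a \<partial>lborel)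
    = ennreal (arctan ((q - t) / \<epsilon>) - arctan ((p - t) / \<epsilon>))"
proof -
  have eq: "\<epsilon> / (cmod (complex_of_real t - Complex a \<epsilon>))\<^sup>2 = inverse (1 + ((a - t) / \<epsilon>)\<^sup>2) * (1 / \<epsilon>)" for a
  proof -
    define u where "u = (a - t) / \<epsilon>"
    have "(cmod (complex_of_real t - Complex a \<epsilon>))\<^sup>2 = \<epsilon>\<^sup>2 * (1 + u\<^sup>2)"
      using e by (simp add: u_def cmod_power2 power_divide field_simps power2_commute)
    then show ?thesis using e by (simp add: power2_eq_square inverse_eq_divide flip: u_def)
  qed
  show ?thesis
    unfolding eq
  proof (rule nn_integral_FTC_Icc[where F = "\<lambda>a. arctan ((a - t) / \<epsilon>)"])
    show "(\<lambda>a. inverse (1 + ((a - t) / \<epsilon>)\<^sup>2) * (1 / \<epsilon>)) \<in> borel_measurable borel" by measurable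
    show "DERIV (\<lambda>a. arctan ((a - t) / \<epsilon>)) a :> inverse (1 + ((a - t) / \<epsilon>)\<^sup>2) * (1 / \<epsilon>)" for a
      using e by (auto intro!: derivative_eq_intros)
    show "0 \<le> inverse (1 + ((a - t) / \<epsilon>)\<^sup>2) * (1 / \<epsilon>)" for a
      using e by (auto intro!: mult_nonneg_nonneg add_nonneg_nonneg)
  qed (rule pq)
qed

text \<open>The difference of arctangents tends to \<open>\<pi>\<close> times the indicator function of \<open>{p<..q}\<close>:
  the shift by \<open>1 / n\<close> is large compared with the scale \<open>1 / n\<^sup>2\<close>, which settles the end points.\<close>

lemma arctan_diff_tendsto_indicator:
  assumes "p < q"
  shows "(\<lambda>n. arctan ((q + 1 / real (Suc n) - t) / (1 / (real (Suc n))\<^sup>2)) - arctan ((p + 1 / real (Suc n) - t) / (1 / (real (Suc n))\<^sup>2)))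
    \<longlonglongrightarrow> pi * indicator {p<..q} t"
proof -
  have pos: "(\<lambda>n. arctan ((r + 1 / real (Suc n) - t) / (1 / (real (Suc n))\<^sup>2))) \<longlonglongrightarrow> pi / 2" if "t \<le> r" for r
  proof (rule filterlim_compose[OF tendsto_arctan_at_top], rule filterlim_at_top_mono)
    show "filterlim (\<lambda>n. real (Suc n)) at_top sequentially"
      using filterlim_real_sequentially by (rule filterlim_compose) (rule filterlim_Suc)
    show "eventually (\<lambda>n. real (Suc n) \<le> (r + 1 / real (Suc n) - t) / (1 / (real (Suc n))\<^sup>2)) sequentially"
    proof (intro always_eventually allI)
      fix n
      have "1 / real (Suc n) * (real (Suc n))\<^sup>2 \<le> (r + 1 / real (Suc n) - t) * (real (Suc n))\<^sup>2"
        using that by (intro mult_right_mono) auto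
      moreover have "1 / real (Suc n) * (real (Suc n))\<^sup>2 = real (Suc n)"
        by (simp add: power2_eq_square)
      ultimately show "real (Suc n) \<le> (r + 1 / real (Suc n) - t) / (1 / (real (Suc n))\<^sup>2)"
        by simp
    qed
  qed
  have neg: "(\<lambda>n. arctan ((r + 1 / real (Suc n) - t) / (1 / (real (Suc n))\<^sup>2))) \<longlonglongrightarrow> - (pi / 2)" if "r < t" for r
  proof -
    have "filterlim (\<lambda>n. (t - r - 1 / real (Suc n)) * (real (Suc n))\<^sup>2) at_top sequentially"
    proof (rule filterlim_tendsto_pos_mult_at_top)
      show "(\<lambda>n. t - r - 1 / real (Suc n)) \<longlonglongrightarrow> t - r - 0"
        by (intro tendsto_intros LIMSEQ_inverse_real_of_nat[unfolded inverse_eq_divide])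
      show "0 < t - r - 0" using that by simp
      have s: "filterlim (\<lambda>n. real (Suc n)) at_top sequentially"
        using filterlim_real_sequentially by (rule filterlim_compose) (rule filterlim_Suc)
      show "filterlim (\<lambda>n. (real (Suc n))\<^sup>2) at_top sequentially"
        by (rule filterlim_pow_at_top[OF _ s]) simp
    qed
    then have "(\<lambda>n. - arctan ((t - r - 1 / real (Suc n)) * (real (Suc n))\<^sup>2)) \<longlonglongrightarrow> - (pi / 2)"
      by (intro tendsto_minus filterlim_compose[OF tendsto_arctan_at_top])
    moreover have "- arctan ((t - r - 1 / real (Suc n)) * (real (Suc n))\<^sup>2) = arctan ((r + 1 / real (Suc n) - t) / (1 / (real (Suc n))\<^sup>2))" for n
      unfolding arctan_minus[symmetric] by (simp add: algebra_simps)
    ultimately show ?thesis by simp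
  qed
  consider "t \<le> p" | "p < t" "t \<le> q" | "q < t" by linarith
  then show ?thesis
  proof cases
    case 1
    then show ?thesis using tendsto_diff[OF pos[of q] pos[of p]] assms by simp
  next
    case 2
    then show ?thesis using tendsto_diff[OF pos[of q] neg[of p]] by simp
  next
    case 3
    then show ?thesis using tendsto_diff[OF neg[of q] neg[of p]] assms by simp
  qed
qed

text \<open>Integrating the Poisson integrals over a in [p, q] and exchanging integrals gives equal
  integrals of arctangent differences. Shifted and shrunk, these converge boundedly to pi times the
  indicator of (p, q], and half-open intervals determine a finite measure.\<close>

lemma measure_eq_poisson:
  assumes fin: "finite_measure M" "finite_measure N" and s: "sets M = sets borel" "sets N = sets borel"
    and eq: "\<And>a \<epsilon>. \<epsilon> > 0 \<Longrightarrow> (\<integral>\<^sup>+t. ennreal (1 / (cmod (complex_of_real t - Complex a \<epsilon>))\<^sup>2) \<partial>M)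
      = (\<integral>\<^sup>+t. ennreal (1 / (cmod (complex_of_real t - Complex a \<epsilon>))\<^sup>2) \<partial>N)"
  shows "M = N"
proof -
  interpret M: finite_measure M by fact
  interpret N: finite_measure N by fact
  have sp: "space M = UNIV" "space N = UNIV"
    using sets_eq_imp_space_eq[OF s(1)] sets_eq_imp_space_eq[OF s(2)] by auto
  let ?A = "\<lambda>p q \<epsilon> t. arctan ((q - t) / \<epsilon>) - arctan ((p - t) / \<epsilon>)"
  have swap: "(\<integral>\<^sup>+t. ennreal (?A p q \<epsilon> t) \<partial>K)
      = (\<integral>\<^sup>+a. indicator {p..q} a * (ennreal \<epsilon> * (\<integral>\<^sup>+t. ennreal (1 / (cmod (complex_of_real t - Complex a \<epsilon>))\<^sup>2) \<partial>K)) \<partial>lborel)"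
    if K: "finite_measure K" "sets K = sets borel" and e: "\<epsilon> > 0" and pq: "p \<le> q" for K p q \<epsilon>
  proof -
    interpret K: finite_measure K by fact
    interpret KL: pair_sigma_finite K "lborel :: real measure" by standard
    have [measurable_cong]: "sets K = sets borel" by fact
    have Cm [measurable]: "(\<lambda>a. Complex a \<epsilon>) \<in> borel_measurable borel"
      by (rule borel_measurable_continuous_onI) (simp add: Complex_eq continuous_intros)
    have "(\<integral>\<^sup>+t. ennreal (?A p q \<epsilon> t) \<partial>K)
        = (\<integral>\<^sup>+t. \<integral>\<^sup>+a. ennreal (\<epsilon> / (cmod (complex_of_real t - Complex a \<epsilon>))\<^sup>2) * indicator {p..q} a \<partial>lborel \<partial>K)"
      by (simp add: poisson_integral_primitive[OF e pq])
    also have "\<dots> = (\<integral>\<^sup>+a. \<integral>\<^sup>+t. ennreal (\<epsilon> / (cmod (complex_of_real t - Complex a \<epsilon>))\<^sup>2) * indicator {p..q} a \<partial>K \<partial>lborel)"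
      by (rule KL.Fubini'[symmetric]) measurable
    also have "\<dots> = (\<integral>\<^sup>+a. indicator {p..q} a * (ennreal \<epsilon> * (\<integral>\<^sup>+t. ennreal (1 / (cmod (complex_of_real t - Complex a \<epsilon>))\<^sup>2) \<partial>K)) \<partial>lborel)"
    proof (rule nn_integral_cong)
      fix a
      have "(\<integral>\<^sup>+t. ennreal (\<epsilon> / (cmod (complex_of_real t - Complex a \<epsilon>))\<^sup>2) * indicator {p..q} a \<partial>K)
          = (\<integral>\<^sup>+t. (indicator {p..q} a * ennreal \<epsilon>) * ennreal (1 / (cmod (complex_of_real t - Complex a \<epsilon>))\<^sup>2) \<partial>K)"
      proof (rule nn_integral_cong)
        fix t
        have "ennreal (\<epsilon> / (cmod (complex_of_real t - Complex a \<epsilon>))\<^sup>2) = ennreal \<epsilon> * ennreal (1 / (cmod (complex_of_real t - Complex a \<epsilon>))\<^sup>2)"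
          using e by (subst ennreal_mult[symmetric]) auto
        then show "ennreal (\<epsilon> / (cmod (complex_of_real t - Complex a \<epsilon>))\<^sup>2) * indicator {p..q} a
            = (indicator {p..q} a * ennreal \<epsilon>) * ennreal (1 / (cmod (complex_of_real t - Complex a \<epsilon>))\<^sup>2)"
          by (simp only: mult_ac)
      qed
      also have "\<dots> = (indicator {p..q} a * ennreal \<epsilon>) * (\<integral>\<^sup>+t. ennreal (1 / (cmod (complex_of_real t - Complex a \<epsilon>))\<^sup>2) \<partial>K)"
        by (rule nn_integral_cmult) measurable
      finally show "(\<integral>\<^sup>+t. ennreal (\<epsilon> / (cmod (complex_of_real t - Complex a \<epsilon>))\<^sup>2) * indicator {p..q} a \<partial>K)
          = indicator {p..q} a * (ennreal \<epsilon> * (\<integral>\<^sup>+t. ennreal (1 / (cmod (complex_of_real t - Complex a \<epsilon>))\<^sup>2) \<partial>K))"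
        by (simp only: mult.assoc)
    qed
    finally show ?thesis .
  qed
  have A_bd: "\<bar>?A p q \<epsilon> t\<bar> \<le> 2 * pi" for p q \<epsilon> t
    using arctan_bounded[of "(q - t) / \<epsilon>"] arctan_bounded[of "(p - t) / \<epsilon>"] by linarith
  have A_nn: "0 \<le> ?A p q \<epsilon> t" if "\<epsilon> > 0" "p \<le> q" for p q \<epsilon> t
    using that by (simp add: arctan_le_iff divide_right_mono)
  have A_meas: "(\<lambda>t. ?A p q \<epsilon> t) \<in> borel_measurable K" if "sets K = sets borel" for p q \<epsilon> K
    by (subst measurable_cong_sets[OF that refl]) measurable
  have A_int: "integrable K (?A p q \<epsilon>)" if "finite_measure K" "sets K = sets borel" for p q \<epsilon> K
    by (rule finite_measure.integrable_const_bound[OF that(1), of _ "2 * pi"]) (use A_bd A_meas[OF that(2)] in auto)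
  have A_eq: "(LINT t|M. ?A p q \<epsilon> t) = (LINT t|N. ?A p q \<epsilon> t)" if e: "\<epsilon> > 0" "p \<le> q" for p q \<epsilon>
  proof -
    have "ennreal (LINT t|M. ?A p q \<epsilon> t) = ennreal (LINT t|N. ?A p q \<epsilon> t)"
      unfolding nn_integral_eq_integral[OF A_int[OF fin(1) s(1)], symmetric, OF AE_I2[OF A_nn[OF e]]]
        nn_integral_eq_integral[OF A_int[OF fin(2) s(2)], symmetric, OF AE_I2[OF A_nn[OF e]]]
      unfolding swap[OF fin(1) s(1) e] swap[OF fin(2) s(2) e] by (simp only: eq[OF e(1)])
    then show ?thesis
      using A_nn[OF e] by (simp add: Bochner_Integration.integral_nonneg)
  qed
  have lim: "(\<lambda>n. LINT t|K. ?A (p + 1 / real (Suc n)) (q + 1 / real (Suc n)) (1 / (real (Suc n))\<^sup>2) t) \<longlonglongrightarrow> pi * measure K {p<..q}"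
    if K: "finite_measure K" "sets K = sets borel" and pq: "p < q" for K p q
  proof -
    interpret K: finite_measure K by fact
    have Ks: "{p<..q} \<in> sets K" using K by simp
    have "(\<lambda>n. LINT t|K. ?A (p + 1 / real (Suc n)) (q + 1 / real (Suc n)) (1 / (real (Suc n))\<^sup>2) t) \<longlonglongrightarrow> (LINT t|K. pi * indicator {p<..q} t)"
    proof (rule integral_dominated_convergence[where w = "\<lambda>t. 2 * pi"])
      show "(\<lambda>t. pi * indicator {p<..q} t) \<in> borel_measurable K" using Ks by measurable
      show "(\<lambda>t. ?A (p + 1 / real (Suc n)) (q + 1 / real (Suc n)) (1 / (real (Suc n))\<^sup>2) t) \<in> borel_measurable K" for n
        by (rule A_meas[OF K(2)])
      show "AE t in K. norm (?A (p + 1 / real (Suc n)) (q + 1 / real (Suc n)) (1 / (real (Suc n))\<^sup>2) t) \<le> 2 * pi" for n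
        unfolding real_norm_def by (intro AE_I2 A_bd)
    qed (use arctan_diff_tendsto_indicator[OF pq] in auto)
    then show ?thesis using Ks by simp
  qed
  have Ioc: "measure M {p<..q} = measure N {p<..q}" for p q
  proof (cases "p < q")
    case True
    have "pi * measure M {p<..q} = pi * measure N {p<..q}"
    proof (rule LIMSEQ_unique[OF lim[OF fin(1) s(1) True]])
      show "(\<lambda>n. LINT t|M. ?A (p + 1 / real (Suc n)) (q + 1 / real (Suc n)) (1 / (real (Suc n))\<^sup>2) t) \<longlonglongrightarrow> pi * measure N {p<..q}"
        using lim[OF fin(2) s(2) True] A_eq[of "1 / (real (Suc _))\<^sup>2" "p + 1 / real (Suc _)" "q + 1 / real (Suc _)"] True by simp
    qed
    then show ?thesis by simp
  qed simp
  have gen: "sets borel = sigma_sets UNIV (range (\<lambda>(a, b). {a<..b::real}))"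
    by (simp add: borel_sigma_sets_Ioc)
  show ?thesis
  proof (rule measure_eqI_generator_eq[where E = "range (\<lambda>(a, b). {a<..b::real})" and \<Omega> = UNIV and A = "\<lambda>i. {-real i<..real i}"])
    show "Int_stable (range (\<lambda>(a, b). {a<..b::real}))"
    proof (rule Int_stableI)
      fix A B assume "A \<in> range (\<lambda>(a, b). {a<..b::real})" "B \<in> range (\<lambda>(a, b). {a<..b::real})"
      then obtain a b c d where "A = {a<..b}" "B = {c<..d}" by auto
      then have "A \<inter> B = (\<lambda>(a, b). {a<..b}) (max a c, min b d)" by auto
      then show "A \<inter> B \<in> range (\<lambda>(a, b). {a<..b::real})" by blast
    qed
    show "emeasure M X = emeasure N X" if "X \<in> range (\<lambda>(a, b). {a<..b::real})" for X
      using that Ioc by (auto simp: M.emeasure_eq_measure N.emeasure_eq_measure)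
    have "\<exists>i. x \<in> {-real i<..real i}" for x
    proof -
      obtain i where "\<bar>x\<bar> < real i" using reals_Archimedean2 by blast
      then show ?thesis by (intro exI[of _ i]) auto
    qed
    then show "(\<Union>i. {-real i<..real i}) = UNIV" by blast
      show "range (\<lambda>i. {-real i<..real i}) \<subseteq> range (\<lambda>(a, b). {a<..b::real})"
      by auto
  qed (simp_all add: s gen M.emeasure_eq_measure)
qed

section \<open>The spectral measure of a Fourier multiplier\<close>

definition fourier_spectral_measure :: "real set \<Rightarrow> L2 \<Rightarrow> L2" where
  "fourier_spectral_measure B x = inv_fourier (mult_op (indicator B) (fourier x))"

lemma cinner_inv_fourier_left: "cinner (inv_fourier u) v = cinner u (fourier v)"
  using adjoint_fourier by (simp add: adjoint_pair_def)

lemma cinner_inv_fourier_right: "cinner u (inv_fourier v) = cinner (fourier u) v"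
  using adjoint_pair_sym[OF adjoint_fourier] by (simp add: adjoint_pair_def)

lemma projection_measure_fourier: "projection_measure fourier_spectral_measure"
  unfolding projection_measure_def
proof (intro conjI ballI allI impI)
  fix B :: "real set" assume [measurable]: "B \<in> sets borel"
  have i: "indicator B \<in> borel_measurable borel" by measurable
  show "bounded_clinear (fourier_spectral_measure B)"
    unfolding fourier_spectral_measure_def
    by (intro bounded_clinear_compose[OF bounded_clinear_inv_fourier] bounded_clinear_compose[OF bounded_clinear_mult_op]
        bounded_clinear_fourier i bounded_indicator)
  show "fourier_spectral_measure B \<circ> fourier_spectral_measure B = fourier_spectral_measure B"
    by (rule ext) (simp add: fourier_spectral_measure_def mult_op_mult_op[OF i bounded_indicator i bounded_indicator]
        indicator_inter_arith[symmetric])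
  fix x y
  have "cinner (mult_op (indicator B) u) v = cinner u (mult_op (indicator B) v)" for u v
  proof -
    have "(\<lambda>x. cnj (indicator B x)) = (indicator B :: real \<Rightarrow> complex)"
      by (auto simp: indicator_def)
    then show ?thesis
      using adjoint_mult_op[OF i bounded_indicator] by (simp add: adjoint_pair_def)
  qed
  then show "cinner (fourier_spectral_measure B x) y = cinner x (fourier_spectral_measure B y)"
    by (simp add: fourier_spectral_measure_def cinner_inv_fourier_left cinner_inv_fourier_right)
next
  show "fourier_spectral_measure UNIV = id"
    by (rule ext) (simp add: fourier_spectral_measure_def indicator_def mult_op_one)
next
  fix B :: "nat \<Rightarrow> real set" and x
  assume B: "range B \<subseteq> sets borel" "disjoint_family B"
  then have [measurable]: "B n \<in> sets borel" for n by auto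
  let ?S = "\<lambda>n. (\<Union>k<n. B k)"
  have sum: "(\<Sum>k<n. fourier_spectral_measure (B k) x) = inv_fourier (mult_op (indicator (?S n)) (fourier x))" for n
  proof (induction n)
    case 0
    have "mult_op (\<lambda>t. 0) (fourier x) = 0"
      by (rule mult_op_eqI) (use rep_L2_zero in auto)
    then show ?case by (simp add: bounded_clinearD[OF bounded_clinear_inv_fourier])
  next
    case (Suc n)
    have d: "?S n \<inter> B n = {}"
    proof -
      have "B k \<inter> B n = {}" if "k < n" for k
        using disjoint_family_onD[OF B(2), of k n] that by simp
      then show ?thesis by auto
    qed
    have "mult_op (indicator (?S (Suc n))) (fourier x) = mult_op (indicator (?S n)) (fourier x) + mult_op (indicator (B n)) (fourier x)"
    proof (rule mult_op_eqI[OF _ bounded_indicator])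
      have i: "indicator (?S n) \<in> borel_measurable borel" "indicator (B n) \<in> borel_measurable borel" by measurable
      show "AE t in lborel. rep_L2 (mult_op (indicator (?S n)) (fourier x) + mult_op (indicator (B n)) (fourier x)) t
          = indicator (?S (Suc n)) t * rep_L2 (fourier x) t"
        using rep_L2_add[of "mult_op (indicator (?S n)) (fourier x)" "mult_op (indicator (B n)) (fourier x)"]
          rep_mult_op[OF i(1) bounded_indicator, of "fourier x"] rep_mult_op[OF i(2) bounded_indicator, of "fourier x"]
      proof eventually_elim
        case (elim t)
        have "(indicator (?S (Suc n)) t :: complex) = indicator (?S n) t + indicator (B n) t"
        proof -
          have "(indicator (?S n) t :: complex) + indicator (B n) t = indicator (?S n \<union> B n) t"
            by (rule indicator_add[OF d])
          moreover have "?S (Suc n) = ?S n \<union> B n"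
            by (auto simp: lessThan_Suc)
          ultimately show ?thesis by simp
        qed
        then show ?case using elim by (simp add: distrib_right)
      qed
    qed measurable
    then show ?case
      using Suc by (simp add: bounded_clinearD[OF bounded_clinear_inv_fourier] fourier_spectral_measure_def)
  qed
  have "(\<lambda>n. mult_op (indicator (?S n)) (fourier x)) \<longlonglongrightarrow> mult_op (indicator (\<Union>k. B k)) (fourier x)"
  proof (rule mult_op_tendsto[where K = 1])
    fix t
    show "(\<lambda>n. indicator (?S n) t :: complex) \<longlonglongrightarrow> indicator (\<Union>k. B k) t"
    proof (cases "\<exists>k. t \<in> B k")
      case True
      then obtain k where k: "t \<in> B k" by blast
      have "eventually (\<lambda>n. (indicator (?S n) t :: complex) = indicator (\<Union>k. B k) t) sequentially"
        using eventually_gt_at_top[of k] by eventually_elim (use k in \<open>auto simp: indicator_def\<close>)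
      then show ?thesis by (rule tendsto_eventually)
    qed (auto simp: indicator_def)
  qed (auto simp: norm_indicator_le)
  then show "(\<lambda>n. fourier_spectral_measure (B n) x) sums fourier_spectral_measure (\<Union>n. B n) x"
    unfolding sums_def sum by (simp add: fourier_spectral_measure_def bounded_clinear_tendsto[OF bounded_clinear_inv_fourier])
qed

lemma scalar_measure_fourier:
  "scalar_measure fourier_spectral_measure x = density lborel (\<lambda>t. ennreal ((cmod (rep_L2 (fourier x) t))\<^sup>2))"
proof (rule measure_eqI)
  note sm = scalar_measure[OF projection_measure_fourier]
  show "sets (scalar_measure fourier_spectral_measure x) = sets (density lborel (\<lambda>t. ennreal ((cmod (rep_L2 (fourier x) t))\<^sup>2)))"
    by (simp add: sm(1))
  fix B assume "B \<in> sets (scalar_measure fourier_spectral_measure x)"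
  then have B [measurable]: "B \<in> sets borel" by (simp add: sm(1))
  have i: "indicator B \<in> borel_measurable borel" by measurable
  have "emeasure (scalar_measure fourier_spectral_measure x) B = ennreal ((norm (mult_op (indicator B) (fourier x)))\<^sup>2)"
    by (simp add: sm(3) fourier_spectral_measure_def)
  also have "\<dots> = (\<integral>\<^sup>+t. ennreal ((cmod (rep_L2 (mult_op (indicator B) (fourier x)) t))\<^sup>2) \<partial>lborel)"
    unfolding norm_rep_L2 using square_integrable_rep_L2
    by (intro nn_integral_eq_integral[symmetric]) (auto simp: square_integrable_def)
  also have "\<dots> = (\<integral>\<^sup>+t. ennreal ((cmod (rep_L2 (fourier x) t))\<^sup>2) * indicator B t \<partial>lborel)"
    by (rule nn_integral_cong_AE) (use rep_mult_op[OF i bounded_indicator, of "fourier x"] in \<open>eventually_elim, auto simp: indicator_def\<close>)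
  also have "\<dots> = emeasure (density lborel (\<lambda>t. ennreal ((cmod (rep_L2 (fourier x) t))\<^sup>2))) B"
    by (subst emeasure_density) auto
  finally show "emeasure (scalar_measure fourier_spectral_measure x) B = emeasure (density lborel (\<lambda>t. ennreal ((cmod (rep_L2 (fourier x) t))\<^sup>2))) B" .
qed

lemma spectral_domain_fourier:
  assumes [measurable]: "h \<in> borel_measurable borel"
  shows "x \<in> spectral_domain fourier_spectral_measure h \<longleftrightarrow> square_integrable (\<lambda>t. h t * rep_L2 (fourier x) t)"
proof -
  have "integrable (density lborel (\<lambda>t. ennreal ((cmod (rep_L2 (fourier x) t))\<^sup>2))) (\<lambda>t. (cmod (h t))\<^sup>2)
      \<longleftrightarrow> integrable lborel (\<lambda>t. (cmod (rep_L2 (fourier x) t))\<^sup>2 *\<^sub>R (cmod (h t))\<^sup>2)"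
    by (rule integrable_density) auto
  then show ?thesis
    by (simp add: spectral_domain_def scalar_measure_fourier square_integrable_def norm_mult power_mult_distrib mult.commute)
qed

text \<open>In |z + c x|^2 with c = i^k, only the term with coefficient c survives summation against
  (-i)^k.\<close>

lemma spectral_form_fourier:
  assumes [measurable]: "h \<in> borel_measurable borel"
    and z: "square_integrable (\<lambda>t. h t * rep_L2 (fourier z) t)" and x: "square_integrable (\<lambda>t. h t * rep_L2 (fourier x) t)"
  shows "spectral_form fourier_spectral_measure h z x = (LINT t|lborel. cnj (rep_L2 (fourier z) t) * (h t * rep_L2 (fourier x) t))"
proof -
  let ?z = "rep_L2 (fourier z)" and ?x = "rep_L2 (fourier x)"
  have i1: "integrable lborel (\<lambda>t. cnj (?z t) * (h t * ?z t))" "integrable lborel (\<lambda>t. cnj (?z t) * (h t * ?x t))"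
    "integrable lborel (\<lambda>t. cnj (?x t) * (h t * ?z t))" "integrable lborel (\<lambda>t. cnj (?x t) * (h t * ?x t))"
    by (intro square_integrable_product square_integrable_rep_L2 z x)+
  have part: "(LINT t|scalar_measure fourier_spectral_measure (z + c *\<^sub>C x). h t)
      = (LINT t|lborel. cnj (?z t) * (h t * ?z t)) + c * (LINT t|lborel. cnj (?z t) * (h t * ?x t))
        + cnj c * (LINT t|lborel. cnj (?x t) * (h t * ?z t)) + cnj c * c * (LINT t|lborel. cnj (?x t) * (h t * ?x t))" for c
  proof -
    have "(LINT t|scalar_measure fourier_spectral_measure (z + c *\<^sub>C x). h t)
        = (LINT t|lborel. (cmod (rep_L2 (fourier (z + c *\<^sub>C x)) t))\<^sup>2 *\<^sub>R h t)"
      unfolding scalar_measure_fourier by (rule integral_density) auto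
    also have "\<dots> = (LINT t|lborel. cnj (?z t) * (h t * ?z t) + c * (cnj (?z t) * (h t * ?x t))
        + cnj c * (cnj (?x t) * (h t * ?z t)) + cnj c * c * (cnj (?x t) * (h t * ?x t)))"
    proof (rule integral_cong_AE)
      have "fourier (z + c *\<^sub>C x) = fourier z + c *\<^sub>C fourier x"
        by (simp add: bounded_clinearD[OF bounded_clinear_fourier])
      then have "AE t in lborel. rep_L2 (fourier (z + c *\<^sub>C x)) t = ?z t + c * ?x t"
        using rep_L2_add[of "fourier z" "c *\<^sub>C fourier x"] rep_L2_scaleC[of c "fourier x"] by auto
      then show "AE t in lborel. (cmod (rep_L2 (fourier (z + c *\<^sub>C x)) t))\<^sup>2 *\<^sub>R h t
        = cnj (?z t) * (h t * ?z t) + c * (cnj (?z t) * (h t * ?x t))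
        + cnj c * (cnj (?x t) * (h t * ?z t)) + cnj c * c * (cnj (?x t) * (h t * ?x t))"
      proof eventually_elim
        case (elim t)
        have "(cmod (?z t + c * ?x t))\<^sup>2 *\<^sub>R h t = cnj (?z t + c * ?x t) * (?z t + c * ?x t) * h t"
          by (simp only: scaleR_conv_of_real of_real_power complex_mult_cnj_cmod')
        then show ?case unfolding elim by (simp add: algebra_simps)
      qed
    qed measurable
    also have "\<dots> = (LINT t|lborel. cnj (?z t) * (h t * ?z t)) + c * (LINT t|lborel. cnj (?z t) * (h t * ?x t))
        + cnj c * (LINT t|lborel. cnj (?x t) * (h t * ?z t)) + cnj c * c * (LINT t|lborel. cnj (?x t) * (h t * ?x t))"
      using i1 by simp
    finally show ?thesis .
  qed
  show ?thesis
    unfolding spectral_form_def sum_four part by (simp add: imaginary_powers algebra_simps)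
qed

text \<open>Multiplication by h belongs to the graph by Parseval. Conversely the defect d of an
  element of the graph is orthogonal to all transforms of domain vectors, and the truncations of d
  to |h| <= n are such transforms.\<close>

lemma spectral_integral_fourier:
  assumes h [measurable]: "h \<in> borel_measurable borel"
  shows "(x, y) \<in> spectral_integral fourier_spectral_measure h \<longleftrightarrow> (AE t in lborel. rep_L2 (fourier y) t = h t * rep_L2 (fourier x) t)"
proof
  assume eq: "AE t in lborel. rep_L2 (fourier y) t = h t * rep_L2 (fourier x) t"
  have xdom: "square_integrable (\<lambda>t. h t * rep_L2 (fourier x) t)"
    unfolding square_integrable_def
  proof
    have "integrable lborel (\<lambda>t. (cmod (rep_L2 (fourier y) t))\<^sup>2)"
      using square_integrable_rep_L2 by (simp add: square_integrable_def)
    then show "integrable lborel (\<lambda>t. (cmod (h t * rep_L2 (fourier x) t))\<^sup>2)"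
      by (subst integrable_cong_AE[where g = "\<lambda>t. (cmod (rep_L2 (fourier y) t))\<^sup>2"]) (use eq in \<open>auto elim: eventually_mono\<close>)
  qed measurable
  have "cinner z y = spectral_form fourier_spectral_measure h z x" if "z \<in> spectral_domain fourier_spectral_measure h" for z
  proof -
    have "cinner z y = (LINT t|lborel. cnj (rep_L2 (fourier z) t) * rep_L2 (fourier y) t)"
      by (simp flip: cinner_rep_L2)
    also have "\<dots> = (LINT t|lborel. cnj (rep_L2 (fourier z) t) * (h t * rep_L2 (fourier x) t))"
      by (rule integral_cong_AE) (use eq in \<open>auto elim: eventually_mono\<close>)
    also have "\<dots> = spectral_form fourier_spectral_measure h z x"
      using that by (intro spectral_form_fourier[symmetric] h xdom) (simp add: spectral_domain_fourier)
    finally show ?thesis .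
  qed
  then show "(x, y) \<in> spectral_integral fourier_spectral_measure h"
    using xdom by (simp add: spectral_integral_def spectral_domain_fourier)
next
  assume xy: "(x, y) \<in> spectral_integral fourier_spectral_measure h"
  let ?d = "\<lambda>t. rep_L2 (fourier y) t - h t * rep_L2 (fourier x) t"
  have xdom: "square_integrable (\<lambda>t. h t * rep_L2 (fourier x) t)"
    using xy by (simp add: spectral_integral_def spectral_domain_fourier)
  have d: "square_integrable ?d"
    by (intro square_integrable_diff square_integrable_rep_L2 xdom)
  have "AE t in lborel. cmod (h t) \<le> real n \<longrightarrow> ?d t = 0" for n :: nat
  proof -
    \<comment> \<open>The truncation to |h| <= n keeps both i d and h i d square integrable, so the
      test vector lies in the domain although h may be unbounded.\<close>
    define i :: "real \<Rightarrow> complex" where "i t = (if cmod (h t) \<le> real n then 1 else 0)" for t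
    have im [measurable]: "i \<in> borel_measurable borel" unfolding i_def by measurable
    have si: "square_integrable (\<lambda>t. i t * ?d t)"
    proof (rule square_integrable_mult[OF _ _ d])
      have "cmod (i t) \<le> 1" for t by (simp add: i_def)
      then show "bounded (range i)" by (auto simp: bounded_range_norm)
    qed measurable
    have hsi: "square_integrable (\<lambda>t. (h t * i t) * ?d t)"
    proof (rule square_integrable_mult[OF _ _ d])
      have "cmod (h t * i t) \<le> real n" for t by (auto simp: i_def)
      then show "bounded (range (\<lambda>t. h t * i t))" by (auto simp: bounded_range_norm)
    qed measurable
    define z where "z = inv_fourier (abs_L2 (\<lambda>t. i t * ?d t))"
    have fz: "AE t in lborel. rep_L2 (fourier z) t = i t * ?d t"
      unfolding z_def fourier_inv_fourier by (rule rep_abs_L2[OF si])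
    have zdom: "square_integrable (\<lambda>t. h t * rep_L2 (fourier z) t)"
      unfolding square_integrable_def
    proof
      have "integrable lborel (\<lambda>t. (cmod ((h t * i t) * ?d t))\<^sup>2)"
        using hsi unfolding square_integrable_def by blast
      then show "integrable lborel (\<lambda>t. (cmod (h t * rep_L2 (fourier z) t))\<^sup>2)"
        by (subst integrable_cong_AE[where g = "\<lambda>t. (cmod ((h t * i t) * ?d t))\<^sup>2"])
           (use fz in \<open>auto elim!: eventually_mono simp: mult.assoc\<close>)
    qed measurable
    have "cinner z y = spectral_form fourier_spectral_measure h z x"
      using xy zdom by (simp add: spectral_integral_def spectral_domain_fourier)
    also have "\<dots> = (LINT t|lborel. cnj (rep_L2 (fourier z) t) * (h t * rep_L2 (fourier x) t))"
      by (rule spectral_form_fourier[OF h zdom xdom])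
    finally have "(LINT t|lborel. cnj (rep_L2 (fourier z) t) * rep_L2 (fourier y) t) = (LINT t|lborel. cnj (rep_L2 (fourier z) t) * (h t * rep_L2 (fourier x) t))"
      by (simp flip: cinner_rep_L2)
    then have "(LINT t|lborel. cnj (rep_L2 (fourier z) t) * ?d t) = 0"
      using square_integrable_product[OF square_integrable_rep_L2 square_integrable_rep_L2, of "fourier z" "fourier y"]
        square_integrable_product[OF square_integrable_rep_L2 xdom, of "fourier z"]
      by (simp add: right_diff_distrib)
    also have "(LINT t|lborel. cnj (rep_L2 (fourier z) t) * ?d t) = (LINT t|lborel. complex_of_real ((cmod (i t * ?d t))\<^sup>2))"
    proof (rule integral_cong_AE)
      show "AE t in lborel. cnj (rep_L2 (fourier z) t) * ?d t = complex_of_real ((cmod (i t * ?d t))\<^sup>2)"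
        using fz
      proof eventually_elim
        case (elim t)
        show ?case unfolding elim by (auto simp: i_def complex_mult_cnj_cmod' simp del: complex_cnj_diff)
      qed
    qed measurable
    finally have "(LINT t|lborel. (cmod (i t * ?d t))\<^sup>2) = 0"
      by (simp only: integral_complex_of_real of_real_eq_0_iff)
    then have "AE t in lborel. (cmod (i t * ?d t))\<^sup>2 = 0"
      using si by (subst (asm) integral_nonneg_eq_0_iff_AE) (auto simp: square_integrable_def)
    then show ?thesis
      by eventually_elim (auto simp: i_def split: if_splits)
  qed
  then have "AE t in lborel. \<forall>n::nat. cmod (h t) \<le> real n \<longrightarrow> ?d t = 0"
    by (intro AE_all_countable[THEN iffD2] allI)
  then show "AE t in lborel. rep_L2 (fourier y) t = h t * rep_L2 (fourier x) t"
  proof eventually_elim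
    case (elim t)
    obtain n where "cmod (h t) \<le> real n" using real_arch_simple by blast
    then show ?case using elim[rule_format, of n] by simp
  qed
qed

text \<open>The resolvent vector x = (D - \<zeta>)^-1 v is computed on the Fourier side. Its
  membership in the graph does not mention the spectral measure, so both scalar measures of v have
  Poisson integral ||x||^2 at \<zeta>.\<close>

lemma scalar_measure_unique:
  assumes E: "projection_measure E"
    and eq: "spectral_integral fourier_spectral_measure complex_of_real = spectral_integral E complex_of_real"
  shows "scalar_measure E v = scalar_measure fourier_spectral_measure v"
proof (rule measure_eq_poisson)
  note sm = scalar_measure[OF E] and smf = scalar_measure[OF projection_measure_fourier]
  show "finite_measure (scalar_measure E v)" "finite_measure (scalar_measure fourier_spectral_measure v)"
    "sets (scalar_measure E v) = sets borel" "sets (scalar_measure fourier_spectral_measure v) = sets borel"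
    by (fact sm smf)+
  fix a \<epsilon> :: real assume e: "\<epsilon> > 0"
  define \<zeta> where "\<zeta> = Complex a \<epsilon>"
  define r where "r t = 1 / (complex_of_real t - \<zeta>)" for t
  have [measurable]: "r \<in> borel_measurable borel" unfolding r_def by measurable
  have nz: "complex_of_real t - \<zeta> \<noteq> 0" for t
    using e by (auto simp: \<zeta>_def complex_eq_iff)
  have rb: "bounded (range r)"
    unfolding bounded_range_norm
  proof (intro exI allI)
    fix t
    have "\<epsilon> \<le> cmod (complex_of_real t - \<zeta>)"
      using abs_Im_le_cmod[of "complex_of_real t - \<zeta>"] e by (simp add: \<zeta>_def)
    then show "cmod (r t) \<le> 1 / \<epsilon>"
      using e by (simp add: r_def norm_divide frac_le)
  qed
  \<comment> \<open>Division by t - \<zeta> is a bounded multiplier because \<zeta> is not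
    real.\<close>
  define x where "x = inv_fourier (mult_op r (fourier v))"
  have fx: "AE t in lborel. rep_L2 (fourier x) t = r t * rep_L2 (fourier v) t"
    unfolding x_def fourier_inv_fourier by (rule rep_mult_op[OF _ rb]) measurable
  have "(x, v + \<zeta> *\<^sub>C x) \<in> spectral_integral fourier_spectral_measure complex_of_real"
  proof (subst spectral_integral_fourier)
    have "fourier (v + \<zeta> *\<^sub>C x) = fourier v + \<zeta> *\<^sub>C fourier x"
      by (simp add: bounded_clinearD[OF bounded_clinear_fourier])
    then have "AE t in lborel. rep_L2 (fourier (v + \<zeta> *\<^sub>C x)) t = rep_L2 (fourier v) t + \<zeta> * rep_L2 (fourier x) t"
      using rep_L2_add[of "fourier v" "\<zeta> *\<^sub>C fourier x"] rep_L2_scaleC[of \<zeta> "fourier x"] by auto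
    then show "AE t in lborel. rep_L2 (fourier (v + \<zeta> *\<^sub>C x)) t = complex_of_real t * rep_L2 (fourier x) t"
      using fx
    proof eventually_elim
      case (elim t)
      have "(complex_of_real t - \<zeta>) * r t = 1"
        using nz[of t] by (simp add: r_def)
      then have "rep_L2 (fourier v) t = (complex_of_real t - \<zeta>) * r t * rep_L2 (fourier v) t"
        by simp
      then show ?case unfolding elim by (simp add: algebra_simps)
    qed
  qed simp
  note mem = this this[unfolded eq]
  have "Im \<zeta> \<noteq> 0" using e by (simp add: \<zeta>_def)
  from poisson_integral_scalar_measure[OF E mem(2) this] poisson_integral_scalar_measure[OF projection_measure_fourier mem(1) this]
  show "(\<integral>\<^sup>+t. ennreal (1 / (cmod (complex_of_real t - Complex a \<epsilon>))\<^sup>2) \<partial>scalar_measure E v)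
      = (\<integral>\<^sup>+t. ennreal (1 / (cmod (complex_of_real t - Complex a \<epsilon>))\<^sup>2) \<partial>scalar_measure fourier_spectral_measure v)"
    by (simp add: \<zeta>_def)
qed

text \<open>\<open>spectral_integral\<close> sees a spectral measure only through its scalar
  measures. These are compared, rather than the measures themselves, which are unconstrained off the
  Borel sets.\<close>

lemma functional_calculus_fourier:
  assumes T: "T = spectral_integral fourier_spectral_measure complex_of_real"
  shows "functional_calculus h T = spectral_integral fourier_spectral_measure h"
proof -
  define E where "E = (SOME E. is_spectral_measure E T)"
  have "is_spectral_measure fourier_spectral_measure T"
    by (simp add: is_spectral_measure_def T projection_measure_fourier)
  then have "is_spectral_measure E T"
    unfolding E_def by (rule someI[of "\<lambda>E. is_spectral_measure E T"])
  then have E: "projection_measure E" "T = spectral_integral E complex_of_real"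
    by (auto simp: is_spectral_measure_def)
  have "scalar_measure E v = scalar_measure fourier_spectral_measure v" for v
    by (rule scalar_measure_unique[OF E(1)]) (use T E(2) in simp)
  then have "spectral_integral E h = spectral_integral fourier_spectral_measure h"
    by (simp add: spectral_integral_def spectral_form_def spectral_domain_def)
  then show ?thesis by (simp add: functional_calculus_def E_def)
qed

lemma op_of_graph_functional_calculus:
  assumes T: "T = spectral_integral fourier_spectral_measure complex_of_real"
    and h: "h \<in> borel_measurable borel" "bounded (range h)"
  shows "op_of_graph (functional_calculus h T) x = inv_fourier (mult_op h (fourier x))"
  unfolding op_of_graph_def functional_calculus_fourier[OF T] spectral_integral_fourier[OF h(1)]
proof (rule the_equality)
  show "AE t in lborel. rep_L2 (fourier (inv_fourier (mult_op h (fourier x)))) t = h t * rep_L2 (fourier x) t"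
    unfolding fourier_inv_fourier by (rule rep_mult_op[OF h])
  fix y assume "AE t in lborel. rep_L2 (fourier y) t = h t * rep_L2 (fourier x) t"
  from mult_op_eqI[OF h this] have "inv_fourier (mult_op h (fourier x)) = inv_fourier (fourier y)" by simp
  then show "y = inv_fourier (mult_op h (fourier x))" by simp
qed

section \<open>Smooth functions with compact support\<close>

definition smooth :: "(real \<Rightarrow> real) \<Rightarrow> bool" where
  "smooth f \<longleftrightarrow> (\<forall>n. (deriv ^^ n) f differentiable_on UNIV)"

text \<open>A coinduction principle: a class that contains a derivative of each of its members
  consists of smooth functions. It replaces formulas for iterated derivatives.\<close>

lemma smooth_closed_class:
  assumes cl: "\<And>f. f \<in> C \<Longrightarrow> \<exists>f'\<in>C. \<forall>x. DERIV f x :> f' x" and f: "f \<in> C"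
  shows "smooth f"
proof -
  have d: "deriv g \<in> C" if g: "g \<in> C" for g
  proof -
    obtain g' where g': "g' \<in> C" "\<And>x. DERIV g x :> g' x" using cl[OF g] by blast
    then have "deriv g = g'" by (intro ext DERIV_imp_deriv)
    with g' show ?thesis by simp
  qed
  have "(deriv ^^ n) f \<in> C" for n
    by (induction n) (auto simp: f d)
  moreover have "g differentiable_on UNIV" if "g \<in> C" for g
    using cl[OF that] unfolding differentiable_on_def real_differentiable_def by blast
  ultimately show ?thesis by (simp add: smooth_def)
qed

lemma smooth_deriv:
  assumes "smooth f"
  shows "smooth (deriv f)" and "DERIV f x :> deriv f x"
proof -
  have "(deriv ^^ n) (deriv f) differentiable_on UNIV" for n
    using assms[unfolded smooth_def, rule_format, of "Suc n"] by (simp add: funpow_swap1)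
  then show "smooth (deriv f)" by (simp add: smooth_def)
  have "f differentiable_on UNIV"
    using assms[unfolded smooth_def, rule_format, of 0] by simp
  then show "DERIV f x :> deriv f x"
    by (simp add: differentiable_on_def DERIV_deriv_iff_real_differentiable)
qed

lemma smooth_continuous: "smooth f \<Longrightarrow> continuous_on A f"
  by (meson DERIV_continuous_on has_field_derivative_at_within smooth_deriv(2))

lemma smooth_antiderivative:
  assumes "smooth f" "\<And>x. DERIV F x :> f x"
  shows "smooth F"
proof (rule smooth_closed_class[of "insert F {g. smooth g}"])
  fix h assume "h \<in> insert F {g. smooth g}"
  then consider "h = F" | "smooth h" by blast
  then show "\<exists>h'\<in>insert F {g. smooth g}. \<forall>x. DERIV h x :> h' x"
  proof cases
    case 1
    then show ?thesis using assms by (intro bexI[of _ f]) auto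
  next
    case 2
    then show ?thesis by (intro bexI[of _ "deriv h"]) (auto intro: smooth_deriv)
  qed
qed simp

lemma smooth_diff:
  assumes "smooth f" "smooth g"
  shows "smooth (\<lambda>x. f x - g x)"
proof (rule smooth_closed_class[of "{\<lambda>x. f x - g x | f g. smooth f \<and> smooth g}"])
  fix h assume "h \<in> {\<lambda>x. f x - g x | f g. smooth f \<and> smooth g}"
  then obtain f g where h: "h = (\<lambda>x. f x - g x)" "smooth f" "smooth g" by blast
  show "\<exists>h'\<in>{\<lambda>x. f x - g x | f g. smooth f \<and> smooth g}. \<forall>x. DERIV h x :> h' x"
  proof (intro bexI allI)
    show "DERIV h x :> deriv f x - deriv g x" for x
      unfolding h(1) by (intro DERIV_diff smooth_deriv h)
    show "(\<lambda>x. deriv f x - deriv g x) \<in> {\<lambda>x. f x - g x | f g. smooth f \<and> smooth g}"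
      using smooth_deriv(1) h by blast
  qed
qed (use assms in blast)

lemma smooth_affine:
  assumes "smooth f"
  shows "smooth (\<lambda>x. k * f (c * x + d))"
proof (rule smooth_closed_class[of "{\<lambda>x. k * f (c * x + d) | f k. smooth f}"])
  fix h assume "h \<in> {\<lambda>x. k * f (c * x + d) | f k. smooth f}"
  then obtain f k where h: "h = (\<lambda>x. k * f (c * x + d))" "smooth f" by blast
  show "\<exists>h'\<in>{\<lambda>x. k * f (c * x + d) | f k. smooth f}. \<forall>x. DERIV h x :> h' x"
  proof (intro bexI allI)
    fix x
    have "DERIV (\<lambda>x. c * x + d) x :> c"
      by (auto intro!: derivative_eq_intros)
    from DERIV_cmult[OF DERIV_chain2[OF smooth_deriv(2)[OF h(2)] this], of k]
    show "DERIV h x :> (k * c) * deriv f (c * x + d)"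
      unfolding h(1) by (rule DERIV_cong) simp
  next
    show "(\<lambda>x. (k * c) * deriv f (c * x + d)) \<in> {\<lambda>x. k * f (c * x + d) | f k. smooth f}"
      using smooth_deriv(1)[OF h(2)] by blast
  qed
qed (use assms in blast)

section \<open>A smooth step function\<close>

definition flat_exp :: "real poly \<Rightarrow> real \<Rightarrow> real" where
  "flat_exp p x = (if 0 < x then poly p (1 / x) * exp (- (1 / x)) else 0)"

lemma poly_times_exp_neg_tendsto: "((\<lambda>y. poly p y * exp (- y)) \<longlongrightarrow> 0) (at_top :: real filter)"
proof -
  have "((\<lambda>y. \<Sum>i\<le>degree p. coeff p i * (y ^ i / exp y)) \<longlongrightarrow> (\<Sum>i\<le>degree p. coeff p i * 0)) (at_top :: real filter)"
    by (intro tendsto_intros tendsto_power_div_exp_0)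
  then show ?thesis
    by (simp add: poly_altdef sum_distrib_right exp_minus divide_inverse mult.assoc)
qed

text \<open>With y = 1/x the chain rule gives y^2 (p(y) - p'(y)) exp(-y), which is again of the form
  \<open>flat_exp\<close>. At 0 the exponential beats every polynomial in y.\<close>

lemma DERIV_flat_exp: "DERIV (flat_exp p) x :> flat_exp (monom 1 2 * (p - pderiv p)) x"
proof -
  consider "x > 0" | "x = 0" | "x < 0" by linarith
  then show ?thesis
  proof cases
    case 1
    have "DERIV (\<lambda>x. poly p (1 / x) * exp (- (1 / x))) x :> flat_exp (monom 1 2 * (p - pderiv p)) x"
      using 1 by (auto intro!: derivative_eq_intros DERIV_chain2[OF poly_DERIV] simp: flat_exp_def poly_monom field_simps power2_eq_square)
    then show ?thesis
      by (rule DERIV_cong_ev[OF refl _ refl, THEN iffD1, rotated])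
         (use 1 in \<open>auto simp: flat_exp_def intro!: eventually_mono[OF eventually_nhds_in_open[of "{0<..}"]]\<close>)
  next
    case 3
    have "DERIV (\<lambda>x. 0) x :> flat_exp (monom 1 2 * (p - pderiv p)) x"
      using 3 by (simp add: flat_exp_def)
    then show ?thesis
      by (rule DERIV_cong_ev[OF refl _ refl, THEN iffD1, rotated])
         (use 3 in \<open>auto simp: flat_exp_def intro!: eventually_mono[OF eventually_nhds_in_open[of "{..<0}"]]\<close>)
  next
    case 2
    have "((\<lambda>h. (flat_exp p (0 + h) - flat_exp p 0) / h) \<longlongrightarrow> 0) (at 0)"
    proof (rule filterlim_split_at)
      have "eventually (\<lambda>h. (flat_exp p (0 + h) - flat_exp p 0) / h = 0) (at_left 0)"
        unfolding eventually_at_left_field by (intro exI[of _ "-1"]) (auto simp: flat_exp_def)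
      then show "((\<lambda>h. (flat_exp p (0 + h) - flat_exp p 0) / h) \<longlongrightarrow> 0) (at_left 0)"
        by (rule tendsto_eventually)
      \<comment> \<open>\<open>pCons 0 p\<close> is X p: dividing by h multiplies the polynomial in
        1/h by its variable.\<close>
      have "((\<lambda>h. poly (pCons 0 p) (inverse h) * exp (- inverse h)) \<longlongrightarrow> 0) (at_right 0)"
        by (rule filterlim_compose[OF poly_times_exp_neg_tendsto filterlim_inverse_at_top_right])
      moreover have "eventually (\<lambda>h. poly (pCons 0 p) (inverse h) * exp (- inverse h) = (flat_exp p (0 + h) - flat_exp p 0) / h) (at_right 0)"
        unfolding eventually_at_right_field by (intro exI[of _ 1]) (auto simp: flat_exp_def field_simps)
      ultimately show "((\<lambda>h. (flat_exp p (0 + h) - flat_exp p 0) / h) \<longlongrightarrow> 0) (at_right 0)"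
        by (rule Lim_transform_eventually)
    qed
    then show ?thesis using 2 by (simp add: DERIV_def flat_exp_def)
  qed
qed

text \<open>Sums are included because the product rule leaves the set of products.\<close>

inductive_set bump_class :: "(real \<Rightarrow> real) set" where
  prod: "(\<lambda>x. flat_exp p x * flat_exp q (1 - x)) \<in> bump_class"
| add: "f \<in> bump_class \<Longrightarrow> g \<in> bump_class \<Longrightarrow> (\<lambda>x. f x + g x) \<in> bump_class"

lemma smooth_bump_class:
  assumes "f \<in> bump_class"
  shows "smooth f"
proof (rule smooth_closed_class[OF _ assms])
  fix f assume "f \<in> bump_class"
  then show "\<exists>f'\<in>bump_class. \<forall>x. DERIV f x :> f' x"
  proof induction
    case (prod p q)
    let ?D = "\<lambda>p. monom 1 2 * (p - pderiv p)"
    \<comment> \<open>The sign from differentiating 1 - x is absorbed into the polynomial of the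
      second factor.\<close>
    have "DERIV (\<lambda>x. flat_exp p x * flat_exp q (1 - x)) x :> flat_exp (?D p) x * flat_exp q (1 - x) + flat_exp p x * flat_exp (- ?D q) (1 - x)" for x
    proof -
      have "DERIV (\<lambda>x. 1 - x) x :> (-1::real)" by (auto intro!: derivative_eq_intros)
      from DERIV_mult[OF DERIV_flat_exp DERIV_chain2[OF DERIV_flat_exp this], of p q]
      show ?thesis by (rule DERIV_cong) (simp add: flat_exp_def)
    qed
    moreover have "(\<lambda>x. flat_exp (?D p) x * flat_exp q (1 - x) + flat_exp p x * flat_exp (- ?D q) (1 - x)) \<in> bump_class"
      by (intro bump_class.intros)
    ultimately show ?case
      by (intro bexI[of _ "\<lambda>x. flat_exp (?D p) x * flat_exp q (1 - x) + flat_exp p x * flat_exp (- ?D q) (1 - x)"] allI)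
  next
    case (add f g)
    then obtain f' g' where "f' \<in> bump_class" "\<forall>x. DERIV f x :> f' x" "g' \<in> bump_class" "\<forall>x. DERIV g x :> g' x"
      by blast
    then show ?case
      by (intro bexI[of _ "\<lambda>x. f' x + g' x"] allI DERIV_add bump_class.add) simp_all
  qed
qed

text \<open>H is the primitive of a bump on (0, 1), normalised by its total mass. The bump b is
  returned too: with mass 1 it serves below as an approximate identity.\<close>

lemma smooth_step_exists:
  obtains b H :: "real \<Rightarrow> real" where "smooth b" "smooth H" "\<And>x. DERIV H x :> b x" "\<And>x. 0 \<le> b x"
    "\<forall>x. x \<le> 0 \<or> 1 \<le> x \<longrightarrow> b x = 0" "\<forall>x\<le>0. H x = 0" "\<forall>x\<ge>1. H x = 1" "\<And>x. 0 \<le> H x \<and> H x \<le> 1"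
proof -
  define b0 where "b0 x = flat_exp 1 x * flat_exp 1 (1 - x)" for x
  have b0: "smooth b0"
    unfolding b0_def[abs_def] by (intro smooth_bump_class bump_class.prod)
  have b0_nn: "0 \<le> b0 x" and b0_pos: "0 < x \<Longrightarrow> x < 1 \<Longrightarrow> 0 < b0 x" and b0_0: "x \<le> 0 \<or> 1 \<le> x \<Longrightarrow> b0 x = 0" for x
    by (auto simp: b0_def flat_exp_def)
  define H0 where "H0 x = (LBINT y=0..x. b0 y)" for x :: real
  have DH0: "DERIV H0 x :> b0 x" for x
  proof -
    have "((\<lambda>u. LBINT y=ereal 0..u. b0 y) has_vector_derivative b0 x) (at x within {min 0 x - 1..max 0 x + 1})"
      by (rule interval_integral_FTC2) (auto intro: smooth_continuous[OF b0])
    moreover have "at x within {min 0 x - 1..max 0 x + 1} = at x"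
      by (rule at_within_interior) (auto simp: interior_atLeastAtMost_real min_def max_def)
    ultimately have "((\<lambda>u. LBINT y=ereal 0..u. b0 y) has_vector_derivative b0 x) (at x)"
      by simp
    then show ?thesis
      by (simp add: has_real_derivative_iff_has_vector_derivative H0_def[abs_def] zero_ereal_def)
  qed
  have H00: "H0 0 = 0" by (simp add: H0_def zero_ereal_def)
  have mono: "H0 x \<le> H0 y" if "x \<le> y" for x y
    using that by (rule DERIV_nonneg_imp_nondecreasing) (use DH0 b0_nn in blast)
  have c: "H0 1 > 0"
  proof -
    obtain z where "0 < z" "z < 1" "H0 1 - H0 0 = (1 - 0) * b0 z"
      using MVT2[of 0 1 H0 b0] DH0 by auto
    then show ?thesis using b0_pos[of z] by (simp add: H00)
  qed
  have left: "H0 x = 0" if "x \<le> 0" for x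
  proof (cases "x = 0")
    case False
    with that have "x < 0" by simp
    then obtain z where "x < z" "z < 0" "H0 0 - H0 x = (0 - x) * b0 z"
      using MVT2[of x 0 H0 b0] DH0 by auto
    then show ?thesis using b0_0[of z] by (simp add: H00)
  qed (simp add: H00)
  have right: "H0 x = H0 1" if "1 \<le> x" for x
  proof (cases "x = 1")
    case False
    with that have "1 < x" by simp
    then obtain z where "1 < z" "z < x" "H0 x - H0 1 = (x - 1) * b0 z"
      using MVT2[of 1 x H0 b0] DH0 by auto
    then show ?thesis using b0_0[of z] by simp
  qed simp
  have bd: "0 \<le> H0 x \<and> H0 x \<le> H0 1" for x
    using mono[of 0 x] mono[of x 1] left[of x] right[of x] c by (cases "x \<le> 0"; cases "1 \<le> x") (auto simp: H00)
  have sb: "smooth (\<lambda>x. (1 / H0 1) * b0 (1 * x + 0))"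
    by (rule smooth_affine[OF b0])
  show thesis
  proof (rule that[of "\<lambda>x. (1 / H0 1) * b0 x" "\<lambda>x. (1 / H0 1) * H0 x"])
    show s: "smooth (\<lambda>x. (1 / H0 1) * b0 x)" using sb by simp
    show d: "DERIV (\<lambda>x. (1 / H0 1) * H0 x) x :> (1 / H0 1) * b0 x" for x
      by (rule DERIV_cmult[OF DH0])
    show "smooth (\<lambda>x. (1 / H0 1) * H0 x)" by (rule smooth_antiderivative[OF s d])
    show "0 \<le> 1 / H0 1 * b0 x" for x using c b0_nn[of x] by simp
    show "\<forall>x. x \<le> 0 \<or> 1 \<le> x \<longrightarrow> 1 / H0 1 * b0 x = 0" using b0_0 by simp
    show "\<forall>x\<le>0. 1 / H0 1 * H0 x = 0" using left by simp
    have "1 / H0 1 * H0 x = 1" if "1 \<le> x" for x unfolding right[OF that] using c by simp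
    then show "\<forall>x\<ge>1. 1 / H0 1 * H0 x = 1" by blast
    show "0 \<le> 1 / H0 1 * H0 x \<and> 1 / H0 1 * H0 x \<le> 1" for x using bd[of x] c by (simp add: divide_le_eq)
  qed
qed

lemma integral_derivative_compact_support:
  fixes F f :: "real \<Rightarrow> complex"
  assumes d: "\<And>x. (F has_vector_derivative f x) (at x)" and cont: "continuous_on UNIV f"
    and F0: "\<And>x. \<bar>x\<bar> \<ge> K \<Longrightarrow> F x = 0" and f0: "\<And>x. \<bar>x\<bar> \<ge> K \<Longrightarrow> f x = 0"
  shows "integral\<^sup>L lborel f = 0"
proof -
  define L where "L = \<bar>K\<bar> + 1"
  have "(LINT x|lborel. indicator {-L..L} x *\<^sub>R f x) = F L - F (-L)"
  proof (rule integral_FTC_Icc)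
    show "(F has_vector_derivative f x) (at x within {-L..L})" for x
      by (rule has_vector_derivative_at_within[OF d])
    show "continuous_on {-L..L} f" by (rule continuous_on_subset[OF cont]) simp
  qed (simp add: L_def)
  also have "F L - F (-L) = 0" using F0 by (simp add: L_def)
  also have "(\<lambda>x. indicator {-L..L} x *\<^sub>R f x) = f"
  proof
    fix x
    show "indicator {-L..L} x *\<^sub>R f x = f x"
    proof (cases "x \<in> {-L..L}")
      case False
      then have "\<bar>x\<bar> \<ge> K" by (auto simp: L_def)
      with f0 False show ?thesis by simp
    qed simp
  qed
  finally show ?thesis .
qed

lemma test_functionD:
  assumes "test_function \<phi>"
  shows "smooth \<phi>" and "\<exists>K. (\<forall>x. \<bar>x\<bar> \<ge> K \<longrightarrow> \<phi> x = 0) \<and> (\<forall>x. \<bar>x\<bar> \<ge> K \<longrightarrow> deriv \<phi> x = 0)"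
proof -
  show "smooth \<phi>" using assms by (simp add: test_function_def smooth_def)
  obtain K where K: "\<And>x. \<phi> x \<noteq> 0 \<Longrightarrow> \<bar>x\<bar> \<le> K"
    using assms by (auto simp: test_function_def bounded_iff)
  show "\<exists>K. (\<forall>x. \<bar>x\<bar> \<ge> K \<longrightarrow> \<phi> x = 0) \<and> (\<forall>x. \<bar>x\<bar> \<ge> K \<longrightarrow> deriv \<phi> x = 0)"
  proof (intro exI[of _ "\<bar>K\<bar> + 1"] conjI allI impI)
    show "\<phi> x = 0" if "\<bar>K\<bar> + 1 \<le> \<bar>x\<bar>" for x using K[of x] that by (cases "\<phi> x = 0") auto
    show "deriv \<phi> x = 0" if "\<bar>K\<bar> + 1 \<le> \<bar>x\<bar>" for x
    proof -
      have "eventually (\<lambda>y. y \<in> {y. \<bar>K\<bar> < \<bar>y\<bar>}) (nhds x)"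
        using that by (intro eventually_nhds_in_open open_Collect_less continuous_intros) auto
      then have "eventually (\<lambda>y. \<phi> y = 0) (nhds x)"
        by eventually_elim (use K in force)
      then have "DERIV \<phi> x :> 0"
        using DERIV_cong_ev[of x x \<phi> "\<lambda>y. 0" 0 0] by simp
      then show ?thesis by (rule DERIV_imp_deriv)
    qed
  qed
qed

lemma test_functionI:
  assumes "smooth \<phi>" "\<And>x. \<bar>x\<bar> \<ge> K \<Longrightarrow> \<phi> x = 0"
  shows "test_function \<phi>"
  unfolding test_function_def
proof
  show "\<forall>n. (deriv ^^ n) \<phi> differentiable_on UNIV"
    using assms(1) by (simp add: smooth_def)
  have "\<bar>x\<bar> \<le> K" if "\<phi> x \<noteq> 0" for x
    using assms(2)[of x] that by linarith
  then show "bounded {x. \<phi> x \<noteq> 0}"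
    by (auto simp: bounded_iff)
qed

lemma test_function_square_integrable:
  assumes "continuous_on UNIV \<phi>" "\<forall>x. \<bar>x\<bar> \<ge> K \<longrightarrow> \<phi> x = (0::real)"
  shows "square_integrable (\<lambda>x. complex_of_real (\<phi> x))" and "integrable lborel (\<lambda>x. complex_of_real (\<phi> x))"
proof -
  have [measurable]: "\<phi> \<in> borel_measurable borel"
    using assms(1) by (rule borel_measurable_continuous_onI)
  have "bounded (\<phi> ` {-K..K})"
    by (intro compact_imp_bounded compact_continuous_image continuous_on_subset[OF assms(1)]) auto
  then obtain B where "\<forall>y\<in>\<phi> ` {-K..K}. norm y \<le> B"
    unfolding bounded_iff by blast
  then have B: "\<bar>\<phi> x\<bar> \<le> B" if "x \<in> {-K..K}" for x
    using that by simp
  show si: "square_integrable (\<lambda>x. complex_of_real (\<phi> x))"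
  proof (rule square_integrable_bound)
    show "integrable lborel (\<lambda>x. B\<^sup>2 * indicator {-K..K} x)"
      by (intro integrable_mult_right integrable_real_indicator emeasure_bounded_finite) auto
    show "(cmod (complex_of_real (\<phi> x)))\<^sup>2 \<le> B\<^sup>2 * indicator {-K..K} x" for x
    proof (cases "\<bar>x\<bar> \<ge> K")
      case False
      then have "x \<in> {-K..K}" by auto
      with power_mono[OF B[OF this] abs_ge_zero, of 2] show ?thesis by simp
    qed (use assms(2) in simp)
  qed measurable
  show "integrable lborel (\<lambda>x. complex_of_real (\<phi> x))"
    by (rule integrable_compact_square_integrable[OF si, of K]) (use assms(2) in auto)
qed

text \<open>The derivative of cis(- x \<xi>) \<phi>(x) has compact support and integral 0.\<close>

lemma ft_deriv_test_function:
  assumes "test_function \<phi>"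
  shows "ft (\<lambda>x. complex_of_real (deriv \<phi> x)) \<xi> = \<i> * complex_of_real \<xi> * ft (\<lambda>x. complex_of_real (\<phi> x)) \<xi>"
proof -
  have \<phi>: "smooth \<phi>" by (rule test_functionD(1)[OF assms])
  obtain K where K: "\<forall>x. \<bar>x\<bar> \<ge> K \<longrightarrow> \<phi> x = 0" "\<forall>x. \<bar>x\<bar> \<ge> K \<longrightarrow> deriv \<phi> x = 0"
    using test_functionD(2)[OF assms] by blast
  note c = smooth_continuous[OF \<phi>, of UNIV] smooth_continuous[OF smooth_deriv(1)[OF \<phi>], of UNIV]
  note i = test_function_square_integrable(2)[OF c(1) K(1)] test_function_square_integrable(2)[OF c(2) K(2)]
  have i': "integrable lborel (\<lambda>x. cis (- (x * \<xi>)) * complex_of_real (\<phi> x))"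
    "integrable lborel (\<lambda>x. cis (- (x * \<xi>)) * complex_of_real (deriv \<phi> x))"
    using integrable_cis_mult[OF i(1), of "-\<xi>"] integrable_cis_mult[OF i(2), of "-\<xi>"] by (simp_all add: mult.commute)
  have "(LINT x|lborel. cis (- (x * \<xi>)) * complex_of_real (deriv \<phi> x) - \<i> * complex_of_real \<xi> * (cis (- (x * \<xi>)) * complex_of_real (\<phi> x))) = 0"
  proof (rule integral_derivative_compact_support[where F = "\<lambda>x. cis (- (x * \<xi>)) * complex_of_real (\<phi> x)" and K = K])
    fix x
    have d1: "((\<lambda>x. complex_of_real (\<phi> x)) has_vector_derivative complex_of_real (deriv \<phi> x)) (at x)"
      using smooth_deriv(2)[OF \<phi>, of x]
      by (intro has_vector_derivative_of_real) (simp add: has_real_derivative_iff_has_vector_derivative)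
    have d2: "((\<lambda>x. cis (- (x * \<xi>))) has_vector_derivative - \<i> * complex_of_real \<xi> * cis (- (x * \<xi>))) (at x)"
    proof -
      have "((\<lambda>z. exp (- (\<i> * complex_of_real \<xi>) * z)) has_field_derivative
          - (\<i> * complex_of_real \<xi>) * exp (- (\<i> * complex_of_real \<xi>) * complex_of_real x)) (at (complex_of_real x))"
        by (auto intro!: derivative_eq_intros)
      from has_vector_derivative_real_field[OF this] show ?thesis
        by (simp add: cis_conv_exp mult_ac)
    qed
    show "((\<lambda>x. cis (- (x * \<xi>)) * complex_of_real (\<phi> x)) has_vector_derivative
        cis (- (x * \<xi>)) * complex_of_real (deriv \<phi> x) - \<i> * complex_of_real \<xi> * (cis (- (x * \<xi>)) * complex_of_real (\<phi> x))) (at x)"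
      by (rule has_vector_derivative_eq_rhs[OF has_vector_derivative_mult[OF d2 d1]]) simp
  qed (use K in \<open>auto intro!: continuous_intros c\<close>)
  then have "(LINT x|lborel. cis (- (x * \<xi>)) * complex_of_real (deriv \<phi> x)) = \<i> * complex_of_real \<xi> * (LINT x|lborel. cis (- (x * \<xi>)) * complex_of_real (\<phi> x))"
    using i' by (subst (asm) Bochner_Integration.integral_diff) auto
  then show ?thesis by (simp add: ft_def)
qed

section \<open>The operator D is multiplication by the variable on the Fourier side\<close>

lemma locally_integrable_rep_L2: "locally_integrable (rep_L2 u)"
  unfolding locally_integrable_def set_integrable_def
proof (intro allI impI)
  fix K :: "real set" assume K: "compact K"
  then obtain N where N: "\<And>x. x \<in> K \<Longrightarrow> \<bar>x\<bar> \<le> N" using compact_imp_bounded bounded_iff by (metis real_norm_def)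
  have [measurable]: "K \<in> sets borel" using K by (rule borel_compact)
  have "square_integrable (\<lambda>x. indicator K x * rep_L2 u x)"
    by (intro square_integrable_mult bounded_indicator square_integrable_rep_L2) measurable
  then have "integrable lborel (\<lambda>x. indicator K x * rep_L2 u x)"
    by (rule integrable_compact_square_integrable[where K = N]) (use N in \<open>force simp: indicator_def\<close>)
  then show "integrable lborel (\<lambda>x. indicator K x *\<^sub>R rep_L2 u x)"
    by (simp add: scaleR_conv_of_real of_real_indicator)
qed

lemma ft_zero_imp_zero:
  assumes q: "integrable lborel q" "square_integrable q" and z: "\<And>\<xi>. ft q \<xi> = 0"
  shows "AE x in lborel. q x = 0"
proof -
  have "cinner (abs_L2 q) (abs_L2 (indicator {a<..b})) = 0" if "a < b" for a b
    using ft_indicator_parseval[OF q that] by (simp add: cinner_abs_L2 q square_integrable_indicator_Ioc z)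
  then have "abs_L2 q = 0" by (rule L2_indicators_total)
  then show ?thesis
    using rep_abs_L2[OF q(2)] rep_L2_zero by auto
qed

text \<open>Parseval turns the weak derivative condition for \<phi> into the vanishing of an
  integral against the transform of \<phi>. Translating \<phi> multiplies its transform by
  characters, so all translates together say that a product has vanishing Fourier transform;
  shrinking \<phi> makes its transform nonzero at any given frequency.\<close>

lemma weak_derivative_iff_fourier:
  "weak_derivative (rep_L2 u) (rep_L2 w) \<longleftrightarrow> (AE t in lborel. rep_L2 (fourier w) t = \<i> * complex_of_real t * rep_L2 (fourier u) t)"
proof -
  let ?U = "rep_L2 (fourier u)" and ?W = "rep_L2 (fourier w)"
  have pairing: "(LINT x|lborel. deriv \<phi> x *\<^sub>R rep_L2 u x) = - (LINT x|lborel. \<phi> x *\<^sub>R rep_L2 w x)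
      \<longleftrightarrow> (LINT t|lborel. cnj (ft (\<lambda>x. complex_of_real (\<phi> x)) t) * (?W t - \<i> * complex_of_real t * ?U t)) = 0"
    and int1: "integrable lborel (\<lambda>t. cnj (ft (\<lambda>x. complex_of_real (\<phi> x)) t) * (?W t - \<i> * complex_of_real t * ?U t))"
    and si1: "square_integrable (\<lambda>t. cnj (ft (\<lambda>x. complex_of_real (\<phi> x)) t) * (?W t - \<i> * complex_of_real t * ?U t))"
    if t: "test_function \<phi>" for \<phi>
  proof -
    have \<phi>: "smooth \<phi>" by (rule test_functionD(1)[OF t])
    obtain K where K: "\<forall>x. \<bar>x\<bar> \<ge> K \<longrightarrow> \<phi> x = 0" "\<forall>x. \<bar>x\<bar> \<ge> K \<longrightarrow> deriv \<phi> x = 0"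
      using test_functionD(2)[OF t] by blast
    let ?f = "\<lambda>x. complex_of_real (\<phi> x)" and ?g = "\<lambda>x. complex_of_real (deriv \<phi> x)"
    note c = smooth_continuous[OF \<phi>, of UNIV] smooth_continuous[OF smooth_deriv(1)[OF \<phi>], of UNIV]
    note si = test_function_square_integrable(1)[OF c(1) K(1)] test_function_square_integrable(1)[OF c(2) K(2)]
    note i = test_function_square_integrable(2)[OF c(1) K(1)] test_function_square_integrable(2)[OF c(2) K(2)]
    have ftg: "ft ?g t = \<i> * complex_of_real t * ft ?f t" for t by (rule ft_deriv_test_function[OF t])
    have par: "(LINT x|lborel. f x *\<^sub>R rep_L2 v x) = (LINT t|lborel. cnj (ft (\<lambda>x. complex_of_real (f x)) t) * rep_L2 (fourier v) t)"
      if f: "square_integrable (\<lambda>x. complex_of_real (f x))" "integrable lborel (\<lambda>x. complex_of_real (f x))" "\<forall>x. \<bar>x\<bar> \<ge> K \<longrightarrow> f x = 0" for f v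
    proof -
      let ?h = "\<lambda>x. complex_of_real (f x)"
      have "(LINT x|lborel. f x *\<^sub>R rep_L2 v x) = cinner (abs_L2 ?h) v"
        using cinner_abs_L2[OF f(1) square_integrable_rep_L2, of v] by (simp add: abs_rep_L2 scaleR_conv_of_real)
      also have "\<dots> = cinner (fourier (abs_L2 ?h)) (fourier v)" by simp
      also have "fourier (abs_L2 ?h) = abs_L2 (ft ?h)"
        by (rule fourier_abs_L2[OF f(1), of K]) (use f(3) in auto)
      also have "cinner (abs_L2 (ft ?h)) (fourier v) = (LINT t|lborel. cnj (ft ?h t) * rep_L2 (fourier v) t)"
        using cinner_abs_L2[OF square_integrable_ft(1)[OF f(2,1)] square_integrable_rep_L2, of "fourier v"] by (simp add: abs_rep_L2)
      finally show ?thesis .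
    qed
    have p1: "integrable lborel (\<lambda>t. cnj (ft ?f t) * ?W t)" "integrable lborel (\<lambda>t. cnj (ft ?g t) * ?U t)"
      by (intro square_integrable_product square_integrable_ft si i square_integrable_rep_L2)+
    \<comment> \<open>t U need not be square integrable; its product with the transform of \<phi>
      is, since the factor t turns that into the transform of the derivative.\<close>
    have eq: "cnj (ft ?f t) * (?W t - \<i> * complex_of_real t * ?U t) = cnj (ft ?f t) * ?W t + cnj (ft ?g t) * ?U t" for t
      by (simp add: ftg algebra_simps)
    show "integrable lborel (\<lambda>t. cnj (ft ?f t) * (?W t - \<i> * complex_of_real t * ?U t))"
      unfolding eq using p1 by (rule Bochner_Integration.integrable_add)
    have b: "bounded (range (\<lambda>t. cnj (ft ?f t)))" "bounded (range (\<lambda>t. cnj (ft ?g t)))"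
      unfolding bounded_range_norm complex_mod_cnj using ft_bound by blast+
    have [measurable]: "?f \<in> borel_measurable borel" "?g \<in> borel_measurable borel"
      using i by auto
    show "square_integrable (\<lambda>t. cnj (ft ?f t) * (?W t - \<i> * complex_of_real t * ?U t))"
      unfolding eq by (intro square_integrable_add square_integrable_mult b square_integrable_rep_L2) measurable
    have "(LINT t|lborel. cnj (ft ?f t) * (?W t - \<i> * complex_of_real t * ?U t))
        = (LINT x|lborel. \<phi> x *\<^sub>R rep_L2 w x) + (LINT x|lborel. deriv \<phi> x *\<^sub>R rep_L2 u x)"
      unfolding eq par[OF si(1) i(1) K(1)] par[OF si(2) i(2) K(2)] using p1 by (rule Bochner_Integration.integral_add)
    then show "(LINT x|lborel. deriv \<phi> x *\<^sub>R rep_L2 u x) = - (LINT x|lborel. \<phi> x *\<^sub>R rep_L2 w x)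
      \<longleftrightarrow> (LINT t|lborel. cnj (ft ?f t) * (?W t - \<i> * complex_of_real t * ?U t)) = 0"
      by (simp add: add_eq_0_iff)
  qed
  show ?thesis
  proof
    assume wd: "weak_derivative (rep_L2 u) (rep_L2 w)"
    obtain b H :: "real \<Rightarrow> real" where b: "smooth b" "smooth H" "\<And>x. DERIV H x :> b x" "\<And>x. 0 \<le> b x"
      "\<forall>x. x \<le> 0 \<or> 1 \<le> x \<longrightarrow> b x = 0" "\<forall>x\<le>0. H x = 0" "\<forall>x\<ge>1. H x = 1" "\<And>x. 0 \<le> H x \<and> H x \<le> 1"
      by (rule smooth_step_exists) blast
    \<comment> \<open>Bumps of width 1 / (n + 1) beginning at s: s provides the characters, n the
      nonvanishing.\<close>
    define \<phi> where "\<phi> n s x = b (real (Suc n) * x - real (Suc n) * s)" for n s x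
    have \<phi>t: "test_function (\<phi> n s)" for n s
    proof (rule test_functionI[where K = "\<bar>s\<bar> + 1"])
      show "smooth (\<phi> n s)"
        using smooth_affine[OF b(1), of 1 "real (Suc n)" "- (real (Suc n) * s)"] by (simp add: \<phi>_def[abs_def])
      fix x assume "\<bar>s\<bar> + 1 \<le> \<bar>x\<bar>"
      then have "x - s \<le> 0 \<or> 1 \<le> x - s" by auto
      then have "real (Suc n) * (x - s) \<le> 0 \<or> 1 \<le> real (Suc n) * (x - s)"
        using mult_mono[of 1 "real (Suc n)" 1 "x - s"] by (auto simp: mult_le_0_iff)
      then have "b (real (Suc n) * (x - s)) = 0" using b(5) by blast
      then show "\<phi> n s x = 0" by (simp only: \<phi>_def right_diff_distrib)
    qed
    have shift: "ft (\<lambda>x. complex_of_real (\<phi> n s x)) t = cis (- (s * t)) * ft (\<lambda>x. complex_of_real (\<phi> n 0 x)) t" for n s t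
    proof -
      have "(LINT x|lborel. cis (- (x * t)) * complex_of_real (\<phi> n s x))
          = \<bar>1\<bar> *\<^sub>R (LINT x|lborel. cis (- ((s + 1 * x) * t)) * complex_of_real (\<phi> n s (s + 1 * x)))"
        by (rule lborel_integral_real_affine) simp
      also have "\<dots> = (LINT x|lborel. cis (- (s * t)) * (cis (- (x * t)) * complex_of_real (\<phi> n 0 x)))"
      proof -
        have "cis (- ((s + 1 * x) * t)) = cis (- (s * t)) * cis (- (x * t))" for x
          by (simp add: cis_mult algebra_simps)
        moreover have "\<phi> n s (s + 1 * x) = \<phi> n 0 x" for x
          by (simp add: \<phi>_def algebra_simps)
        ultimately show ?thesis by (simp only: mult.assoc abs_one scaleR_one)
      qed
      finally show ?thesis by (simp add: ft_def)
    qed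
    have q0: "AE t in lborel. cnj (ft (\<lambda>x. complex_of_real (\<phi> n 0 x)) t) * (?W t - \<i> * complex_of_real t * ?U t) = 0" for n
    proof (rule ft_zero_imp_zero[OF int1[OF \<phi>t] si1[OF \<phi>t]])
      fix \<xi>
      \<comment> \<open>The translate by -\<xi> produces, after conjugation, exactly the character
        of the transform at \<xi>.\<close>
      have "(LINT x|lborel. deriv (\<phi> n (-\<xi>)) x *\<^sub>R rep_L2 u x) = - (LINT x|lborel. \<phi> n (-\<xi>) x *\<^sub>R rep_L2 w x)"
        using wd \<phi>t by (simp add: weak_derivative_def)
      then have "(LINT t|lborel. cnj (ft (\<lambda>x. complex_of_real (\<phi> n (-\<xi>) x)) t) * (?W t - \<i> * complex_of_real t * ?U t)) = 0"
        using pairing[OF \<phi>t] by blast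
      moreover define Q where "Q t = cnj (ft (\<lambda>x. complex_of_real (\<phi> n 0 x)) t) * (?W t - \<i> * complex_of_real t * ?U t)" for t
      ultimately have "(LINT t|lborel. cis (- (t * \<xi>)) * Q t) = 0"
        unfolding shift[of n "- \<xi>"] by (simp add: cis_cnj mult.assoc mult.commute[of \<xi>])
      then have "ft Q \<xi> = 0" by (simp add: ft_def)
      then show "ft (\<lambda>t. cnj (ft (\<lambda>x. complex_of_real (\<phi> n 0 x)) t) * (?W t - \<i> * complex_of_real t * ?U t)) \<xi> = 0"
        by (simp only: Q_def[abs_def])
    qed
    \<comment> \<open>Up to a positive factor the transform of \<open>\<phi> n 0\<close> at t is
      that of b at t / (n + 1), which tends to a multiple of the integral 1 of b.\<close>
    have nz: "\<exists>n. ft (\<lambda>x. complex_of_real (\<phi> n 0 x)) t \<noteq> 0" for t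
    proof -
      note bc = smooth_continuous[OF b(1), of UNIV]
      have bK: "\<forall>x. \<bar>x\<bar> \<ge> 1 \<longrightarrow> b x = 0"
        using b(5) by (auto simp: abs_if split: if_splits)
      note bi = test_function_square_integrable(2)[OF bc bK]
      have b1: "(LINT x|lborel. complex_of_real (b x)) = 1"
      proof -
        have "(LINT x|lborel. indicator {0..1} x *\<^sub>R b x) = H 1 - H 0"
        proof (rule integral_FTC_Icc)
          show "(H has_vector_derivative b x) (at x within {0..1})" for x
            using b(3)[of x] by (rule has_vector_derivative_at_within[OF has_real_derivative_iff_has_vector_derivative[THEN iffD1]])
          show "continuous_on {0..1} b" by (rule continuous_on_subset[OF bc]) simp
        qed simp
        moreover have "(\<lambda>x. indicator {0..1} x *\<^sub>R b x) = b"
        proof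
          fix x show "indicator {0..1} x *\<^sub>R b x = b x"
            using b(5) by (cases "x \<in> {0..1}") auto
        qed
        ultimately have "integral\<^sup>L lborel b = H 1 - H 0" by (simp only:)
        then show ?thesis using b(6,7) by simp
      qed
      have sc: "(LINT x|lborel. cis (- (x * (t / real (Suc n)))) * complex_of_real (b x))
          = real (Suc n) *\<^sub>R (LINT x|lborel. cis (- (x * t)) * complex_of_real (\<phi> n 0 x))" for n
      proof -
        have "(LINT x|lborel. cis (- (x * (t / real (Suc n)))) * complex_of_real (b x))
            = \<bar>real (Suc n)\<bar> *\<^sub>R (LINT x|lborel. cis (- ((0 + real (Suc n) * x) * (t / real (Suc n)))) * complex_of_real (b (0 + real (Suc n) * x)))"
          by (rule lborel_integral_real_affine) simp
        then show ?thesis by (simp add: \<phi>_def del: of_nat_Suc)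
      qed
      have "(\<lambda>n. LINT x|lborel. cis (- (x * (t / real (Suc n)))) * complex_of_real (b x)) \<longlonglongrightarrow> (LINT x|lborel. complex_of_real (b x))"
      proof (rule integral_dominated_convergence[where w = "\<lambda>x. cmod (complex_of_real (b x))"])
        show "AE x in lborel. (\<lambda>n. cis (- (x * (t / real (Suc n)))) * complex_of_real (b x)) \<longlonglongrightarrow> complex_of_real (b x)"
        proof (rule AE_I2)
          fix x
          have "(\<lambda>n. - (x * (t * (1 / real (Suc n))))) \<longlonglongrightarrow> - (x * (t * 0))"
            by (intro tendsto_intros LIMSEQ_inverse_real_of_nat[unfolded inverse_eq_divide])
          then have "(\<lambda>n. - (x * (t / real (Suc n)))) \<longlonglongrightarrow> - (x * (t * 0))"
            by simp
          then have "(\<lambda>n. cis (- (x * (t / real (Suc n))))) \<longlonglongrightarrow> cis (- (x * (t * 0)))"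
            unfolding cis_conv_exp by (intro tendsto_exp tendsto_mult tendsto_const tendsto_of_real)
          from tendsto_mult[OF this tendsto_const, of "complex_of_real (b x)"]
          show "(\<lambda>n. cis (- (x * (t / real (Suc n)))) * complex_of_real (b x)) \<longlonglongrightarrow> complex_of_real (b x)" by simp
        qed
        have [measurable]: "b \<in> borel_measurable borel" using bc by (rule borel_measurable_continuous_onI)
        show "(\<lambda>x. cis (- (x * (t / real (Suc n)))) * complex_of_real (b x)) \<in> borel_measurable lborel" for n by measurable
      qed (use bi integrable_norm[OF bi] in \<open>auto simp: norm_mult\<close>)
      then have "eventually (\<lambda>n. (LINT x|lborel. cis (- (x * (t / real (Suc n)))) * complex_of_real (b x)) \<in> - {0}) sequentially"
        unfolding b1 by (rule topological_tendstoD) auto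
      then obtain n where "(LINT x|lborel. cis (- (x * (t / real (Suc n)))) * complex_of_real (b x)) \<noteq> 0"
        by (auto dest!: eventually_happens'[OF sequentially_bot])
      then have "ft (\<lambda>x. complex_of_real (\<phi> n 0 x)) t \<noteq> 0"
        unfolding sc by (simp add: ft_def del: of_nat_Suc)
      then show ?thesis by blast
    qed
    \<comment> \<open>Countably many n serve for all t, so the exceptional sets stay null.\<close>
    have "AE t in lborel. \<forall>n. cnj (ft (\<lambda>x. complex_of_real (\<phi> n 0 x)) t) * (?W t - \<i> * complex_of_real t * ?U t) = 0"
      by (intro AE_all_countable[THEN iffD2] allI q0)
    then show "AE t in lborel. ?W t = \<i> * complex_of_real t * ?U t"
    proof eventually_elim
      case (elim t)
      from nz obtain n where n: "ft (\<lambda>x. complex_of_real (\<phi> n 0 x)) t \<noteq> 0" by blast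
      from elim have "cnj (ft (\<lambda>x. complex_of_real (\<phi> n 0 x)) t) * (?W t - \<i> * complex_of_real t * ?U t) = 0" by (rule spec)
      with n show ?case by simp
    qed
  next
    assume ae: "AE t in lborel. ?W t = \<i> * complex_of_real t * ?U t"
    show "weak_derivative (rep_L2 u) (rep_L2 w)"
      unfolding weak_derivative_def
    proof (intro conjI allI impI locally_integrable_rep_L2)
      fix \<phi> assume t: "test_function \<phi>"
      have "AE t in lborel. cnj (ft (\<lambda>x. complex_of_real (\<phi> x)) t) * (?W t - \<i> * complex_of_real t * ?U t) = 0"
        using ae by eventually_elim simp
      then have "(LINT t|lborel. cnj (ft (\<lambda>x. complex_of_real (\<phi> x)) t) * (?W t - \<i> * complex_of_real t * ?U t)) = 0"
        by (rule integral_eq_zero_AE)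
      then show "(LINT x|lborel. deriv \<phi> x *\<^sub>R rep_L2 u x) = - (LINT x|lborel. \<phi> x *\<^sub>R rep_L2 w x)"
        using pairing[OF t] by blast
    qed
  qed
qed

lemma D_op_fourier: "D_op = spectral_integral fourier_spectral_measure complex_of_real"
proof -
  have "(u, y) \<in> D_op \<longleftrightarrow> (u, y) \<in> spectral_integral fourier_spectral_measure complex_of_real" for u y
  proof -
    have "(u, y) \<in> D_op \<longleftrightarrow> weak_derivative (rep_L2 u) (rep_L2 (\<i> *\<^sub>C y))"
      unfolding D_op_def by (auto simp: scaleC_scaleC intro!: exI[of _ "\<i> *\<^sub>C y"])
    also have "\<dots> \<longleftrightarrow> (AE t in lborel. rep_L2 (fourier (\<i> *\<^sub>C y)) t = \<i> * complex_of_real t * rep_L2 (fourier u) t)"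
      by (rule weak_derivative_iff_fourier)
    also have "\<dots> \<longleftrightarrow> (AE t in lborel. rep_L2 (fourier y) t = complex_of_real t * rep_L2 (fourier u) t)"
    proof -
      have "AE t in lborel. rep_L2 (fourier (\<i> *\<^sub>C y)) t = \<i> * rep_L2 (fourier y) t"
        using rep_L2_scaleC[of \<i> "fourier y"] by (simp add: bounded_clinearD[OF bounded_clinear_fourier])
      then show ?thesis by (auto elim!: eventually_elim2)
    qed
    also have "\<dots> \<longleftrightarrow> (u, y) \<in> spectral_integral fourier_spectral_measure complex_of_real"
      by (rule spectral_integral_fourier[symmetric]) simp
    finally show ?thesis .
  qed
  then show ?thesis by auto
qed

section \<open>Commutators with Fourier multipliers\<close>

definition fourier_multiplier :: "(real \<Rightarrow> complex) \<Rightarrow> L2 \<Rightarrow> L2" where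
  "fourier_multiplier h u = inv_fourier (mult_op h (fourier u))"

lemma op_of_graph_functional_calculus_D:
  "h \<in> borel_measurable borel \<Longrightarrow> bounded (range h) \<Longrightarrow> op_of_graph (functional_calculus h D_op) = fourier_multiplier h"
  by (rule ext) (simp add: fourier_multiplier_def op_of_graph_functional_calculus[OF D_op_fourier])

lemma bounded_clinear_fourier_multiplier:
  "h \<in> borel_measurable borel \<Longrightarrow> bounded (range h) \<Longrightarrow> bounded_clinear (fourier_multiplier h)"
  unfolding fourier_multiplier_def
  by (rule bounded_clinear_compose[OF bounded_clinear_inv_fourier bounded_clinear_compose[OF bounded_clinear_mult_op bounded_clinear_fourier]])

lemma adjoint_fourier_multiplier:
  assumes "h \<in> borel_measurable borel" "bounded (range h)"
  shows "adjoint_pair (fourier_multiplier h) (fourier_multiplier (\<lambda>x. cnj (h x)))"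
  using adjoint_mult_op[OF assms]
  by (simp add: adjoint_pair_def fourier_multiplier_def cinner_inv_fourier_left cinner_inv_fourier_right)

lemma norm_fourier_multiplier_le:
  "h \<in> borel_measurable borel \<Longrightarrow> (\<And>x. cmod (h x) \<le> K) \<Longrightarrow> norm (fourier_multiplier h u) \<le> K * norm u"
  using norm_mult_op_le[of h K "fourier u"] by (simp add: fourier_multiplier_def)

lemma bounded_clinear_commutator:
  assumes "bounded_clinear S" "bounded_clinear T"
  shows "bounded_clinear (commutator S T)"
  unfolding commutator_def
  by (rule bounded_clinear_diff[OF bounded_clinear_compose[OF assms] bounded_clinear_compose[OF assms(2,1)]])

lemma adjoint_commutator:
  "adjoint_pair S S' \<Longrightarrow> adjoint_pair T T' \<Longrightarrow> adjoint_pair (commutator S T) (commutator T' S')"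
  by (simp add: adjoint_pair_def commutator_def cinner_diff_left cinner_diff_right)

lemma bounded_range_cnj: "bounded (range h) \<Longrightarrow> bounded (range (\<lambda>x. cnj (h x)))"
  by (simp add: bounded_range_norm)

section \<open>The commutator with the sign function\<close>

lemma integral_cis_Icc:
  assumes "s \<noteq> 0" "a \<le> b"
  shows "(LINT \<xi>|lborel. indicator {a..b} \<xi> *\<^sub>R cis (- (s * \<xi>))) = \<i> / complex_of_real s * (cis (- (s * b)) - cis (- (s * a)))"
proof -
  have "(LINT \<xi>|lborel. indicator {a..b} \<xi> *\<^sub>R cis (- (s * \<xi>))) = \<i> / complex_of_real s * cis (- (s * b)) - \<i> / complex_of_real s * cis (- (s * a))"
  proof (rule integral_FTC_Icc)
    show "((\<lambda>\<xi>. \<i> / complex_of_real s * cis (- (s * \<xi>))) has_vector_derivative cis (- (s * x))) (at x within {a..b})" for x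
    proof (rule has_vector_derivative_at_within)
      have "((\<lambda>z. \<i> / complex_of_real s * exp (- (\<i> * complex_of_real s) * z)) has_field_derivative
          exp (- (\<i> * complex_of_real s) * complex_of_real x)) (at (complex_of_real x))"
        using assms(1) by (auto intro!: derivative_eq_intros)
      from has_vector_derivative_real_field[OF this]
      show "((\<lambda>\<xi>. \<i> / complex_of_real s * cis (- (s * \<xi>))) has_vector_derivative cis (- (s * x))) (at x)"
        by (simp add: cis_conv_exp mult_ac)
    qed
  qed (use assms in \<open>auto intro!: continuous_intros\<close>)
  then show ?thesis by (simp add: right_diff_distrib)
qed

text \<open>Truncated in frequency so that its kernel is an ordinary integral; \<open>sgn\<close>
  itself only has a principal value kernel.\<close>

definition sgn_cut :: "real \<Rightarrow> real \<Rightarrow> complex" where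
  "sgn_cut N \<xi> = indicator {-N..N} \<xi> * complex_of_real (sgn \<xi>)"

text \<open>Apart from -2i, the truncated Hilbert kernel (1 - cos(N s)) / s is nonnegative for s >
  0, and the oscillating part drops out as N grows.\<close>

lemma integral_cis_sgn_cut:
  assumes "s > 0" "N \<ge> 0"
  shows "(LINT \<xi>|lborel. cis (- (s * \<xi>)) * sgn_cut N \<xi>) = - (2 * \<i>) * complex_of_real ((1 - cos (N * s)) / s)"
proof -
  let ?f = "\<lambda>a b \<xi>. indicator {a..b} \<xi> *\<^sub>R cis (- (s * \<xi>))"
  have int: "integrable lborel (?f a b)" for a b
    by (rule borel_integrable_atLeastAtMost'[unfolded set_integrable_def]) (auto intro!: continuous_intros)
  have "AE \<xi> in lborel. cis (- (s * \<xi>)) * sgn_cut N \<xi> = ?f 0 N \<xi> - ?f (-N) 0 \<xi>"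
    using AE_lborel_singleton[of "0::real"]
    by eventually_elim (auto simp: sgn_cut_def indicator_def sgn_real_def)
  then have "(LINT \<xi>|lborel. cis (- (s * \<xi>)) * sgn_cut N \<xi>) = (LINT \<xi>|lborel. ?f 0 N \<xi> - ?f (-N) 0 \<xi>)"
    by (intro integral_cong_AE) (auto simp: sgn_cut_def)
  also have "\<dots> = (LINT \<xi>|lborel. ?f 0 N \<xi>) - (LINT \<xi>|lborel. ?f (-N) 0 \<xi>)"
    by (rule Bochner_Integration.integral_diff[OF int int])
  also have "\<dots> = \<i> / complex_of_real s * (cis (- (s * N)) + cis (s * N) - 2)"
    using assms by (subst (1 2) integral_cis_Icc) (auto simp: algebra_simps)
  also have "cis (- (s * N)) + cis (s * N) - 2 = complex_of_real (- 2 * (1 - cos (N * s)))"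
    by (simp add: complex_eq_iff mult.commute)
  finally show ?thesis using assms(1) by (simp add: field_simps)
qed

text \<open>On the two mirror intervals the kernel of sgn(D) has constant phase, so nothing cancels.
  In modulus the form is the integral of 1 / (pi (x + y)) over the square (r, 2 r]^2; there x + y <=
  4 r and the area is r^2, whence r / (4 pi).\<close>

lemma sgn_form_lower_bound:
  assumes r: "r > 0" and u: "u = abs_L2 (indicator {r<..2 * r})" and v: "v = abs_L2 (\<lambda>x. indicator {r<..2 * r} (- x))"
  shows "r / (4 * pi) \<le> cmod (cinner v (fourier_multiplier (\<lambda>t. complex_of_real (sgn t)) u))"
proof -
  let ?J = "indicator {r<..2 * r} :: real \<Rightarrow> complex"
  let ?h = "\<lambda>t. complex_of_real (sgn t)"
  let ?c = "complex_of_real (1 / sqrt (2 * pi))"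
  have J: "square_integrable ?J" by (rule square_integrable_indicator_Ioc)
  have J0: "?J x = 0" if "\<bar>x\<bar> > 2 * r" for x using that r by (auto simp: indicator_def)
  have J1: "integrable lborel ?J" by (rule integrable_compact_square_integrable[OF J J0])
  have J': "square_integrable (\<lambda>x. ?J (- x))" "\<And>x. \<bar>x\<bar> > 2 * r \<Longrightarrow> ?J (- x) = 0"
  proof -
    have "(\<lambda>x. ?J (- x)) = (indicator {- (2 * r)..<- r} :: real \<Rightarrow> complex)" by (auto simp: indicator_def fun_eq_iff)
    moreover have "square_integrable (indicator {- (2 * r)..<- r} :: real \<Rightarrow> complex)"
    proof -
      have "(\<lambda>x. (cmod (indicator {- (2 * r)..<- r} x))\<^sup>2) = (indicator {- (2 * r)..<- r} :: real \<Rightarrow> real)"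
        by (auto simp: indicator_def)
      moreover have "emeasure lborel {- (2 * r)..<- r} < \<infinity>"
        by (intro emeasure_bounded_finite) (auto intro: bounded_subset[of "{- (2 * r)..- r}"])
      ultimately show ?thesis by (simp add: square_integrable_def)
    qed
    ultimately show "square_integrable (\<lambda>x. ?J (- x))" by simp
    show "?J (- x) = 0" if "\<bar>x\<bar> > 2 * r" for x using that r by (auto simp: indicator_def)
  qed
  define U where "U = ft ?J"
  have U: "square_integrable U" unfolding U_def by (rule square_integrable_ft[OF J1 J])
  have [measurable]: "U \<in> borel_measurable borel" using U by (rule square_integrable_measurable)
  \<comment> \<open>Reflection of a real function conjugates its transform, so the form becomes the
    integral of sgn times U^2 instead of |U|^2.\<close>
  have ftv: "ft (\<lambda>x. ?J (- x)) \<xi> = cnj (U \<xi>)" for \<xi>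
  proof -
    have "(LINT x|lborel. cis (- (x * \<xi>)) * ?J (- x)) = \<bar>-1\<bar> *\<^sub>R (LINT x|lborel. cis (- ((0 + (-1) * x) * \<xi>)) * ?J (- (0 + (-1) * x)))"
      by (rule lborel_integral_real_affine) simp
    also have "\<dots> = (LINT x|lborel. cnj (cis (- (x * \<xi>)) * ?J x))"
      by (simp add: cis_cnj indicator_def of_bool_def if_distrib[of cnj] cong: if_cong)
    also have "\<dots> = cnj (LINT x|lborel. cis (- (x * \<xi>)) * ?J x)"
      by (simp only: Bochner_Integration.integral_cnj)
    finally show ?thesis by (simp add: U_def ft_def)
  qed
  define I where "I N = (LINT \<xi>|lborel. sgn_cut N \<xi> * (U \<xi> * U \<xi>))" for N
  have form: "cinner v (fourier_multiplier ?h u) = (LINT \<xi>|lborel. complex_of_real (sgn \<xi>) * (U \<xi> * U \<xi>))"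
  proof -
    have hm: "?h \<in> borel_measurable borel" "bounded (range ?h)"
      by (auto simp: bounded_range_norm sgn_real_def intro!: exI[of _ 1])
    have fv: "fourier v = abs_L2 (\<lambda>\<xi>. cnj (U \<xi>))"
      using fourier_abs_L2[OF J'] by (simp add: v ftv[abs_def])
    have fu: "fourier u = abs_L2 U"
      unfolding u U_def by (rule fourier_abs_L2[OF J J0])
    have "cinner v (fourier_multiplier ?h u) = cinner (fourier v) (mult_op ?h (fourier u))"
      by (simp add: fourier_multiplier_def cinner_inv_fourier_right)
    also have "\<dots> = (LINT \<xi>|lborel. cnj (cnj (U \<xi>)) * (?h \<xi> * U \<xi>))"
      unfolding fv fu mult_op_abs_L2[OF hm U]
      by (rule cinner_abs_L2[OF square_integrable_cnj[OF U] square_integrable_mult[OF _ hm(2) U]]) simp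
    finally show ?thesis by (simp add: mult_ac)
  qed
  have UU: "integrable lborel (\<lambda>\<xi>. U \<xi> * U \<xi>)"
    using square_integrable_product[OF square_integrable_cnj[OF U] U] by simp
  have lim: "(\<lambda>n. I (real n)) \<longlonglongrightarrow> cinner v (fourier_multiplier ?h u)"
    unfolding I_def form
  proof (rule integral_dominated_convergence[where w = "\<lambda>\<xi>. cmod (U \<xi> * U \<xi>)"])
    show "integrable lborel (\<lambda>\<xi>. cmod (U \<xi> * U \<xi>))" using UU by (rule integrable_norm)
    show "AE \<xi> in lborel. (\<lambda>n. sgn_cut (real n) \<xi> * (U \<xi> * U \<xi>)) \<longlonglongrightarrow> complex_of_real (sgn \<xi>) * (U \<xi> * U \<xi>)"
    proof (rule AE_I2)
      fix \<xi> :: real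
      obtain M where M: "\<bar>\<xi>\<bar> \<le> real M" using real_arch_simple by blast
      have "eventually (\<lambda>n. sgn_cut (real n) \<xi> * (U \<xi> * U \<xi>) = complex_of_real (sgn \<xi>) * (U \<xi> * U \<xi>)) sequentially"
        using eventually_ge_at_top[of M] by eventually_elim (use M in \<open>auto simp: sgn_cut_def indicator_def\<close>)
      then show "(\<lambda>n. sgn_cut (real n) \<xi> * (U \<xi> * U \<xi>)) \<longlonglongrightarrow> complex_of_real (sgn \<xi>) * (U \<xi> * U \<xi>)"
        by (rule tendsto_eventually)
    qed
    show "AE \<xi> in lborel. norm (sgn_cut (real n) \<xi> * (U \<xi> * U \<xi>)) \<le> cmod (U \<xi> * U \<xi>)" for n
      by (intro AE_I2) (auto simp: norm_mult sgn_cut_def indicator_def sgn_real_def)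
  qed (auto simp: sgn_cut_def)
  \<comment> \<open>X collects the contribution of all x in the first interval at a fixed y; y
    stands for the reflected variable.\<close>
  define \<kappa> where "\<kappa> N s = (1 - cos (N * s)) / s" for N s :: real
  define X where "X N y = (LINT x|lborel. indicator {r<..2 * r} x * \<kappa> N (x + y))" for N y
  have \<kappa>_bd: "0 \<le> \<kappa> N s" "\<kappa> N s \<le> 2 / s" if "s > 0" for N s
    using that cos_ge_minus_one[of "N * s"] by (auto simp: \<kappa>_def divide_right_mono)
  have [measurable]: "\<kappa> N \<in> borel_measurable borel" for N unfolding \<kappa>_def by measurable
  have val: "I N = - (\<i> / complex_of_real pi) * complex_of_real (LINT y|lborel. indicator {r<..2 * r} y * X N y)" if N: "N \<ge> 0" for N
  proof -
    have e_si: "square_integrable (sgn_cut N)"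
    proof (rule square_integrable_bound)
      show "integrable lborel (indicator {-N..N} :: real \<Rightarrow> real)"
        by (intro integrable_real_indicator emeasure_bounded_finite) auto
      show "(cmod (sgn_cut N x))\<^sup>2 \<le> indicator {-N..N} x" for x
        by (auto simp: sgn_cut_def indicator_def sgn_real_def)
    qed (unfold sgn_cut_def[abs_def], measurable)
    have e_int: "integrable lborel (sgn_cut N)"
      by (rule integrable_compact_square_integrable[OF e_si, of N]) (auto simp: sgn_cut_def indicator_def)
    have [measurable]: "sgn_cut N \<in> borel_measurable borel" using e_int by auto
    have inner: "(LINT \<xi>|lborel. cis (- (y * \<xi>)) * U \<xi> * sgn_cut N \<xi>) = ?c * (- (2 * \<i>) * complex_of_real (X N y))" if y: "y \<in> {r<..2 * r}" for y
    proof -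
      have "cis (- (y * \<xi>)) * U \<xi> * sgn_cut N \<xi> = ?c * (LINT x|lborel. cis (- ((x + y) * \<xi>)) * (sgn_cut N \<xi> * ?J x))" for \<xi>
      proof -
        have "cis (- ((x + y) * \<xi>)) * (sgn_cut N \<xi> * ?J x) = (cis (- (y * \<xi>)) * sgn_cut N \<xi>) * (cis (- (x * \<xi>)) * ?J x)" for x
        proof -
          have "cis (- ((x + y) * \<xi>)) = cis (- (y * \<xi>)) * cis (- (x * \<xi>))"
            by (simp add: cis_mult algebra_simps)
          then show ?thesis by (simp only: mult_ac)
        qed
        then have "(LINT x|lborel. cis (- ((x + y) * \<xi>)) * (sgn_cut N \<xi> * ?J x)) = (cis (- (y * \<xi>)) * sgn_cut N \<xi>) * (LINT x|lborel. cis (- (x * \<xi>)) * ?J x)"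
          by (simp only: integral_mult_right_zero)
        then show ?thesis by (simp only: U_def ft_def mult_ac)
      qed
      then have "(LINT \<xi>|lborel. cis (- (y * \<xi>)) * U \<xi> * sgn_cut N \<xi>) = ?c * (LINT \<xi>|lborel. LINT x|lborel. cis (- ((x + y) * \<xi>)) * (sgn_cut N \<xi> * ?J x))"
        by (simp only: integral_mult_right_zero)
      also have "(LINT \<xi>|lborel. LINT x|lborel. cis (- ((x + y) * \<xi>)) * (sgn_cut N \<xi> * ?J x)) = (LINT x|lborel. LINT \<xi>|lborel. cis (- ((x + y) * \<xi>)) * (sgn_cut N \<xi> * ?J x))"
        by (rule Fubini_bounded_kernel(2)[OF e_int J1, where K = 1]) auto
      also have "\<dots> = (LINT x|lborel. - (2 * \<i>) * complex_of_real (indicator {r<..2 * r} x * \<kappa> N (x + y)))"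
      proof (rule Bochner_Integration.integral_cong[OF refl])
        fix x
        show "(LINT \<xi>|lborel. cis (- ((x + y) * \<xi>)) * (sgn_cut N \<xi> * ?J x)) = - (2 * \<i>) * complex_of_real (indicator {r<..2 * r} x * \<kappa> N (x + y))"
        proof (cases "x \<in> {r<..2 * r}")
          case True
          have "x + y > 0" using True y r by auto
          from integral_cis_sgn_cut[OF this N] True show ?thesis by (simp add: \<kappa>_def)
        qed simp
      qed
      also have "\<dots> = - (2 * \<i>) * complex_of_real (X N y)"
        unfolding X_def by (simp only: integral_mult_right_zero integral_complex_of_real)
      finally show ?thesis .
    qed
    have "sgn_cut N \<xi> * (U \<xi> * U \<xi>) = ?c * (LINT y|lborel. (cis (- (y * \<xi>)) * U \<xi>) * (sgn_cut N \<xi> * ?J y))" for \<xi>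
    proof -
      have "(cis (- (y * \<xi>)) * U \<xi>) * (sgn_cut N \<xi> * ?J y) = (sgn_cut N \<xi> * U \<xi>) * (cis (- (y * \<xi>)) * ?J y)" for y
        by (simp only: mult_ac)
      then have "(LINT y|lborel. (cis (- (y * \<xi>)) * U \<xi>) * (sgn_cut N \<xi> * ?J y)) = (sgn_cut N \<xi> * U \<xi>) * (LINT y|lborel. cis (- (y * \<xi>)) * ?J y)"
        by (simp only: integral_mult_right_zero)
      then have "?c * (LINT y|lborel. (cis (- (y * \<xi>)) * U \<xi>) * (sgn_cut N \<xi> * ?J y)) = (sgn_cut N \<xi> * U \<xi>) * U \<xi>"
        unfolding U_def ft_def by (simp only: mult_ac)
      then show ?thesis by (simp only: mult_ac)
    qed
    then have "I N = ?c * (LINT \<xi>|lborel. LINT y|lborel. (cis (- (y * \<xi>)) * U \<xi>) * (sgn_cut N \<xi> * ?J y))"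
      by (simp only: I_def integral_mult_right_zero)
    also have "(LINT \<xi>|lborel. LINT y|lborel. (cis (- (y * \<xi>)) * U \<xi>) * (sgn_cut N \<xi> * ?J y)) = (LINT y|lborel. LINT \<xi>|lborel. (cis (- (y * \<xi>)) * U \<xi>) * (sgn_cut N \<xi> * ?J y))"
      by (rule Fubini_bounded_kernel(2)[OF e_int J1, where K = "(LINT x|lborel. cmod (?J x)) / sqrt (2 * pi)"])
         (auto simp: norm_mult U_def intro: ft_bound)
    also have "\<dots> = (LINT y|lborel. ?c * - (2 * \<i>) * complex_of_real (indicator {r<..2 * r} y * X N y))"
    proof (rule Bochner_Integration.integral_cong[OF refl])
      fix y
      show "(LINT \<xi>|lborel. (cis (- (y * \<xi>)) * U \<xi>) * (sgn_cut N \<xi> * ?J y)) = ?c * - (2 * \<i>) * complex_of_real (indicator {r<..2 * r} y * X N y)"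
        using inner[of y] by (cases "y \<in> {r<..2 * r}") auto
    qed
    also have "\<dots> = ?c * - (2 * \<i>) * complex_of_real (LINT y|lborel. indicator {r<..2 * r} y * X N y)"
      by (simp only: integral_mult_right_zero integral_complex_of_real)
    also have "?c * \<dots> = - (\<i> / complex_of_real pi) * complex_of_real (LINT y|lborel. indicator {r<..2 * r} y * X N y)"
    proof -
      have "?c * ?c = complex_of_real (1 / (2 * pi))"
        by (simp flip: of_real_mult)
      then have "?c * (?c * - (2 * \<i>)) = - (\<i> / complex_of_real pi)"
        by (simp only: mult.assoc[symmetric]) simp
      then show ?thesis by (simp only: mult.assoc[symmetric])
    qed
    finally show ?thesis .
  qed
  \<comment> \<open>The bound x + y <= 4 r supplies 1 / (4 r), and the integral of 1 - cos over an
    interval of length r is at least r - 2 / N.\<close>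
  have Xlow: "1 / (4 * r) * (r - 2 / N) \<le> X N y" if N: "N > 0" and y: "y \<in> {r<..2 * r}" for N y
  proof -
    let ?J' = "indicator {r<..2 * r} :: real \<Rightarrow> real"
    have intJ: "integrable lborel ?J'"
      by (intro integrable_real_indicator emeasure_bounded_finite) (auto intro: bounded_subset[of "{r..2 * r}"])
    have i1: "integrable lborel (\<lambda>x. ?J' x * \<kappa> N (x + y))"
    proof (rule Bochner_Integration.integrable_bound)
      show "integrable lborel (\<lambda>x. ?J' x * (1 / r))" using intJ by simp
      show "AE x in lborel. norm (?J' x * \<kappa> N (x + y)) \<le> norm (?J' x * (1 / r))"
      proof (rule AE_I2)
        fix x
        show "norm (?J' x * \<kappa> N (x + y)) \<le> norm (?J' x * (1 / r))"
        proof (cases "x \<in> {r<..2 * r}")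
          case True
          then have s: "x + y > 0" "2 * r \<le> x + y" using y r by auto
          have "2 / (x + y) \<le> 1 / r" using s r by (simp add: field_simps)
          with \<kappa>_bd[OF s(1), of N] True r show ?thesis by simp
        qed simp
      qed
    qed measurable
    have i2: "integrable lborel (\<lambda>x. ?J' x * (1 - cos (N * (x + y))))"
    proof (rule Bochner_Integration.integrable_bound)
      show "integrable lborel (\<lambda>x. ?J' x * 2)" using intJ by simp
      show "AE x in lborel. norm (?J' x * (1 - cos (N * (x + y)))) \<le> norm (?J' x * 2)"
      proof (rule AE_I2)
        fix x show "norm (?J' x * (1 - cos (N * (x + y)))) \<le> norm (?J' x * 2)"
          using cos_ge_minus_one[of "N * (x + y)"] cos_le_one[of "N * (x + y)"] by (auto simp: indicator_def)
      qed
    qed measurable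
    have "(LINT x|lborel. ?J' x * (1 - cos (N * (x + y)))) = (LINT x|lborel. indicator {r..2 * r} x *\<^sub>R (1 - cos (N * (x + y))))"
    proof (rule integral_cong_AE)
      show "AE x in lborel. ?J' x * (1 - cos (N * (x + y))) = indicator {r..2 * r} x *\<^sub>R (1 - cos (N * (x + y)))"
        using AE_lborel_singleton[of r] by eventually_elim (auto simp: indicator_def)
    qed measurable
    also have "\<dots> = (2 * r - sin (N * (2 * r + y)) / N) - (r - sin (N * (r + y)) / N)"
    proof (rule integral_FTC_Icc)
      show "((\<lambda>x. x - sin (N * (x + y)) / N) has_vector_derivative 1 - cos (N * (x + y))) (at x within {r..2 * r})" for x
        unfolding has_real_derivative_iff_has_vector_derivative[symmetric]
        using N by (auto intro!: derivative_eq_intros)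
    qed (use r in \<open>auto intro!: continuous_intros\<close>)
    also have "\<dots> \<ge> r - 2 / N"
    proof -
      have "sin (N * (2 * r + y)) / N \<le> 1 / N" "- 1 / N \<le> sin (N * (r + y)) / N"
        using N divide_right_mono[OF sin_ge_minus_one[of "N * (r + y)"], of N]
          divide_right_mono[OF sin_le_one[of "N * (2 * r + y)"], of N] by auto
      then show ?thesis by (simp add: field_simps)
    qed
    finally have "1 / (4 * r) * (r - 2 / N) \<le> 1 / (4 * r) * (LINT x|lborel. ?J' x * (1 - cos (N * (x + y))))"
      using r by (intro mult_left_mono) auto
    also have "\<dots> = (LINT x|lborel. 1 / (4 * r) * (?J' x * (1 - cos (N * (x + y)))))"
      by (rule integral_mult_right_zero[symmetric])
    also have "\<dots> \<le> X N y"
      unfolding X_def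
    proof (rule integral_mono)
      show "integrable lborel (\<lambda>x. 1 / (4 * r) * (?J' x * (1 - cos (N * (x + y)))))"
        using i2 by (rule integrable_mult_right)
      show "1 / (4 * r) * (?J' x * (1 - cos (N * (x + y)))) \<le> ?J' x * \<kappa> N (x + y)" for x
      proof (cases "x \<in> {r<..2 * r}")
        case True
        then have s: "0 < x + y" "x + y \<le> 4 * r" using y r by auto
        then have "1 / (4 * r) * (1 - cos (N * (x + y))) \<le> 1 / (x + y) * (1 - cos (N * (x + y)))"
          using r by (intro mult_right_mono) (auto simp: frac_le)
        with True show ?thesis by (simp add: \<kappa>_def)
      qed simp
    qed (rule i1)
    finally show ?thesis .
  qed
  have low: "(r - 2 / real n) / (4 * pi) \<le> cmod (I (real n))" if n: "real n > 0" "r - 2 / real n \<ge> 0" for n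
  proof -
    let ?J' = "indicator {r<..2 * r} :: real \<Rightarrow> real"
    have Xm [measurable]: "X (real n) \<in> borel_measurable borel"
      unfolding X_def by measurable
    have Xup: "X (real n) y \<le> 1" if y: "y \<in> {r<..2 * r}" for y
    proof -
      have "X (real n) y \<le> (LINT x|lborel. ?J' x * (1 / r))"
        unfolding X_def
      proof (rule integral_mono')
        show "integrable lborel (\<lambda>x. ?J' x * (1 / r))"
          by (intro integrable_mult_left integrable_real_indicator emeasure_bounded_finite) (auto intro: bounded_subset[of "{r..2 * r}"])
        show "?J' x * \<kappa> (real n) (x + y) \<le> ?J' x * (1 / r)" "0 \<le> ?J' x * (1 / r)" for x
        proof -
          show "?J' x * \<kappa> (real n) (x + y) \<le> ?J' x * (1 / r)"
          proof (cases "x \<in> {r<..2 * r}")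
            case True
            then have s: "x + y > 0" "2 * r \<le> x + y" using y r by auto
            have "2 / (x + y) \<le> 1 / r" using s r by (simp add: field_simps)
            with \<kappa>_bd[OF s(1), of "real n"] True show ?thesis by simp
          qed simp
          show "0 \<le> ?J' x * (1 / r)" using r by simp
        qed
      qed
      also have "\<dots> = 1" using r by simp
      finally show ?thesis .
    qed
    have X0: "0 \<le> X (real n) y" if y: "y \<in> {r<..2 * r}" for y
      by (rule order_trans[OF _ Xlow[OF n(1) y]]) (use r n(2) in auto)
    have intJ: "integrable lborel ?J'"
      by (intro integrable_real_indicator emeasure_bounded_finite) (auto intro: bounded_subset[of "{r..2 * r}"])
    have "(r - 2 / real n) / 4 = (LINT y|lborel. ?J' y * (1 / (4 * r) * (r - 2 / real n)))"
      using r by simp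
    also have "\<dots> \<le> (LINT y|lborel. ?J' y * X (real n) y)"
    proof (rule integral_mono)
      show "integrable lborel (\<lambda>y. ?J' y * (1 / (4 * r) * (r - 2 / real n)))"
        using intJ by (rule integrable_mult_left)
      show "integrable lborel (\<lambda>y. ?J' y * X (real n) y)"
      proof (rule Bochner_Integration.integrable_bound[OF intJ])
        show "AE y in lborel. norm (?J' y * X (real n) y) \<le> norm (?J' y)"
          using Xup X0 by (intro AE_I2) (auto simp: indicator_def)
      qed measurable
      show "?J' y * (1 / (4 * r) * (r - 2 / real n)) \<le> ?J' y * X (real n) y" for y
        using Xlow[OF n(1), of y] by (cases "y \<in> {r<..2 * r}") auto
    qed
    finally have "(r - 2 / real n) / 4 / pi \<le> (LINT y|lborel. ?J' y * X (real n) y) / pi"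
      by (rule divide_right_mono) simp
    also have "\<dots> \<le> cmod (I (real n))"
      by (simp add: val norm_mult norm_divide divide_right_mono)
    finally show ?thesis by simp
  qed
  have "(\<lambda>n. (r - 2 / real n) / (4 * pi)) \<longlonglongrightarrow> (r - 0) / (4 * pi)"
    by (intro tendsto_intros lim_const_over_n) auto
  moreover have "eventually (\<lambda>n. (r - 2 / real n) / (4 * pi) \<le> cmod (I (real n))) sequentially"
  proof -
    obtain M where M: "2 / r < real M" using reals_Archimedean2 by blast
    show ?thesis
      using eventually_ge_at_top[of M]
    proof eventually_elim
      case (elim n)
      then have "2 / r < real n" using M by linarith
      moreover have "0 < 2 / r" using r by simp
      ultimately have n0: "0 < real n" by linarith
      with \<open>2 / r < real n\<close> have "2 / real n \<le> r" using r by (simp add: field_simps)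
      with n0 show ?case by (intro low) auto
    qed
  qed
  ultimately have "(r - 0) / (4 * pi) \<le> cmod (cinner v (fourier_multiplier ?h u))"
    using tendsto_norm[OF lim] by (intro tendsto_le[OF sequentially_bot]) auto
  then show ?thesis by simp
qed

text \<open>Paired with the mirror indicator v, the commutator is close to (Lm - Lp) <v, sgn(D) u>,
  because \<psi> may be replaced by its limits on remote intervals. The rest is the contradiction
  with square summability along an orthonormal sequence.\<close>

theorem commutator_sgn_not_trace_class:
  assumes \<psi>: "\<psi> \<in> borel_measurable borel" "\<And>x. cmod (\<psi> x) \<le> K"
    and lim: "(\<psi> \<longlongrightarrow> Lp) at_top" "(\<psi> \<longlongrightarrow> Lm) at_bot" "Lp \<noteq> Lm"
  shows "\<not> trace_class (commutator (mult_op \<psi>) (fourier_multiplier (\<lambda>t. complex_of_real (sgn t))))"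
proof
  let ?h = "\<lambda>t. complex_of_real (sgn t)"
  let ?S = "fourier_multiplier ?h"
  let ?T = "commutator (mult_op \<psi>) ?S"
  assume tc: "trace_class ?T"
  have \<psi>b: "bounded (range \<psi>)" using \<psi>(2) by (auto simp: bounded_range_norm)
  have hm: "?h \<in> borel_measurable borel" "bounded (range ?h)" "\<And>x. cmod (?h x) \<le> 1"
    by (auto simp: bounded_range_norm sgn_real_def intro!: exI[of _ 1])
  define T' where "T' = commutator (fourier_multiplier (\<lambda>x. cnj (?h x))) (mult_op (\<lambda>x. cnj (\<psi> x)))"
  have adj: "adjoint_pair ?T T'"
    unfolding T'_def by (intro adjoint_commutator adjoint_mult_op adjoint_fourier_multiplier \<psi> \<psi>b hm)
  have "bounded_clinear T'"
    unfolding T'_def using \<psi>(1) hm(1)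
    by (intro bounded_clinear_commutator bounded_clinear_fourier_multiplier bounded_clinear_mult_op bounded_range_cnj \<psi>b hm(2)) auto
  from trace_class_square_summable[OF tc this adj]
  obtain C where C: "\<And>F (e :: nat \<Rightarrow> L2). bessel_family F e \<Longrightarrow> (\<Sum>j\<in>F. (norm (?T (e j)))\<^sup>2) \<le> C" by blast
  \<comment> \<open>Chosen so that the main term is at least d 2^n. Two replacement errors of at
    most d/4 times 2^n leave d/2 times 2^n.\<close>
  define d where "d = cmod (Lm - Lp) / (4 * pi)"
  have d: "d > 0" using lim(3) by (simp add: d_def)
  have "eventually (\<lambda>x. dist (\<psi> x) Lp < d / 4) at_top" "eventually (\<lambda>x. dist (\<psi> x) Lm < d / 4) at_bot"
    using d tendstoD[OF lim(1), of "d / 4"] tendstoD[OF lim(2), of "d / 4"] by simp_all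
  then obtain R1 R2 where R: "\<And>x. x \<ge> R1 \<Longrightarrow> dist (\<psi> x) Lp < d / 4" "\<And>x. x \<le> R2 \<Longrightarrow> dist (\<psi> x) Lm < d / 4"
    by (auto simp: eventually_at_top_linorder eventually_at_bot_linorder)
  \<comment> \<open>From n0 on the dyadic intervals and their mirror images lie where \<psi> is
    within d/4 of its limits.\<close>
  obtain n0 where n0: "max R1 (- R2) < 2 ^ n0"
    using real_arch_pow[of 2 "max R1 (- R2)"] by auto
  define u where "u n = abs_L2 (indicator {2 ^ n<..2 * 2 ^ n})" for n :: nat
  define v where "v n = abs_L2 (\<lambda>x. indicator {2 ^ n<..2 * 2 ^ n} (- x))" for n :: nat
  let ?J = "\<lambda>n::nat. indicator {2 ^ n<..2 * 2 ^ n} :: real \<Rightarrow> complex"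
  have si: "square_integrable (?J n)" for n by (rule square_integrable_indicator_Ioc)
  have si': "square_integrable (\<lambda>x. ?J n (- x))" for n
  proof -
    have "(\<lambda>x. (cmod (?J n (- x)))\<^sup>2) = (\<lambda>x. (\<lambda>y. (cmod (?J n y))\<^sup>2) (0 + (-1) * x))" by simp
    then show ?thesis
      using si[of n] lborel_integrable_real_affine[of "\<lambda>y. (cmod (?J n y))\<^sup>2" "-1" 0] by (simp add: square_integrable_def)
  qed
  have nn: "(norm (abs_L2 (?J n)))\<^sup>2 = 2 ^ n" "(norm (abs_L2 (\<lambda>x. ?J n (- x))))\<^sup>2 = 2 ^ n" for n
  proof -
    have sq: "(\<lambda>x. (cmod (?J n x))\<^sup>2) = (indicator {2 ^ n<..2 * 2 ^ n} :: real \<Rightarrow> real)" by (auto simp: indicator_def)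
    have one: "(LINT x|lborel. indicator {2 ^ n<..2 * 2 ^ n :: real} x) = (2 ^ n :: real)" for n :: nat by simp
    show "(norm (abs_L2 (?J n)))\<^sup>2 = 2 ^ n"
      unfolding norm_abs_L2[OF si] sq by (rule one)
    have "(LINT x|lborel. (cmod (?J n (- x)))\<^sup>2) = \<bar>-1\<bar> *\<^sub>R (LINT x|lborel. (cmod (?J n (- (0 + (-1) * x))))\<^sup>2)"
      by (rule lborel_integral_real_affine) simp
    also have "\<dots> = (LINT x|lborel. (cmod (?J n x))\<^sup>2)" by simp
    finally show "(norm (abs_L2 (\<lambda>x. ?J n (- x))))\<^sup>2 = 2 ^ n"
      unfolding norm_abs_L2[OF si'] sq using one by simp
  qed
  have near: "norm (mult_op h (abs_L2 w) - c *\<^sub>C abs_L2 w) \<le> d / 4 * norm (abs_L2 w)"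
    if h: "h \<in> borel_measurable borel" "bounded (range h)" and w: "square_integrable w" and c: "\<And>x. w x \<noteq> 0 \<Longrightarrow> cmod (h x - c) \<le> d / 4" for h w c
  proof -
    have hw: "square_integrable (\<lambda>x. h x * w x)" using square_integrable_mult[OF _ h(2) w] h(1) by simp
    have "(norm (mult_op h (abs_L2 w) - c *\<^sub>C abs_L2 w))\<^sup>2 = (LINT x|lborel. (cmod (h x * w x - c * w x))\<^sup>2)"
      unfolding mult_op_abs_L2[OF h w] abs_L2_scaleC[OF w] by (rule norm_diff_abs_L2(1)[OF hw square_integrable_scale[OF w]])
    also have "\<dots> \<le> (LINT x|lborel. (d / 4)\<^sup>2 * (cmod (w x))\<^sup>2)"
    proof (rule integral_mono)
      show "integrable lborel (\<lambda>x. (cmod (h x * w x - c * w x))\<^sup>2)"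
        using square_integrable_diff[OF hw square_integrable_scale[OF w]] by (simp add: square_integrable_def)
      show "integrable lborel (\<lambda>x. (d / 4)\<^sup>2 * (cmod (w x))\<^sup>2)" using w by (simp add: square_integrable_def)
      show "(cmod (h x * w x - c * w x))\<^sup>2 \<le> (d / 4)\<^sup>2 * (cmod (w x))\<^sup>2" for x
      proof (cases "w x = 0")
        case False
        then show ?thesis
          unfolding left_diff_distrib[symmetric] norm_mult power_mult_distrib using c[of x]
          by (intro mult_right_mono power_mono) auto
      qed simp
    qed
    also have "\<dots> = (d / 4 * norm (abs_L2 w))\<^sup>2"
      by (simp add: power_mult_distrib power_divide norm_abs_L2[OF w])
    finally show ?thesis
      using d by (auto intro: power2_le_imp_le)
  qed
  have lower: "d / 2 * sqrt (2 ^ n) \<le> norm (?T (u n))" if n: "n \<ge> n0" for n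
  proof -
    have pn: "2 ^ n \<ge> (2 ^ n0 :: real)" using n by (intro power_increasing) auto
    have nu: "norm (u n) = sqrt (2 ^ n)" "norm (v n) = sqrt (2 ^ n)"
      unfolding u_def v_def by (rule real_sqrt_unique[symmetric, OF nn(1)], simp, rule real_sqrt_unique[symmetric, OF nn(2)], simp)
    have e1: "norm (mult_op \<psi> (u n) - Lp *\<^sub>C u n) \<le> d / 4 * sqrt (2 ^ n)"
      unfolding nu(1)[symmetric] u_def
    proof (rule near[OF \<psi>(1) \<psi>b si])
      fix x assume "?J n x \<noteq> 0"
      then have "x > 2 ^ n" by (auto simp: indicator_def split: if_splits)
      then have "x \<ge> R1" using n0 pn by linarith
      from R(1)[OF this] show "cmod (\<psi> x - Lp) \<le> d / 4" by (simp add: dist_norm)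
    qed
    have e2: "norm (mult_op (\<lambda>x. cnj (\<psi> x)) (v n) - cnj Lm *\<^sub>C v n) \<le> d / 4 * sqrt (2 ^ n)"
      unfolding nu(2)[symmetric] v_def
    proof (rule near[OF _ bounded_range_cnj[OF \<psi>b] si'])
      fix x assume "?J n (- x) \<noteq> 0"
      then have "- x > 2 ^ n" by (auto simp: indicator_def split: if_splits)
      then have "x \<le> R2" using n0 pn by linarith
      from R(2)[OF this] show "cmod (cnj (\<psi> x) - cnj Lm) \<le> d / 4"
        by (simp add: dist_norm flip: complex_cnj_diff)
    qed (use \<psi>(1) in measurable)
    have SL: "norm (?S w) \<le> norm w" for w
      using norm_fourier_multiplier_le[OF hm(1,3), of w] by simp
    note Slin = bounded_clinearD[OF bounded_clinear_fourier_multiplier[OF hm(1,2)]]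
    define a where "a = cinner (v n) (?S (u n))"
    have r0: "(2 ^ n :: real) > 0" by simp
    have a: "2 ^ n / (4 * pi) \<le> cmod a"
      unfolding a_def by (rule sgn_form_lower_bound[OF r0 u_def v_def])
    \<comment> \<open>On the side of v the operator \<psi> is moved across by its adjoint and
      replaced by Lm; in \<open>t2\<close> it acts on u directly and is replaced by Lp.\<close>
    have t1: "cmod (cinner (v n) (mult_op \<psi> (?S (u n))) - Lm * a) \<le> d / 4 * 2 ^ n"
    proof -
      have "cinner (v n) (mult_op \<psi> (?S (u n))) = cinner (mult_op (\<lambda>x. cnj (\<psi> x)) (v n)) (?S (u n))"
        using adjoint_mult_op[OF \<psi>(1) \<psi>b] by (simp add: adjoint_pair_def)
      then have "cinner (v n) (mult_op \<psi> (?S (u n))) - Lm * a = cinner (mult_op (\<lambda>x. cnj (\<psi> x)) (v n) - cnj Lm *\<^sub>C v n) (?S (u n))"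
        by (simp add: a_def cinner_diff_left cinner_scaleC_left)
      also have "cmod \<dots> \<le> norm (mult_op (\<lambda>x. cnj (\<psi> x)) (v n) - cnj Lm *\<^sub>C v n) * norm (?S (u n))"
        by (rule cinner_Cauchy_Schwarz)
      also have "\<dots> \<le> (d / 4 * sqrt (2 ^ n)) * sqrt (2 ^ n)"
        using e2 SL[of "u n"] d nu by (intro mult_mono) auto
      finally show ?thesis by (simp add: mult.assoc)
    qed
    have t2: "cmod (cinner (v n) (?S (mult_op \<psi> (u n))) - Lp * a) \<le> d / 4 * 2 ^ n"
    proof -
      have "cinner (v n) (?S (mult_op \<psi> (u n))) - Lp * a = cinner (v n) (?S (mult_op \<psi> (u n) - Lp *\<^sub>C u n))"
        by (simp add: a_def Slin cinner_diff_right cinner_scaleC_right)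
      also have "cmod \<dots> \<le> norm (v n) * norm (?S (mult_op \<psi> (u n) - Lp *\<^sub>C u n))"
        by (rule cinner_Cauchy_Schwarz)
      also have "\<dots> \<le> sqrt (2 ^ n) * (d / 4 * sqrt (2 ^ n))"
        using e1 SL[of "mult_op \<psi> (u n) - Lp *\<^sub>C u n"] nu by (intro mult_mono) auto
      finally show ?thesis by (simp add: mult.left_commute)
    qed
    have "cinner (v n) (?T (u n)) = (Lm - Lp) * a + (cinner (v n) (mult_op \<psi> (?S (u n))) - Lm * a) - (cinner (v n) (?S (mult_op \<psi> (u n))) - Lp * a)"
      by (simp add: commutator_def cinner_diff_right algebra_simps)
    then have "cmod ((Lm - Lp) * a) \<le> cmod (cinner (v n) (?T (u n))) + cmod (cinner (v n) (mult_op \<psi> (?S (u n))) - Lm * a) + cmod (cinner (v n) (?S (mult_op \<psi> (u n))) - Lp * a)"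
      using norm_triangle_ineq4[of "cinner (v n) (?T (u n))" "cinner (v n) (mult_op \<psi> (?S (u n))) - Lm * a"]
        norm_triangle_ineq[of "cinner (v n) (?T (u n)) - (cinner (v n) (mult_op \<psi> (?S (u n))) - Lm * a)" "cinner (v n) (?S (mult_op \<psi> (u n))) - Lp * a"]
      by (simp add: algebra_simps)
    moreover have "d * 2 ^ n \<le> cmod ((Lm - Lp) * a)"
      using mult_left_mono[OF a, of "cmod (Lm - Lp)"] by (simp add: d_def norm_mult mult.commute)
    ultimately have "d / 2 * 2 ^ n \<le> cmod (cinner (v n) (?T (u n)))"
      using t1 t2 by linarith
    also have "\<dots> \<le> sqrt (2 ^ n) * norm (?T (u n))"
      using cinner_Cauchy_Schwarz[of "v n" "?T (u n)"] by (simp add: nu)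
    finally have "sqrt (2 ^ n) * (d / 2 * sqrt (2 ^ n)) \<le> sqrt (2 ^ n) * norm (?T (u n))"
      by (simp add: mult.left_commute)
    then show ?thesis by simp
  qed
  define e where "e n = (1 / sqrt (2 ^ n)) *\<^sub>R u n" for n
  have e1: "norm (e n) = 1" for n
    using real_sqrt_unique[symmetric, OF nn(1)[of n]] by (simp add: e_def u_def)
  have orth: "cinner (e m) (e n) = 0" if mn: "m \<noteq> n" for m n
  proof -
    \<comment> \<open>Half-open dyadic intervals are disjoint, so the normalised indicators are
      orthonormal.\<close>
    have "cnj (?J m x) * ?J n x = 0" for x
    proof (rule ccontr)
      assume "cnj (?J m x) * ?J n x \<noteq> 0"
      then have x: "2 ^ m < x" "x \<le> 2 ^ Suc m" "2 ^ n < x" "x \<le> 2 ^ Suc n"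
        by (auto simp: indicator_def split: if_splits)
      have "2 ^ m < (2 ^ Suc n :: real)" "2 ^ n < (2 ^ Suc m :: real)" using x by linarith+
      then have "m < Suc n" "n < Suc m"
        using power_less_imp_less_exp[of "2::real" m "Suc n"] power_less_imp_less_exp[of "2::real" n "Suc m"] by linarith+
      with mn show False by simp
    qed
    then have "cinner (u m) (u n) = 0"
      unfolding u_def cinner_abs_L2[OF si si] by (simp only: Bochner_Integration.integral_zero)
    then show ?thesis by (simp add: e_def)
  qed
  \<comment> \<open>Each of k consecutive unit vectors contributes at least (d / 2)^2 to a sum
    bounded by C.\<close>
  have "real k * (d / 2)\<^sup>2 \<le> C" for k :: nat
  proof -
    let ?F = "{n0..<n0 + k}"
    have "real k * (d / 2)\<^sup>2 = (\<Sum>n\<in>?F. (d / 2)\<^sup>2)" by simp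
    also have "\<dots> \<le> (\<Sum>n\<in>?F. (norm (?T (e n)))\<^sup>2)"
    proof (intro sum_mono power_mono)
      fix n assume "n \<in> ?F"
      then have "d / 2 * sqrt (2 ^ n) \<le> norm (?T (u n))" by (intro lower) simp
      moreover have "norm (?T (e n)) = norm (?T (u n)) / sqrt (2 ^ n)"
        by (simp add: e_def bounded_clinearD[OF bounded_clinear_commutator[OF bounded_clinear_mult_op[OF \<psi>(1) \<psi>b] bounded_clinear_fourier_multiplier[OF hm(1,2)]]])
      ultimately show "d / 2 \<le> norm (?T (e n))"
        by (simp add: pos_le_divide_eq)
    qed (use d in simp)
    also have "\<dots> \<le> C"
      by (rule C, rule bessel_inequality(3)) (auto simp: e1 orth)
    finally show ?thesis .
  qed
  moreover obtain k where "C / (d / 2)\<^sup>2 < real k" using reals_Archimedean2 by blast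
  ultimately show False
    using d by (metis divide_less_eq half_gt_zero not_le zero_less_power)
qed

section \<open>Integral operators and Bessel families\<close>

lemma integrable_pair_mult:
  fixes f :: "'a \<Rightarrow> 'c::{real_normed_field, banach, second_countable_topology}" and g :: "'b \<Rightarrow> 'c"
  assumes "sigma_finite_measure M" "sigma_finite_measure N" and f: "integrable M f" and g: "integrable N g"
  shows "integrable (M \<Otimes>\<^sub>M N) (\<lambda>(x, y). f x * g y)"
    and "(LINT z|(M \<Otimes>\<^sub>M N). (case z of (x, y) \<Rightarrow> f x * g y)) = integral\<^sup>L M f * integral\<^sup>L N g"
proof -
  interpret pair_sigma_finite M N
    using assms(1,2) by (rule pair_sigma_finite.intro)
  have [measurable]: "f \<in> borel_measurable M" "g \<in> borel_measurable N" using f g by auto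
  show *: "integrable (M \<Otimes>\<^sub>M N) (\<lambda>(x, y). f x * g y)"
  proof (rule Fubini_integrable)
    show "integrable M (\<lambda>x. LINT y|N. norm (case (x, y) of (x, y) \<Rightarrow> f x * g y))"
      using f by (simp add: norm_mult)
    show "AE x in M. integrable N (\<lambda>y. case (x, y) of (x, y) \<Rightarrow> f x * g y)"
      using g by simp
  qed measurable
  show "(LINT z|(M \<Otimes>\<^sub>M N). (case z of (x, y) \<Rightarrow> f x * g y)) = integral\<^sup>L M f * integral\<^sup>L N g"
    using integral_fst'[OF *] by simp
qed

text \<open>Cauchy-Schwarz in L2 for the absolute values of f and g, whose norms are those of f and
  g.\<close>

lemma integral_norm_mult_le:
  assumes f: "square_integrable f" and g: "square_integrable g"
  shows "(LINT x|lborel. cmod (f x * g x)) \<le> norm (abs_L2 f) * norm (abs_L2 g)"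
proof -
  have si: "square_integrable (\<lambda>x. complex_of_real (cmod (h x)))" if "square_integrable h" for h
  proof -
    have [measurable]: "h \<in> borel_measurable borel" using that by (rule square_integrable_measurable)
    show ?thesis using that by (simp add: square_integrable_def)
  qed
  have n: "norm (abs_L2 (\<lambda>x. complex_of_real (cmod (h x)))) = norm (abs_L2 h)" if "square_integrable h" for h
  proof -
    have "(norm (abs_L2 (\<lambda>x. complex_of_real (cmod (h x)))))\<^sup>2 = (norm (abs_L2 h))\<^sup>2"
      unfolding norm_abs_L2[OF si[OF that]] norm_abs_L2[OF that] by simp
    then show ?thesis by (simp add: power2_eq_iff_nonneg)
  qed
  have "cinner (abs_L2 (\<lambda>x. complex_of_real (cmod (f x)))) (abs_L2 (\<lambda>x. complex_of_real (cmod (g x))))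
      = (LINT x|lborel. complex_of_real (cmod (f x * g x)))"
    unfolding cinner_abs_L2[OF si[OF f] si[OF g]] by (simp add: norm_mult)
  also have "\<dots> = complex_of_real (LINT x|lborel. cmod (f x * g x))"
    by (rule integral_complex_of_real)
  finally have "cmod (complex_of_real (LINT x|lborel. cmod (f x * g x))) \<le> norm (abs_L2 f) * norm (abs_L2 g)"
    using cinner_Cauchy_Schwarz[of "abs_L2 (\<lambda>x. complex_of_real (cmod (f x)))" "abs_L2 (\<lambda>x. complex_of_real (cmod (g x)))"]
    by (simp add: n[OF f] n[OF g])
  moreover have "0 \<le> (LINT x|lborel. cmod (f x * g x))" by simp
  ultimately show ?thesis by (simp only: norm_of_real abs_of_nonneg)
qed

text \<open>A superposition of the rank one operators with kernels \<open>u w x * v w y\<close> has trace norm at most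
  \<open>\<integral> \<parallel>u w\<parallel> \<parallel>v w\<parallel>\<close>; the arithmetic mean of the squares is enough here.\<close>

lemma bessel_double_integral_bound:
  fixes u v :: "'c \<Rightarrow> real \<Rightarrow> complex" and p q :: "'i \<Rightarrow> real \<Rightarrow> complex"
  assumes M: "sigma_finite_measure M"
    and um: "(\<lambda>(w, x). u w x) \<in> borel_measurable (M \<Otimes>\<^sub>M lborel)"
    and vm: "(\<lambda>(w, x). v w x) \<in> borel_measurable (M \<Otimes>\<^sub>M lborel)"
    and su: "\<And>w. square_integrable (u w)" and sv: "\<And>w. square_integrable (v w)"
    and iu: "integrable M (\<lambda>w. LINT x|lborel. (cmod (u w x))\<^sup>2)"
    and iv: "integrable M (\<lambda>w. LINT x|lborel. (cmod (v w x))\<^sup>2)"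
    and p: "\<And>j. square_integrable (p j)" and q: "\<And>j. square_integrable (q j)"
    and bp: "bessel_family F (\<lambda>j. abs_L2 (p j))" and bq: "bessel_family F (\<lambda>j. abs_L2 (q j))"
  shows "(\<Sum>j\<in>F. cmod (LINT x|lborel. LINT y|lborel. (LINT w|M. u w x * v w y) * (cnj (p j x) * q j y)))
     \<le> ((LINT w|M. LINT x|lborel. (cmod (u w x))\<^sup>2) + (LINT w|M. LINT x|lborel. (cmod (v w x))\<^sup>2)) / 2"
proof -
  let ?L = "lborel \<Otimes>\<^sub>M lborel :: (real \<times> real) measure"
  have sL: "sigma_finite_measure (lborel :: real measure)" by (rule lborel.sigma_finite_measure_axioms)
  interpret P: pair_sigma_finite M ?L
    by (intro pair_sigma_finite.intro M sigma_finite_pair_measure sL)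
  define U where "U w = (LINT x|lborel. (cmod (u w x))\<^sup>2)" for w
  define V where "V w = (LINT x|lborel. (cmod (v w x))\<^sup>2)" for w
  \<comment> \<open>For fixed w the rank one kernel acts through the coefficients A and B, to which
    the two Bessel inequalities apply.\<close>
  define A where "A j w = (LINT x|lborel. u w x * cnj (p j x))" for j w
  define B where "B j w = (LINT y|lborel. v w y * q j y)" for j w
  have [measurable]: "p j \<in> borel_measurable borel" "q j \<in> borel_measurable borel" for j
    using square_integrable_measurable[OF p] square_integrable_measurable[OF q] by auto
  have up: "integrable lborel (\<lambda>x. u w x * cnj (p j x))" for j w
    using square_integrable_product[OF p su, of j w] by (simp add: mult.commute)
  have vq: "integrable lborel (\<lambda>x. v w x * q j x)" for j w
    using square_integrable_product[OF square_integrable_cnj[OF sv] q, of w j] by simp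
  have A: "A j w = cinner (abs_L2 (p j)) (abs_L2 (u w))" for j w
    unfolding A_def cinner_abs_L2[OF p su] by (simp add: mult.commute)
  have B: "B j w = cinner (abs_L2 (\<lambda>y. cnj (v w y))) (abs_L2 (q j))" for j w
    by (simp add: B_def cinner_abs_L2[OF square_integrable_cnj[OF sv] q])
  have nu: "(norm (abs_L2 (u w)))\<^sup>2 = U w" "(norm (abs_L2 (\<lambda>y. cnj (v w y))))\<^sup>2 = V w" "(norm (abs_L2 (v w)))\<^sup>2 = V w" for w
    unfolding U_def V_def norm_abs_L2[OF su] norm_abs_L2[OF square_integrable_cnj[OF sv]] norm_abs_L2[OF sv] by simp_all
  define G where "G j w z = (u w (fst z) * cnj (p j (fst z))) * (v w (snd z) * q j (snd z))" for j w z
  have uz: "(\<lambda>(w, z). u w (fst z)) \<in> borel_measurable (M \<Otimes>\<^sub>M ?L)"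
    using measurable_compose[OF _ um, of "\<lambda>(w, z). (w, fst z)" "M \<Otimes>\<^sub>M ?L"] by (simp add: case_prod_unfold)
  have vz: "(\<lambda>(w, z). v w (snd z)) \<in> borel_measurable (M \<Otimes>\<^sub>M ?L)"
    using measurable_compose[OF _ vm, of "\<lambda>(w, z). (w, snd z)" "M \<Otimes>\<^sub>M ?L"] by (simp add: case_prod_unfold)
  note [measurable] = uz[unfolded case_prod_unfold] vz[unfolded case_prod_unfold]
  have Gm [measurable]: "(\<lambda>(w, z). G j w z) \<in> borel_measurable (M \<Otimes>\<^sub>M ?L)" for j
    unfolding G_def case_prod_unfold by measurable
  have Gw: "integrable ?L (G j w)" "(LINT z|?L. G j w z) = A j w * B j w" for j w
    using integrable_pair_mult[OF sL sL up[of w j] vq[of w j]]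
    by (simp_all add: G_def[abs_def] case_prod_unfold A_def B_def)
  have nG: "(LINT z|?L. norm (G j w z)) = (LINT x|lborel. cmod (u w x * cnj (p j x))) * (LINT y|lborel. cmod (v w y * q j y))" for j w
    using integrable_pair_mult(2)[OF sL sL integrable_norm[OF up[of w j]] integrable_norm[OF vq[of w j]]]
    by (simp add: G_def[abs_def] case_prod_unfold norm_mult)
  \<comment> \<open>Joint integrability in (w, x, y) comes from Cauchy-Schwarz in x and in y and the
    integrability of the squared norms of u w and v w.\<close>
  have Gint: "integrable (M \<Otimes>\<^sub>M ?L) (\<lambda>(w, z). G j w z)" for j
  proof (rule P.Fubini_integrable)
    let ?P = "norm (abs_L2 (p j))" and ?Q = "norm (abs_L2 (q j))"
    show "integrable M (\<lambda>w. LINT z|?L. norm (case (w, z) of (w, z) \<Rightarrow> G j w z))"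
    proof (rule Bochner_Integration.integrable_bound)
      show "integrable M (\<lambda>w. ?P\<^sup>2 * U w + ?Q\<^sup>2 * V w)"
        using iu iv unfolding U_def[symmetric] V_def[symmetric] by simp
      show "(\<lambda>w. LINT z|?L. norm (case (w, z) of (w, z) \<Rightarrow> G j w z)) \<in> borel_measurable M"
        by (rule sigma_finite_measure.borel_measurable_lebesgue_integral[OF sigma_finite_pair_measure[OF sL sL]]) measurable
      show "AE w in M. norm (LINT z|?L. norm (case (w, z) of (w, z) \<Rightarrow> G j w z)) \<le> norm (?P\<^sup>2 * U w + ?Q\<^sup>2 * V w)"
      proof (rule AE_I2)
        fix w
        have a: "(LINT x|lborel. cmod (u w x * cnj (p j x))) \<le> norm (abs_L2 (u w)) * ?P"
        proof -
          have "(LINT x|lborel. cmod (u w x * cnj (p j x))) = (LINT x|lborel. cmod (u w x * p j x))"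
            by (simp add: norm_mult)
          then show ?thesis using integral_norm_mult_le[OF su p, of w j] by simp
        qed
        have b: "(LINT y|lborel. cmod (v w y * q j y)) \<le> norm (abs_L2 (v w)) * ?Q"
          by (rule integral_norm_mult_le[OF sv q])
        have "(LINT z|?L. norm (G j w z)) \<le> (norm (abs_L2 (u w)) * ?P) * (norm (abs_L2 (v w)) * ?Q)"
          unfolding nG by (rule mult_mono[OF a b]) auto
        also have "\<dots> \<le> (norm (abs_L2 (u w)) * ?P)\<^sup>2 + (norm (abs_L2 (v w)) * ?Q)\<^sup>2"
        proof -
          have "a * b \<le> a\<^sup>2 + b\<^sup>2" if "0 \<le> a" "0 \<le> b" for a b :: real
            using sum_squares_bound[of a b] mult_nonneg_nonneg[OF that] by linarith
          then show ?thesis by simp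
        qed
        also have "\<dots> = ?P\<^sup>2 * U w + ?Q\<^sup>2 * V w"
          by (simp add: power_mult_distrib nu mult.commute)
        finally show "norm (LINT z|?L. norm (case (w, z) of (w, z) \<Rightarrow> G j w z)) \<le> norm (?P\<^sup>2 * U w + ?Q\<^sup>2 * V w)"
          by simp
      qed
    qed
    show "AE w in M. integrable ?L (\<lambda>z. case (w, z) of (w, z) \<Rightarrow> G j w z)"
      by (simp add: Gw(1))
  qed measurable
  have eq: "(LINT x|lborel. LINT y|lborel. (LINT w|M. u w x * v w y) * (cnj (p j x) * q j y)) = (LINT w|M. A j w * B j w)" for j
  proof -
    have i: "integrable ?L (\<lambda>z. LINT w|M. G j w z)"
      by (rule P.integrable_snd[OF Gint])
    have "(LINT w|M. u w x * v w y) * (cnj (p j x) * q j y) = (LINT w|M. G j w (x, y))" for x y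
      unfolding integral_mult_left_zero[symmetric]
      by (rule Bochner_Integration.integral_cong) (simp_all add: G_def mult_ac)
    then have "(LINT x|lborel. LINT y|lborel. (LINT w|M. u w x * v w y) * (cnj (p j x) * q j y)) = (LINT x|lborel. LINT y|lborel. LINT w|M. G j w (x, y))"
      by simp
    also have "\<dots> = (LINT z|?L. LINT w|M. G j w z)"
      by (rule lborel_pair.integral_fst'[OF i])
    also have "\<dots> = (LINT w|M. LINT z|?L. G j w z)"
      by (rule P.Fubini_integral[OF Gint])
    finally show ?thesis by (simp add: Gw(2))
  qed
  have ABi: "integrable M (\<lambda>w. A j w * B j w)" for j
    using P.integrable_fst[OF Gint[of j]] by (simp add: Gw(2))
  have "(\<Sum>j\<in>F. cmod (LINT x|lborel. LINT y|lborel. (LINT w|M. u w x * v w y) * (cnj (p j x) * q j y)))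
      \<le> (\<Sum>j\<in>F. LINT w|M. cmod (A j w * B j w))"
    unfolding eq by (intro sum_mono integral_norm_bound)
  also have "\<dots> = (LINT w|M. (\<Sum>j\<in>F. cmod (A j w * B j w)))"
    by (rule Bochner_Integration.integral_sum[symmetric]) (rule integrable_norm[OF ABi])
  also have "\<dots> \<le> (LINT w|M. (U w + V w) / 2)"
  proof (rule integral_mono)
    show "integrable M (\<lambda>w. \<Sum>j\<in>F. cmod (A j w * B j w))"
      by (intro Bochner_Integration.integrable_sum integrable_norm ABi)
    show "integrable M (\<lambda>w. (U w + V w) / 2)"
      using iu iv unfolding U_def[symmetric] V_def[symmetric] by simp
    fix w
    \<comment> \<open>Summation over j takes place inside the integral over w, so Bessel is used
      pointwise in w.\<close>
    have "(\<Sum>j\<in>F. cmod (A j w * B j w)) \<le> (\<Sum>j\<in>F. (cmod (A j w))\<^sup>2 / 2 + (cmod (B j w))\<^sup>2 / 2)"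
    proof (rule sum_mono)
      fix j
      show "cmod (A j w * B j w) \<le> (cmod (A j w))\<^sup>2 / 2 + (cmod (B j w))\<^sup>2 / 2"
        using sum_squares_bound[of "cmod (A j w)" "cmod (B j w)"] by (simp add: norm_mult)
    qed
    also have "\<dots> = (\<Sum>j\<in>F. (cmod (A j w))\<^sup>2) / 2 + (\<Sum>j\<in>F. (cmod (B j w))\<^sup>2) / 2"
      by (simp add: sum.distrib sum_divide_distrib)
    also have "\<dots> \<le> U w / 2 + V w / 2"
    proof -
      have "(\<Sum>j\<in>F. (cmod (A j w))\<^sup>2) \<le> U w"
        using bp unfolding A nu(1)[symmetric] bessel_family_def by blast
      moreover have "(\<Sum>j\<in>F. (cmod (B j w))\<^sup>2) \<le> V w"
        using bq unfolding B nu(2)[symmetric] bessel_family_def cmod_cinner_commute[of "abs_L2 (\<lambda>y. cnj (v w y))"] by blast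
      ultimately show ?thesis by simp
    qed
    finally show "(\<Sum>j\<in>F. cmod (A j w * B j w)) \<le> (U w + V w) / 2" by (simp add: add_divide_distrib)
  qed
  also have "\<dots> = ((LINT w|M. U w) + (LINT w|M. V w)) / 2"
    using iu iv unfolding U_def[symmetric] V_def[symmetric] by simp
  finally show ?thesis by (simp only: U_def V_def)
qed

text \<open>The transform at x - y is an integral over s of cis(- s x) cis(s y) h(s), and k is an
  integral over t of a(t, x) a(t, y). Their product is thus a superposition of rank one kernels over
  the pairs (t, s). The squared norms |h(s)| times the integral of a(t, .)^2 integrate to the L1
  norm of h times the integral of k over the diagonal.\<close>

lemma kernel_bessel_bound:
  fixes a k :: "real \<Rightarrow> real \<Rightarrow> real"
  assumes am: "(\<lambda>(t, x). a t x) \<in> borel_measurable (borel \<Otimes>\<^sub>M borel)"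
    and sq: "\<And>t. integrable lborel (\<lambda>x. (a t x)\<^sup>2)"
    and k: "\<And>x y. has_bochner_integral lborel (\<lambda>t. a t x * a t y) (k x y)"
    and diag: "integrable lborel (\<lambda>x. k x x)"
    and h: "integrable lborel h"
    and p: "\<And>j. square_integrable (p j)" and q: "\<And>j. square_integrable (q j)"
    and bp: "bessel_family F (\<lambda>j. abs_L2 (p j))" and bq: "bessel_family F (\<lambda>j. abs_L2 (q j))"
  shows "(\<Sum>j\<in>F. cmod (LINT x|lborel. LINT y|lborel. complex_of_real (k x y) * ft h (x - y) * (cnj (p j x) * q j y)))
    \<le> (LINT x|lborel. k x x) * (LINT s|lborel. cmod (h s)) / sqrt (2 * pi)"
proof -
  let ?L = "lborel \<Otimes>\<^sub>M lborel :: (real \<times> real) measure"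
  have sL: "sigma_finite_measure (lborel :: real measure)" by (rule lborel.sigma_finite_measure_axioms)
  have [measurable]: "h \<in> borel_measurable borel" using h by auto
  have am'[measurable (raw)]: "(\<lambda>z. a (f z) (g z)) \<in> borel_measurable N"
    if "f \<in> borel_measurable N" "g \<in> borel_measurable N" for f g and N :: "'z measure"
    using measurable_compose[OF measurable_Pair[OF that] am] by simp
  define w where "w t = (LINT x|lborel. (a t x)\<^sup>2)" for t
  have ka: "(LINT t|lborel. (a t x)\<^sup>2) = k x x" "integrable lborel (\<lambda>t. (a t x)\<^sup>2)" for x
    using k[of x x] by (simp_all add: has_bochner_integral_iff power2_eq_square)
  have aa: "integrable ?L (\<lambda>(x, t). (a t x)\<^sup>2)"
  proof (rule lborel_pair.Fubini_integrable)
    have "(\<lambda>z. (a (snd z) (fst z))\<^sup>2) \<in> borel_measurable ?L"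
      by (intro borel_measurable_power am') measurable
    then show "(\<lambda>(x, t). (a t x)\<^sup>2) \<in> borel_measurable ?L" by (simp add: case_prod_unfold)
    show "integrable lborel (\<lambda>x. LINT t|lborel. norm (case (x, t) of (x, t) \<Rightarrow> (a t x)\<^sup>2))"
      using diag by (simp add: ka)
    show "AE x in lborel. integrable lborel (\<lambda>t. case (x, t) of (x, t) \<Rightarrow> (a t x)\<^sup>2)"
      by (simp add: ka)
  qed
  have w: "integrable lborel w" "(LINT t|lborel. w t) = (LINT x|lborel. k x x)"
    using lborel_pair.integrable_snd[OF aa] lborel_pair.Fubini_integral[OF aa] by (simp_all add: w_def[abs_def] ka)
  \<comment> \<open>Both factors get the square root of |h|, and v also the phase of h. Where h = 0
    the quotient in v is 0, since x / 0 = 0.\<close>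
  define u where "u z x = complex_of_real (sqrt (cmod (h (snd z))) * a (fst z) x) * cis (- (snd z * x))" for z :: "real \<times> real" and x
  define v where "v z y = (h (snd z) / complex_of_real (sqrt (cmod (h (snd z))))) * complex_of_real (a (fst z) y) * cis (snd z * y)" for z :: "real \<times> real" and y
  have nu: "(cmod (u z x))\<^sup>2 = cmod (h (snd z)) * (a (fst z) x)\<^sup>2" for z x
    by (simp add: u_def norm_mult power_mult_distrib)
  have nv: "(cmod (v z x))\<^sup>2 = cmod (h (snd z)) * (a (fst z) x)\<^sup>2" for z x
    by (cases "h (snd z) = 0") (auto simp: v_def norm_mult norm_divide power_mult_distrib power_divide power2_eq_square)
  have um: "(\<lambda>(z, x). u z x) \<in> borel_measurable (?L \<Otimes>\<^sub>M lborel)" "(\<lambda>(z, x). v z x) \<in> borel_measurable (?L \<Otimes>\<^sub>M lborel)"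
    unfolding u_def v_def case_prod_unfold by measurable
  have uzm: "u z \<in> borel_measurable borel" "v z \<in> borel_measurable borel" for z
    unfolding u_def v_def by measurable
  have su: "square_integrable (u z)" "square_integrable (v z)" for z
    unfolding square_integrable_def nu nv using uzm[of z] sq[of "fst z"] by simp_all
  have hw: "integrable ?L (\<lambda>z. cmod (h (snd z)) * w (fst z))" "(LINT z|?L. cmod (h (snd z)) * w (fst z)) = (LINT x|lborel. k x x) * (LINT s|lborel. cmod (h s))"
    using integrable_pair_mult[OF sL sL w(1) integrable_norm[OF h]] by (simp_all add: case_prod_unfold mult.commute w(2))
  have K: "(LINT z|?L. u z x * v z y) = complex_of_real (sqrt (2 * pi)) * (complex_of_real (k x y) * ft h (x - y))" for x y
  proof -
    have e: "u z x * v z y = (case z of (t, s) \<Rightarrow> complex_of_real (a t x * a t y) * (cis (- (s * (x - y))) * h s))" for z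
    proof -
      obtain t s where z: "z = (t, s)" by (cases z)
      have hs: "complex_of_real (sqrt (cmod (h s))) * (h s / complex_of_real (sqrt (cmod (h s)))) = h s"
        by (cases "h s = 0") auto
      have "cis (- (s * x)) * cis (s * y) = cis (- (s * (x - y)))"
        by (simp add: cis_mult algebra_simps)
      moreover have "u z x * v z y = (complex_of_real (sqrt (cmod (h s))) * (h s / complex_of_real (sqrt (cmod (h s))))) * complex_of_real (a t x * a t y) * (cis (- (s * x)) * cis (s * y))"
        unfolding u_def v_def z by (simp only: of_real_mult fst_conv snd_conv mult_ac)
      ultimately show ?thesis unfolding hs z by (simp add: mult_ac)
    qed
    have i: "integrable lborel (\<lambda>t. complex_of_real (a t x * a t y))" "(LINT t|lborel. complex_of_real (a t x * a t y)) = complex_of_real (k x y)"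
      using k[of x y] unfolding has_bochner_integral_iff integral_complex_of_real by (simp_all del: of_real_mult)
    have i2: "integrable lborel (\<lambda>s. cis (- (s * (x - y))) * h s)"
      using integrable_cis_mult[OF h, of "- (x - y)"] by (simp add: algebra_simps)
    have "(LINT z|?L. u z x * v z y) = complex_of_real (k x y) * (LINT s|lborel. cis (- (s * (x - y))) * h s)"
      unfolding e integrable_pair_mult(2)[OF sL sL i(1) i2] i(2) ..
    also have "(LINT s|lborel. cis (- (s * (x - y))) * h s) = complex_of_real (sqrt (2 * pi)) * ft h (x - y)"
      by (simp add: ft_def)
    finally show ?thesis by (simp only: mult_ac)
  qed
  let ?I = "\<lambda>j. LINT x|lborel. LINT y|lborel. complex_of_real (k x y) * ft h (x - y) * (cnj (p j x) * q j y)"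
  have I: "(LINT x|lborel. LINT y|lborel. (LINT z|?L. u z x * v z y) * (cnj (p j x) * q j y)) = complex_of_real (sqrt (2 * pi)) * ?I j" for j
    unfolding K mult.assoc[of "complex_of_real (sqrt (2 * pi))"] integral_mult_right_zero ..
  have "sqrt (2 * pi) * (\<Sum>j\<in>F. cmod (?I j)) = (\<Sum>j\<in>F. cmod (LINT x|lborel. LINT y|lborel. (LINT z|?L. u z x * v z y) * (cnj (p j x) * q j y)))"
    unfolding I by (simp add: norm_mult sum_distrib_left)
  also have "\<dots> \<le> ((LINT z|?L. LINT x|lborel. (cmod (u z x))\<^sup>2) + (LINT z|?L. LINT x|lborel. (cmod (v z x))\<^sup>2)) / 2"
    by (rule bessel_double_integral_bound[OF sigma_finite_pair_measure[OF sL sL] um su _ _ p q bp bq])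
       (use hw(1) in \<open>simp_all add: nu nv w_def\<close>)
  also have "\<dots> = (LINT x|lborel. k x x) * (LINT s|lborel. cmod (h s))"
    unfolding nu nv using hw(2) by (simp add: w_def)
  finally show ?thesis
    by (simp add: pos_le_divide_eq mult.commute)
qed

section \<open>The kernels for \<open>g\<close>\<close>

text \<open>Rescaled total masses of the Erlang densities of orders 0 and 1.\<close>

lemma has_bochner_integral_exp:
  assumes c: "c > 0"
  shows "has_bochner_integral lborel (\<lambda>t. indicator {0..} t * exp (- (c * t))) (1 / c :: real)"
    and "has_bochner_integral lborel (\<lambda>t. indicator {0..} t * (t * exp (- (c * t)))) (1 / c\<^sup>2 :: real)"
proof -
  have e: "has_bochner_integral lborel (erlang_density k c) 1" for k
    using nn_integral_erlang_ith_moment[OF c, of k 0] c by (intro has_bochner_integral_nn_integral) auto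
  have "(\<lambda>t. 1 / c * erlang_density 0 c t) = (\<lambda>t. indicator {0..} t * exp (- (c * t)))"
    using c by (auto simp: erlang_density_def indicator_def fun_eq_iff)
  then show "has_bochner_integral lborel (\<lambda>t. indicator {0..} t * exp (- (c * t))) (1 / c)"
    using has_bochner_integral_mult_right[OF e[of 0], of "1 / c"] by simp
  have "(\<lambda>t. 1 / c\<^sup>2 * erlang_density 1 c t) = (\<lambda>t. indicator {0..} t * (t * exp (- (c * t))))"
    using c by (auto simp: erlang_density_def indicator_def fun_eq_iff power2_eq_square)
  then show "has_bochner_integral lborel (\<lambda>t. indicator {0..} t * (t * exp (- (c * t)))) (1 / c\<^sup>2)"
    using has_bochner_integral_mult_right[OF e[of 1], of "1 / c\<^sup>2"] by simp
qed

definition bracket :: "real \<Rightarrow> real" where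
  "bracket x = sqrt (1 + x\<^sup>2)"

lemma bracket: "0 < bracket x" "1 \<le> bracket x" "(bracket x)\<^sup>2 = 1 + x\<^sup>2" "bracket x \<noteq> 0"
proof -
  have "0 < 1 + x\<^sup>2" by (rule add_pos_nonneg) auto
  then show "0 < bracket x" "1 \<le> bracket x" "(bracket x)\<^sup>2 = 1 + x\<^sup>2" "bracket x \<noteq> 0" by (auto simp: bracket_def)
qed

lemma bracket_measurable [measurable]: "bracket \<in> borel_measurable borel"
  unfolding bracket_def by measurable

lemma integrable_inverse_bracket_sq: "integrable lborel (\<lambda>x. 1 / (bracket x)\<^sup>2)"
  using integrable_inverse_1_plus_square by (simp add: set_integrable_def bracket(3) inverse_eq_divide)

definition kernel1 :: "real \<Rightarrow> real \<Rightarrow> real" where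
  "kernel1 x y = 2 / (bracket x * bracket y * (bracket x + bracket y))"

definition kernel2 :: "real \<Rightarrow> real \<Rightarrow> real" where
  "kernel2 x y = 1 / (bracket x + bracket y)\<^sup>2"

lemma kernel_measurable [measurable]:
  "(\<lambda>(x, y). kernel1 x y) \<in> borel_measurable (borel \<Otimes>\<^sub>M borel)" "(\<lambda>(x, y). kernel2 x y) \<in> borel_measurable (borel \<Otimes>\<^sub>M borel)"
  unfolding kernel1_def kernel2_def by measurable

lemma kernel_le: "\<bar>kernel1 x y\<bar> \<le> 2" "\<bar>kernel2 x y\<bar> \<le> 1"
proof -
  have "1 * 1 * 1 \<le> bracket x * bracket y * (bracket x + bracket y)"
    by (intro mult_mono) (use bracket[of x] bracket[of y] in auto)
  then show "\<bar>kernel1 x y\<bar> \<le> 2" by (simp add: kernel1_def divide_le_eq)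
  have "1\<^sup>2 \<le> (bracket x + bracket y)\<^sup>2"
    by (rule power_mono) (use bracket(2)[of x] bracket(2)[of y] in auto)
  then show "\<bar>kernel2 x y\<bar> \<le> 1" by (simp add: kernel2_def divide_le_eq)
qed

text \<open>The diagonal integrals enter the trace norm bounds as constants; both diagonals are at
  most 1 / (1 + x^2).\<close>

lemma kernel_diag_integrable: "integrable lborel (\<lambda>x. kernel1 x x)" "integrable lborel (\<lambda>x. kernel2 x x)"
proof -
  show "integrable lborel (\<lambda>x. kernel1 x x)"
  proof (rule Bochner_Integration.integrable_bound[OF integrable_inverse_bracket_sq])
    show "AE x in lborel. norm (kernel1 x x) \<le> norm (1 / (bracket x)\<^sup>2)"
    proof (rule AE_I2)
      fix x
      have "kernel1 x x = 1 / (bracket x)\<^sup>2 * (1 / bracket x)"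
        using bracket[of x] by (simp add: kernel1_def power2_eq_square)
      also have "\<dots> \<le> 1 / (bracket x)\<^sup>2 * 1"
        using bracket[of x] by (intro mult_left_mono) auto
      finally show "norm (kernel1 x x) \<le> norm (1 / (bracket x)\<^sup>2)"
        using bracket[of x] by (simp add: kernel1_def)
    qed
  qed (simp add: kernel1_def)
  have "(\<lambda>x. kernel2 x x) = (\<lambda>x. 1 / 4 * (1 / (bracket x)\<^sup>2))"
    by (auto simp: kernel2_def power2_eq_square)
  then show "integrable lborel (\<lambda>x. kernel2 x x)"
    using integrable_mult_right[OF integrable_inverse_bracket_sq, of "1 / 4"] by simp
qed

text \<open>The representation comes from 1 / c = int exp(- c t) dt over t >= 0 with c = A + B: the
  exponential factors into one function of x and one of y.\<close>

lemma kernel1_bessel_bound: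
  assumes h: "integrable lborel h"
    and pq: "\<And>j. square_integrable (p j)" "\<And>j. square_integrable (q j)"
      "bessel_family F (\<lambda>j. abs_L2 (p j))" "bessel_family F (\<lambda>j. abs_L2 (q j))"
  shows "(\<Sum>j\<in>F. cmod (LINT x|lborel. LINT y|lborel. complex_of_real (kernel1 x y) * ft h (x - y) * (cnj (p j x) * q j y)))
    \<le> (LINT x|lborel. kernel1 x x) * (LINT s|lborel. cmod (h s)) / sqrt (2 * pi)"
proof (rule kernel_bessel_bound[where a = "\<lambda>t x. indicator {0..} t * (sqrt 2 / bracket x * exp (- (t * bracket x)))" and k = kernel1, OF _ _ _ kernel_diag_integrable(1) h pq])
  fix t :: real
  show "integrable lborel (\<lambda>x. (indicator {0..} t * (sqrt 2 / bracket x * exp (- (t * bracket x))))\<^sup>2)"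
  proof (rule Bochner_Integration.integrable_bound[OF integrable_mult_right[OF integrable_inverse_bracket_sq, of 2]])
    show "AE x in lborel. norm ((indicator {0..} t * (sqrt 2 / bracket x * exp (- (t * bracket x))))\<^sup>2) \<le> norm (2 * (1 / (bracket x)\<^sup>2))"
    proof (rule AE_I2)
      fix x
      have "(exp (- (t * bracket x)))\<^sup>2 \<le> 1\<^sup>2" if "0 \<le> t"
        using that bracket(1)[of x] by (intro power_mono) auto
      then show "norm ((indicator {0..} t * (sqrt 2 / bracket x * exp (- (t * bracket x))))\<^sup>2) \<le> norm (2 * (1 / (bracket x)\<^sup>2))"
        using bracket(1)[of x] by (auto simp: indicator_def power_mult_distrib power_divide divide_right_mono)
    qed
  qed measurable
  fix x y :: real
  have c: "bracket x + bracket y > 0" using bracket(1)[of x] bracket(1)[of y] by simp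
  have "(\<lambda>t. indicator {0..} t * (sqrt 2 / bracket x * exp (- (t * bracket x))) * (indicator {0..} t * (sqrt 2 / bracket y * exp (- (t * bracket y)))))
      = (\<lambda>t. 2 / (bracket x * bracket y) * (indicator {0..} t * exp (- ((bracket x + bracket y) * t))))"
  proof
    fix t :: real
    have e: "exp (- ((bracket x + bracket y) * t)) = exp (- (t * bracket x)) * exp (- (t * bracket y))"
      by (simp add: algebra_simps flip: exp_add)
    show "indicator {0..} t * (sqrt 2 / bracket x * exp (- (t * bracket x))) * (indicator {0..} t * (sqrt 2 / bracket y * exp (- (t * bracket y))))
      = 2 / (bracket x * bracket y) * (indicator {0..} t * exp (- ((bracket x + bracket y) * t)))"
      unfolding e by (simp add: indicator_def)
  qed
  then show "has_bochner_integral lborel (\<lambda>t. indicator {0..} t * (sqrt 2 / bracket x * exp (- (t * bracket x))) * (indicator {0..} t * (sqrt 2 / bracket y * exp (- (t * bracket y))))) (kernel1 x y)"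
    using has_bochner_integral_mult_right[OF has_bochner_integral_exp(1)[OF c], of "2 / (bracket x * bracket y)"]
    by (simp add: kernel1_def)
qed measurable

text \<open>Now 1 / c^2 = int t exp(- c t) dt; the weight t is shared as two square roots.\<close>

lemma kernel2_bessel_bound:
  assumes h: "integrable lborel h"
    and pq: "\<And>j. square_integrable (p j)" "\<And>j. square_integrable (q j)"
      "bessel_family F (\<lambda>j. abs_L2 (p j))" "bessel_family F (\<lambda>j. abs_L2 (q j))"
  shows "(\<Sum>j\<in>F. cmod (LINT x|lborel. LINT y|lborel. complex_of_real (kernel2 x y) * ft h (x - y) * (cnj (p j x) * q j y)))
    \<le> (LINT x|lborel. kernel2 x x) * (LINT s|lborel. cmod (h s)) / sqrt (2 * pi)"
proof (rule kernel_bessel_bound[where a = "\<lambda>t x. indicator {0..} t * (sqrt t * exp (- (t * bracket x)))" and k = kernel2, OF _ _ _ kernel_diag_integrable(2) h pq])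
  fix t :: real
  show "integrable lborel (\<lambda>x. (indicator {0..} t * (sqrt t * exp (- (t * bracket x))))\<^sup>2)"
  proof (cases "t > 0")
    case True
    show ?thesis
    proof (rule Bochner_Integration.integrable_bound[OF integrable_mult_right[OF integrable_inverse_bracket_sq, of "1 / (2 * t)"]])
      show "AE x in lborel. norm ((indicator {0..} t * (sqrt t * exp (- (t * bracket x))))\<^sup>2) \<le> norm (1 / (2 * t) * (1 / (bracket x)\<^sup>2))"
      proof (rule AE_I2)
        fix x
        have tb: "0 < t * bracket x" using True bracket(1)[of x] by simp
        \<comment> \<open>The function must be square integrable in x for each single t. With z = t
          A, exp(2 z) >= 2 z^2 trades the exponential for the integrable 1 / A^2, with a constant
          depending on t.\<close>
        have "(2 * (t * bracket x))\<^sup>2 / 2 \<le> exp (2 * (t * bracket x))"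
          using exp_lower_Taylor_quadratic[of "2 * (t * bracket x)"] tb by linarith
        then have "2 * (t * bracket x)\<^sup>2 \<le> exp (2 * (t * bracket x))"
          by (simp add: power_mult_distrib)
        then have "exp (- (2 * (t * bracket x))) \<le> 1 / (2 * (t * bracket x)\<^sup>2)"
          using frac_le[of 1 1 "2 * (t * bracket x)\<^sup>2" "exp (2 * (t * bracket x))"] tb True bracket(4)[of x]
          by (simp add: exp_minus inverse_eq_divide)
        moreover have "(exp (- (t * bracket x)))\<^sup>2 = exp (- (2 * (t * bracket x)))"
          by (simp add: power2_eq_square flip: exp_add)
        ultimately have "t * (exp (- (t * bracket x)))\<^sup>2 \<le> t * (1 / (2 * (t * bracket x)\<^sup>2))"
          using True by (intro mult_left_mono) auto
        also have "\<dots> = 1 / (2 * t) * (1 / (bracket x)\<^sup>2)"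
          using True bracket(1)[of x] by (simp add: power2_eq_square)
        finally show "norm ((indicator {0..} t * (sqrt t * exp (- (t * bracket x))))\<^sup>2) \<le> norm (1 / (2 * t) * (1 / (bracket x)\<^sup>2))"
          using True by (simp add: power_mult_distrib)
      qed
    qed measurable
  next
    case False
    \<comment> \<open>At t = 0, which the indicator admits, the factor sqrt t vanishes.\<close>
    then have "(\<lambda>x. (indicator {0..} t * (sqrt t * exp (- (t * bracket x))))\<^sup>2) = (\<lambda>x. 0)"
      by (auto simp: indicator_def)
    then show ?thesis by simp
  qed
  fix x y :: real
  have c: "bracket x + bracket y > 0" using bracket(1)[of x] bracket(1)[of y] by simp
  have "(\<lambda>t. indicator {0..} t * (sqrt t * exp (- (t * bracket x))) * (indicator {0..} t * (sqrt t * exp (- (t * bracket y)))))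
      = (\<lambda>t. indicator {0..} t * (t * exp (- ((bracket x + bracket y) * t))))"
  proof
    fix t :: real
    have e: "exp (- ((bracket x + bracket y) * t)) = exp (- (t * bracket x)) * exp (- (t * bracket y))"
      by (simp add: algebra_simps flip: exp_add)
    have s: "sqrt t * sqrt t = t" if "0 \<le> t" using that by simp
    show "indicator {0..} t * (sqrt t * exp (- (t * bracket x))) * (indicator {0..} t * (sqrt t * exp (- (t * bracket y))))
      = indicator {0..} t * (t * exp (- ((bracket x + bracket y) * t)))"
      unfolding e using s by (cases "0 \<le> t") (auto simp: mult_ac)
  qed
  then show "has_bochner_integral lborel (\<lambda>t. indicator {0..} t * (sqrt t * exp (- (t * bracket x))) * (indicator {0..} t * (sqrt t * exp (- (t * bracket y))))) (kernel2 x y)"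
    using has_bochner_integral_exp(2)[OF c] by (simp add: kernel2_def)
qed measurable

lemma g_fun_eq: "g_fun x = x / bracket x"
proof -
  have "(1 + x\<^sup>2) powr (- (1 / 2)) = 1 / bracket x"
    unfolding powr_minus by (simp add: powr_half_sqrt bracket_def inverse_eq_divide)
  then show ?thesis by (simp add: g_fun_def)
qed

lemma g_fun_le: "\<bar>g_fun x\<bar> \<le> 1"
proof -
  have "sqrt (x\<^sup>2) \<le> bracket x" unfolding bracket_def by (rule real_sqrt_le_mono) simp
  then show ?thesis using bracket(1)[of x] by (simp add: g_fun_eq divide_le_eq)
qed

lemma g_fun_measurable [measurable]: "g_fun \<in> borel_measurable borel"
  unfolding g_fun_def by measurable

text \<open>The difference is (x B - y A) / (A B). The numerator satisfies \<open>key\<close>, and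
  its cofactor there is half of (A + B)^2 - (x - y)^2. Hence (g(x) - g(y)) ((A + B)^2 - (x - y)^2) =
  2 (x - y) (A + B) / (A B); dividing by (A + B)^2 and leaving the second term on the right gives
  the claim.\<close>

lemma g_fun_diff: "g_fun x - g_fun y = (x - y) * kernel1 x y + (g_fun x - g_fun y) * (x - y)\<^sup>2 * kernel2 x y"
proof -
  define A B where "A = bracket x" and "B = bracket y"
  have A: "A > 0" "A\<^sup>2 = 1 + x\<^sup>2" and B: "B > 0" "B\<^sup>2 = 1 + y\<^sup>2" using bracket by (auto simp: A_def B_def)
  have key: "(x * B - y * A) * (1 + A * B + x * y) = (x - y) * (A + B)"
  proof -
    have "(x * B - y * A) * (1 + A * B + x * y) = x * B + x * A * B\<^sup>2 + x\<^sup>2 * y * B - y * A - y * B * A\<^sup>2 - y\<^sup>2 * x * A"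
      by (simp add: algebra_simps power2_eq_square)
    also have "\<dots> = (x - y) * (A + B)"
      unfolding A(2) B(2) by (simp add: algebra_simps)
    finally show ?thesis .
  qed
  have sq: "(A + B)\<^sup>2 - (x - y)\<^sup>2 = 2 * (1 + A * B + x * y)"
    using A(2) B(2) by (simp add: power2_sum power2_diff)
  have d: "x / A - y / B = (x * B - y * A) / (A * B)"
    using A(1) B(1) by (simp add: field_simps)
  have "(x / A - y / B) * ((A + B)\<^sup>2 - (x - y)\<^sup>2) = 2 * ((x * B - y * A) * (1 + A * B + x * y)) / (A * B)"
    unfolding sq d by simp
  also have "\<dots> = 2 * (x - y) * (A + B) / (A * B)"
    unfolding key by simp
  finally have "(x / A - y / B) * ((A + B)\<^sup>2 - (x - y)\<^sup>2) / (A + B)\<^sup>2 = 2 * (x - y) * (A + B) / (A * B) / (A + B)\<^sup>2"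
    by simp
  moreover have "2 * (x - y) * (A + B) / (A * B) / (A + B)\<^sup>2 = (x - y) * (2 / (A * B * (A + B)))"
    using A(1) B(1) by (simp add: power2_eq_square mult_ac)
  moreover have "(x / A - y / B) * ((A + B)\<^sup>2 - (x - y)\<^sup>2) / (A + B)\<^sup>2 = (x / A - y / B) - (x / A - y / B) * (x - y)\<^sup>2 * (1 / (A + B)\<^sup>2)"
    using A(1) B(1) by (simp add: right_diff_distrib diff_divide_distrib)
  ultimately show ?thesis
    by (simp add: g_fun_eq kernel1_def kernel2_def A_def B_def)
qed

section \<open>The commutator with \<open>g\<close>\<close>

lemma square_integrable_reflect:
  assumes "square_integrable f"
  shows "square_integrable (\<lambda>x. f (- x))"
proof -
  have "f \<in> borel_measurable borel" using assms by (rule square_integrable_measurable)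
  then have "(\<lambda>x. f (- x)) \<in> borel_measurable borel" by measurable
  then show ?thesis
    using assms lborel_integrable_real_affine[of "\<lambda>y. (cmod (f y))\<^sup>2" "-1" 0] by (simp add: square_integrable_def)
qed

text \<open>On the Fourier side, multiplication by \<psi> is convolution with its transform over
  sqrt(2 pi). Compact support of p and q makes them integrable, so that Fubini applies.\<close>

lemma cinner_mult_inv_fourier:
  assumes \<psi>: "integrable lborel \<psi>" "\<And>x. cmod (\<psi> x) \<le> K"
    and p: "square_integrable p" "\<And>x. \<bar>x\<bar> > N \<Longrightarrow> p x = 0"
    and q: "square_integrable q" "\<And>x. \<bar>x\<bar> > N \<Longrightarrow> q x = 0"
  shows "cinner (inv_fourier (abs_L2 p)) (mult_op \<psi> (inv_fourier (abs_L2 q)))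
    = complex_of_real (1 / sqrt (2 * pi)) * (LINT x|lborel. LINT y|lborel. ft \<psi> (x - y) * (cnj (p x) * q y))"
proof -
  let ?c = "complex_of_real (1 / sqrt (2 * pi))"
  have p1: "integrable lborel p" and q1: "integrable lborel q"
    using integrable_compact_square_integrable[OF p] integrable_compact_square_integrable[OF q] by auto
  have [measurable]: "p \<in> borel_measurable borel" "q \<in> borel_measurable borel" "\<psi> \<in> borel_measurable borel"
    using p1 q1 \<psi>(1) by auto
  have \<psi>b: "bounded (range \<psi>)" using \<psi>(2) by (auto simp: bounded_range_norm)
  have \<psi>m: "\<psi> \<in> borel_measurable borel" and \<psi>l: "\<psi> \<in> borel_measurable lborel" using \<psi>(1) by auto
  have pc: "integrable lborel (\<lambda>x. cnj (p x))" using p1 by simp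
  define Q where "Q z = ft q (- z)" for z
  have [measurable]: "Q \<in> borel_measurable borel" unfolding Q_def by measurable
  have siP: "square_integrable (\<lambda>z. ft p (- z))" and siQ: "square_integrable Q"
    unfolding Q_def using square_integrable_reflect[OF square_integrable_ft(1)[OF p1 p(1)]] square_integrable_reflect[OF square_integrable_ft(1)[OF q1 q(1)]] by auto
  have Q\<psi>: "integrable lborel (\<lambda>z. Q z * \<psi> z)"
    by (rule integrable_mult_bounded[OF \<psi>(1)]) (auto simp: Q_def intro: ft_bound)
  have "cinner (inv_fourier (abs_L2 p)) (mult_op \<psi> (inv_fourier (abs_L2 q))) = (LINT z|lborel. cnj (ft p (- z)) * (\<psi> z * Q z))"
    using inv_fourier_abs_L2[OF p(1), of N] inv_fourier_abs_L2[OF q(1), of N] p(2) q(2) cinner_abs_L2[OF siP square_integrable_mult[OF \<psi>l \<psi>b siQ]]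
    by (simp add: mult_op_abs_L2[OF \<psi>m \<psi>b siQ] flip: Q_def)
  also have "\<dots> = (LINT z|lborel. ?c * (LINT x|lborel. cis (- (z * x)) * ((Q z * \<psi> z) * cnj (p x))))"
  proof (rule Bochner_Integration.integral_cong[OF refl])
    fix z
    have e: "cnj (ft p (- z)) = ?c * (LINT x|lborel. cis (- (z * x)) * cnj (p x))"
      unfolding ft_def complex_cnj_mult Bochner_Integration.integral_cnj[symmetric] by (simp add: cis_cnj mult.commute)
    show "cnj (ft p (- z)) * (\<psi> z * Q z) = ?c * (LINT x|lborel. cis (- (z * x)) * ((Q z * \<psi> z) * cnj (p x)))"
      unfolding e mult.assoc integral_mult_left_zero[symmetric] by (simp only: mult_ac)
  qed
  also have "\<dots> = ?c * (LINT z|lborel. LINT x|lborel. cis (- (z * x)) * ((Q z * \<psi> z) * cnj (p x)))"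
    by (rule integral_mult_right_zero)
  also have "(LINT z|lborel. LINT x|lborel. cis (- (z * x)) * ((Q z * \<psi> z) * cnj (p x))) = (LINT x|lborel. LINT z|lborel. cis (- (z * x)) * ((Q z * \<psi> z) * cnj (p x)))"
    by (rule Fubini_bounded_kernel(2)[OF Q\<psi> pc, where K = 1]) auto
  also have "\<dots> = (LINT x|lborel. LINT y|lborel. ft \<psi> (x - y) * (cnj (p x) * q y))"
  proof (rule Bochner_Integration.integral_cong[OF refl])
    fix x
    have Qz: "cis (- (z * x)) * (Q z * \<psi> z) = ?c * (LINT y|lborel. cis (- (z * (x - y))) * (\<psi> z * q y))" for z
    proof -
      have "cis (- (z * (x - y))) * (\<psi> z * q y) = cis (- (z * x)) * \<psi> z * (cis (- (y * - z)) * q y)" for y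
      proof -
        have "cis (- (z * (x - y))) = cis (- (z * x)) * cis (- (y * - z))" by (simp add: cis_mult algebra_simps)
        then show ?thesis by (simp only: mult_ac)
      qed
      then have "(LINT y|lborel. cis (- (z * (x - y))) * (\<psi> z * q y)) = cis (- (z * x)) * \<psi> z * (LINT y|lborel. cis (- (y * - z)) * q y)"
        by (simp only: integral_mult_right_zero)
      then show ?thesis unfolding Q_def ft_def by (simp only: mult_ac)
    qed
    have "(LINT z|lborel. cis (- (z * x)) * (Q z * \<psi> z)) = ?c * (LINT z|lborel. LINT y|lborel. cis (- (z * (x - y))) * (\<psi> z * q y))"
      unfolding Qz by (rule integral_mult_right_zero)
    also have "(LINT z|lborel. LINT y|lborel. cis (- (z * (x - y))) * (\<psi> z * q y)) = (LINT y|lborel. LINT z|lborel. cis (- (z * (x - y))) * (\<psi> z * q y))"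
      by (rule Fubini_bounded_kernel(2)[OF \<psi>(1) q1, where K = 1]) auto
    also have "?c * \<dots> = (LINT y|lborel. ?c * (LINT z|lborel. cis (- (z * (x - y))) * (\<psi> z * q y)))"
      by (rule integral_mult_right_zero[symmetric])
    also have "\<dots> = (LINT y|lborel. ft \<psi> (x - y) * q y)"
      unfolding ft_def mult.assoc[symmetric] integral_mult_left_zero ..
    finally have e: "(LINT z|lborel. cis (- (z * x)) * (Q z * \<psi> z)) = (LINT y|lborel. ft \<psi> (x - y) * q y)" .
    have "(LINT z|lborel. cis (- (z * x)) * ((Q z * \<psi> z) * cnj (p x))) = (LINT z|lborel. cis (- (z * x)) * (Q z * \<psi> z)) * cnj (p x)"
      by (simp only: mult.assoc[symmetric] integral_mult_left_zero)
    also have "\<dots> = (LINT y|lborel. ft \<psi> (x - y) * (cnj (p x) * q y))"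
      unfolding e integral_mult_left_zero[symmetric] by (simp only: mult_ac)
    finally show "(LINT z|lborel. cis (- (z * x)) * ((Q z * \<psi> z) * cnj (p x))) = (LINT y|lborel. ft \<psi> (x - y) * (cnj (p x) * q y))" .
  qed
  finally show ?thesis .
qed

abbreviation "g_op \<equiv> fourier_multiplier (\<lambda>t. complex_of_real (g_fun t))"

lemma g_fun_bounded: "(\<lambda>t. complex_of_real (g_fun t)) \<in> borel_measurable borel" "bounded (range (\<lambda>t. complex_of_real (g_fun t)))"
  using g_fun_le by (auto simp: bounded_range_norm)

text \<open>The relations \<open>rel\<close> say that h1 and h2 are the first two derivatives of
  \<psi>, in terms of transforms alone. The factor g(x) - g(y) of the second kernel is distributed
  over the two functions, which gives the terms with \<open>gm p\<close> and
  \<open>gm q\<close>.\<close>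

lemma commutator_g_form:
  assumes \<psi>: "integrable lborel \<psi>" "\<And>x. cmod (\<psi> x) \<le> K"
    and h: "integrable lborel h1" "integrable lborel h2"
    and rel: "\<And>\<zeta>. \<i> * complex_of_real \<zeta> * ft \<psi> \<zeta> = ft h1 \<zeta>" "\<And>\<zeta>. \<i> * complex_of_real \<zeta> * ft h1 \<zeta> = ft h2 \<zeta>"
    and p: "square_integrable p" "\<And>x. \<bar>x\<bar> > N \<Longrightarrow> p x = 0"
    and q: "square_integrable q" "\<And>x. \<bar>x\<bar> > N \<Longrightarrow> q x = 0"
  defines "I \<equiv> \<lambda>\<kappa> p q. LINT x|lborel. LINT y|lborel. \<kappa> x y * (cnj (p x) * q y)"
    and "gm \<equiv> \<lambda>p x. complex_of_real (g_fun x) * p x"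
  shows "cinner (inv_fourier (abs_L2 p)) (commutator (mult_op \<psi>) g_op (inv_fourier (abs_L2 q)))
    = complex_of_real (1 / sqrt (2 * pi)) * (\<i> * I (\<lambda>x y. complex_of_real (kernel1 x y) * ft h1 (x - y)) p q
      + I (\<lambda>x y. complex_of_real (kernel2 x y) * ft h2 (x - y)) (gm p) q
      - I (\<lambda>x y. complex_of_real (kernel2 x y) * ft h2 (x - y)) p (gm q))"
proof -
  let ?c = "complex_of_real (1 / sqrt (2 * pi))"
  let ?g = "\<lambda>t. complex_of_real (g_fun t)"
  let ?L = "lborel \<Otimes>\<^sub>M lborel :: (real \<times> real) measure"
  have gsi: "square_integrable (gm f)" if "square_integrable f" for f
    unfolding gm_def using square_integrable_mult[OF _ g_fun_bounded(2) that] g_fun_bounded(1) by auto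
  have gp: "square_integrable (gm p)" "\<And>x. \<bar>x\<bar> > N \<Longrightarrow> gm p x = 0"
    and gq: "square_integrable (gm q)" "\<And>x. \<bar>x\<bar> > N \<Longrightarrow> gm q x = 0"
    using gsi p q by (auto simp: gm_def)
  have g_inv: "g_op (inv_fourier (abs_L2 f)) = inv_fourier (abs_L2 (gm f))" if "square_integrable f" for f
    by (simp add: fourier_multiplier_def mult_op_abs_L2[OF g_fun_bounded that] gm_def)
  have adj: "cinner u (g_op v) = cinner (g_op u) v" for u v
    using adjoint_fourier_multiplier[OF g_fun_bounded] by (simp add: adjoint_pair_def)
  have meas: "\<psi> \<in> borel_measurable borel" "h1 \<in> borel_measurable borel" "h2 \<in> borel_measurable borel"
    using \<psi>(1) h by auto
  \<comment> \<open>The iterated integrals are rewritten over the product measure, where they can be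
    added under one integral sign.\<close>
  have int: "integrable ?L (\<lambda>z. \<kappa> (fst z) (snd z) * (cnj (f (fst z)) * f' (snd z)))"
      "I \<kappa> f f' = (LINT z|?L. \<kappa> (fst z) (snd z) * (cnj (f (fst z)) * f' (snd z)))"
    if "square_integrable f" "\<forall>x. \<bar>x\<bar> > N \<longrightarrow> f x = 0" "square_integrable f'" "\<forall>x. \<bar>x\<bar> > N \<longrightarrow> f' x = 0"
      "(\<lambda>(x, y). \<kappa> x y) \<in> borel_measurable (borel \<Otimes>\<^sub>M borel)" "\<forall>x y. cmod (\<kappa> x y) \<le> C" for f f' \<kappa> C
  proof -
    have "integrable lborel (\<lambda>x. cnj (f x))" "integrable lborel f'"
      using integrable_compact_square_integrable[OF that(1), of N] integrable_compact_square_integrable[OF that(3), of N] that(2,4) by auto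
    from Fubini_bounded_kernel(1)[OF this that(5), of C] that(6)
    have *: "integrable ?L (\<lambda>(x, y). \<kappa> x y * (cnj (f x) * f' y))" by blast
    then show "integrable ?L (\<lambda>z. \<kappa> (fst z) (snd z) * (cnj (f (fst z)) * f' (snd z)))"
      by (simp add: case_prod_unfold)
    show "I \<kappa> f f' = (LINT z|?L. \<kappa> (fst z) (snd z) * (cnj (f (fst z)) * f' (snd z)))"
      using lborel_pair.integral_fst'[OF *] by (simp add: I_def case_prod_unfold)
  qed
  have fm: "(\<lambda>(x, y). ft k (x - y)) \<in> borel_measurable (borel \<Otimes>\<^sub>M borel)" if "k \<in> borel_measurable borel" for k
    using that by measurable
  have km: "(\<lambda>(x, y). complex_of_real (kernel1 x y) * ft h1 (x - y)) \<in> borel_measurable (borel \<Otimes>\<^sub>M borel)"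
      "(\<lambda>(x, y). complex_of_real (kernel2 x y) * ft h2 (x - y)) \<in> borel_measurable (borel \<Otimes>\<^sub>M borel)"
    using fm[OF meas(2)] fm[OF meas(3)] kernel_measurable unfolding case_prod_unfold by measurable
  have kb: "\<forall>x y. cmod (complex_of_real (kernel1 x y) * ft h1 (x - y)) \<le> 2 * ((LINT x|lborel. cmod (h1 x)) / sqrt (2 * pi))"
      "\<forall>x y. cmod (complex_of_real (kernel2 x y) * ft h2 (x - y)) \<le> 1 * ((LINT x|lborel. cmod (h2 x)) / sqrt (2 * pi))"
    unfolding norm_mult norm_of_real by (intro allI mult_mono kernel_le ft_bound; simp)+
  have p': "\<forall>x. \<bar>x\<bar> > N \<longrightarrow> p x = 0" "\<forall>x. \<bar>x\<bar> > N \<longrightarrow> gm p x = 0" and q': "\<forall>x. \<bar>x\<bar> > N \<longrightarrow> q x = 0" "\<forall>x. \<bar>x\<bar> > N \<longrightarrow> gm q x = 0"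
    using p(2) q(2) gp(2) gq(2) by auto
  note i1 = int[OF p(1) p'(1) gq(1) q'(2) fm[OF meas(1)] allI[OF allI[OF ft_bound]]]
  note i2 = int[OF gp(1) p'(2) q(1) q'(1) fm[OF meas(1)] allI[OF allI[OF ft_bound]]]
  note j1 = int[OF p(1) p'(1) q(1) q'(1) km(1) kb(1)]
  note j2 = int[OF gp(1) p'(2) q(1) q'(1) km(2) kb(2)]
  note j3 = int[OF p(1) p'(1) gq(1) q'(2) km(2) kb(2)]
  have "cinner (inv_fourier (abs_L2 p)) (commutator (mult_op \<psi>) g_op (inv_fourier (abs_L2 q)))
      = cinner (inv_fourier (abs_L2 p)) (mult_op \<psi> (inv_fourier (abs_L2 (gm q))))
        - cinner (inv_fourier (abs_L2 (gm p))) (mult_op \<psi> (inv_fourier (abs_L2 q)))"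
    by (simp add: commutator_def cinner_diff_right adj g_inv[OF p(1)] g_inv[OF q(1)])
  also have "\<dots> = ?c * (I (\<lambda>x y. ft \<psi> (x - y)) p (gm q) - I (\<lambda>x y. ft \<psi> (x - y)) (gm p) q)"
  proof -
    have "cinner (inv_fourier (abs_L2 p)) (mult_op \<psi> (inv_fourier (abs_L2 (gm q)))) = ?c * I (\<lambda>x y. ft \<psi> (x - y)) p (gm q)"
      unfolding I_def by (rule cinner_mult_inv_fourier[OF \<psi> p(1) _ gq(1), of N]) (use p gq in auto)
    moreover have "cinner (inv_fourier (abs_L2 (gm p))) (mult_op \<psi> (inv_fourier (abs_L2 q))) = ?c * I (\<lambda>x y. ft \<psi> (x - y)) (gm p) q"
      unfolding I_def by (rule cinner_mult_inv_fourier[OF \<psi> gp(1) _ q(1), of N]) (use q gp in auto)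
    ultimately show ?thesis by (simp only: right_diff_distrib)
  qed
  also have "I (\<lambda>x y. ft \<psi> (x - y)) p (gm q) - I (\<lambda>x y. ft \<psi> (x - y)) (gm p) q
      = \<i> * I (\<lambda>x y. complex_of_real (kernel1 x y) * ft h1 (x - y)) p q
      + I (\<lambda>x y. complex_of_real (kernel2 x y) * ft h2 (x - y)) (gm p) q
      - I (\<lambda>x y. complex_of_real (kernel2 x y) * ft h2 (x - y)) p (gm q)"
  proof -
    \<comment> \<open>\<open>g_fun_diff\<close> multiplied by the transform of \<psi>. Each factor x
      - y costs a factor -i when it is traded for a derivative: one gives the i of the first term,
      two give the sign of the others.\<close>
    have pt: "ft \<psi> (x - y) * (cnj (p x) * gm q y) - ft \<psi> (x - y) * (cnj (gm p x) * q y)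
      = \<i> * (complex_of_real (kernel1 x y) * ft h1 (x - y) * (cnj (p x) * q y))
        + complex_of_real (kernel2 x y) * ft h2 (x - y) * (cnj (gm p x) * q y)
        - complex_of_real (kernel2 x y) * ft h2 (x - y) * (cnj (p x) * gm q y)" for x y
    proof -
      define z where "z = complex_of_real (x - y)"
      define gx gy k1 k2 F where "gx = complex_of_real (g_fun x)" and "gy = complex_of_real (g_fun y)"
        and "k1 = complex_of_real (kernel1 x y)" and "k2 = complex_of_real (kernel2 x y)" and "F = ft \<psi> (x - y)"
      have gd: "gx - gy = z * k1 + (gx - gy) * z\<^sup>2 * k2"
        using arg_cong[OF g_fun_diff[of x y], of complex_of_real] by (simp add: gx_def gy_def z_def k1_def k2_def)
      have r1: "ft h1 (x - y) = \<i> * z * F"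
        unfolding rel(1)[symmetric] z_def F_def ..
      have "ft h2 (x - y) = (\<i> * \<i>) * (z * z * F)"
        unfolding rel(2)[symmetric] rel(1)[symmetric] z_def F_def by (simp only: mult_ac)
      then have r2: "ft h2 (x - y) = - (z\<^sup>2 * F)"
        by (simp add: power2_eq_square)
      have "F * (gy - gx) = \<i> * (k1 * (\<i> * z * F)) + (gx - gy) * (k2 * (- (z\<^sup>2 * F)))"
      proof -
        have "F * (gy - gx) = - (F * (gx - gy))" by (simp add: algebra_simps)
        also have "\<dots> = - (F * (z * k1 + (gx - gy) * z\<^sup>2 * k2))" by (subst gd) (rule refl)
        also have "\<dots> = \<i> * (k1 * (\<i> * z * F)) + (gx - gy) * (k2 * (- (z\<^sup>2 * F)))"
          by (simp add: algebra_simps)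
        finally show ?thesis .
      qed
      then have "F * (gy - gx) * (cnj (p x) * q y) = (\<i> * (k1 * (\<i> * z * F)) + (gx - gy) * (k2 * (- (z\<^sup>2 * F)))) * (cnj (p x) * q y)"
        by simp
      then show ?thesis
        unfolding r1 r2 F_def[symmetric] gm_def k1_def[symmetric] k2_def[symmetric] gy_def[symmetric] gx_def[symmetric]
        by (simp add: gx_def algebra_simps)
    qed
    show ?thesis
      unfolding i1(2) i2(2) j1(2) j2(2) j3(2)
      unfolding Bochner_Integration.integral_diff[OF i1(1) i2(1), symmetric] pt
      unfolding Bochner_Integration.integral_diff[OF Bochner_Integration.integrable_add[OF integrable_mult_right[OF j1(1)] j2(1)] j3(1)]
        Bochner_Integration.integral_add[OF integrable_mult_right[OF j1(1)] j2(1)] integral_mult_right_zero ..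
  qed
  finally show ?thesis .
qed

text \<open>The vectors are transformed, cut off in frequency and possibly multiplied by g. All
  these are contractions with adjoints, so the kernel bounds apply to Bessel families, and the
  cutoff is removed in the limit. The constant 2 pi combines sqrt(2 pi) from the convolution and
  from the kernel bound; the 2 counts the two places of g.\<close>

lemma commutator_g_bessel_bound:
  assumes \<psi>: "integrable lborel \<psi>" "\<And>x. cmod (\<psi> x) \<le> K"
    and h: "integrable lborel h1" "integrable lborel h2"
    and rel: "\<And>\<zeta>. \<i> * complex_of_real \<zeta> * ft \<psi> \<zeta> = ft h1 \<zeta>" "\<And>\<zeta>. \<i> * complex_of_real \<zeta> * ft h1 \<zeta> = ft h2 \<zeta>"
    and bes: "bessel_family F e" "bessel_family F f"
  shows "(\<Sum>j\<in>F. cmod (cinner (f j) (commutator (mult_op \<psi>) g_op (e j))))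
    \<le> ((LINT x|lborel. kernel1 x x) * (LINT s|lborel. cmod (h1 s))
      + 2 * ((LINT x|lborel. kernel2 x x) * (LINT s|lborel. cmod (h2 s)))) / (2 * pi)" (is "_ \<le> ?B")
proof -
  let ?c = "complex_of_real (1 / sqrt (2 * pi))"
  let ?T = "commutator (mult_op \<psi>) g_op"
  have meas: "\<psi> \<in> borel_measurable borel" using \<psi>(1) by auto
  have \<psi>b: "bounded (range \<psi>)" using \<psi>(2) by (auto simp: bounded_range_norm)
  have T: "bounded_clinear ?T"
    by (rule bounded_clinear_commutator[OF bounded_clinear_mult_op[OF meas \<psi>b] bounded_clinear_fourier_multiplier[OF g_fun_bounded]])
  let ?cut = "\<lambda>n u x. indicator {- real n..real n} x * rep_L2 (fourier u) x"
  let ?E = "\<lambda>n u. inv_fourier (cutoff n (fourier u))"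
  let ?gm = "\<lambda>p x. complex_of_real (g_fun x) * p x"
  have fin: "finite F" using bes(1) by (simp add: bessel_family_def)
  have cut: "bessel_family F (\<lambda>j. abs_L2 (?cut n (d j)))" if "bessel_family F d" for d n
    unfolding cutoff_abs[symmetric] cutoff_def
    by (rule bessel_family_image[OF bessel_family_image[OF that adjoint_fourier] adjoint_mult_op[OF _ bounded_indicator]])
       (use norm_mult_op_le[of "indicator {- real n..real n}" 1, OF _ norm_indicator_le] in auto)
  have gcut: "bessel_family F (\<lambda>j. abs_L2 (?gm (?cut n (d j))))" if "bessel_family F d" for d n
    unfolding mult_op_abs_L2[OF g_fun_bounded cut_rep(1), symmetric]
    by (rule bessel_family_image[OF cut[OF that] adjoint_mult_op[OF g_fun_bounded]])
       (use norm_mult_op_le[OF g_fun_bounded(1), of 1] g_fun_le in auto)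
  have si: "square_integrable (?cut n u)" "square_integrable (?gm (?cut n u))" for n u
    using cut_rep(1) square_integrable_mult[OF _ g_fun_bounded(2) cut_rep(1)] g_fun_bounded(1) by auto
  have z: "?cut n u x = 0" if "\<bar>x\<bar> > real n" for n u x using that by (auto simp: indicator_def)
  define I where "I \<kappa> p q = (LINT x|lborel. LINT y|lborel. \<kappa> x y * (cnj (p x) * q y))" for \<kappa> :: "real \<Rightarrow> real \<Rightarrow> complex" and p q
  have bound: "(\<Sum>j\<in>F. cmod (cinner (?E n (f j)) (?T (?E n (e j))))) \<le> ?B" for n
  proof -
    let ?I1 = "\<lambda>j. I (\<lambda>x y. complex_of_real (kernel1 x y) * ft h1 (x - y)) (?cut n (f j)) (?cut n (e j))"
    let ?I2 = "\<lambda>j. I (\<lambda>x y. complex_of_real (kernel2 x y) * ft h2 (x - y)) (?gm (?cut n (f j))) (?cut n (e j))"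
    let ?I3 = "\<lambda>j. I (\<lambda>x y. complex_of_real (kernel2 x y) * ft h2 (x - y)) (?cut n (f j)) (?gm (?cut n (e j)))"
    have "cmod (cinner (?E n (f j)) (?T (?E n (e j)))) \<le> 1 / sqrt (2 * pi) * (cmod (?I1 j) + cmod (?I2 j) + cmod (?I3 j))" for j
    proof -
      have "cinner (?E n (f j)) (?T (?E n (e j))) = ?c * (\<i> * ?I1 j + ?I2 j - ?I3 j)"
        unfolding cutoff_abs I_def by (rule commutator_g_form[OF \<psi> h rel si(1) z si(1) z])
      moreover have "cmod (\<i> * ?I1 j + ?I2 j - ?I3 j) \<le> cmod (?I1 j) + cmod (?I2 j) + cmod (?I3 j)"
        using norm_triangle_ineq4[of "\<i> * ?I1 j + ?I2 j" "?I3 j"] norm_triangle_ineq[of "\<i> * ?I1 j" "?I2 j"]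
        by (simp add: norm_mult)
      ultimately show ?thesis
        by (simp add: norm_mult norm_divide divide_right_mono)
    qed
    then have "(\<Sum>j\<in>F. cmod (cinner (?E n (f j)) (?T (?E n (e j))))) \<le> (\<Sum>j\<in>F. 1 / sqrt (2 * pi) * (cmod (?I1 j) + cmod (?I2 j) + cmod (?I3 j)))"
      by (intro sum_mono)
    also have "\<dots> = 1 / sqrt (2 * pi) * ((\<Sum>j\<in>F. cmod (?I1 j)) + (\<Sum>j\<in>F. cmod (?I2 j)) + (\<Sum>j\<in>F. cmod (?I3 j)))"
      by (simp only: sum_distrib_left[symmetric] sum.distrib)
    also have "\<dots> \<le> 1 / sqrt (2 * pi) * ((LINT x|lborel. kernel1 x x) * (LINT s|lborel. cmod (h1 s)) / sqrt (2 * pi)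
        + (LINT x|lborel. kernel2 x x) * (LINT s|lborel. cmod (h2 s)) / sqrt (2 * pi)
        + (LINT x|lborel. kernel2 x x) * (LINT s|lborel. cmod (h2 s)) / sqrt (2 * pi))"
      unfolding I_def
      by (intro mult_left_mono add_mono
          kernel1_bessel_bound[OF h(1) si(1) si(1) cut[OF bes(2)] cut[OF bes(1)]]
          kernel2_bessel_bound[OF h(2) si(2) si(1) gcut[OF bes(2)] cut[OF bes(1)]]
          kernel2_bessel_bound[OF h(2) si(1) si(2) cut[OF bes(2)] gcut[OF bes(1)]]) simp
    also have "\<dots> = ?B"
    proof -
      have "sqrt (2 * pi) * sqrt (2 * pi) = 2 * pi" by simp
      then have "1 / sqrt (2 * pi) * (a / sqrt (2 * pi) + b / sqrt (2 * pi) + b / sqrt (2 * pi)) = (a + 2 * b) / (2 * pi)" for a b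
        by (simp add: add_divide_distrib flip: real_sqrt_mult)
      then show ?thesis .
    qed
    finally show ?thesis .
  qed
  have lim: "(\<lambda>n. ?E n u) \<longlonglongrightarrow> u" for u
    using bounded_clinear_tendsto[OF bounded_clinear_inv_fourier cutoff_tendsto[of "fourier u"]] by simp
  have "(\<lambda>n. \<Sum>j\<in>F. cmod (cinner (?E n (f j)) (?T (?E n (e j))))) \<longlonglongrightarrow> (\<Sum>j\<in>F. cmod (cinner (f j) (?T (e j))))"
    by (intro tendsto_sum tendsto_norm tendsto_cinner lim bounded_clinear_tendsto[OF T])
  then show ?thesis
    by (rule LIMSEQ_le_const2) (use bound in blast)
qed

section \<open>Functions with integrable weak derivative\<close>

text \<open>Tested against functions rising slowly (over an interval of length \<open>n\<close>) near \<open>-\<infinity>\<close> and falling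
  steeply (over an interval of length \<open>1/n\<close>) to the right of \<open>s\<close>.\<close>

lemma weak_derivative_primitive:
  fixes f f' :: "real \<Rightarrow> real"
  assumes wd: "weak_derivative f f'" and f: "integrable lborel f" "continuous_on UNIV f" "\<And>x. \<bar>f x\<bar> \<le> K"
    and f': "integrable lborel f'"
  shows "f s = (LINT x|lborel. indicator {..s} x * f' x)"
proof -
  obtain b H :: "real \<Rightarrow> real" where b: "smooth b" "smooth H" "\<And>x. DERIV H x :> b x" "\<And>x. 0 \<le> b x"
    "\<forall>x. x \<le> 0 \<or> 1 \<le> x \<longrightarrow> b x = 0" "\<forall>x\<le>0. H x = 0" "\<forall>x\<ge>1. H x = 1" "\<And>x. 0 \<le> H x \<and> H x \<le> 1"
    by (rule smooth_step_exists) blast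
  note bc = smooth_continuous[OF b(1), of UNIV]
  have [measurable]: "f \<in> borel_measurable borel" "f' \<in> borel_measurable borel" using f(1) f' by auto
  have [measurable]: "b \<in> borel_measurable borel" "H \<in> borel_measurable borel"
    using smooth_continuous[OF b(1)] smooth_continuous[OF b(2)] by (auto intro: borel_measurable_continuous_onI)
  have bK: "\<forall>x. \<bar>x\<bar> \<ge> 1 \<longrightarrow> b x = 0"
    using b(5) by (auto simp: abs_if split: if_splits)
  have bi: "integrable lborel b"
    using integrable_norm[OF test_function_square_integrable(2)[OF bc bK]] b(4) by simp
  have "bounded (b ` {0..1})"
    by (intro compact_imp_bounded compact_continuous_image continuous_on_subset[OF bc]) auto
  then obtain B where B: "\<forall>y\<in>b ` {0..1}. norm y \<le> B" by (auto simp: bounded_iff)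
  have bB: "b x \<le> B" for x
  proof (cases "x \<in> {0..1}")
    case True then show ?thesis using B by force
  next
    case False
    then have "b x = 0" using b(5) by auto
    moreover have "0 \<le> B" using B by force
    ultimately show ?thesis by simp
  qed
  have B0: "0 \<le> B" using b(4)[of 0] bB[of 0] by linarith
  have b1: "integral\<^sup>L lborel b = 1"
  proof -
    have "(LINT x|lborel. indicator {0..1} x *\<^sub>R b x) = H 1 - H 0"
    proof (rule integral_FTC_Icc)
      show "(H has_vector_derivative b x) (at x within {0..1})" for x
        using b(3)[of x] by (rule has_vector_derivative_at_within[OF has_real_derivative_iff_has_vector_derivative[THEN iffD1]])
      show "continuous_on {0..1} b" by (rule continuous_on_subset[OF bc]) simp
    qed simp
    moreover have "(\<lambda>x. indicator {0..1} x *\<^sub>R b x) = b"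
    proof
      fix x show "indicator {0..1} x *\<^sub>R b x = b x"
        using b(5) by (cases "x \<in> {0..1}") auto
    qed
    ultimately have "integral\<^sup>L lborel b = H 1 - H 0" by (simp only:)
    then show ?thesis using b(6,7) by simp
  qed
  define N where "N n = real (Suc n)" for n
  define c where "c n = 1 / N n" for n
  have N: "1 \<le> N n" "0 < N n" "real n \<le> N n" for n by (auto simp: N_def)
  have c: "0 < c n" "c n * N n = 1" "N n * c n = 1" for n using N(2)[of n] by (auto simp: c_def)
  \<comment> \<open>The plateau function rises from 0 to 1 on [-2 N, -N] and falls back on
    [s, s + 1/N].\<close>
  define \<phi> where "\<phi> n x = 1 * H (c n * x + 2) - 1 * H (N n * x + - (N n * s))" for n x
  define d where "d n x = c n * b (c n * x + 2) - N n * b (N n * x + - (N n * s))" for n x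
  have D: "DERIV (\<phi> n) x :> d n x" for n x
  proof -
    have "DERIV (\<lambda>x. H (c n * x + 2)) x :> b (c n * x + 2) * c n"
      by (rule DERIV_chain2[OF b(3)]) (auto intro!: derivative_eq_intros)
    moreover have "DERIV (\<lambda>x. H (N n * x + - (N n * s))) x :> b (N n * x + - (N n * s)) * N n"
      by (rule DERIV_chain2[OF b(3)]) (auto intro!: derivative_eq_intros)
    ultimately show ?thesis
      unfolding \<phi>_def[abs_def] d_def mult_1_left by (simp add: DERIV_diff mult.commute)
  qed
  have \<phi>1: "H (c n * x + 2) = 1" if "- N n \<le> x" for n x
  proof -
    have "c n * (- N n) \<le> c n * x" using that c(1)[of n] by (intro mult_left_mono) auto
    then have "1 \<le> c n * x + 2" using c(2)[of n] by simp
    then show ?thesis using b(7) by blast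
  qed
  have \<phi>2: "H (N n * x + - (N n * s)) = 0" if "x \<le> s" for n x
  proof -
    have "N n * x \<le> N n * s" using that N(2)[of n] by (intro mult_left_mono) auto
    then have "N n * x + - (N n * s) \<le> 0" by simp
    then show ?thesis using b(6) by blast
  qed
  have \<phi>3: "H (N n * x + - (N n * s)) = 1" if "1 \<le> N n * (x - s)" for n x
  proof -
    have "1 \<le> N n * x + - (N n * s)" using that by (simp add: right_diff_distrib)
    then show ?thesis using b(7) by blast
  qed
  have tf: "test_function (\<phi> n)" for n
  proof (rule test_functionI[where K = "2 * N n + \<bar>s\<bar> + 1"])
    show "smooth (\<phi> n)"
      unfolding \<phi>_def[abs_def] by (intro smooth_diff smooth_affine b(2))
    fix x assume x: "2 * N n + \<bar>s\<bar> + 1 \<le> \<bar>x\<bar>"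
    show "\<phi> n x = 0"
    proof (cases "x \<ge> 0")
      case True
      then have "- N n \<le> x" "1 \<le> x - s" using N(2)[of n] x by linarith+
      moreover have "1 * 1 \<le> N n * (x - s)" by (rule mult_mono) (use N(1)[of n] \<open>1 \<le> x - s\<close> in auto)
      ultimately show ?thesis using \<phi>1[of n x] \<phi>3[of n x] by (simp add: \<phi>_def)
    next
      case False
      then have "x \<le> s" "x \<le> - (2 * N n)" using N(2)[of n] x by linarith+
      moreover have "c n * x \<le> c n * (- (2 * N n))" using \<open>x \<le> - (2 * N n)\<close> c(1)[of n] by (intro mult_left_mono) auto
      then have "c n * x + 2 \<le> 0" using c(2)[of n] by simp
      then have "H (c n * x + 2) = 0" using b(6) by blast
      ultimately show ?thesis using \<phi>2[of x n] by (simp add: \<phi>_def)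
    qed
  qed
  have eq: "(LINT x|lborel. d n x * f x) = - (LINT x|lborel. \<phi> n x * f' x)" for n
  proof -
    have "deriv (\<phi> n) = d n" using D by (intro ext DERIV_imp_deriv)
    then show ?thesis using wd tf[of n] unfolding weak_derivative_def by fastforce
  qed
  have r: "(\<lambda>n. LINT x|lborel. \<phi> n x * f' x) \<longlonglongrightarrow> (LINT x|lborel. indicator {..s} x * f' x)"
  proof (rule integral_dominated_convergence[where w = "\<lambda>x. \<bar>f' x\<bar>"])
    show "integrable lborel (\<lambda>x. \<bar>f' x\<bar>)" using f' by simp
    show "(\<lambda>x. \<phi> n x * f' x) \<in> borel_measurable lborel" for n unfolding \<phi>_def by measurable
    show "AE x in lborel. norm (\<phi> n x * f' x) \<le> \<bar>f' x\<bar>" for n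
    proof (rule AE_I2)
      fix x
      have "\<bar>\<phi> n x\<bar> \<le> 1" using b(8)[of "c n * x + 2"] b(8)[of "N n * x + - (N n * s)"] by (simp add: \<phi>_def abs_le_iff)
      from mult_right_mono[OF this, of "\<bar>f' x\<bar>"] show "norm (\<phi> n x * f' x) \<le> \<bar>f' x\<bar>" by (simp add: abs_mult)
    qed
    show "AE x in lborel. (\<lambda>n. \<phi> n x * f' x) \<longlonglongrightarrow> indicator {..s} x * f' x"
    proof (rule AE_I2)
      fix x
      obtain M where M: "max (- x) (1 / (x - s)) \<le> real M" using real_arch_simple by blast
      have "eventually (\<lambda>n. \<phi> n x * f' x = indicator {..s} x * f' x) sequentially"
        using eventually_ge_at_top[of M]
      proof eventually_elim
        case (elim n)
        then have n: "- x \<le> N n" "1 / (x - s) \<le> N n" using M N(3)[of n] by linarith+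
        show ?case
        proof (cases "x \<le> s")
          case True
          then show ?thesis using \<phi>1[of n x] \<phi>2[of x n] n(1) by (simp add: \<phi>_def)
        next
          case False
          then have "1 \<le> N n * (x - s)" using n(2) by (simp add: pos_divide_le_eq)
          then show ?thesis using \<phi>1[of n x] \<phi>3[of n x] n(1) False by (simp add: \<phi>_def)
        qed
      qed
      then show "(\<lambda>n. \<phi> n x * f' x) \<longlonglongrightarrow> indicator {..s} x * f' x" by (rule tendsto_eventually)
    qed
  qed measurable
  have c0: "c \<longlonglongrightarrow> 0"
    using LIMSEQ_inverse_real_of_nat by (simp add: c_def[abs_def] N_def inverse_eq_divide)
  \<comment> \<open>The slow rise: its slope is at most B c n and f is integrable, so this part
    vanishes in the limit.\<close>
  have i1: "integrable lborel (\<lambda>x. b (c n * x + 2) * f x)" and l1: "\<bar>LINT x|lborel. b (c n * x + 2) * f x\<bar> \<le> B * (LINT x|lborel. \<bar>f x\<bar>)" for n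
  proof -
    have bd: "\<bar>b (c n * x + 2) * f x\<bar> \<le> B * \<bar>f x\<bar>" for x
      using bB[of "c n * x + 2"] b(4)[of "c n * x + 2"] by (simp add: abs_mult mult_right_mono)
    show i: "integrable lborel (\<lambda>x. b (c n * x + 2) * f x)"
    proof (rule Bochner_Integration.integrable_bound)
      show "integrable lborel (\<lambda>x. B * \<bar>f x\<bar>)" using f(1) by simp
      show "AE x in lborel. norm (b (c n * x + 2) * f x) \<le> norm (B * \<bar>f x\<bar>)"
        using bd B0 by (intro AE_I2) (simp add: abs_mult)
    qed measurable
    have "\<bar>LINT x|lborel. b (c n * x + 2) * f x\<bar> \<le> (LINT x|lborel. \<bar>b (c n * x + 2) * f x\<bar>)"
      using integral_norm_bound[of lborel "\<lambda>x. b (c n * x + 2) * f x"] by simp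
    also have "\<dots> \<le> (LINT x|lborel. B * \<bar>f x\<bar>)"
      using i f(1) by (intro integral_mono bd) auto
    finally show "\<bar>LINT x|lborel. b (c n * x + 2) * f x\<bar> \<le> B * (LINT x|lborel. \<bar>f x\<bar>)" by simp
  qed
  have l1': "(\<lambda>n. c n * (LINT x|lborel. b (c n * x + 2) * f x)) \<longlonglongrightarrow> 0"
  proof (rule Lim_null_comparison)
    show "eventually (\<lambda>n. norm (c n * (LINT x|lborel. b (c n * x + 2) * f x)) \<le> c n * (B * (LINT x|lborel. \<bar>f x\<bar>))) sequentially"
      using c(1) l1 by (intro always_eventually) (auto simp: abs_mult less_imp_le intro!: mult_left_mono)
    show "(\<lambda>n. c n * (B * (LINT x|lborel. \<bar>f x\<bar>))) \<longlonglongrightarrow> 0"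
      using tendsto_mult_right[OF c0, of "B * (LINT x|lborel. \<bar>f x\<bar>)"] by simp
  qed
  have i2: "integrable lborel (\<lambda>y. b y * f (s + c n * y))" for n
  proof (rule Bochner_Integration.integrable_bound)
    show "integrable lborel (\<lambda>y. K * b y)" using bi by simp
    show "AE y in lborel. norm (b y * f (s + c n * y)) \<le> norm (K * b y)"
    proof (rule AE_I2)
      fix y show "norm (b y * f (s + c n * y)) \<le> norm (K * b y)"
        using f(3)[of "s + c n * y"] b(4)[of y] by (simp add: abs_mult mult.commute[of "b y"] mult_right_mono)
    qed
  qed measurable
  have af: "b (N n * (s + c n * y) + - (N n * s)) = b y" for n y
    using c(3)[of n] by (simp add: distrib_left mult.assoc[symmetric])
  have i3: "integrable lborel (\<lambda>x. N n * b (N n * x + - (N n * s)) * f x)"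
    and s3: "(LINT x|lborel. N n * b (N n * x + - (N n * s)) * f x) = (LINT y|lborel. b y * f (s + c n * y))" for n
  proof -
    have e: "N n * b (N n * (s + c n * y) + - (N n * s)) * f (s + c n * y) = N n * (b y * f (s + c n * y))" for y
      by (simp only: af mult.assoc)
    have "integrable lborel (\<lambda>y. N n * b (N n * (s + c n * y) + - (N n * s)) * f (s + c n * y))"
      unfolding e using i2 by simp
    then show "integrable lborel (\<lambda>x. N n * b (N n * x + - (N n * s)) * f x)"
      using lborel_integrable_real_affine_iff[of "c n" "\<lambda>x. N n * b (N n * x + - (N n * s)) * f x" s] c(1)[of n] by simp
    have "(LINT x|lborel. N n * b (N n * x + - (N n * s)) * f x) = \<bar>c n\<bar> *\<^sub>R (LINT y|lborel. N n * b (N n * (s + c n * y) + - (N n * s)) * f (s + c n * y))"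
      by (rule lborel_integral_real_affine) (use c(1)[of n] in simp)
    also have "\<dots> = c n * N n * (LINT y|lborel. b y * f (s + c n * y))"
      unfolding e using c(1)[of n] by simp
    finally show "(LINT x|lborel. N n * b (N n * x + - (N n * s)) * f x) = (LINT y|lborel. b y * f (s + c n * y))"
      by (simp add: c)
  qed
  \<comment> \<open>The steep fall: after rescaling, b is an approximate identity concentrating at
    s. Continuity of f gives the limit at every s, not just almost everywhere.\<close>
  have "(\<lambda>n. LINT y|lborel. b y * f (s + c n * y)) \<longlonglongrightarrow> (LINT y|lborel. b y * f s)"
  proof (rule integral_dominated_convergence[where w = "\<lambda>y. K * b y"])
    show "integrable lborel (\<lambda>y. K * b y)" using bi by simp
    show "AE y in lborel. norm (b y * f (s + c n * y)) \<le> K * b y" for n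
    proof (rule AE_I2)
      fix y show "norm (b y * f (s + c n * y)) \<le> K * b y"
        using f(3)[of "s + c n * y"] b(4)[of y] by (simp add: abs_mult mult.commute[of "b y"] mult_right_mono)
    qed
    show "AE y in lborel. (\<lambda>n. b y * f (s + c n * y)) \<longlonglongrightarrow> b y * f s"
    proof (rule AE_I2)
      fix y
      have "(\<lambda>n. s + c n * y) \<longlonglongrightarrow> s + 0 * y" by (intro tendsto_intros c0)
      then have "(\<lambda>n. f (s + c n * y)) \<longlonglongrightarrow> f s"
        using f(2) by (intro continuous_on_tendsto_compose[OF f(2)]) auto
      then show "(\<lambda>n. b y * f (s + c n * y)) \<longlonglongrightarrow> b y * f s" by (rule tendsto_mult_left)
    qed
  qed measurable
  then have l3: "(\<lambda>n. LINT x|lborel. N n * b (N n * x + - (N n * s)) * f x) \<longlonglongrightarrow> f s"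
    unfolding s3 by (simp add: b1)
  have "(LINT x|lborel. d n x * f x) = c n * (LINT x|lborel. b (c n * x + 2) * f x) - (LINT x|lborel. N n * b (N n * x + - (N n * s)) * f x)" for n
  proof -
    have "(LINT x|lborel. d n x * f x) = (LINT x|lborel. c n * (b (c n * x + 2) * f x) - N n * b (N n * x + - (N n * s)) * f x)"
      by (simp add: d_def left_diff_distrib mult.assoc)
    also have "\<dots> = (LINT x|lborel. c n * (b (c n * x + 2) * f x)) - (LINT x|lborel. N n * b (N n * x + - (N n * s)) * f x)"
      by (rule Bochner_Integration.integral_diff[OF integrable_mult_right[OF i1] i3])
    finally show ?thesis by simp
  qed
  then have "(\<lambda>n. LINT x|lborel. d n x * f x) \<longlonglongrightarrow> 0 - f s"
    using tendsto_diff[OF l1' l3] by simp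
  moreover have "(\<lambda>n. LINT x|lborel. d n x * f x) \<longlonglongrightarrow> - (LINT x|lborel. indicator {..s} x * f' x)"
    unfolding eq by (rule tendsto_minus[OF r])
  ultimately have "0 - f s = - (LINT x|lborel. indicator {..s} x * f' x)"
    by (rule LIMSEQ_unique)
  then show ?thesis by simp
qed

section \<open>Integration by parts on the line\<close>

lemma integral_derivative_Ici:
  fixes w w' :: "real \<Rightarrow> complex"
  assumes d: "\<And>x. (w has_vector_derivative w' x) (at x)" and c: "continuous_on UNIV w'"
    and i: "integrable lborel w'" and l: "(w \<longlongrightarrow> 0) at_top"
  shows "(LINT x|lborel. indicator {a..} x *\<^sub>R w' x) = - w a"
proof -
  have [measurable]: "w' \<in> borel_measurable borel" using i by auto
  have "(LINT x|lborel. indicator {a..a + real n} x *\<^sub>R w' x) = w (a + real n) - w a" for n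
    by (rule integral_FTC_Icc[OF _ has_vector_derivative_at_within[OF d] continuous_on_subset[OF c]]) auto
  moreover have "(\<lambda>n. w (a + real n) - w a) \<longlonglongrightarrow> 0 - w a"
    by (intro tendsto_diff tendsto_const filterlim_compose[OF l] filterlim_tendsto_add_at_top[OF tendsto_const] filterlim_real_sequentially)
  moreover have "(\<lambda>n. LINT x|lborel. indicator {a..a + real n} x *\<^sub>R w' x) \<longlonglongrightarrow> (LINT x|lborel. indicator {a..} x *\<^sub>R w' x)"
  proof (rule integral_dominated_convergence[where w = "\<lambda>x. cmod (w' x)"])
    show "integrable lborel (\<lambda>x. cmod (w' x))" using i by (rule integrable_norm)
    show "AE x in lborel. (\<lambda>n. indicator {a..a + real n} x *\<^sub>R w' x) \<longlonglongrightarrow> indicator {a..} x *\<^sub>R w' x"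
    proof (rule AE_I2)
      fix x
      obtain M where M: "x - a \<le> real M" using real_arch_simple by blast
      have "eventually (\<lambda>n. indicator {a..a + real n} x *\<^sub>R w' x = indicator {a..} x *\<^sub>R w' x) sequentially"
        using eventually_ge_at_top[of M] by eventually_elim (use M in \<open>auto simp: indicator_def\<close>)
      then show "(\<lambda>n. indicator {a..a + real n} x *\<^sub>R w' x) \<longlonglongrightarrow> indicator {a..} x *\<^sub>R w' x" by (rule tendsto_eventually)
    qed
    show "AE x in lborel. norm (indicator {a..a + real n} x *\<^sub>R w' x) \<le> cmod (w' x)" for n
      by (intro AE_I2) (auto simp: indicator_def)
  qed measurable
  ultimately show ?thesis using LIMSEQ_unique by fastforce
qed

lemma integral_derivative_UNIV:
  fixes w w' :: "real \<Rightarrow> complex"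
  assumes d: "\<And>x. (w has_vector_derivative w' x) (at x)" and c: "continuous_on UNIV w'"
    and i: "integrable lborel w'" and l: "(w \<longlongrightarrow> 0) at_top" "(w \<longlongrightarrow> 0) at_bot"
  shows "integral\<^sup>L lborel w' = 0"
proof -
  have [measurable]: "w' \<in> borel_measurable borel" using i by auto
  have "(LINT x|lborel. indicator {- real n..} x *\<^sub>R w' x) = - w (- real n)" for n
    by (rule integral_derivative_Ici[OF d c i l(1)])
  moreover have "(\<lambda>n. - w (- real n)) \<longlonglongrightarrow> - 0"
    by (intro tendsto_minus filterlim_compose[OF l(2)] filterlim_compose[OF filterlim_uminus_at_bot_at_top] filterlim_real_sequentially)
  moreover have "(\<lambda>n. LINT x|lborel. indicator {- real n..} x *\<^sub>R w' x) \<longlonglongrightarrow> integral\<^sup>L lborel w'"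
  proof (rule integral_dominated_convergence[where w = "\<lambda>x. cmod (w' x)"])
    show "integrable lborel (\<lambda>x. cmod (w' x))" using i by (rule integrable_norm)
    show "AE x in lborel. (\<lambda>n. indicator {- real n..} x *\<^sub>R w' x) \<longlonglongrightarrow> w' x"
    proof (rule AE_I2)
      fix x
      obtain M where M: "- x \<le> real M" using real_arch_simple by blast
      have "eventually (\<lambda>n. indicator {- real n..} x *\<^sub>R w' x = w' x) sequentially"
        using eventually_ge_at_top[of M] by eventually_elim (use M in \<open>auto simp: indicator_def\<close>)
      then show "(\<lambda>n. indicator {- real n..} x *\<^sub>R w' x) \<longlonglongrightarrow> w' x" by (rule tendsto_eventually)
    qed
    show "AE x in lborel. norm (indicator {- real n..} x *\<^sub>R w' x) \<le> cmod (w' x)" for n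
      by (intro AE_I2) (auto simp: indicator_def)
  qed measurable
  ultimately show ?thesis using LIMSEQ_unique by fastforce
qed

text \<open>f is the primitive of a merely integrable function, so the product rule is replaced by
  Fubini on the region y <= x; the inner integral of w' over [y, infinity) is - w(y).\<close>

lemma integral_by_parts_primitive:
  fixes f f' :: "real \<Rightarrow> real" and w w' :: "real \<Rightarrow> complex"
  assumes f: "\<And>x. f x = (LINT y|lborel. indicator {..x} y * f' y)" and f': "integrable lborel f'"
    and w: "\<And>x. (w has_vector_derivative w' x) (at x)" "continuous_on UNIV w'" "integrable lborel w'" "(w \<longlongrightarrow> 0) at_top"
  shows "(LINT x|lborel. complex_of_real (f' x) * w x) = - (LINT x|lborel. complex_of_real (f x) * w' x)"
proof -
  let ?k = "\<lambda>x y :: real. (if y \<le> x then 1 else 0) :: complex"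
  have f'c: "integrable lborel (\<lambda>y. complex_of_real (f' y))" using f' by simp
  have "complex_of_real (f x) * w' x = (LINT y|lborel. ?k x y * (w' x * complex_of_real (f' y)))" for x
  proof -
    have "(LINT y|lborel. ?k x y * (w' x * complex_of_real (f' y))) = (LINT y|lborel. w' x * complex_of_real (indicator {..x} y * f' y))"
      by (rule Bochner_Integration.integral_cong) (auto simp: indicator_def)
    then show ?thesis unfolding f[of x] integral_mult_right_zero integral_complex_of_real by simp
  qed
  then have "(LINT x|lborel. complex_of_real (f x) * w' x) = (LINT x|lborel. LINT y|lborel. ?k x y * (w' x * complex_of_real (f' y)))"
    by simp
  also have "\<dots> = (LINT y|lborel. LINT x|lborel. ?k x y * (w' x * complex_of_real (f' y)))"
    by (rule Fubini_bounded_kernel(2)[OF w(3) f'c, where K = 1]) auto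
  also have "\<dots> = (LINT y|lborel. - (complex_of_real (f' y) * w y))"
  proof (rule Bochner_Integration.integral_cong[OF refl])
    fix y
    have "(LINT x|lborel. ?k x y * (w' x * complex_of_real (f' y))) = (LINT x|lborel. complex_of_real (f' y) * (indicator {y..} x *\<^sub>R w' x))"
      by (rule Bochner_Integration.integral_cong) (auto simp: indicator_def)
    then show "(LINT x|lborel. ?k x y * (w' x * complex_of_real (f' y))) = - (complex_of_real (f' y) * w y)"
      unfolding integral_mult_right_zero integral_derivative_Ici[OF w] by simp
  qed
  finally show ?thesis by simp
qed

section \<open>Cutting off the phase factor\<close>

text \<open>A rational cutoff is convenient because its derivatives are dominated by multiples of
  itself, with powers of \<delta> that keep their L1 norms bounded.\<close>

definition chi :: "real \<Rightarrow> real \<Rightarrow> real" where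
  "chi \<delta> x = inverse (1 + (\<delta> * x)\<^sup>2)"

definition chi1 :: "real \<Rightarrow> real \<Rightarrow> real" where
  "chi1 \<delta> x = - (2 * \<delta>\<^sup>2) * x * (chi \<delta> x)\<^sup>2"

definition chi2 :: "real \<Rightarrow> real \<Rightarrow> real" where
  "chi2 \<delta> x = - (2 * \<delta>\<^sup>2) * (chi \<delta> x)\<^sup>2 + 8 * \<delta> ^ 4 * x\<^sup>2 * (chi \<delta> x) ^ 3"

lemma chi_pos: "0 < 1 + (\<delta> * x)\<^sup>2" "0 < chi \<delta> x" "chi \<delta> x \<le> 1"
proof -
  show p: "0 < 1 + (\<delta> * x)\<^sup>2" by (rule add_pos_nonneg) auto
  show "0 < chi \<delta> x" unfolding chi_def using p by (rule positive_imp_inverse_positive)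
  show "chi \<delta> x \<le> 1" unfolding chi_def by (rule inverse_le_1_iff[THEN iffD2]) simp
qed

lemma DERIV_chi: "DERIV (chi \<delta>) x :> chi1 \<delta> x"
proof -
  have "DERIV (\<lambda>x. 1 + (\<delta> * x)\<^sup>2) x :> 2 * \<delta>\<^sup>2 * x"
    by (auto intro!: derivative_eq_intros simp: power2_eq_square)
  from DERIV_inverse'[OF this] show ?thesis
    using chi_pos(1)[of \<delta> x] unfolding chi_def[abs_def] chi1_def by (simp add: power2_eq_square mult_ac)
qed

lemma DERIV_chi1: "DERIV (chi1 \<delta>) x :> chi2 \<delta> x"
proof -
  have "DERIV (\<lambda>x. - (2 * \<delta>\<^sup>2) * x * (chi \<delta> x)\<^sup>2) x :> - (2 * \<delta>\<^sup>2) * (chi \<delta> x)\<^sup>2 + - (2 * \<delta>\<^sup>2) * x * (2 * chi \<delta> x * chi1 \<delta> x)"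
    by (auto intro!: derivative_eq_intros DERIV_chi)
  moreover have "- (2 * \<delta>\<^sup>2) * (chi \<delta> x)\<^sup>2 + - (2 * \<delta>\<^sup>2) * x * (2 * chi \<delta> x * chi1 \<delta> x) = chi2 \<delta> x"
    by (simp add: chi1_def chi2_def power2_eq_square power3_eq_cube power4_eq_xxxx)
  ultimately show ?thesis unfolding chi1_def[abs_def] by simp
qed

text \<open>Reduces to 2 |z| <= 1 + z^2 at z = \<delta> x.\<close>

lemma chi1_le:
  assumes "0 < \<delta>"
  shows "\<bar>chi1 \<delta> x\<bar> \<le> \<delta> * chi \<delta> x"
proof -
  have "2 * \<bar>\<delta> * x\<bar> \<le> 1 + (\<delta> * x)\<^sup>2"
    using sum_squares_bound[of 1 "\<bar>\<delta> * x\<bar>"] by simp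
  then have "2 * \<bar>\<delta> * x\<bar> * chi \<delta> x \<le> (1 + (\<delta> * x)\<^sup>2) * chi \<delta> x"
    using chi_pos(2)[of \<delta> x] by (intro mult_right_mono) auto
  also have "\<dots> = 1" using chi_pos(1)[of \<delta> x] by (simp add: chi_def)
  finally have "\<delta> * chi \<delta> x * (2 * \<bar>\<delta> * x\<bar> * chi \<delta> x) \<le> \<delta> * chi \<delta> x * 1"
    using assms chi_pos(2)[of \<delta> x] by (intro mult_left_mono) auto
  moreover have "\<bar>chi1 \<delta> x\<bar> = \<delta> * chi \<delta> x * (2 * \<bar>\<delta> * x\<bar> * chi \<delta> x)"
    using assms chi_pos(2)[of \<delta> x] by (simp add: chi1_def abs_mult power2_eq_square)
  ultimately show ?thesis by simp
qed

text \<open>10 = 2 + 8: the two terms are bounded separately, using (\<delta> x)^2 chi <= 1 and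
  chi^2 <= chi.\<close>

lemma chi2_le: "\<bar>chi2 \<delta> x\<bar> \<le> 10 * \<delta>\<^sup>2 * chi \<delta> x"
proof -
  define c where "c = chi \<delta> x"
  have c: "0 < c" "c \<le> 1" using chi_pos by (auto simp: c_def)
  have "(1 + (\<delta> * x)\<^sup>2) * c = 1" using chi_pos(1)[of \<delta> x] by (simp add: c_def chi_def)
  then have "(\<delta> * x)\<^sup>2 * c \<le> 1" using c by (simp add: distrib_right)
  have cc: "c\<^sup>2 \<le> c" using c by (simp add: power2_eq_square mult_left_le)
  have "8 * \<delta> ^ 4 * x\<^sup>2 * c ^ 3 = 8 * \<delta>\<^sup>2 * ((\<delta> * x)\<^sup>2 * c) * c\<^sup>2"
    by (simp add: power2_eq_square power3_eq_cube power4_eq_xxxx)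
  also have "\<dots> \<le> 8 * \<delta>\<^sup>2 * 1 * c"
    using \<open>(\<delta> * x)\<^sup>2 * c \<le> 1\<close> cc c by (intro mult_mono mult_nonneg_nonneg) auto
  finally have 1: "8 * \<delta> ^ 4 * x\<^sup>2 * c ^ 3 \<le> 8 * \<delta>\<^sup>2 * c" by simp
  have 2: "2 * \<delta>\<^sup>2 * c\<^sup>2 \<le> 2 * \<delta>\<^sup>2 * c" using cc by (intro mult_left_mono) auto
  have 3: "0 \<le> 8 * \<delta> ^ 4 * x\<^sup>2 * c ^ 3" "0 \<le> 2 * \<delta>\<^sup>2 * c\<^sup>2" using c by auto
  have "chi2 \<delta> x = - (2 * \<delta>\<^sup>2 * c\<^sup>2) + 8 * \<delta> ^ 4 * x\<^sup>2 * c ^ 3"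
    by (simp add: chi2_def c_def)
  then show ?thesis using 1 2 3 unfolding c_def[symmetric] by linarith
qed

lemma chi_continuous: "continuous_on UNIV (chi \<delta>)" "continuous_on UNIV (chi1 \<delta>)" "continuous_on UNIV (chi2 \<delta>)"
proof -
  show c: "continuous_on UNIV (chi \<delta>)"
    by (rule DERIV_continuous_on[OF has_field_derivative_at_within[OF DERIV_chi]])
  show "continuous_on UNIV (chi1 \<delta>)" "continuous_on UNIV (chi2 \<delta>)"
    unfolding chi1_def[abs_def] chi2_def[abs_def] by (intro continuous_intros c)+
qed

lemma chi_measurable [measurable]:
  "chi \<delta> \<in> borel_measurable borel" "chi1 \<delta> \<in> borel_measurable borel" "chi2 \<delta> \<in> borel_measurable borel"
  using chi_continuous by (auto intro: borel_measurable_continuous_onI)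

lemma chi_tendsto:
  assumes "0 < \<delta>"
  shows "(chi \<delta> \<longlongrightarrow> 0) at_top" "(chi \<delta> \<longlongrightarrow> 0) at_bot"
proof -
  have "filterlim (\<lambda>x. 1 + (\<delta> * x)\<^sup>2) at_top at_top"
    by (intro filterlim_tendsto_add_at_top[OF tendsto_const] filterlim_pow_at_top filterlim_tendsto_pos_mult_at_top[OF tendsto_const assms] filterlim_ident) auto
  then show t: "(chi \<delta> \<longlongrightarrow> 0) at_top"
    unfolding chi_def[abs_def] by (rule tendsto_inverse_0_at_top)
  have "chi \<delta> (- x) = chi \<delta> x" for x by (simp add: chi_def)
  then show "(chi \<delta> \<longlongrightarrow> 0) at_bot"
    using t by (simp add: filterlim_at_bot_mirror)
qed

text \<open>Scaling: the integral of \<delta> chi is the same for all \<delta>. Hence the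
  derivatives of the cutoff contribute to the L1 norms uniformly.\<close>

lemma chi_integral:
  assumes "0 < \<delta>"
  shows "integrable lborel (chi \<delta>)" "\<delta> * (LINT x|lborel. chi \<delta> x) = (LINT x|lborel. 1 / (bracket x)\<^sup>2)"
proof -
  have e: "(\<lambda>x. 1 / (bracket (0 + \<delta> * x))\<^sup>2) = chi \<delta>"
    by (simp add: fun_eq_iff bracket(3) chi_def inverse_eq_divide)
  show "integrable lborel (chi \<delta>)"
    using lborel_integrable_real_affine[OF integrable_inverse_bracket_sq, of \<delta> 0] assms unfolding e by simp
  show "\<delta> * (LINT x|lborel. chi \<delta> x) = (LINT x|lborel. 1 / (bracket x)\<^sup>2)"
    using lborel_integral_real_affine[of \<delta> "\<lambda>x. 1 / (bracket x)\<^sup>2" 0] assms unfolding e by simp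
qed

lemma has_vector_derivative_cis:
  assumes "DERIV G x :> g"
  shows "((\<lambda>x. cis (- G x)) has_vector_derivative - \<i> * complex_of_real g * cis (- G x)) (at x)"
proof -
  have "((\<lambda>x. - \<i> * complex_of_real (G x)) has_vector_derivative - \<i> * complex_of_real g) (at x)"
    using assms by (intro has_vector_derivative_mult_right has_vector_derivative_of_real) (simp add: has_real_derivative_iff_has_vector_derivative)
  from field_vector_diff_chain_at[OF this DERIV_exp] show ?thesis
    by (simp add: comp_def cis_conv_exp)
qed

text \<open>The Bessel bound applies to the cut off \<psi> with constants independent of the cutoff.
  It passes to the limit for each pair of finite Bessel families, which is all that
  \<open>trace_classI\<close> asks for.\<close>

lemma commutator_g_trace_class:
  fixes f f' F :: "real \<Rightarrow> real"
  assumes f: "integrable lborel f" "continuous_on UNIV f" "\<And>x. \<bar>f x\<bar> \<le> K"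
    and f': "integrable lborel f'" and prim: "\<And>s. f s = (LINT x|lborel. indicator {..s} x * f' x)"
    and F: "\<And>x. DERIV F x :> f x"
  shows "trace_class (commutator (mult_op (\<lambda>x. cis (- F x))) g_op)"
proof -
  define \<psi> where "\<psi> x = cis (- F x)" for x
  define J where "J = (LINT x|lborel. 1 / (bracket x)\<^sup>2)"
  define \<delta> where "\<delta> n = inverse (real (Suc n))" for n
  have \<delta>: "0 < \<delta> n" "\<delta> n \<le> 1" for n by (auto simp: \<delta>_def inverse_le_1_iff)
  have Fc: "continuous_on UNIV F" by (rule DERIV_continuous_on[OF has_field_derivative_at_within[OF F]])
  have [measurable]: "f \<in> borel_measurable borel" "f' \<in> borel_measurable borel" using f(1) f' by auto
  have [measurable]: "F \<in> borel_measurable borel" using Fc by (rule borel_measurable_continuous_onI)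
  have \<psi>m [measurable]: "\<psi> \<in> borel_measurable borel" unfolding \<psi>_def by measurable
  have K0: "0 \<le> K" using f(3)[of 0] by linarith
  define \<psi>n where "\<psi>n n x = \<psi> x * complex_of_real (chi (\<delta> n) x)" for n x
  define h1 where "h1 n x = - \<i> * complex_of_real (f x) * \<psi> x * complex_of_real (chi (\<delta> n) x) + \<psi> x * complex_of_real (chi1 (\<delta> n) x)" for n x
  \<comment> \<open>The formal derivative of h1, with the weak derivative f' of f inserted; only its
    transform will be compared with that of h1.\<close>
  define h2 where "h2 n x = - \<i> * complex_of_real (f' x) * \<psi> x * complex_of_real (chi (\<delta> n) x) - complex_of_real (f x) * complex_of_real (f x) * \<psi> x * complex_of_real (chi (\<delta> n) x)
      - 2 * \<i> * complex_of_real (f x) * \<psi> x * complex_of_real (chi1 (\<delta> n) x) + \<psi> x * complex_of_real (chi2 (\<delta> n) x)" for n x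
  have c1: "\<bar>chi1 (\<delta> n) x\<bar> \<le> \<delta> n * chi (\<delta> n) x" "\<bar>chi1 (\<delta> n) x\<bar> \<le> 1" "\<bar>chi2 (\<delta> n) x\<bar> \<le> 10 * (\<delta> n * chi (\<delta> n) x)" "\<bar>chi (\<delta> n) x\<bar> \<le> 1" for n x
  proof -
    show a: "\<bar>chi1 (\<delta> n) x\<bar> \<le> \<delta> n * chi (\<delta> n) x" by (rule chi1_le[OF \<delta>(1)])
    have "\<delta> n * chi (\<delta> n) x \<le> 1 * 1" by (rule mult_mono) (use \<delta>[of n] chi_pos[of "\<delta> n" x] in auto)
    with a show "\<bar>chi1 (\<delta> n) x\<bar> \<le> 1" by simp
    have "(\<delta> n)\<^sup>2 \<le> \<delta> n" using \<delta>[of n] by (simp add: power2_eq_square mult_left_le)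
    then have "10 * (\<delta> n)\<^sup>2 * chi (\<delta> n) x \<le> 10 * \<delta> n * chi (\<delta> n) x"
      using chi_pos(2)[of "\<delta> n" x] by (intro mult_right_mono) auto
    then show "\<bar>chi2 (\<delta> n) x\<bar> \<le> 10 * (\<delta> n * chi (\<delta> n) x)" using chi2_le[of "\<delta> n" x] by simp
    show "\<bar>chi (\<delta> n) x\<bar> \<le> 1" using chi_pos[of "\<delta> n" x] by simp
  qed
  have ci: "integrable lborel (\<lambda>x. \<delta> n * chi (\<delta> n) x)" "(LINT x|lborel. \<delta> n * chi (\<delta> n) x) = J" for n
    using chi_integral[OF \<delta>(1)[of n]] by (simp_all add: J_def)
  have cc: "integrable lborel (\<lambda>x. complex_of_real (chi (\<delta> n) x))" "integrable lborel (\<lambda>x. complex_of_real (chi1 (\<delta> n) x))" "integrable lborel (\<lambda>x. complex_of_real (chi2 (\<delta> n) x))" for n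
  proof -
    show "integrable lborel (\<lambda>x. complex_of_real (chi (\<delta> n) x))" using chi_integral(1)[OF \<delta>(1)[of n]] by simp
    have "integrable lborel (chi1 (\<delta> n))"
    proof (rule Bochner_Integration.integrable_bound[OF ci(1)])
      show "AE x in lborel. norm (chi1 (\<delta> n) x) \<le> norm (\<delta> n * chi (\<delta> n) x)"
      proof (rule AE_I2)
        fix x show "norm (chi1 (\<delta> n) x) \<le> norm (\<delta> n * chi (\<delta> n) x)"
          using c1(1)[of n x] \<delta>(1)[of n] chi_pos(2)[of "\<delta> n" x] by simp
      qed
    qed measurable
    then show "integrable lborel (\<lambda>x. complex_of_real (chi1 (\<delta> n) x))" by simp
    have "integrable lborel (chi2 (\<delta> n))"
    proof (rule Bochner_Integration.integrable_bound[OF integrable_mult_right[OF ci(1), of 10]])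
      show "AE x in lborel. norm (chi2 (\<delta> n) x) \<le> norm (10 * (\<delta> n * chi (\<delta> n) x))"
      proof (rule AE_I2)
        fix x show "norm (chi2 (\<delta> n) x) \<le> norm (10 * (\<delta> n * chi (\<delta> n) x))"
          using c1(3)[of n x] \<delta>(1)[of n] chi_pos(2)[of "\<delta> n" x] by simp
      qed
    qed measurable
    then show "integrable lborel (\<lambda>x. complex_of_real (chi2 (\<delta> n) x))" by simp
  qed
  have fc: "integrable lborel (\<lambda>x. complex_of_real (f x))" "integrable lborel (\<lambda>x. complex_of_real (f' x))" using f(1) f' by auto
  \<comment> \<open>Stated for an arbitrary unimodular E because the products occur both with \<psi>
    and with \<psi> times a character.\<close>
  have int:
    "integrable lborel (\<lambda>x. E x * complex_of_real (chi (\<delta> n) x))"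
    "integrable lborel (\<lambda>x. E x * complex_of_real (chi1 (\<delta> n) x))"
    "integrable lborel (\<lambda>x. E x * complex_of_real (chi2 (\<delta> n) x))"
    "integrable lborel (\<lambda>x. (E x * complex_of_real (chi (\<delta> n) x)) * complex_of_real (f x))"
    "integrable lborel (\<lambda>x. (E x * complex_of_real (chi1 (\<delta> n) x)) * complex_of_real (f x))"
    "integrable lborel (\<lambda>x. (E x * complex_of_real (chi (\<delta> n) x)) * complex_of_real (f' x))"
    "integrable lborel (\<lambda>x. (complex_of_real (f x) * (E x * complex_of_real (chi (\<delta> n) x))) * complex_of_real (f x))"
    if [measurable]: "E \<in> borel_measurable borel" and E: "\<forall>x. cmod (E x) = 1" for E n
  proof -
    have e: "cmod (E x) \<le> 1" "cmod (E x * complex_of_real (chi (\<delta> n) x)) \<le> 1" "cmod (E x * complex_of_real (chi1 (\<delta> n) x)) \<le> 1"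
        "cmod (complex_of_real (f x) * (E x * complex_of_real (chi (\<delta> n) x))) \<le> K * 1" for x
    proof -
      show "cmod (E x) \<le> 1" "cmod (E x * complex_of_real (chi (\<delta> n) x)) \<le> 1" "cmod (E x * complex_of_real (chi1 (\<delta> n) x)) \<le> 1"
        unfolding norm_mult norm_of_real E[rule_format] using c1[of n x] by simp_all
      show "cmod (complex_of_real (f x) * (E x * complex_of_real (chi (\<delta> n) x))) \<le> K * 1"
        unfolding norm_mult norm_of_real E[rule_format] mult_1_left by (rule mult_mono[OF f(3) c1(4) K0]) simp
    qed
    have "E \<in> borel_measurable lborel" "(\<lambda>x. E x * complex_of_real (chi (\<delta> n) x)) \<in> borel_measurable lborel"
      "(\<lambda>x. E x * complex_of_real (chi1 (\<delta> n) x)) \<in> borel_measurable lborel"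
      "(\<lambda>x. complex_of_real (f x) * (E x * complex_of_real (chi (\<delta> n) x))) \<in> borel_measurable lborel" by measurable
    note m = this
    show "integrable lborel (\<lambda>x. E x * complex_of_real (chi (\<delta> n) x))" "integrable lborel (\<lambda>x. E x * complex_of_real (chi1 (\<delta> n) x))"
      "integrable lborel (\<lambda>x. E x * complex_of_real (chi2 (\<delta> n) x))"
      by (rule integrable_mult_bounded[OF cc(1) m(1) e(1)], rule integrable_mult_bounded[OF cc(2) m(1) e(1)], rule integrable_mult_bounded[OF cc(3) m(1) e(1)])
    show "integrable lborel (\<lambda>x. (E x * complex_of_real (chi (\<delta> n) x)) * complex_of_real (f x))"
      by (rule integrable_mult_bounded[OF fc(1) m(2) e(2)])
    show "integrable lborel (\<lambda>x. (E x * complex_of_real (chi1 (\<delta> n) x)) * complex_of_real (f x))"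
      by (rule integrable_mult_bounded[OF fc(1) m(3) e(3)])
    show "integrable lborel (\<lambda>x. (E x * complex_of_real (chi (\<delta> n) x)) * complex_of_real (f' x))"
      by (rule integrable_mult_bounded[OF fc(2) m(2) e(2)])
    show "integrable lborel (\<lambda>x. (complex_of_real (f x) * (E x * complex_of_real (chi (\<delta> n) x))) * complex_of_real (f x))"
      by (rule integrable_mult_bounded[OF fc(1) m(4) e(4)])
  qed
  have \<psi>1: "\<forall>x. cmod (\<psi> x) = 1" by (simp add: \<psi>_def)
  have \<psi>ni: "integrable lborel (\<psi>n n)" for n
    unfolding \<psi>n_def[abs_def] by (rule int(1)[OF \<psi>m \<psi>1])
  have \<psi>nb: "cmod (\<psi>n n x) \<le> 1" for n x
    using \<psi>1 c1(4)[of n x] by (simp add: \<psi>n_def norm_mult)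
  have h1i: "integrable lborel (h1 n)" for n
  proof -
    have "h1 n = (\<lambda>x. - \<i> * ((\<psi> x * complex_of_real (chi (\<delta> n) x)) * complex_of_real (f x)) + \<psi> x * complex_of_real (chi1 (\<delta> n) x))"
      by (simp add: h1_def fun_eq_iff)
    then show ?thesis
      using Bochner_Integration.integrable_add[OF integrable_mult_right[OF int(4)[OF \<psi>m \<psi>1], of "- \<i>"] int(2)[OF \<psi>m \<psi>1]] by simp
  qed
  have h2i: "integrable lborel (h2 n)" for n
  proof -
    have "h2 n = (\<lambda>x. - \<i> * ((\<psi> x * complex_of_real (chi (\<delta> n) x)) * complex_of_real (f' x)) - (complex_of_real (f x) * (\<psi> x * complex_of_real (chi (\<delta> n) x))) * complex_of_real (f x)
        - 2 * \<i> * ((\<psi> x * complex_of_real (chi1 (\<delta> n) x)) * complex_of_real (f x)) + \<psi> x * complex_of_real (chi2 (\<delta> n) x))"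
      by (simp add: h2_def fun_eq_iff)
    then show ?thesis
      using Bochner_Integration.integrable_add[OF Bochner_Integration.integrable_diff[OF Bochner_Integration.integrable_diff[OF integrable_mult_right[OF int(6)[OF \<psi>m \<psi>1], of "- \<i>"] int(7)[OF \<psi>m \<psi>1]]
        integrable_mult_right[OF int(5)[OF \<psi>m \<psi>1], of "2 * \<i>"]] int(3)[OF \<psi>m \<psi>1]] by simp
  qed
  have rel: "\<i> * complex_of_real \<zeta> * ft (\<psi>n n) \<zeta> = ft (h1 n) \<zeta>" "\<i> * complex_of_real \<zeta> * ft (h1 n) \<zeta> = ft (h2 n) \<zeta>" for n \<zeta>
  proof -
    \<comment> \<open>The character of the transform is absorbed into the phase, so F(x) + x \<zeta>
      takes the place of F; differentiating E then produces the factor \<zeta>.\<close>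
    define E where "E x = cis (- (F x + x * \<zeta>))" for x
    have Em [measurable]: "E \<in> borel_measurable borel" unfolding E_def by measurable
    have E1: "\<forall>x. cmod (E x) = 1" by (simp add: E_def)
    have E\<psi>: "cis (- (x * \<zeta>)) * \<psi> x = E x" for x by (simp add: E_def \<psi>_def cis_mult algebra_simps)
    note int = int[OF Em E1, of n]
    let ?c = "\<lambda>x. complex_of_real (chi (\<delta> n) x)" and ?c1 = "\<lambda>x. complex_of_real (chi1 (\<delta> n) x)" and ?c2 = "\<lambda>x. complex_of_real (chi2 (\<delta> n) x)"
    let ?f = "\<lambda>x. complex_of_real (f x)" and ?z = "\<i> * complex_of_real \<zeta>"
    have dE: "(E has_vector_derivative - \<i> * complex_of_real (f x + \<zeta>) * E x) (at x)" for x
      unfolding E_def[abs_def] by (rule has_vector_derivative_cis) (auto intro!: derivative_eq_intros F)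
    have dc: "(?c has_vector_derivative ?c1 x) (at x)" "(?c1 has_vector_derivative ?c2 x) (at x)" for x
      using DERIV_chi[of "\<delta> n" x] DERIV_chi1[of "\<delta> n" x] by (auto intro!: has_vector_derivative_of_real simp: has_real_derivative_iff_has_vector_derivative)
    have cE: "continuous_on UNIV E" unfolding E_def by (intro continuous_intros Fc)
    note cont = cE chi_continuous[of "\<delta> n"] f(2)
    define w where "w x = E x * ?c x" for x
    define w' where "w' x = - (?z * (E x * ?c x)) + (- \<i> * (E x * ?c x * ?f x) + E x * ?c1 x)" for x
    define v where "v x = E x * ?c1 x" for x
    define v' where "v' x = - (?z * (E x * ?c1 x)) + (- \<i> * (E x * ?c1 x * ?f x) + E x * ?c2 x)" for x
    have dw: "(w has_vector_derivative w' x) (at x)" for x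
      unfolding w_def[abs_def] by (rule has_vector_derivative_eq_rhs[OF has_vector_derivative_mult[OF dE dc(1)]]) (simp add: w'_def algebra_simps)
    have dv: "(v has_vector_derivative v' x) (at x)" for x
      unfolding v_def[abs_def] by (rule has_vector_derivative_eq_rhs[OF has_vector_derivative_mult[OF dE dc(2)]]) (simp add: v'_def algebra_simps)
    have cw: "continuous_on UNIV w'" "continuous_on UNIV v'"
      unfolding w'_def v'_def by (intro continuous_intros cont)+
    have iEh1: "integrable lborel (\<lambda>x. - \<i> * (E x * ?c x * ?f x) + E x * ?c1 x)"
      by (rule Bochner_Integration.integrable_add[OF integrable_mult_right[OF int(4)] int(2)])
    have iv: "integrable lborel (\<lambda>x. - \<i> * (E x * ?c1 x * ?f x) + E x * ?c2 x)"
      by (rule Bochner_Integration.integrable_add[OF integrable_mult_right[OF int(5)] int(3)])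
    have iz: "integrable lborel (\<lambda>x. - (?z * (E x * ?c x)))" "integrable lborel (\<lambda>x. - (?z * (E x * ?c1 x)))"
      by (rule Bochner_Integration.integrable_minus[OF integrable_mult_right[OF int(1)]], rule Bochner_Integration.integrable_minus[OF integrable_mult_right[OF int(2)]])
    have iw: "integrable lborel w'" "integrable lborel v'"
      unfolding w'_def[abs_def] v'_def[abs_def]
      by (rule Bochner_Integration.integrable_add[OF iz(1) iEh1], rule Bochner_Integration.integrable_add[OF iz(2) iv])
    have lw: "(w \<longlongrightarrow> 0) net" if "(chi (\<delta> n) \<longlongrightarrow> 0) net" for net
    proof (rule Lim_null_comparison[OF always_eventually that], rule allI)
      fix x show "norm (w x) \<le> chi (\<delta> n) x" using E1 chi_pos(2)[of "\<delta> n" x] by (simp add: w_def norm_mult)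
    qed
    have lv: "(v \<longlongrightarrow> 0) net" if "(chi (\<delta> n) \<longlongrightarrow> 0) net" for net
    proof (rule Lim_null_comparison[OF always_eventually that], rule allI)
      fix x
      have "\<delta> n * chi (\<delta> n) x \<le> 1 * chi (\<delta> n) x" using \<delta>(2)[of n] chi_pos(2)[of "\<delta> n" x] by (intro mult_right_mono) auto
      then show "norm (v x) \<le> chi (\<delta> n) x" using E1 c1(1)[of n x] by (simp add: v_def norm_mult)
    qed
    note lim = lw[OF chi_tendsto(1)[OF \<delta>(1)]] lw[OF chi_tendsto(2)[OF \<delta>(1)]] lv[OF chi_tendsto(1)[OF \<delta>(1)]] lv[OF chi_tendsto(2)[OF \<delta>(1)]]
    have Eh1: "cis (- (x * \<zeta>)) * h1 n x = - \<i> * (E x * ?c x * ?f x) + E x * ?c1 x" for x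
      unfolding E\<psi>[symmetric] h1_def by (simp add: algebra_simps)
    \<comment> \<open>The vanishing integral of (E chi)' is the first relation: the term with
      \<zeta> balances the transform of h1.\<close>
    have "integral\<^sup>L lborel w' = 0" by (rule integral_derivative_UNIV[OF dw cw(1) iw(1) lim(1,2)])
    then have "?z * (LINT x|lborel. E x * ?c x) = (LINT x|lborel. - \<i> * (E x * ?c x * ?f x) + E x * ?c1 x)"
      unfolding w'_def[abs_def] Bochner_Integration.integral_add[OF iz(1) iEh1] Bochner_Integration.integral_minus integral_mult_right_zero
      by (simp add: add_eq_0_iff)
    then have "?z * (LINT x|lborel. cis (- (x * \<zeta>)) * \<psi>n n x) = (LINT x|lborel. cis (- (x * \<zeta>)) * h1 n x)"
      unfolding Eh1 \<psi>n_def mult.assoc[symmetric] E\<psi> .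
    then show "?z * ft (\<psi>n n) \<zeta> = ft (h1 n) \<zeta>"
      unfolding ft_def by (simp only: mult.left_commute[of ?z])
    \<comment> \<open>For the second relation h1 is split. The part with chi1 is differentiated
      classically; the part with f chi is handled in A by parts.\<close>
    have "integral\<^sup>L lborel v' = 0" by (rule integral_derivative_UNIV[OF dv cw(2) iw(2) lim(3,4)])
    then have B: "?z * (LINT x|lborel. E x * ?c1 x) = (LINT x|lborel. - \<i> * (E x * ?c1 x * ?f x) + E x * ?c2 x)"
      unfolding v'_def[abs_def] Bochner_Integration.integral_add[OF iz(2) iv] Bochner_Integration.integral_minus integral_mult_right_zero
      by (simp add: add_eq_0_iff)
    have i8: "integrable lborel (\<lambda>x. - \<i> * (?f x * (E x * ?c x) * ?f x) + E x * ?c1 x * ?f x)"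
      by (rule Bochner_Integration.integrable_add[OF integrable_mult_right[OF int(7)] int(5)])
    have i6: "integrable lborel (\<lambda>x. E x * ?c x * complex_of_real (f' x))" by (rule int(6))
    have fw': "?f x * w' x = - (?z * (E x * ?c x * ?f x)) + (- \<i> * (?f x * (E x * ?c x) * ?f x) + E x * ?c1 x * ?f x)" for x
      by (simp add: w'_def algebra_simps)
    have f'w: "complex_of_real (f' x) * w x = E x * ?c x * complex_of_real (f' x)" for x
      by (simp add: w_def mult.commute)
    have lin: "a = b + c" if "b = - (- a + c)" for a b c :: complex
      using that by simp
    have iz3: "integrable lborel (\<lambda>x. - (?z * (E x * ?c x * ?f x)))"
      by (rule Bochner_Integration.integrable_minus[OF integrable_mult_right[OF int(4)]])
    \<comment> \<open>Here the derivative falls on f, which is only known as the primitive of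
      f'.\<close>
    have "(LINT x|lborel. complex_of_real (f' x) * w x) = - (LINT x|lborel. ?f x * w' x)"
      by (rule integral_by_parts_primitive[OF prim f' dw cw(1) iw(1) lim(1)])
    then have A: "?z * (LINT x|lborel. E x * ?c x * ?f x) = (LINT x|lborel. E x * ?c x * complex_of_real (f' x)) + (LINT x|lborel. - \<i> * (?f x * (E x * ?c x) * ?f x) + E x * ?c1 x * ?f x)"
      unfolding f'w fw' Bochner_Integration.integral_add[OF iz3 i8] Bochner_Integration.integral_minus integral_mult_right_zero
      by (rule lin)
    have Eh2: "cis (- (x * \<zeta>)) * h2 n x = - \<i> * (E x * ?c x * complex_of_real (f' x) + (- \<i> * (?f x * (E x * ?c x) * ?f x) + E x * ?c1 x * ?f x))
        + (- \<i> * (E x * ?c1 x * ?f x) + E x * ?c2 x)" for x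
      unfolding E\<psi>[symmetric] h2_def by (simp add: algebra_simps)
    have "?z * (LINT x|lborel. - \<i> * (E x * ?c x * ?f x) + E x * ?c1 x) = - \<i> * (?z * (LINT x|lborel. E x * ?c x * ?f x)) + ?z * (LINT x|lborel. E x * ?c1 x)"
      unfolding Bochner_Integration.integral_add[OF integrable_mult_right[OF int(4)] int(2)] integral_mult_right_zero
      by (simp only: distrib_left mult_ac)
    also have "\<dots> = (LINT x|lborel. - \<i> * (E x * ?c x * complex_of_real (f' x) + (- \<i> * (?f x * (E x * ?c x) * ?f x) + E x * ?c1 x * ?f x))
        + (- \<i> * (E x * ?c1 x * ?f x) + E x * ?c2 x))"
      unfolding A B Bochner_Integration.integral_add[OF integrable_mult_right[OF Bochner_Integration.integrable_add[OF i6 i8]] iv]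
      unfolding integral_mult_right_zero Bochner_Integration.integral_add[OF i6 i8] ..
    finally have "?z * (LINT x|lborel. cis (- (x * \<zeta>)) * h1 n x) = (LINT x|lborel. cis (- (x * \<zeta>)) * h2 n x)"
      unfolding Eh1 Eh2 .
    then show "?z * ft (h1 n) \<zeta> = ft (h2 n) \<zeta>"
      unfolding ft_def by (simp only: mult.left_commute[of ?z])
  qed
  define Nf where "Nf = (LINT x|lborel. \<bar>f x\<bar>)"
  define Nf' where "Nf' = (LINT x|lborel. \<bar>f' x\<bar>)"
  have h1b: "(LINT x|lborel. cmod (h1 n x)) \<le> Nf + J" for n
  proof -
    have "(LINT x|lborel. cmod (h1 n x)) \<le> (LINT x|lborel. \<bar>f x\<bar> + \<delta> n * chi (\<delta> n) x)"
    proof (rule integral_mono)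
      show "integrable lborel (\<lambda>x. cmod (h1 n x))" by (rule integrable_norm[OF h1i])
      show "integrable lborel (\<lambda>x. \<bar>f x\<bar> + \<delta> n * chi (\<delta> n) x)" by (intro Bochner_Integration.integrable_add integrable_abs f(1) ci(1))
      fix x
      have "cmod (h1 n x) \<le> \<bar>f x\<bar> * \<bar>chi (\<delta> n) x\<bar> + \<bar>chi1 (\<delta> n) x\<bar>"
        unfolding h1_def by (rule order_trans[OF norm_triangle_ineq]) (use \<psi>1 in \<open>simp add: norm_mult\<close>)
      also have "\<dots> \<le> \<bar>f x\<bar> * 1 + \<delta> n * chi (\<delta> n) x" by (intro add_mono mult_left_mono c1) auto
      finally show "cmod (h1 n x) \<le> \<bar>f x\<bar> + \<delta> n * chi (\<delta> n) x" by simp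
    qed
    also have "\<dots> = Nf + J" using f(1) ci[of n] by (simp add: Nf_def)
    finally show ?thesis .
  qed
  have h2b: "(LINT x|lborel. cmod (h2 n x)) \<le> Nf' + K * Nf + 2 * Nf + 10 * J" for n
  proof -
    have "(LINT x|lborel. cmod (h2 n x)) \<le> (LINT x|lborel. \<bar>f' x\<bar> + K * \<bar>f x\<bar> + 2 * \<bar>f x\<bar> + 10 * (\<delta> n * chi (\<delta> n) x))"
    proof (rule integral_mono)
      show "integrable lborel (\<lambda>x. cmod (h2 n x))" by (rule integrable_norm[OF h2i])
      show "integrable lborel (\<lambda>x. \<bar>f' x\<bar> + K * \<bar>f x\<bar> + 2 * \<bar>f x\<bar> + 10 * (\<delta> n * chi (\<delta> n) x))"
        by (intro Bochner_Integration.integrable_add integrable_mult_right integrable_abs f(1) f' ci(1))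
      fix x
      have "cmod (h2 n x) \<le> \<bar>f' x\<bar> * \<bar>chi (\<delta> n) x\<bar> + \<bar>f x\<bar> * \<bar>f x\<bar> * \<bar>chi (\<delta> n) x\<bar> + 2 * \<bar>f x\<bar> * \<bar>chi1 (\<delta> n) x\<bar> + \<bar>chi2 (\<delta> n) x\<bar>"
      proof -
        have t: "cmod (a - b - c + d) \<le> cmod a + cmod b + cmod c + cmod d" for a b c d
          using norm_triangle_ineq[of "a - b - c" d] norm_triangle_ineq4[of "a - b" c] norm_triangle_ineq4[of a b] by linarith
        show ?thesis unfolding h2_def by (rule order_trans[OF t]) (use \<psi>1 in \<open>simp add: norm_mult\<close>)
      qed
      \<comment> \<open>Boundedness of f is used for the quadratic term: f^2 <= K |f|.\<close>
      also have "\<dots> \<le> \<bar>f' x\<bar> * 1 + K * \<bar>f x\<bar> * 1 + 2 * \<bar>f x\<bar> * 1 + 10 * (\<delta> n * chi (\<delta> n) x)"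
        by (intro add_mono mult_mono c1 f(3) mult_nonneg_nonneg) (use K0 in auto)
      finally show "cmod (h2 n x) \<le> \<bar>f' x\<bar> + K * \<bar>f x\<bar> + 2 * \<bar>f x\<bar> + 10 * (\<delta> n * chi (\<delta> n) x)" by simp
    qed
    also have "\<dots> = Nf' + K * Nf + 2 * Nf + 10 * J" using f(1) f' ci[of n] by (simp add: Nf_def Nf'_def)
    finally show ?thesis .
  qed
  define C1 where "C1 = (LINT x|lborel. kernel1 x x)"
  define C2 where "C2 = (LINT x|lborel. kernel2 x x)"
  have C0: "0 \<le> C1" "0 \<le> C2"
  proof -
    have "0 \<le> kernel1 x x" "0 \<le> kernel2 x x" for x using bracket(1)[of x] by (auto simp: kernel1_def kernel2_def)
    then show "0 \<le> C1" "0 \<le> C2" unfolding C1_def C2_def by simp_all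
  qed
  \<comment> \<open>Independent of n: the norms of h1 and h2 are replaced by their uniform
    bounds.\<close>
  define B where "B = (C1 * (Nf + J) + 2 * (C2 * (Nf' + K * Nf + 2 * Nf + 10 * J))) / (2 * pi)"
  have \<psi>b: "bounded (range \<psi>)" using \<psi>1 by (auto simp: bounded_range_norm intro!: exI[of _ 1])
  have gm: "bounded_clinear g_op" by (rule bounded_clinear_fourier_multiplier[OF g_fun_bounded])
  have T: "bounded_clinear (commutator (mult_op \<psi>) g_op)"
    by (rule bounded_clinear_commutator[OF bounded_clinear_mult_op[OF \<psi>m \<psi>b] gm])
  have S: "bounded_clinear (commutator (fourier_multiplier (\<lambda>x. cnj (complex_of_real (g_fun x)))) (mult_op (\<lambda>x. cnj (\<psi> x))))"
    by (rule bounded_clinear_commutator[OF bounded_clinear_fourier_multiplier[OF _ bounded_range_cnj[OF g_fun_bounded(2)]] bounded_clinear_mult_op[OF _ bounded_range_cnj[OF \<psi>b]]])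
       measurable
  have "trace_class (commutator (mult_op \<psi>) g_op)"
  proof (rule trace_classI[OF T S])
    show "adjoint_pair (commutator (mult_op \<psi>) g_op) (commutator (fourier_multiplier (\<lambda>x. cnj (complex_of_real (g_fun x)))) (mult_op (\<lambda>x. cnj (\<psi> x))))"
      by (rule adjoint_commutator[OF adjoint_mult_op[OF \<psi>m \<psi>b] adjoint_fourier_multiplier[OF g_fun_bounded]])
    fix I :: "L2 set" and e d :: "L2 \<Rightarrow> L2"
    assume bes: "bessel_family I e" "bessel_family I d"
    have bd: "(\<Sum>j\<in>I. cmod (cinner (d j) (commutator (mult_op (\<psi>n n)) g_op (e j)))) \<le> B" for n
    proof -
      have "(\<Sum>j\<in>I. cmod (cinner (d j) (commutator (mult_op (\<psi>n n)) g_op (e j))))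
        \<le> (C1 * (LINT x|lborel. cmod (h1 n x)) + 2 * (C2 * (LINT x|lborel. cmod (h2 n x)))) / (2 * pi)"
        unfolding C1_def C2_def by (rule commutator_g_bessel_bound[OF \<psi>ni \<psi>nb h1i h2i rel bes])
      also have "\<dots> \<le> B"
        unfolding B_def using C0 h1b[of n] h2b[of n] by (intro divide_right_mono add_mono mult_left_mono) auto
      finally show ?thesis .
    qed
    \<comment> \<open>The cutoffs tend to 1 pointwise and boundedly, so the multiplication operators
      converge strongly; a finite sum of matrix elements follows.\<close>
    have lm: "(\<lambda>n. mult_op (\<psi>n n) u) \<longlonglongrightarrow> mult_op \<psi> u" for u
    proof (rule mult_op_tendsto[where K = 1])
      show "\<psi>n n \<in> borel_measurable borel" for n unfolding \<psi>n_def[abs_def] by measurable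
      fix x
      have "\<delta> \<longlonglongrightarrow> 0" unfolding \<delta>_def[abs_def] by (rule LIMSEQ_inverse_real_of_nat)
      then have "(\<lambda>n. chi (\<delta> n) x) \<longlonglongrightarrow> inverse (1 + (0 * x)\<^sup>2)"
        unfolding chi_def by (intro tendsto_intros) auto
      then have "(\<lambda>n. \<psi>n n x) \<longlonglongrightarrow> \<psi> x * complex_of_real (inverse (1 + (0 * x)\<^sup>2))"
        unfolding \<psi>n_def by (intro tendsto_mult tendsto_const tendsto_of_real)
      then show "(\<lambda>n. \<psi>n n x) \<longlonglongrightarrow> \<psi> x" by simp
    qed (use \<psi>m \<psi>1 \<psi>nb in auto)
    have "(\<lambda>n. \<Sum>j\<in>I. cmod (cinner (d j) (commutator (mult_op (\<psi>n n)) g_op (e j)))) \<longlonglongrightarrow> (\<Sum>j\<in>I. cmod (cinner (d j) (commutator (mult_op \<psi>) g_op (e j))))"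
      unfolding commutator_def
      by (intro tendsto_sum tendsto_norm tendsto_cinner tendsto_const tendsto_diff lm bounded_clinear_tendsto[OF gm])
    then show "(\<Sum>j\<in>I. cmod (cinner (d j) (commutator (mult_op \<psi>) g_op (e j)))) \<le> B"
      by (rule LIMSEQ_le_const2) (use bd in blast)
  qed
  then show ?thesis by (simp add: \<psi>_def[abs_def])
qed

section \<open>The phase factor at infinity\<close>

text \<open>Dominated convergence with majorant |f|. For the left end the orientation of the
  interval integral produces a minus sign.\<close>

lemma interval_integral_tendsto:
  fixes f :: "real \<Rightarrow> real"
  assumes f: "integrable lborel f"
  shows "((\<lambda>x. LBINT y=0..ereal x. f y) \<longlongrightarrow> (LBINT y=0..\<infinity>. f y)) at_top"
    and "((\<lambda>x. LBINT y=0..ereal x. f y) \<longlongrightarrow> (LBINT y=0..-\<infinity>. f y)) at_bot"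
proof -
  have [measurable]: "f \<in> borel_measurable borel" using f by auto
  have p: "(LBINT y=0..ereal x. f y) = (LINT y|lborel. indicator {0<..<x} y * f y)" if "0 \<le> x" for x
    using that by (simp add: interval_lebesgue_integral_def einterval_def set_lebesgue_integral_def zero_ereal_def greaterThanLessThan_def greaterThan_def lessThan_def Int_def)
  have n: "(LBINT y=0..ereal (- x). f y) = - (LINT y|lborel. indicator {- x<..<0} y * f y)" if "0 < x" for x
    using that by (simp add: interval_lebesgue_integral_def einterval_def set_lebesgue_integral_def zero_ereal_def greaterThanLessThan_def greaterThan_def lessThan_def Int_def)
  have pi: "(LBINT y=0..\<infinity>. f y) = (LINT y|lborel. indicator {0<..} y * f y)"
    by (simp add: interval_lebesgue_integral_def einterval_def set_lebesgue_integral_def zero_ereal_def greaterThan_def)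
  have ni: "(LBINT y=0..-\<infinity>. f y) = - (LINT y|lborel. indicator {..<0} y * f y)"
    by (simp add: interval_lebesgue_integral_def einterval_def set_lebesgue_integral_def zero_ereal_def lessThan_def)
  have "((\<lambda>x. LINT y|lborel. indicator {0<..<x} y * f y) \<longlongrightarrow> (LINT y|lborel. indicator {0<..} y * f y)) at_top"
  proof (rule integral_dominated_convergence_at_top[where w = "\<lambda>y. \<bar>f y\<bar>"])
    show "AE y in lborel. ((\<lambda>x. indicator {0<..<x} y * f y) \<longlongrightarrow> indicator {0<..} y * f y) at_top"
    proof (rule AE_I2)
      fix y :: real
      have "eventually (\<lambda>x. indicator {0<..<x} y * f y = indicator {0<..} y * f y) at_top"
        using eventually_gt_at_top[of y] by eventually_elim (auto simp: indicator_def)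
      then show "((\<lambda>x. indicator {0<..<x} y * f y) \<longlongrightarrow> indicator {0<..} y * f y) at_top" by (rule tendsto_eventually)
    qed
  qed (use f in \<open>auto simp: indicator_def\<close>)
  then show "((\<lambda>x. LBINT y=0..ereal x. f y) \<longlongrightarrow> (LBINT y=0..\<infinity>. f y)) at_top"
    unfolding pi
  proof (rule Lim_transform_eventually)
    show "eventually (\<lambda>x. (LINT y|lborel. indicator {0<..<x} y * f y) = (LBINT y=0..ereal x. f y)) at_top"
      using eventually_ge_at_top[of 0] by eventually_elim (simp only: p)
  qed
  have "((\<lambda>x. LINT y|lborel. indicator {- x<..<0} y * f y) \<longlongrightarrow> (LINT y|lborel. indicator {..<0} y * f y)) at_top"
  proof (rule integral_dominated_convergence_at_top[where w = "\<lambda>y. \<bar>f y\<bar>"])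
    show "AE y in lborel. ((\<lambda>x. indicator {- x<..<0} y * f y) \<longlongrightarrow> indicator {..<0} y * f y) at_top"
    proof (rule AE_I2)
      fix y :: real
      have "eventually (\<lambda>x. indicator {- x<..<0} y * f y = indicator {..<0} y * f y) at_top"
        using eventually_gt_at_top[of "- y"] by eventually_elim (auto simp: indicator_def)
      then show "((\<lambda>x. indicator {- x<..<0} y * f y) \<longlongrightarrow> indicator {..<0} y * f y) at_top" by (rule tendsto_eventually)
    qed
  qed (use f in \<open>auto simp: indicator_def\<close>)
  from tendsto_minus[OF this]
  have "((\<lambda>x. LBINT y=0..ereal (- x). f y) \<longlongrightarrow> (LBINT y=0..-\<infinity>. f y)) at_top"
    unfolding ni
  proof (rule Lim_transform_eventually)
    show "eventually (\<lambda>x. - (LINT y|lborel. indicator {- x<..<0} y * f y) = (LBINT y=0..ereal (- x). f y)) at_top"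
      using eventually_gt_at_top[of 0] by eventually_elim (simp only: n)
  qed
  then show "((\<lambda>x. LBINT y=0..ereal x. f y) \<longlongrightarrow> (LBINT y=0..-\<infinity>. f y)) at_bot"
    by (simp only: filterlim_at_bot_mirror)
qed

lemma interval_integral_DERIV:
  fixes f :: "real \<Rightarrow> real"
  assumes "continuous_on UNIV f"
  shows "DERIV (\<lambda>x. LBINT y=0..ereal x. f y) x :> f x"
proof -
  have "((\<lambda>u. LBINT y=ereal 0..u. f y) has_vector_derivative f x) (at x within {min 0 x - 1..max 0 x + 1})"
    by (rule interval_integral_FTC2) (auto intro: continuous_on_subset[OF assms])
  moreover have "at x within {min 0 x - 1..max 0 x + 1} = at x"
    by (rule at_within_interior) (auto simp: interior_atLeastAtMost_real min_def max_def)
  ultimately have "((\<lambda>u. LBINT y=ereal 0..u. f y) has_vector_derivative f x) (at x)"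
    by simp
  then show ?thesis
    by (simp add: has_real_derivative_iff_has_vector_derivative zero_ereal_def)
qed

theorem propositionA1:
  fixes f :: "real \<Rightarrow> real" and \<psi> :: "real \<Rightarrow> complex"
  assumes "sobolev_W11 f"
    and "continuous_on UNIV f" and "bounded (range f)"
    and "(LBINT x=0..\<infinity>. f x) - (LBINT x=0..-\<infinity>. f x) \<notin> {2 * pi * of_int k | k. True}"
    and "\<psi> = (\<lambda>x. exp (- \<i> * complex_of_real (LBINT y=0..x. f y)))"
  shows "trace_class (commutator (mult_op \<psi>)
            (op_of_graph (functional_calculus (\<lambda>t. complex_of_real (g_fun t)) D_op)))
    \<and> \<not> trace_class (commutator (mult_op \<psi>)
            (op_of_graph (functional_calculus (\<lambda>t. complex_of_real (sgn t)) D_op)))"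
proof -
  obtain f' where f: "integrable lborel f" and f': "integrable lborel f'" and wd: "weak_derivative f f'"
    using assms(1) by (auto simp: sobolev_W11_def)
  obtain K where K: "\<And>x. \<bar>f x\<bar> \<le> K"
    using assms(3) by (auto simp: bounded_range_norm)
  define F where "F x = (LBINT y=0..ereal x. f y)" for x
  have F: "DERIV F x :> f x" for x
    unfolding F_def[abs_def] by (rule interval_integral_DERIV[OF assms(2)])
  have \<psi>: "\<psi> = (\<lambda>x. cis (- F x))"
    unfolding assms(5) F_def by (simp add: cis_conv_exp)
  have Fc: "continuous_on UNIV F" by (rule DERIV_continuous_on[OF has_field_derivative_at_within[OF F]])
  have \<psi>m: "\<psi> \<in> borel_measurable borel"
    unfolding \<psi> by (intro borel_measurable_continuous_onI continuous_intros Fc)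
  define I1 where "I1 = (LBINT x=0..\<infinity>. f x)"
  define I2 where "I2 = (LBINT x=0..-\<infinity>. f x)"
  have lim: "(\<psi> \<longlongrightarrow> cis (- I1)) at_top" "(\<psi> \<longlongrightarrow> cis (- I2)) at_bot"
    unfolding \<psi> cis_conv_exp F_def I1_def I2_def
    by (intro tendsto_exp tendsto_mult tendsto_const tendsto_of_real tendsto_minus interval_integral_tendsto[OF f])+
  \<comment> \<open>The only use of the integral condition: 2 pi i is the period of the exponential,
    so equal limits would put I1 - I2 into the excluded set.\<close>
  have ne: "cis (- I1) \<noteq> cis (- I2)"
  proof
    assume "cis (- I1) = cis (- I2)"
    then obtain n :: int where "\<i> * complex_of_real (- I1) = \<i> * complex_of_real (- I2) + (of_int (2 * n) * pi) * \<i>"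
      unfolding cis_conv_exp exp_eq by blast
    from arg_cong[OF this, of Im] have "I1 - I2 = 2 * pi * of_int (- n)" by (simp add: algebra_simps)
    then have "I1 - I2 \<in> {2 * pi * of_int k | k. True}" by blast
    then show False using assms(4) by (simp add: I1_def I2_def)
  qed
  have sgn: "(\<lambda>t. complex_of_real (sgn t)) \<in> borel_measurable borel" "bounded (range (\<lambda>t. complex_of_real (sgn t)))"
    by (auto simp: bounded_range_norm sgn_real_def intro!: exI[of _ 1])
  have "trace_class (commutator (mult_op \<psi>) g_op)"
    unfolding \<psi> by (rule commutator_g_trace_class[OF f assms(2) K f' weak_derivative_primitive[OF wd f assms(2) K f'] F])
  moreover have "\<not> trace_class (commutator (mult_op \<psi>) (fourier_multiplier (\<lambda>t. complex_of_real (sgn t))))"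
    by (rule commutator_sgn_not_trace_class[OF \<psi>m _ lim ne, of 1]) (simp add: \<psi>)
  ultimately show ?thesis
    unfolding op_of_graph_functional_calculus_D[OF g_fun_bounded] op_of_graph_functional_calculus_D[OF sgn] by blast
qed

end
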